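(* Let $B_1(0)\subset\mathbb{C}^2$ be the open unit ball, with outer normal vector $N$ along $\partial B_1(0)=\mathbb{S}^3$. Let $u\in C^1\cap W^{2,1}(\overline{D^2},\mathbb{C}^2)$ be a weakly conformal map which is a Lagrangian immersion away from finitely many branch points in $D^2$, with continuous Lagrangian angle $\overline{g}$. Assume that $u$ is $B_1(0)$-free boundary Hamiltonian stationary with the localization property and that $$\partial_\tau u\cdot I(N\circ u)=0\quad\text{on }\partial D^2.$$ Then $u(D^2)$ is a flat equatorial Lagrangian disc, i.e. it is the intersection of $B_1(0)$ with a Lagrangian $2$-plane passing through the origin.
   Context: $D^2\subset\mathbb{R}^2$ is the open unit disc, with coordinates $(x,y)$; $\tau$ is the oriented unit tangent of $\partial D^2$. On $\mathbb{C}^2\cong\mathbb{R}^4$ with coordinates $z_j=x_j+iy_j$, $\cdot$ and $\langle\cdot,\cdot\rangle$ denote the Euclidean real inner product, $I$ is complex multiplication by $i$, and $\omega=dx_1\wedge dy_1+dx_2\wedge dy_2$ is the standard symplectic form. $\nabla f$ is the Euclidean gradient of a real function $f$ on $\mathbb{C}^2$. A surface $\Sigma\subset\mathbb{C}^2$ (in particular a $2$-plane) is Lagrangian if $\omega|_\Sigma=0$. A map $u$ on $D^2$ is Lagrangian if $u^*\omega=0$ a.e., and weakly conformal if $\langle\partial_xu,\partial_yu\rangle=0$ and $|\partial_xu|^2=|\partial_yu|^2$ a.e. For a weakly conformal Lagrangian $u$ there is a measurable $g:D^2\to\mathbb{S}^1\subset\mathbb{C}$ with $u^*(dz_1\wedge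 dz_2)=e^{2\lambda}\overline{g}\,dx\wedge dy$ a.e., where $e^{2\lambda}=|\partial_xu|^2=|\partial_yu|^2$; $\overline{g}$ is called the Lagrangian angle of $u$. For a weakly conformal Lagrangian $u\in C^1(\overline{D^2},\mathbb{C}^2)$ such that $\nabla u$ vanishes only at isolated points, a branch point of $u$ is a point $p$ with $\nabla u(p)=0$ at which $\overline{g}$ is continuous. For an open $\Omega\subset\mathbb{C}^2$ with smooth boundary and outer normal $N$, a Lagrangian map $u\in C^1(\overline{D^2},\mathbb{C}^2)$ with $u(\partial D^2)\subset\partial\Omega$ is called $\Omega$-free boundary Hamiltonian stationary with the localization property if for every smooth, relatively open domain $U\subset\overline{D^2}$ $$\int_U\langle d(I(\nabla f)\circ u);du\rangle=0$$ for every smooth $f:\mathbb{C}^2\to\mathbb{R}$ supported away from $u(\partial U\cap D^2)$ such that $I\nabla f(x)\cdot N(x)=0$ for every $x$ in a neighbourhood of $u(\overline{U}\cap\partial D^2)$ in $\partial\Omega$. Here this is used with $\Omega=B_1(0)$. *)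

theory Defs
  imports "HOL-Analysis.Analysis"
begin

section \<open>Smooth functions, gradients, Sobolev functions\<close>

(* For open S: f is k times continuously differentiable on S. *)
primrec Ck_on :: "nat \<Rightarrow> 'a::euclidean_space set \<Rightarrow> ('a \<Rightarrow> 'b::real_normed_vector) \<Rightarrow> bool" where
  "Ck_on 0 S f \<longleftrightarrow> continuous_on S f"
| "Ck_on (Suc k) S f \<longleftrightarrow>
     f differentiable_on S \<and> (\<forall>i\<in>Basis. Ck_on k S (\<lambda>x. frechet_derivative f (at x) i))"

definition smooth_on :: "'a::euclidean_space set \<Rightarrow> ('a \<Rightarrow> 'b::real_normed_vector) \<Rightarrow> bool" where
  "smooth_on S f \<longleftrightarrow> (\<forall>k. Ck_on k S f)"

definition gradient :: "('a::euclidean_space \<Rightarrow> real) \<Rightarrow> 'a \<Rightarrow> 'a" where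
  "gradient f x = (THE D. GDERIV f x :> D)"

definition fun_support :: "('a::topological_space \<Rightarrow> 'b::zero) \<Rightarrow> 'a set" where
  "fun_support f = closure {x. f x \<noteq> 0}"

definition weak_partial ::
  "'a::euclidean_space set \<Rightarrow> 'a \<Rightarrow> ('a \<Rightarrow> 'b::euclidean_space) \<Rightarrow> ('a \<Rightarrow> 'b) \<Rightarrow> bool" where
  "weak_partial \<Omega> i h w \<longleftrightarrow>
     (\<forall>\<phi>::'a \<Rightarrow> real. smooth_on UNIV \<phi> \<and> compact (fun_support \<phi>) \<and> fun_support \<phi> \<subseteq> \<Omega> \<longrightarrow>
        (LINT x:\<Omega>|lebesgue. \<phi> x *\<^sub>R w x) =
        - (LINT x:\<Omega>|lebesgue. frechet_derivative \<phi> (at x) i *\<^sub>R h x))"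

(* The Sobolev space of exponent 1 and order k on the open set \<Omega>; all weak partial derivatives
   up to order k lie in L1, so the integrals in weak_partial converge. *)
primrec sobolev_1 ::
  "nat \<Rightarrow> 'a::euclidean_space set \<Rightarrow> ('a \<Rightarrow> 'b::euclidean_space) \<Rightarrow> bool" where
  "sobolev_1 0 \<Omega> h \<longleftrightarrow> set_integrable lebesgue \<Omega> h"
| "sobolev_1 (Suc k) \<Omega> h \<longleftrightarrow>
     set_integrable lebesgue \<Omega> h \<and> (\<forall>i\<in>Basis. \<exists>w. weak_partial \<Omega> i h w \<and> sobolev_1 k \<Omega> w)"

section \<open>Smooth boundaries\<close>

(* \<rho> is a smooth defining function, in the open set W, for the subset U of the ambient set X. *)
definition defining_function ::
  "'a::euclidean_space set \<Rightarrow> 'a set \<Rightarrow> 'a set \<Rightarrow> ('a \<Rightarrow> real) \<Rightarrow> bool" where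
  "defining_function X U W \<rho> \<longleftrightarrow>
     open W \<and> smooth_on W \<rho> \<and> (\<forall>x\<in>W. gradient \<rho> x \<noteq> 0) \<and> U \<inter> W = {x \<in> X \<inter> W. \<rho> x < 0}"

definition outer_unit_normal :: "'a::euclidean_space set \<Rightarrow> 'a \<Rightarrow> 'a \<Rightarrow> bool" where
  "outer_unit_normal \<Omega> x n \<longleftrightarrow>
     x \<in> frontier \<Omega> \<and>
     (\<exists>W \<rho>. x \<in> W \<and> defining_function UNIV \<Omega> W \<rho> \<and> n = sgn (gradient \<rho> x))"

section \<open>The disc and complex two-space\<close>

text \<open>The plane of the disc is the type \<open>complex\<close>, with \<open>x = Re z\<close> and \<open>y = Im z\<close>.  Complex two-space
  is \<open>complex \<times> complex\<close>, whose library inner product and norm are the Euclidean real ones.\<close>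

type_synonym complex2 = "complex \<times> complex"

abbreviation D2 :: "complex set" where "D2 \<equiv> ball 0 1"
abbreviation closed_D2 :: "complex set" where "closed_D2 \<equiv> cball 0 1"
abbreviation circle :: "complex set" where "circle \<equiv> sphere 0 1"

definition mult_I :: "complex2 \<Rightarrow> complex2" where
  "mult_I v = (\<i> * fst v, \<i> * snd v)"

definition omega :: "complex2 \<Rightarrow> complex2 \<Rightarrow> real" where
  "omega v w = (Re (fst v) * Im (fst w) - Im (fst v) * Re (fst w))
             + (Re (snd v) * Im (snd w) - Im (snd v) * Re (snd w))"

definition dz1_dz2 :: "complex2 \<Rightarrow> complex2 \<Rightarrow> complex" where
  "dz1_dz2 v w = fst v * snd w - fst w * snd v"

definition lagrangian_plane :: "complex2 set \<Rightarrow> bool" where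
  "lagrangian_plane P \<longleftrightarrow> subspace P \<and> dim P = 2 \<and> (\<forall>v\<in>P. \<forall>w\<in>P. omega v w = 0)"

section \<open>Maps on the closed disc\<close>

(* The derivative is taken within the closed disc, so that it also makes sense on the circle. *)
definition du :: "(complex \<Rightarrow> 'b::real_normed_vector) \<Rightarrow> complex \<Rightarrow> complex \<Rightarrow> 'b" where
  "du u z = frechet_derivative u (at z within closed_D2)"

definition dx :: "(complex \<Rightarrow> 'b::real_normed_vector) \<Rightarrow> complex \<Rightarrow> 'b" where
  "dx u z = du u z 1"

definition dy :: "(complex \<Rightarrow> 'b::real_normed_vector) \<Rightarrow> complex \<Rightarrow> 'b" where
  "dy u z = du u z \<i>"

(* The counterclockwise unit tangent of the circle at z is \<i> * z. *)
definition dtau :: "(complex \<Rightarrow> 'b::real_normed_vector) \<Rightarrow> complex \<Rightarrow> 'b" where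
  "dtau u z = du u z (\<i> * z)"

definition C1_closed_disc :: "(complex \<Rightarrow> 'b::real_normed_vector) \<Rightarrow> bool" where
  "C1_closed_disc u \<longleftrightarrow>
     u differentiable_on closed_D2 \<and> continuous_on closed_D2 (dx u) \<and> continuous_on closed_D2 (dy u)"

definition lagrangian_map :: "(complex \<Rightarrow> complex2) \<Rightarrow> bool" where
  "lagrangian_map u \<longleftrightarrow> (AE z in lebesgue_on D2. omega (dx u z) (dy u z) = 0)"

definition weakly_conformal :: "(complex \<Rightarrow> complex2) \<Rightarrow> bool" where
  "weakly_conformal u \<longleftrightarrow>
     (AE z in lebesgue_on D2. dx u z \<bullet> dy u z = 0 \<and> (norm (dx u z))\<^sup>2 = (norm (dy u z))\<^sup>2)"

(* gbar is the Lagrangian angle itself, i.e. the conjugate of g. *)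
definition lagrangian_angle :: "(complex \<Rightarrow> complex2) \<Rightarrow> (complex \<Rightarrow> complex) \<Rightarrow> bool" where
  "lagrangian_angle u gbar \<longleftrightarrow>
     gbar \<in> borel_measurable (lebesgue_on D2) \<and> (\<forall>z\<in>D2. norm (gbar z) = 1) \<and>
     (AE z in lebesgue_on D2.
        dz1_dz2 (dx u z) (dy u z) = of_real ((norm (dx u z))\<^sup>2) * gbar z)"

definition branch_point :: "(complex \<Rightarrow> complex2) \<Rightarrow> (complex \<Rightarrow> complex) \<Rightarrow> complex \<Rightarrow> bool" where
  "branch_point u gbar p \<longleftrightarrow>
     (\<forall>v. du u p v = 0) \<and> continuous (at p within D2) gbar"

definition lagrangian_immersion_on :: "complex set \<Rightarrow> (complex \<Rightarrow> complex2) \<Rightarrow> bool" where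
  "lagrangian_immersion_on A u \<longleftrightarrow>
     (\<forall>z\<in>A. inj (du u z) \<and> omega (dx u z) (dy u z) = 0)"

section \<open>Free boundary Hamiltonian stationarity\<close>

(* A domain of the surface with boundary closed_D2 whose relative boundary closure U - U is a
   smooth curve; half discs centred on the circle and closed_D2 itself are instances. *)
definition smooth_rel_domain :: "complex set \<Rightarrow> bool" where
  "smooth_rel_domain U \<longleftrightarrow>
     U \<noteq> {} \<and> connected U \<and> openin (top_of_set closed_D2) U \<and>
     (\<forall>p \<in> closure U - U. \<exists>W \<rho>. p \<in> W \<and> defining_function closed_D2 U W \<rho>)"

(* N is the outer unit normal field along frontier \<Omega>.  For U relatively open in closed_D2,
   (closure U - U) \<inter> D2 is the part of the boundary of U inside the open disc; "supported away
   from" its image means that the support has positive distance from that image. *)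
definition fb_hamiltonian_stationary_loc ::
  "complex2 set \<Rightarrow> (complex2 \<Rightarrow> complex2) \<Rightarrow> (complex \<Rightarrow> complex2) \<Rightarrow> bool" where
  "fb_hamiltonian_stationary_loc \<Omega> N u \<longleftrightarrow>
     C1_closed_disc u \<and> lagrangian_map u \<and> u ` circle \<subseteq> frontier \<Omega> \<and>
     (\<forall>U (f :: complex2 \<Rightarrow> real).
        smooth_rel_domain U \<and> smooth_on UNIV f \<and>
        fun_support f \<inter> closure (u ` ((closure U - U) \<inter> D2)) = {} \<and>
        (\<exists>V. open V \<and> u ` (closure U \<inter> circle) \<subseteq> V \<and>
             (\<forall>x \<in> V \<inter> frontier \<Omega>. mult_I (gradient f x) \<bullet> N x = 0)) \<longrightarrow>
        (LINT z:U|lebesgue.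
             dx (\<lambda>z. mult_I (gradient f (u z))) z \<bullet> dx u z
           + dy (\<lambda>z. mult_I (gradient f (u z))) z \<bullet> dy u z) = 0)"

end

theory Submission
  imports Defs "HOL-Complex_Analysis.Complex_Analysis"
begin

text \<open>
Write the Lagrangian angle as \<open>exp (\<i> \<beta>)\<close>. In the distributional sense the Laplacian of \<open>u\<close> is \<open>I\<close> applied to
the image of the gradient \<open>(B1, B2)\<close> of \<open>\<beta>\<close> under \<open>du\<close>. Testing stationarity on a half disc with \<open>f\<close>
therefore equates the integral of the inner product of the gradients of \<open>\<beta>\<close> and \<open>f \<circ> u\<close> with the flux of
\<open>I grad f\<close> through the circle. For \<open>f = \<bar>x\<bar>\<^sup>2 - 1\<close> near a boundary point this shows that the radial
derivative of \<open>u\<close> is a real multiple of \<open>u\<close> on the circle; then functions of \<open>\<bar>x\<bar>\<^sup>2\<close> and of a second rotation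
invariant quadratic form have no flux, and their compositions with \<open>u\<close> attain all local boundary values.
Hence \<open>\<beta>\<close> is weakly harmonic with vanishing normal derivative, also across the finitely many branch
points because it is continuous there, and so it is constant. For a constant angle a linear isometry turns \<open>u\<close> into a
holomorphic curve \<open>(w1, w2)\<close>, and on the circle \<open>z w'\<close> is a real multiple of \<open>w\<close>. So the modulus of
\<open>w2(1) w1 - w1(1) w2\<close> is constant on the circle, this function vanishes, and \<open>u\<close> parametrises a plane disc.\<close>

text \<open>Two obstacles shape the argument. For u in C^1 and W^{2,1} the angle has only weak
  derivatives \<open>B1\<close> and \<open>B2\<close>, controlled by |B| |du| \<le> |\<mu>|. This
  bound gives no integrability at the branch points, so every test function first has to vanish near
  \<open>S\<close>; the continuity of the angle later pays for lifting that restriction. Moreover,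
  stationarity accepts only functions of u, so a given function on the disc has to be written
  locally as F o p o u with a map \<open>p\<close> into the plane. In the interior \<open>p\<close>
  is the projection to a tangent plane. At the circle \<open>p\<close> must be invariant under x ->
  e^(it) x, and F o p o u matches the given function only on the circle. That suffices, because
  interior harmonicity makes the functional \<open>T\<close> depend on boundary values alone. The
  localization to half discs is essential, since u is injective only locally. Boundary integrals are
  never formed: a flux is a limit of integrals over thin layers at the circle. Constancy of the
  angle needs no regularity theory: up to constants, every monomial is the Laplacian of a polynomial
  with vanishing normal derivative, and polynomials are dense.\<close>

abbreviation pd :: "'a::euclidean_space => ('a => 'b::real_normed_vector) => 'a => 'b" where
 "pd i f \<equiv> %x. frechet_derivative f (at x) i"

section \<open>Calculus of functions of class \<open>Ck_on\<close>\<close>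

lemma pd_eqI: "(f has_derivative D) (at x) ==> pd i f x = D i"
 using frechet_derivative_at by metis

lemma has_derivative_pd: "f differentiable (at x) ==> (f has_derivative (%v. pd v f x)) (at x)"
 using frechet_derivative_works[of f "at x"] by simp

lemma linear_pd: "f differentiable (at x) ==> linear (%v. pd v f x)"
 using has_derivative_linear has_derivative_pd by blast

lemma pd_expand:
 fixes f :: "'a::euclidean_space => 'b::real_normed_vector"
 assumes "f differentiable (at x)"
 shows "pd v f x = (\<Sum>j\<in>Basis. (v \<bullet> j) *\<^sub>R pd j f x)"
proof -
 interpret linear "%v. pd v f x" by (rule linear_pd[OF assms])
 have "pd v f x = pd (\<Sum>j\<in>Basis. (v \<bullet> j) *\<^sub>R j) f x" by (simp add: euclidean_representation)
 also have "\<dots> = (\<Sum>j\<in>Basis. (v \<bullet> j) *\<^sub>R pd j f x)" by (simp add: sum scale)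
 finally show ?thesis .
qed

lemma pd_cong_open:
 assumes "open S" "x \<in> S" "!!y. y \<in> S ==> f y = g y"
 shows "pd i f x = pd i g x"
proof -
 have "(f has_derivative D) (at x) \<longleftrightarrow> (g has_derivative D) (at x)" for D
  using has_derivative_transform_within_open[OF _ assms(1,2)] assms(3) by metis
 then show ?thesis unfolding frechet_derivative_def by simp
qed

lemma differentiable_cong_open:
 assumes "open S" "x \<in> S" "!!y. y \<in> S ==> f y = g y" "f differentiable (at x)"
 shows "g differentiable (at x)"
 using assms has_derivative_transform_within_open unfolding differentiable_def by metis

lemma Ck_on_cong:
 assumes "open S" "!!x. x \<in> S ==> f x = g x"
 shows "Ck_on k S f \<longleftrightarrow> Ck_on k S g"
proof -
 have "Ck_on k S g" if "Ck_on k S f" "!!x. x \<in> S ==> f x = g x" for f g :: "'a => 'b"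
  using that
 proof (induction k arbitrary: f g)
  case 0 then show ?case using continuous_on_eq unfolding Ck_on.simps by blast
 next
  case (Suc k)
  have "g differentiable_on S"
   using Suc.prems(1) differentiable_cong_open[OF assms(1), of _ f g] Suc.prems(2)
   unfolding Ck_on.simps differentiable_on_eq_differentiable_at[OF assms(1)] by blast
  moreover have "Ck_on k S (pd i g)" if "i \<in> Basis" for i
  proof (rule Suc.IH)
   show "Ck_on k S (pd i f)" using Suc.prems(1) that by simp
   show "pd i f x = pd i g x" if "x \<in> S" for x
    using pd_cong_open[OF assms(1) that Suc.prems(2)] .
  qed
  ultimately show ?case by simp
 qed
 then show ?thesis using assms(2) by metis
qed

lemma Ck_on_SucI:
 assumes "open S" "!!x. x \<in> S ==> (f has_derivative f' x) (at x)"
  "!!i. i \<in> Basis ==> Ck_on k S (%x. f' x i)"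
 shows "Ck_on (Suc k) S f"
proof -
 have "f differentiable_on S"
  using assms by (auto simp: differentiable_on_eq_differentiable_at differentiable_def)
 moreover have "Ck_on k S (pd i f)" if "i \<in> Basis" for i
  using Ck_on_cong[OF assms(1), of "pd i f" "%x. f' x i"] assms(2,3) that pd_eqI by blast
 ultimately show ?thesis by simp
qed

lemma Ck_on_differentiable:
 assumes "open S" "Ck_on k S f" "k \<noteq> 0" "x \<in> S"
 shows "f differentiable (at x)"
 using assms by (cases k) (auto simp: differentiable_on_eq_differentiable_at)

lemma Ck_on_SucD: "open S ==> Ck_on (Suc k) S f ==> x \<in> S ==> f differentiable (at x)"
 using Ck_on_differentiable by blast

lemma Ck_on_Suc_imp: "open S ==> Ck_on (Suc k) S f ==> Ck_on k S f"
proof (induction k arbitrary: f)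
 case 0 then show ?case using differentiable_imp_continuous_on by auto
next
 case (Suc k)
 then show ?case by (metis Ck_on.simps(2))
qed

lemma Ck_on_mono: "open S ==> Ck_on k S f ==> j \<le> k ==> Ck_on j S f"
 by (induction k) (auto simp: le_Suc_eq dest: Ck_on_Suc_imp simp del: Ck_on.simps)

lemma Ck_on_subset: "open S ==> open T ==> T \<subseteq> S ==> Ck_on k S f ==> Ck_on k T f"
 by (induction k arbitrary: f) (auto intro: continuous_on_subset differentiable_on_subset)

lemma Ck_on_continuous: "open S ==> Ck_on k S f ==> continuous_on S f"
 using Ck_on_mono[of S k f 0] by simp

lemma Ck_on_open_Un:
 assumes "open S" "open T"
 shows "Ck_on k S f ==> Ck_on k T f ==> Ck_on k (S \<union> T) f"
proof (induction k arbitrary: f)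
 case 0 then show ?case using continuous_on_open_Un[OF assms] by simp
next
 case (Suc k)
 have "f differentiable_on (S \<union> T)"
  using Suc.prems assms by (auto simp: differentiable_on_eq_differentiable_at open_Un)
 then show ?case using Suc by simp
qed

lemma Ck_on_const: "open S ==> Ck_on k S (%x. c)"
proof (induction k arbitrary: c)
 case (Suc k)
 show ?case
  by (rule Ck_on_SucI[where f'="%_ _. 0"]) (use Suc in auto)
qed simp

lemma Ck_on_bounded_linear:
 assumes "open S" "bounded_linear L" shows "Ck_on k S L"
proof (cases k)
 case 0
 then show ?thesis using assms linear_continuous_on by simp
next
 case (Suc m)
 have "Ck_on (Suc m) S L"
  by (rule Ck_on_SucI[where f'="%_. L"])
    (use assms in \<open>auto intro: Ck_on_const bounded_linear_imp_has_derivative\<close>)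
 then show ?thesis using Suc by simp
qed

lemma Ck_on_pd: "Ck_on (Suc k) S f ==> i \<in> Basis ==> Ck_on k S (pd i f)"
 by simp

lemma Ck_on_add:
 assumes S: "open S"
 shows "Ck_on k S f ==> Ck_on k S g ==> Ck_on k S (%x. f x + g x)"
proof (induction k arbitrary: f g)
 case 0 then show ?case by (auto intro: continuous_intros)
next
 case (Suc k)
 show ?case
 proof (rule Ck_on_SucI[OF S])
  show "((%x. f x + g x) has_derivative (%v. pd v f x + pd v g x)) (at x)" if "x \<in> S" for x
   by (intro has_derivative_add has_derivative_pd) (use Suc.prems that Ck_on_SucD[OF S] in blast)+
  show "Ck_on k S (%x. pd i f x + pd i g x)" if "i \<in> Basis" for i
   by (rule Suc.IH) (use Suc.prems that in auto)
 qed
qed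

lemma Ck_on_sum:
 assumes "open S" "!!i. i \<in> I ==> Ck_on k S (f i)"
 shows "Ck_on k S (%x. \<Sum>i\<in>I. f i x)"
 using assms(2)
proof (induction I rule: infinite_finite_induct)
 case (insert j F)
 have 1: "Ck_on k S (f j)" using insert.prems by simp
 have 2: "Ck_on k S (%x. \<Sum>i\<in>F. f i x)" by (rule insert.IH) (use insert.prems in simp)
 show ?case using Ck_on_add[OF assms(1) 1 2] insert.hyps by simp
qed (use Ck_on_const[OF assms(1)] in simp_all)

lemma Ck_on_bilinear:
 assumes S: "open S" and B: "bounded_bilinear B"
 shows "Ck_on k S f ==> Ck_on k S g ==> Ck_on k S (%x. B (f x) (g x))"
proof (induction k arbitrary: f g)
 case 0 then show ?case by (auto intro: bounded_bilinear.continuous_on[OF B])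
next
 case (Suc k)
 show ?case
 proof (rule Ck_on_SucI[OF S])
  show "((%x. B (f x) (g x)) has_derivative (%v. B (f x) (pd v g x) + B (pd v f x) (g x))) (at x)"
   if "x \<in> S" for x
   by (intro bounded_bilinear.FDERIV[OF B] has_derivative_pd)
     (use Suc.prems that Ck_on_SucD[OF S] in blast)+
  show "Ck_on k S (%x. B (f x) (pd i g x) + B (pd i f x) (g x))" if "i \<in> Basis" for i
   by (rule Ck_on_add[OF S]; rule Suc.IH)
     (use Suc.prems that Ck_on_Suc_imp[OF S] in \<open>auto simp del: Ck_on.simps intro: Ck_on_pd\<close>)
 qed
qed

lemmas Ck_on_mult = Ck_on_bilinear[OF _ bounded_bilinear_mult]
lemmas Ck_on_scaleR = Ck_on_bilinear[OF _ bounded_bilinear_scaleR]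
lemmas Ck_on_inner = Ck_on_bilinear[OF _ bounded_bilinear_inner]

lemma Ck_on_minus: "open S ==> Ck_on k S f ==> Ck_on k S (%x. - f x)"
 using Ck_on_scaleR[of S k "%_. -1" f] Ck_on_const[of S k "-1::real"] by simp

lemma Ck_on_diff: "open S ==> Ck_on k S f ==> Ck_on k S g ==> Ck_on k S (%x. f x - g x)"
 using Ck_on_add[of S k f "%x. - g x"] Ck_on_minus[of S k g] by simp

lemma Ck_on_id: "open S ==> Ck_on k S (%x. x)"
 by (rule Ck_on_bounded_linear) (auto intro: bounded_linear_ident)

lemma Ck_on_compose:
 fixes q :: "'a::euclidean_space => 'b::euclidean_space"
 assumes S: "open S" and T: "open T" and im: "q ` S \<subseteq> T"
 shows "Ck_on k T f ==> Ck_on k S q ==> Ck_on k S (%x. f (q x))"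
proof (induction k arbitrary: f)
 case 0 then show ?case using continuous_on_compose2[of T f S q] im by simp
next
 case (Suc k)
 have q: "q differentiable (at x)" "f differentiable (at (q x))" if "x \<in> S" for x
  using Suc.prems Ck_on_SucD[OF S, of k q x] Ck_on_SucD[OF T, of k f "q x"] im that by blast+
 show ?case
 proof (rule Ck_on_SucI[OF S])
  \<comment> \<open>The inner derivative is expanded in the basis because \<open>Ck_on\<close>
    controls only partial derivatives along basis vectors; the induction hypothesis is applied to
    those of \<open>f\<close>.\<close>
  show "((%x. f (q x)) has_derivative (%v. \<Sum>j\<in>Basis. (pd v q x \<bullet> j) *\<^sub>R pd j f (q x))) (at x)"
   if "x \<in> S" for x
  proof -
   have "((%x. f (q x)) has_derivative (%v. pd (pd v q x) f (q x))) (at x)"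
    using has_derivative_compose[OF has_derivative_pd has_derivative_pd] q that by blast
   then show ?thesis unfolding pd_expand[OF q(2)[OF that], symmetric] .
  qed
  show "Ck_on k S (%x. \<Sum>j\<in>Basis. (pd i q x \<bullet> j) *\<^sub>R pd j f (q x))" if "i \<in> Basis" for i
   by (intro Ck_on_sum Ck_on_scaleR Ck_on_inner Ck_on_const S Suc.IH)
     (use Suc.prems that Ck_on_Suc_imp[OF S] in \<open>auto simp del: Ck_on.simps intro: Ck_on_pd\<close>)
 qed
qed

lemma pd_compose:
 fixes q :: "'a::euclidean_space => 'b::euclidean_space"
 assumes "q differentiable (at x)" "f differentiable (at (q x))"
 shows "pd v (%x. f (q x)) x = pd (pd v q x) f (q x)"
 by (rule pd_eqI) (rule has_derivative_compose[OF has_derivative_pd has_derivative_pd, OF assms])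

lemma pd_add: "f differentiable (at x) ==> g differentiable (at x) ==> 
  pd v (%x. f x + g x) x = pd v f x + pd v g x"
 by (intro pd_eqI has_derivative_add has_derivative_pd)

lemma pd_bilinear:
 "bounded_bilinear B ==> f differentiable (at x) ==> g differentiable (at x) ==>
  pd v (%x. B (f x) (g x)) x = B (f x) (pd v g x) + B (pd v f x) (g x)"
 by (intro pd_eqI bounded_bilinear.FDERIV[of B] has_derivative_pd)

lemmas pd_mult = pd_bilinear[OF bounded_bilinear_mult]
lemmas pd_scaleR = pd_bilinear[OF bounded_bilinear_scaleR]
lemma pd_bounded_linear:
 "bounded_linear L ==> f differentiable (at x) ==> pd v (%x. L (f x)) x = L (pd v f x)"
 by (rule pd_eqI) (rule bounded_linear.has_derivative[OF _ has_derivative_pd])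

lemma Ck_on_linear_comp:
 fixes f :: "'a::euclidean_space => 'b::real_normed_vector"
 assumes S: "open S" and L: "bounded_linear L"
 shows "Ck_on k S f ==> Ck_on k S (%x. L (f x))"
proof (induction k arbitrary: f)
 case 0 then show ?case by (auto intro: bounded_linear.continuous_on[OF L])
next
 case (Suc k)
 show ?case
 proof (rule Ck_on_SucI[OF S])
  show "((%x. L (f x)) has_derivative (%v. L (pd v f x))) (at x)" if "x \<in> S" for x
   by (intro bounded_linear.has_derivative[OF L] has_derivative_pd)
     (use Suc.prems that Ck_on_SucD[OF S] in blast)
  show "Ck_on k S (%x. L (pd i f x))" if "i \<in> Basis" for i
   by (rule Suc.IH) (use Suc.prems that in auto)
 qed
qed

lemma continuous_on_pd:
 fixes f :: "'a::euclidean_space => 'b::real_normed_vector"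
 assumes "open S" "Ck_on 1 S f" shows "continuous_on S (pd v f)"
proof -
 have "continuous_on S (%x. \<Sum>j\<in>Basis. (v \<bullet> j) *\<^sub>R pd j f x)"
  using assms by (auto intro!: continuous_intros)
 moreover have "pd v f x = (\<Sum>j\<in>Basis. (v \<bullet> j) *\<^sub>R pd j f x)" if "x \<in> S" for x
  using pd_expand Ck_on_differentiable[OF assms(1,2) _ that] by auto
 ultimately show ?thesis by (simp cong: continuous_on_cong)
qed

subsection \<open>A smooth bump function\<close>

text \<open>The powers of 1/t are carried along so that the family is closed under differentiation;
  \<open>flat 0\<close> is the classical flat function exp(-1/t).\<close>

definition flat :: "nat => real => real" where
 "flat n t = (if t > 0 then inverse t ^ n * exp (- inverse t) else 0)"

text \<open>A single term of the series of exp(1/t) already dominates the power of 1/t. Two spare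
  powers of t remain, so that the difference quotient at 0 tends to 0.\<close>

lemma flat_small:
 assumes t: "0 < t" shows "flat n t \<le> fact (n + 2) * t\<^sup>2"
proof -
 have "(\<Sum>i\<in>{n + 2}. inverse t ^ i /\<^sub>R fact i) \<le> exp (inverse t)"
  unfolding exp_def using t by (intro sum_le_suminf summable_exp_generic) auto
 then have "inverse t ^ (n + 2) / fact (n + 2) \<le> exp (inverse t)"
  by (simp add: divide_inverse mult.commute del: fact_Suc power_inverse)
 then have le: "inverse t ^ (n + 2) \<le> fact (n + 2) * exp (inverse t)"
  unfolding pos_divide_le_eq[OF fact_gt_zero] by (simp only: mult.commute)
 have "inverse t ^ n * exp (- inverse t) = inverse t ^ (n + 2) * (t\<^sup>2 * exp (- inverse t))"
  using t by (simp add: power_add power2_eq_square field_simps)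
 also have "\<dots> \<le> fact (n + 2) * exp (inverse t) * (t\<^sup>2 * exp (- inverse t))"
  by (intro mult_right_mono le) auto
 also have "\<dots> = fact (n + 2) * t\<^sup>2"
  by (simp add: exp_minus del: fact_Suc)
 finally show ?thesis using t by (simp add: flat_def)
qed

lemma flat_nonneg: "flat n t \<ge> 0"
 by (simp add: flat_def)

lemma flat_deriv:
 "(flat n has_real_derivative (- real n * flat (n + 1) t + flat (n + 2) t)) (at t)"
proof (cases t "0::real" rule: linorder_cases)
 case greater
 have "((%t. inverse t ^ n * exp (- inverse t)) has_real_derivative
   (real n * (- (inverse t ^ Suc (Suc 0)) * inverse t ^ (n - Suc 0))) * exp (- inverse t)
   + (exp (- inverse t) * - (- (inverse t ^ Suc (Suc 0)))) * inverse t ^ n) (at t)"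
  using greater by (intro DERIV_mult DERIV_power[where f=inverse] DERIV_fun_exp DERIV_minus DERIV_inverse) auto
 moreover have "(real n * (- (inverse t ^ Suc (Suc 0)) * inverse t ^ (n - Suc 0))) * exp (- inverse t)
   + (exp (- inverse t) * - (- (inverse t ^ Suc (Suc 0)))) * inverse t ^ n
   = - real n * flat (n + 1) t + flat (n + 2) t"
  using greater by (cases n) (simp_all add: flat_def algebra_simps)
 ultimately have "((%t. inverse t ^ n * exp (- inverse t)) has_real_derivative
   - real n * flat (n + 1) t + flat (n + 2) t) (at t)" by simp
 then show ?thesis
  by (rule has_field_derivative_transform_within_open[where S="{0<..}"])
    (use greater in \<open>auto simp: flat_def\<close>)
next
 case less
 have "((%t. 0) has_real_derivative (- real n * flat (n + 1) t + flat (n + 2) t)) (at t)"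
  using less by (simp add: flat_def)
 then show ?thesis
  by (rule has_field_derivative_transform_within_open[where S="{..<0}"])
    (use less in \<open>auto simp: flat_def\<close>)
next
 case equal
 have "(flat n has_real_derivative 0) (at 0)"
  unfolding has_field_derivative_iff
 proof (rule Lim_null_comparison[where g="%h. fact (n + 2) * \<bar>h\<bar>"])
  show "\<forall>\<^sub>F x in at 0. norm ((flat n x - flat n 0) / (x - 0)) \<le> fact (n + 2) * \<bar>x\<bar>"
  proof (rule always_eventually, rule allI)
   fix x :: real
   show "norm ((flat n x - flat n 0) / (x - 0)) \<le> fact (n + 2) * \<bar>x\<bar>"
   proof (cases "x > 0")
    case True
    have "flat n x / x \<le> fact (n + 2) * x"
     using flat_small[OF True, of n] True by (simp add: divide_le_eq power2_eq_square)
    then show ?thesis using True flat_nonneg[of n x] by (simp add: flat_def)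
   qed (simp add: flat_def mult_le_0_iff del: fact_Suc)
  qed
  show "((%h::real. fact (n + 2) * \<bar>h\<bar>) \<longlongrightarrow> 0) (at 0)"
   by (auto intro!: tendsto_eq_intros)
 qed
 then show ?thesis using equal by (simp add: flat_def)
qed

lemma Ck_on_flat: "Ck_on k UNIV (flat n)"
proof (induction k arbitrary: n)
 case 0 show ?case using DERIV_isCont[OF flat_deriv] by (simp add: continuous_at_imp_continuous_on)
next
 case (Suc k)
 show ?case
 proof (rule Ck_on_SucI[where f'="%t v. (- real n * flat (n + 1) t + flat (n + 2) t) * v"])
  show "(flat n has_derivative (*) (- real n * flat (n + 1) x + flat (n + 2) x)) (at x)" for x
   using flat_deriv[of n x] by (simp add: has_field_derivative_def)
  show "Ck_on k UNIV (%x. (- real n * flat (n + 1) x + flat (n + 2) x) * i)" for i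
   by (intro Ck_on_mult Ck_on_add Ck_on_const Suc open_UNIV)
 qed simp
qed

definition bump :: "'a::euclidean_space => real => 'a => real" where
 "bump p r x = flat 0 (r\<^sup>2 - (x - p) \<bullet> (x - p))"

lemma Ck_on_bump: "Ck_on k UNIV (bump p r)"
 unfolding bump_def
 by (rule Ck_on_compose[OF _ _ _ Ck_on_flat]; (intro Ck_on_diff Ck_on_const Ck_on_inner Ck_on_id)?) auto

lemma bump_nonneg: "bump p r x \<ge> 0" by (simp add: bump_def flat_nonneg)

lemma bump_eq_0_iff: "r > 0 ==> bump p r x = 0 \<longleftrightarrow> x \<notin> ball p r"
 using power_mono_iff[of r "norm (x - p)" 2]
 by (auto simp: bump_def flat_def dist_norm norm_minus_commute[of p] power2_norm_eq_inner not_less not_le)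

text \<open>The vanishing is recorded outside some compact \<open>K\<close>, not through the closed
  support; sums, products, translates and mollifications then only have to exhibit a compact
  set.\<close>

definition Cc :: "nat => 'a::euclidean_space set => ('a => 'b::real_normed_vector) => bool" where
 "Cc k W c \<longleftrightarrow> Ck_on k UNIV c \<and> (\<exists>K. compact K \<and> K \<subseteq> W \<and> (\<forall>x. x \<notin> K \<longrightarrow> c x = 0))"

lemma CcI: "Ck_on k UNIV c ==> compact K ==> K \<subseteq> W ==> (!!x. x \<notin> K ==> c x = 0) ==> Cc k W c"
 unfolding Cc_def by blast

lemma CcE:
 assumes "Cc k W c"
 obtains K where "Ck_on k UNIV c" "compact K" "K \<subseteq> W" "!!x. x \<notin> K ==> c x = 0"
 using assms unfolding Cc_def by blast

lemma Cc_Ck: "Cc k W c ==> Ck_on k UNIV c" by (simp add: Cc_def)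

lemma Cc_mono: "Cc k W c ==> j \<le> k ==> W \<subseteq> V ==> Cc j V c"
 unfolding Cc_def using Ck_on_mono[OF open_UNIV] by blast

lemma Cc_differentiable: "Cc 1 W c ==> c differentiable (at x)"
 using Ck_on_SucD[OF open_UNIV, of 0 c x] Cc_Ck[of 1 W c] by simp

lemma pd_eq_0_outside: "closed K ==> (!!x. x \<notin> K ==> c x = 0) ==> x \<notin> K ==> pd i c x = 0"
proof -
 assume K: "closed K" "!!x. x \<notin> K ==> c x = 0" "x \<notin> K"
 have "pd i c x = pd i (%x. 0) x"
  by (rule pd_cong_open[of "- K"]) (use K in auto)
 also have "pd i (%x. 0) x = 0" by (simp add: frechet_derivative_const)
 finally show ?thesis .
qed

lemma Cc_pd: "Cc (Suc k) W c ==> i \<in> Basis ==> Cc k W (pd i c)"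
 by (erule CcE, rule CcI[OF Ck_on_pd]) (auto simp del: Ck_on.simps intro: pd_eq_0_outside[OF compact_imp_closed])

lemma Cc_pd1: "Cc 1 W c ==> i \<in> Basis ==> Cc 0 W (pd i c)"
 using Cc_pd[of 0 W c i] by simp

lemma Cc_add: assumes "Cc k W c" "Cc k W d" shows "Cc k W (%x. c x + d x)"
proof -
 obtain K L where "compact K" "K \<subseteq> W" "!!x. x \<notin> K ==> c x = 0" "compact L" "L \<subseteq> W" "!!x. x \<notin> L ==> d x = 0"
  using assms unfolding Cc_def by metis
 then show ?thesis
  by (intro CcI[where K="K \<union> L"] Ck_on_add[OF open_UNIV Cc_Ck[OF assms(1)] Cc_Ck[OF assms(2)]]) auto
qed

lemma Cc_scaleR_left: assumes "Cc k W c" "Ck_on k UNIV f" shows "Cc k W (%x. c x *\<^sub>R f x)"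
proof -
 obtain K where "compact K" "K \<subseteq> W" "!!x. x \<notin> K ==> c x = 0" using assms(1) by (auto elim: CcE)
 then show ?thesis
  by (intro CcI[OF Ck_on_scaleR[OF open_UNIV Cc_Ck[OF assms(1)] assms(2)], where K=K]) auto
qed

lemma Cc_mult: assumes "Cc k W c" "Ck_on k UNIV f" shows "Cc k W (%x. c x * f x :: real)"
 using Cc_scaleR_left[OF assms] by simp

text \<open>\<open>V\<close> and the complement of \<open>K\<close> are open and cover the space;
  the extension is \<open>f\<close> on the first and 0 on the second.\<close>

lemma Cc_zero_extend:
 assumes V: "open V" and f: "Ck_on k V f" and K: "compact K" "K \<subseteq> V" "!!x. x \<in> V ==> x \<notin> K ==> f x = 0"
 shows "Cc k V (%x. if x \<in> V then f x else 0)"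
proof (rule CcI[OF _ K(1,2)])
 let ?g = "%x. if x \<in> V then f x else 0"
 have "Ck_on k V ?g" using Ck_on_cong[OF V, of ?g f] f by simp
 moreover have "Ck_on k (- K) ?g"
 proof -
  have "open (- K)" using compact_imp_closed[OF K(1)] by auto
  then show ?thesis
   using Ck_on_cong[of "- K" ?g "%_. 0"] K Ck_on_const[of "- K" k 0] by (simp del: Ck_on.simps)
 qed
 ultimately have "Ck_on k (V \<union> - K) ?g"
  using V compact_imp_closed[OF K(1)] by (intro Ck_on_open_Un) auto
 moreover have "V \<union> - K = UNIV" using K by auto
 ultimately show "Ck_on k UNIV ?g" by simp
qed (use K in auto)

lemma Cc_integrable:
 fixes c :: "'a::euclidean_space => 'b::euclidean_space"
 assumes "Cc k W c" shows "integrable lborel c"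
proof -
 obtain K where K: "compact K" "!!x. x \<notin> K ==> c x = 0" using assms by (auto elim: CcE)
 have "continuous_on K c"
  using Ck_on_continuous[OF open_UNIV Cc_Ck[OF assms]] continuous_on_subset by blast
 then have "integrable lborel (%x. indicator K x *\<^sub>R c x)" by (rule borel_integrable_compact[OF K(1)])
 moreover have "(%x. indicator K x *\<^sub>R c x) = c" using K(2) by (auto simp: indicator_def fun_eq_iff)
 ultimately show ?thesis by simp
qed

lemma Cc_bounded:
 assumes "Cc k W c" obtains B where "B > 0" "!!x. norm (c x) \<le> B"
proof -
 obtain K where K: "compact K" "!!x. x \<notin> K ==> c x = 0" using assms by (auto elim: CcE)
 have "continuous_on K c"
  using Ck_on_continuous[OF open_UNIV Cc_Ck[OF assms]] continuous_on_subset by blast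
 then have "bounded (c ` K)" using K compact_imp_bounded compact_continuous_image by blast
 then obtain B where "B > 0" "!!x. x \<in> K ==> norm (c x) \<le> B" by (auto simp: bounded_pos)
 then show ?thesis using that[of B] K(2) by (metis less_imp_le norm_zero)
qed

lemma compact_thicken:
 fixes K :: "'a::euclidean_space set"
 assumes "compact K" shows "compact (\<Union>x\<in>K. cball x r)"
proof -
 have "(\<Union>x\<in>K. cball x r) = {x + y | x y. x \<in> K \<and> y \<in> cball 0 r}"
  by (auto simp: dist_norm) (metis add_diff_cancel_left' diff_add_cancel norm_minus_commute add.commute)+
 then show ?thesis using compact_sums[OF assms compact_cball[of 0 r]] by simp
qed

lemma Cc_uniformly_continuous:
 assumes "Cc k W c" "e > 0"
 obtains d where "d > 0" "!!x y. dist x y < d ==> dist (c x) (c y) < e"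
proof -
 obtain K where K: "compact K" "!!x. x \<notin> K ==> c x = 0" using assms by (auto elim: CcE)
 let ?T = "\<Union>x\<in>K. cball x 1"
 have "continuous_on ?T c"
  using Ck_on_continuous[OF open_UNIV Cc_Ck[OF assms(1)]] continuous_on_subset by blast
 then have "uniformly_continuous_on ?T c"
  using compact_thicken[OF K(1)] compact_uniformly_continuous by blast
 then obtain d where d: "d > 0" "!!x y. x \<in> ?T ==> y \<in> ?T ==> dist y x < d ==> dist (c y) (c x) < e"
  using assms(2) unfolding uniformly_continuous_on_def by metis
 have "dist (c x) (c y) < e" if "dist x y < min d 1" for x y
 proof (cases "x \<in> K \<or> y \<in> K")
  case True
  then have "x \<in> ?T" "y \<in> ?T" using that by (force simp: dist_commute)+
  then show ?thesis using d(2)[of y x] that by simp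
 qed (use K(2) assms(2) in auto)
 then show ?thesis using that[of "min d 1"] d(1) by simp
qed

text \<open>The partial derivatives are uniformly continuous, so the first-order Taylor error is
  small uniformly in the base point. This uniformity lets difference quotients pass under the
  integral.\<close>

lemma uniform_linearization:
 fixes c :: "'a::euclidean_space => 'b::real_normed_vector"
 assumes "Cc 1 W c" "e > 0"
 obtains d where "d > 0" "!!x h. norm h < d ==> norm (c (x + h) - c x - pd h c x) \<le> e * norm h"
proof -
 define e' where "e' = e / DIM('a)"
 have e': "e' > 0" using assms by (simp add: e'_def)
 have "\<forall>j\<in>Basis. \<exists>d>0. \<forall>x y. dist x y < d \<longrightarrow> dist (pd j c x) (pd j c y) < e'"
  using Cc_uniformly_continuous[OF Cc_pd1[OF assms(1)] e'] by metis
 then obtain D where D: "!!j. j \<in> Basis ==> D j > 0"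
  "!!j x y. j \<in> Basis ==> dist x y < D j ==> dist (pd j c x) (pd j c y) < e'" by metis
 define d where "d = Min (D ` Basis)"
 have d: "d > 0" "!!j. j \<in> Basis ==> d \<le> D j" using D by (auto simp: d_def)
 have diff: "c differentiable (at x)" for x by (rule Cc_differentiable[OF assms(1)])
 have *: "norm (pd v c y - pd v c x) \<le> e * norm v" if "dist y x < d" for x y v
 proof -
  have "norm (pd v c y - pd v c x) = norm (\<Sum>j\<in>Basis. (v \<bullet> j) *\<^sub>R (pd j c y - pd j c x))"
   by (simp add: pd_expand[OF diff, where v=v] sum_subtractf scaleR_diff_right)
  also have "\<dots> \<le> (\<Sum>j\<in>(Basis::'a set). norm v * e')"
  proof (rule sum_norm_le)
   fix j :: 'a assume j: "j \<in> Basis"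
   have "dist (pd j c y) (pd j c x) < e'" using D(2)[OF j] d(2)[OF j] that by force
   then show "norm ((v \<bullet> j) *\<^sub>R (pd j c y - pd j c x)) \<le> norm v * e'"
    using Basis_le_norm[OF j, of v] by (auto simp: dist_norm intro!: mult_mono)
  qed
  also have "\<dots> = e * norm v" by (simp add: e'_def)
  finally show ?thesis .
 qed
 have "norm (c (x + h) - c x - pd h c x) \<le> e * norm h" if h: "norm h < d" for x h
 proof -
  have "norm (c (x + h) - c x - pd (x + h - x) c x) \<le> norm (x + h - x) * e"
  proof (rule differentiable_bound_linearization[where S="ball x d" and f'="%y v. pd v c y"])
   show "x + t *\<^sub>R (x + h - x) \<in> ball x d" if "t \<in> {0..1}" for t
    using that h mult_left_le_one_le[of "norm h" t] by (simp add: dist_norm)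
   show "(c has_derivative (%v. pd v c y)) (at y within ball x d)" for y
    using has_derivative_at_withinI[OF has_derivative_pd[OF diff]] .
   show "onorm ((%v. pd v c y) - (%v. pd v c x)) \<le> e" if "y \<in> ball x d" for y
    by (rule onorm_le) (use *[of y x] that in \<open>simp add: dist_commute\<close>)
  qed (use d in auto)
  then show ?thesis by (simp add: mult.commute)
 qed
 then show ?thesis using that d(1) by blast
qed

section \<open>Translation invariance and integration by parts\<close>

lemma integrable_scaleR_bounded:
 fixes F :: "'a => 'b::{banach, second_countable_topology}"
 assumes "integrable M F" "g \<in> borel_measurable M" "!!x. \<bar>g x\<bar> \<le> B"
 shows "integrable M (%x. g x *\<^sub>R F x)"
proof (rule Bochner_Integration.integrable_bound[where f="%x. B *\<^sub>R F x"])
 show "AE x in M. norm (g x *\<^sub>R F x) \<le> norm (B *\<^sub>R F x)"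
  using assms(3) by (intro AE_I2) (auto intro!: mult_right_mono intro: order.trans[OF _ abs_ge_self])
qed (use assms in auto)

lemma lborel_integral_translate:
 fixes f :: "'a::euclidean_space => 'b::{banach, second_countable_topology}"
 assumes [measurable]: "f \<in> borel_measurable borel"
 shows "(LBINT x. f (x + t)) = (LBINT x. f x)"
proof -
 have "(LBINT x. f x) = (LINT x|distr lborel borel ((+) t). f x)"
  by (simp add: lborel_distr_plus)
 also have "\<dots> = (LBINT x. f (t + x))"
  by (rule integral_distr) auto
 finally show ?thesis by (simp add: add.commute)
qed

lemma lborel_integrable_translate:
 fixes f :: "'a::euclidean_space => 'b::{banach, second_countable_topology}"
 assumes "integrable lborel f"
 shows "integrable lborel (%x. f (x + t))"
proof -
 have "integrable (distr lborel borel ((+) t)) f"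
  using assms by (simp add: lborel_distr_plus)
 then have "integrable lborel (%x. f (t + x))"
  by (subst (asm) integrable_distr_eq) (use assms in auto)
 then show ?thesis by (simp add: add.commute)
qed

text \<open>By translation invariance every difference quotient has integral 0, and the quotients
  converge to the derivative uniformly on a fixed compact neighbourhood of the support.\<close>

lemma integral_pd_eq_0:
 fixes c :: "'a::euclidean_space => 'b::euclidean_space"
 assumes c: "Cc 1 W c" and i: "i \<in> Basis"
 shows "(LBINT x. pd i c x) = 0"
proof -
 obtain K where K: "compact K" "!!x. x \<notin> K ==> c x = 0" using c by (auto elim: CcE)
 define T where "T = (\<Union>x\<in>K. cball x 1)"
 have T: "compact T" using compact_thicken[OF K(1)] by (simp add: T_def)
 have KT: "K \<subseteq> T" by (auto simp: T_def)
 have Tm: "integrable lborel (indicator T :: 'a => real)"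
  using borel_integrable_compact[OF T, of "%_. 1::real"] by simp
 note ci = Cc_integrable[OF c] and pi = Cc_integrable[OF Cc_pd1[OF c i]]
 note mc = borel_measurable_integrable[OF ci]
 have "norm (LBINT x. pd i c x) \<le> e * measure lborel T" if e: "e > 0" for e
 proof -
  obtain d where d: "d > 0" "!!x h. norm h < d ==> norm (c (x + h) - c x - pd h c x) \<le> e * norm h"
   using uniform_linearization[OF c e] by metis
  \<comment> \<open>The bound 1 is the radius by which \<open>T\<close> thickens \<open>K\<close>: a
    translate by at most 1 keeps its support inside \<open>T\<close>.\<close>
  define t where "t = min (d/2) 1"
  have t: "t > 0" "t < d" "t \<le> 1" using d by (auto simp: t_def)
  define D where "D x = (1/t) *\<^sub>R (c (x + t *\<^sub>R i) - c x)" for x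
  have iD: "integrable lborel D"
   unfolding D_def by (intro integrable_scaleR_right Bochner_Integration.integrable_diff ci lborel_integrable_translate)
  have "(LBINT x. D x) = 0"
   unfolding D_def using lborel_integral_translate[of c "t *\<^sub>R i"] mc
   by (simp add: Bochner_Integration.integral_diff lborel_integrable_translate ci)
  then have "norm (LBINT x. pd i c x) = norm (LBINT x. D x - pd i c x)"
   by (simp add: Bochner_Integration.integral_diff iD pi)
  also have "\<dots> \<le> (LBINT x. e * indicator T x)"
  proof (rule Bochner_Integration.integral_norm_bound_integral)
   fix x
   show "norm (D x - pd i c x) \<le> e * indicator T x"
   proof (cases "x \<in> T")
    case True
    have "pd (t *\<^sub>R i) c x = t *\<^sub>R pd i c x"
     using linear_scale[OF linear_pd[OF Cc_differentiable[OF c]]] by simp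
    then have "D x - pd i c x = (1/t) *\<^sub>R (c (x + t *\<^sub>R i) - c x - pd (t *\<^sub>R i) c x)"
     using t by (simp add: D_def algebra_simps)
    then have "norm (D x - pd i c x) \<le> (1/t) * (e * t)"
     using d(2)[of "t *\<^sub>R i" x] t i by (simp add: divide_le_eq)
    then show ?thesis using t True by simp
   next
    case False
    then have "x \<notin> K" using KT by auto
    moreover have "x + t *\<^sub>R i \<notin> K"
    proof
     assume "x + t *\<^sub>R i \<in> K"
     then have "x \<in> T" unfolding T_def using t i by (intro UN_I[of "x + t *\<^sub>R i"]) (auto simp: dist_norm)
     then show False using False by simp
    qed
    ultimately show ?thesis
     using K(2) pd_eq_0_outside[OF compact_imp_closed[OF K(1)] K(2)] False by (simp add: D_def)
   qed
  qed (use iD pi Tm in auto)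
  also have "\<dots> = e * measure lborel T" using T by (simp add: compact_imp_closed borel_closed)
  finally show ?thesis .
 qed
 note le = this
 have "norm (LBINT x. pd i c x) \<le> 0"
 proof (rule field_le_epsilon)
  fix e :: real assume e: "e > 0"
  define m where "m = measure lborel T + 1"
  have m: "m > 0" by (simp add: m_def add_nonneg_pos)
  have "norm (LBINT x. pd i c x) \<le> e / m * measure lborel T" using le[of "e/m"] e m by simp
  also have "\<dots> \<le> e / m * m" using e m by (intro mult_left_mono) (auto simp: m_def)
  finally show "norm (LBINT x. pd i c x) \<le> 0 + e" using m by simp
 qed
 then show ?thesis by simp
qed

lemma integral_pd_product:
 fixes f :: "'a::euclidean_space => 'b::euclidean_space"
 assumes c: "Cc 1 W c" and f: "Ck_on 1 UNIV f" and i: "i \<in> Basis"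
 shows "(LBINT x. pd i c x *\<^sub>R f x) = - (LBINT x. c x *\<^sub>R pd i f x)"
proof -
 note cf = Cc_scaleR_left[OF c f]
 have fd: "f differentiable (at x)" for x using f Ck_on_SucD[OF open_UNIV, of 0 f x] by simp
 have 1: "integrable lborel (%x. pd i c x *\<^sub>R f x)"
  using Cc_integrable[OF Cc_scaleR_left[OF Cc_pd1[OF c i]]] Ck_on_mono[OF open_UNIV f, of 0] by simp
 have 2: "integrable lborel (%x. c x *\<^sub>R pd i f x)"
  using Cc_integrable[OF Cc_scaleR_left[OF Cc_mono[OF c, of 0 W] Ck_on_pd[of 0 UNIV f i]]] f i by simp
 have "0 = (LBINT x. pd i (%x. c x *\<^sub>R f x) x)" using integral_pd_eq_0[OF cf i] by simp
 also have "\<dots> = (LBINT x. c x *\<^sub>R pd i f x + pd i c x *\<^sub>R f x)"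
  by (simp add: pd_scaleR[OF Cc_differentiable[OF c] fd])
 finally show ?thesis using 1 2 by (simp add: eq_neg_iff_add_eq_0 add.commute)
qed

subsection \<open>Mollification\<close>

definition conv :: "('a::euclidean_space => 'b::euclidean_space) => ('a => real) => 'a => 'b" where
 "conv F \<rho> x = (LBINT y. \<rho> (x - y) *\<^sub>R F y)"

lemma Cc_measurable:
 fixes c :: "'a::euclidean_space => 'b::euclidean_space"
 shows "Cc k W c ==> c \<in> borel_measurable borel"
 using borel_measurable_integrable[OF Cc_integrable] by simp

lemma conv_integrable:
 fixes F :: "'a::euclidean_space => 'b::euclidean_space"
 assumes "integrable lborel F" "Cc k W \<rho>"
 shows "integrable lborel (%y. \<rho> (x - y) *\<^sub>R F y)"
proof -
 obtain B where "!!x. norm (\<rho> x) \<le> B" using Cc_bounded[OF assms(2)] by metis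
 moreover note Cc_measurable[OF assms(2), measurable]
 ultimately show ?thesis by (intro integrable_scaleR_bounded[OF assms(1)]) auto
qed

text \<open>All differentiation falls on the kernel, whose linearization error is uniform; hence
  integrability of \<open>F\<close> is enough.\<close>

lemma conv_has_derivative:
 fixes F :: "'a::euclidean_space => 'b::euclidean_space"
 assumes F: "integrable lborel F" and r: "Cc 1 W \<rho>"
 shows "(conv F \<rho> has_derivative (%v. conv F (pd v \<rho>) x)) (at x)"
proof -
 note ij = conv_integrable[OF F Cc_pd1[OF r]]
 have pdv: "pd v \<rho> (x - y) *\<^sub>R F y = (\<Sum>j\<in>Basis. (v \<bullet> j) *\<^sub>R (pd j \<rho> (x - y) *\<^sub>R F y))" for v x y
  by (subst pd_expand[OF Cc_differentiable[OF r], where v=v]) (simp add: scaleR_sum_left)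
 have iv: "integrable lborel (%y. pd v \<rho> (x - y) *\<^sub>R F y)" for v
  by (subst pdv, intro Bochner_Integration.integrable_sum integrable_scaleR_right ij)
 have L: "conv F (pd v \<rho>) x = (\<Sum>j\<in>Basis. (v \<bullet> j) *\<^sub>R conv F (pd j \<rho>) x)" for v
 proof -
  have "conv F (pd v \<rho>) x = (LBINT y. (\<Sum>j\<in>Basis. (v \<bullet> j) *\<^sub>R (pd j \<rho> (x - y) *\<^sub>R F y)))"
   unfolding conv_def by (subst pdv) (rule refl)
  also have "\<dots> = (\<Sum>j\<in>Basis. (v \<bullet> j) *\<^sub>R conv F (pd j \<rho>) x)"
   unfolding conv_def by (simp add: ij Bochner_Integration.integral_sum del: scaleR_scaleR)
  finally show ?thesis .
 qed
 show ?thesis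
  unfolding has_derivative_at_alt
 proof (intro conjI allI impI)
  show "bounded_linear (%v. conv F (pd v \<rho>) x)"
   by (subst L) (intro bounded_linear_sum bounded_linear_scaleR_left bounded_linear_compose[OF bounded_linear_scaleR_left bounded_linear_inner_left])
  fix e :: real assume e: "e > 0"
  define m where "m = (LBINT y. norm (F y)) + 1"
  have m0: "(LBINT y. norm (F y)) \<ge> 0" by simp
  then have m: "m > 0" by (simp add: m_def add_nonneg_pos)
  obtain d where d: "d > 0" "!!x h. norm h < d ==> norm (\<rho> (x + h) - \<rho> x - pd h \<rho> x) \<le> (e / m) * norm h"
   using uniform_linearization[OF r, of "e/m"] e m by (metis divide_pos_pos)
  show "\<exists>d>0. \<forall>y. norm (y - x) < d \<longrightarrow> norm (conv F \<rho> y - conv F \<rho> x - conv F (pd (y - x) \<rho>) x) \<le> e * norm (y - x)"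
  proof (intro exI[of _ d] conjI allI impI d(1))
   fix y assume y: "norm (y - x) < d"
   have "conv F \<rho> y - conv F \<rho> x - conv F (pd (y - x) \<rho>) x
     = (LBINT z. (\<rho> (y - z) - \<rho> (x - z) - pd (y - x) \<rho> (x - z)) *\<^sub>R F z)"
    unfolding conv_def using conv_integrable[OF F r] iv
    by (simp add: scaleR_diff_left Bochner_Integration.integral_diff)
   also have "norm \<dots> \<le> (LBINT z. (e / m * norm (y - x)) * norm (F z))"
   proof (rule Bochner_Integration.integral_norm_bound_integral)
    show "integrable lborel (%z. (\<rho> (y - z) - \<rho> (x - z) - pd (y - x) \<rho> (x - z)) *\<^sub>R F z)"
     using conv_integrable[OF F r] iv by (simp add: scaleR_diff_left)
    show "integrable lborel (%z. (e / m * norm (y - x)) * norm (F z))" using F by auto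
    fix z
    have "norm (\<rho> (y - z) - \<rho> (x - z) - pd (y - x) \<rho> (x - z)) \<le> e / m * norm (y - x)"
     using d(2)[OF y, of "x - z"] by simp
    then show "norm ((\<rho> (y - z) - \<rho> (x - z) - pd (y - x) \<rho> (x - z)) *\<^sub>R F z) \<le> (e / m * norm (y - x)) * norm (F z)"
     unfolding norm_scaleR by (intro mult_right_mono) auto
   qed
   also have "\<dots> = e * norm (y - x) * ((m - 1) / m)" by (simp add: m_def)
   also have "\<dots> \<le> e * norm (y - x)"
    using m e by (intro mult_left_le) (auto simp: divide_simps)
   finally show "norm (conv F \<rho> y - conv F \<rho> x - conv F (pd (y - x) \<rho>) x) \<le> e * norm (y - x)" .
  qed
 qed
qed

lemma pd_conv: "integrable lborel F ==> Cc 1 W \<rho> ==> pd i (conv F \<rho>) x = conv F (pd i \<rho>) x"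
 by (rule pd_eqI[OF conv_has_derivative])

lemma Ck_on_conv:
 assumes "integrable lborel F"
 shows "(!!k. Cc k W \<rho>) ==> Ck_on k UNIV (conv F \<rho>)"
proof (induction k arbitrary: \<rho>)
 case 0
 have "continuous (at x) (conv F \<rho>)" for x
  using has_derivative_continuous[OF conv_has_derivative[OF assms 0]] .
 then show ?case by (simp add: continuous_at_imp_continuous_on)
next
 case (Suc k)
 show ?case
 proof (rule Ck_on_SucI[OF open_UNIV conv_has_derivative[OF assms Suc.prems]])
  fix i :: 'a assume "i \<in> Basis"
  then have "Cc k W (pd i \<rho>)" for k using Cc_pd Suc.prems by blast
  then show "Ck_on k UNIV (conv F (pd i \<rho>))" by (rule Suc.IH)
 qed
qed

definition moll :: "real => 'a::euclidean_space => real" where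
 "moll r x = bump 0 r x / (LBINT y. bump (0::'a) r y)"

lemma Cc_bump: "r > 0 ==> Cc k (cball p r) (bump p r)"
 by (rule CcI[OF Ck_on_bump, where K="cball p r"]) (auto simp: bump_eq_0_iff)

lemma bump_integral_pos: assumes r: "r > 0" shows "(LBINT y. bump (0::'a::euclidean_space) r y) > 0"
proof -
 have i: "integrable lborel (bump (0::'a) r)" using Cc_integrable[OF Cc_bump[OF r, of 0 "0::'a"]] by simp
 have "(LBINT y. bump (0::'a) r y) \<noteq> 0"
 proof
  assume "(LBINT y. bump (0::'a) r y) = 0"
  then have "AE y in lborel. bump (0::'a) r y = 0"
   using integral_nonneg_eq_0_iff_AE[OF i] bump_nonneg by auto
  then have "AE y in lborel. y \<notin> ball (0::'a) r"
   by (rule eventually_mono) (simp add: bump_eq_0_iff[OF r])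
  then have "emeasure lborel (ball (0::'a) r) = 0"
   using AE_iff_measurable[of "ball (0::'a) r" lborel "%y. y \<notin> ball 0 r"] by (simp add: ball_def)
  then show False using emeasure_lborel_ball_finite[of "0::'a" r] content_ball_pos[OF r, of "0::'a"]
   by (simp add: measure_def)
 qed
 moreover have "(LBINT y. bump (0::'a) r y) \<ge> 0" by (simp add: bump_nonneg Bochner_Integration.integral_nonneg)
 ultimately show ?thesis by simp
qed

lemma Cc_moll: "r > 0 ==> Cc k (cball 0 r) (moll r)"
 unfolding moll_def divide_inverse
 by (rule Cc_mult[OF Cc_bump Ck_on_const[OF open_UNIV]])

lemma moll_nonneg: "moll r x \<ge> 0"
 by (simp add: moll_def bump_nonneg Bochner_Integration.integral_nonneg)

lemma moll_eq_0: "r > 0 ==> r \<le> norm x ==> moll r x = 0"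
 by (simp add: moll_def bump_eq_0_iff)

lemma moll_minus: "moll r (- x) = moll r x"
 by (simp add: moll_def bump_def)

lemma integral_moll: assumes "r > 0" shows "(LBINT y. moll r (y :: 'a::euclidean_space)) = 1"
 using bump_integral_pos[OF assms, where 'a='a] by (simp add: moll_def)

lemma integral_moll_shift: assumes "r > 0"
 shows "integrable lborel (%y. moll r (x - y))" "(LBINT y. moll r (x - y :: 'a::euclidean_space)) = 1"
proof -
 have *: "(%y. moll r (x - y)) = (%y. moll r (y + - x))"
  using moll_minus[of r "x - _"] by (auto simp: fun_eq_iff)
 show "integrable lborel (%y. moll r (x - y))"
  unfolding * using Cc_integrable[OF Cc_moll[OF assms]] by (intro lborel_integrable_translate) auto
 show "(LBINT y. moll r (x - y)) = 1"
  unfolding * by (simp only: lborel_integral_translate[OF Cc_measurable[OF Cc_moll[OF assms, of 0]]] integral_moll[OF assms])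
qed

lemma conv_moll_close:
 assumes F: "integrable lborel F" and r: "r > 0" and close: "!!y. dist x y < r ==> norm (F y - F x) \<le> e"
 shows "norm (conv F (moll r) x - F x) \<le> e"
proof -
 note i1 = conv_integrable[OF F Cc_moll[OF r, of 0], of x] and i2 = integral_moll_shift[OF r, of x]
 have "conv F (moll r) x - F x = (LBINT y. moll r (x - y) *\<^sub>R F y - moll r (x - y) *\<^sub>R F x)"
  unfolding conv_def using i1 i2 by (subst Bochner_Integration.integral_diff) auto
 also have "norm \<dots> \<le> (LBINT y. e * moll r (x - y))"
 proof (rule Bochner_Integration.integral_norm_bound_integral)
  fix y
  show "norm (moll r (x - y) *\<^sub>R F y - moll r (x - y) *\<^sub>R F x) \<le> e * moll r (x - y)"
  proof (cases "dist x y < r")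
   case True
   have "norm (moll r (x - y) *\<^sub>R (F y - F x)) \<le> moll r (x - y) * e"
    using close[OF True] moll_nonneg[of r "x - y"] by (simp add: mult_left_mono)
   then show ?thesis by (simp add: scaleR_diff_right mult.commute)
  qed (use moll_eq_0[OF r, of "x - y"] in \<open>auto simp: dist_norm\<close>)
 qed (use i1 i2 in auto)
 also have "\<dots> = e" using i2 by simp
 finally show ?thesis .
qed

lemma conv_moll_uniform:
 assumes F: "integrable lborel F" and r: "r > 0" "r \<le> d"
  and close: "!!x y. dist x y < d ==> dist (F x) (F y) < e"
 shows "norm (conv F (moll r) x - F x) \<le> e"
proof (rule conv_moll_close[OF F r(1)])
 show "norm (F y - F x) \<le> e" if "dist x y < r" for y
  using close[of y x] that r(2) by (simp add: dist_norm norm_minus_commute)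
qed

lemma conv_pd_moll:
 fixes F :: "'a::euclidean_space => 'b::euclidean_space"
 assumes F: "Cc 1 W F" and r: "r > 0" and i: "i \<in> Basis"
 shows "conv F (pd i (moll r)) x = conv (pd i F) (moll r) x"
proof -
 have k: "(%y. moll r (x - y)) = (%y. moll r (y - x))" 
  using moll_minus[of r "x - _"] by (auto simp: fun_eq_iff)
 have md: "(moll r :: 'a => real) differentiable (at y)" for y
  by (rule Cc_differentiable[OF Cc_moll[OF r]])
 have pdm: "pd i (%y. moll r (x - y)) y = - pd i (moll r) (x - y)" for y
 proof -
  have "((%y. moll r (x - y)) has_derivative (%v. pd (- v) (moll r) (x - y))) (at y)"
   by (rule has_derivative_compose[OF _ has_derivative_pd[OF md], of "%y. x - y" uminus, simplified])
     (auto intro!: derivative_eq_intros)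
  then show ?thesis using pd_eqI[of _ _ y i] linear_neg[OF linear_pd[OF md]] by metis
 qed
 have Ck: "Cc 1 (cball x r) (%y. moll r (x - y))"
 proof (rule CcI[where K="cball x r"])
  show "Ck_on 1 UNIV (%y. moll r (x - y))"
   by (rule Ck_on_compose[OF open_UNIV open_UNIV _ Cc_Ck[OF Cc_moll[OF r]]])
     (auto intro!: Ck_on_diff Ck_on_const Ck_on_id simp del: Ck_on.simps One_nat_def)
  show "moll r (x - y) = 0" if "y \<notin> cball x r" for y
   using that r by (intro moll_eq_0) (auto simp: dist_norm)
 qed auto
 have "(LBINT y. pd i (%y. moll r (x - y)) y *\<^sub>R F y) = - (LBINT y. moll r (x - y) *\<^sub>R pd i F y)"
  by (rule integral_pd_product[OF Ck Cc_Ck[OF F] i])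
 then show ?thesis by (simp add: pdm conv_def)
qed

lemma conv_support:
 assumes "r > 0" "!!y. y \<notin> K ==> F y = 0" "x \<notin> (\<Union>y\<in>K. cball y r)"
 shows "conv F (moll r) x = 0"
proof -
 have "moll r (x - y) *\<^sub>R F y = 0" for y
  using assms(2)[of y] assms(3) moll_eq_0[OF assms(1), of "x - y"]
  by (cases "y \<in> K") (auto simp: dist_norm norm_minus_commute not_le)
 then have "(%y. moll r (x - y) *\<^sub>R F y) = (%_. 0)" by (rule ext)
 then show ?thesis by (simp add: conv_def)
qed

lemma compact_thicken_subset:
 fixes K :: "'a::euclidean_space set"
 assumes "compact K" "open W" "K \<subseteq> W"
 obtains r where "r > 0" "(\<Union>x\<in>K. cball x r) \<subseteq> W"
proof (cases "K = {} \<or> W = UNIV")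
 case True then show ?thesis using that[of 1] by auto
next
 case False
 then have "setdist K (- W) > 0"
  using assms setdist_gt_0_compact_closed[of K "- W"] by auto
 moreover have "(\<Union>x\<in>K. cball x (setdist K (- W) / 2)) \<subseteq> W"
 proof
  fix y assume "y \<in> (\<Union>x\<in>K. cball x (setdist K (- W) / 2))"
  then obtain x where x: "x \<in> K" "dist x y \<le> setdist K (- W) / 2" by auto
  show "y \<in> W"
  proof (rule ccontr)
   assume "y \<notin> W"
   then have "setdist K (- W) \<le> dist x y" using x by (intro setdist_le_dist) auto
   then show False using x \<open>setdist K (- W) > 0\<close> by simp
  qed
 qed
 ultimately show ?thesis using that[of "setdist K (- W) / 2"] by simp
qed

lemma smooth_approx0:
 fixes F :: "'a::euclidean_space => real"
 assumes F: "Cc 0 W F" and W: "open W" and e: "e > 0"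
 obtains \<phi> where "!!k. Cc k W \<phi>" "!!x. \<bar>\<phi> x - F x\<bar> \<le> e"
proof -
 obtain K where K: "compact K" "K \<subseteq> W" "!!x. x \<notin> K ==> F x = 0" using F by (auto elim: CcE)
 obtain r where r: "r > 0" "(\<Union>x\<in>K. cball x r) \<subseteq> W" using compact_thicken_subset[OF K(1) W K(2)] .
 obtain d where d: "d > 0" "!!x y. dist x y < d ==> dist (F x) (F y) < e"
  using Cc_uniformly_continuous[OF F e] by metis
 define s where "s = min r d"
 have s: "s > 0" "s \<le> r" "s \<le> d" using r d by (auto simp: s_def)
 note Fi = Cc_integrable[OF F]
 show ?thesis
 proof (rule that[of "conv F (moll s)"])
  show "Cc k W (conv F (moll s))" for k
  proof (rule CcI[OF Ck_on_conv[OF Fi Cc_moll[OF s(1)]] compact_thicken[OF K(1), of s]])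
   show "(\<Union>x\<in>K. cball x s) \<subseteq> W" 
    by (rule order.trans[OF UN_mono[OF order_refl subset_cball[OF s(2)]] r(2)])
   show "conv F (moll s) x = 0" if "x \<notin> (\<Union>x\<in>K. cball x s)" for x
    by (rule conv_support[OF s(1) K(3) that])
  qed
  show "\<bar>conv F (moll s) x - F x\<bar> \<le> e" for x
   using conv_moll_uniform[OF Fi s(1,3) d(2)] by simp
 qed
qed

text \<open>For small radii the mollification keeps its support in \<open>W\<close>, and its partial
  derivatives are the mollified partial derivatives of \<open>F\<close>. Identities for smooth test
  functions thereby extend to C^1 ones.\<close>

lemma smooth_approx1:
 fixes F :: "'a::euclidean_space => real"
 assumes F: "Cc 1 W F" and W: "open W" and e: "e > 0"
 obtains \<phi> where "!!k. Cc k W \<phi>" "!!x. \<bar>\<phi> x - F x\<bar> \<le> e" "!!x i. i \<in> Basis ==> \<bar>pd i \<phi> x - pd i F x\<bar> \<le> e"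
proof -
 obtain K where K: "compact K" "K \<subseteq> W" "!!x. x \<notin> K ==> F x = 0" using F by (auto elim: CcE)
 obtain r where r: "r > 0" "(\<Union>x\<in>K. cball x r) \<subseteq> W" using compact_thicken_subset[OF K(1) W K(2)] .
 obtain d where d: "d > 0" "!!x y. dist x y < d ==> dist (F x) (F y) < e"
  using Cc_uniformly_continuous[OF F e] by metis
 have "\<forall>j\<in>Basis. \<exists>d>0. \<forall>x y. dist x y < d \<longrightarrow> dist (pd j F x) (pd j F y) < e"
  using Cc_uniformly_continuous[OF Cc_pd1[OF F] e] by metis
 then obtain D where D: "!!j. j \<in> Basis ==> D j > 0"
  "!!j x y. j \<in> Basis ==> dist x y < D j ==> dist (pd j F x) (pd j F y) < e" by metis
 define s where "s = min (min r d) (Min (D ` Basis))"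
 have s: "s > 0" "s \<le> r" "s \<le> d" "!!j. j \<in> Basis ==> s \<le> D j" using r d D by (auto simp: s_def min_le_iff_disj)
 note Fi = Cc_integrable[OF F]
 show ?thesis
 proof (rule that[of "conv F (moll s)"])
  show "Cc k W (conv F (moll s))" for k
  proof (rule CcI[OF Ck_on_conv[OF Fi Cc_moll[OF s(1)]] compact_thicken[OF K(1), of s]])
   show "(\<Union>x\<in>K. cball x s) \<subseteq> W" 
    by (rule order.trans[OF UN_mono[OF order_refl subset_cball[OF s(2)]] r(2)])
   show "conv F (moll s) x = 0" if "x \<notin> (\<Union>x\<in>K. cball x s)" for x
    by (rule conv_support[OF s(1) K(3) that])
  qed
  show "\<bar>conv F (moll s) x - F x\<bar> \<le> e" for x
   using conv_moll_uniform[OF Fi s(1,3) d(2)] by simp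
  show "\<bar>pd i (conv F (moll s)) x - pd i F x\<bar> \<le> e" if i: "i \<in> Basis" for i x
  proof -
   have "pd i (conv F (moll s)) x = conv (pd i F) (moll s) x"
    using pd_conv[OF Fi Cc_moll[OF s(1)]] conv_pd_moll[OF F s(1) i] by simp
   then show ?thesis
    using conv_moll_uniform[OF Cc_integrable[OF Cc_pd1[OF F i]] s(1) s(4)[OF i] D(2)[OF i]] by simp
  qed
 qed
qed

subsection \<open>The fundamental lemma of the calculus of variations\<close>

lemma Cc_times_integrable:
 fixes w :: "'a::euclidean_space => 'b::euclidean_space"
 assumes "Cc k U c" "integrable lborel w"
 shows "integrable lborel (%x. c x *\<^sub>R w x)"
proof -
 obtain B where "!!x. norm (c x) \<le> B" using Cc_bounded[OF assms(1)] by metis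
 then show ?thesis using Cc_measurable[OF assms(1)] by (intro integrable_scaleR_bounded[OF assms(2)]) auto
qed

lemma mult_frac_le: "(m::real) \<ge> 0 ==> e > 0 ==> e * (m / (m + 1)) \<le> e"
 by (intro mult_left_le) (auto simp: divide_le_eq)

text \<open>A uniform error \<open>q\<close> in the test function changes the integral by at most
  \<open>q\<close> times the L^1 norm of \<open>w\<close>.\<close>

lemma integral_zero_C0:
 fixes w :: "'a::euclidean_space => 'b::euclidean_space"
 assumes V: "open V" and w: "integrable lborel w"
  and z: "!!c::'a=>real. (!!k. Cc k V c) ==> (LBINT x. c x *\<^sub>R w x) = 0"
  and c: "Cc 0 V c"
 shows "(LBINT x. c x *\<^sub>R w x) = 0"
proof -
 note int = Cc_times_integrable[OF _ w]
 let ?m = "LBINT x. norm (w x)"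
 have m: "?m \<ge> 0" by simp
 have "norm (LBINT x. c x *\<^sub>R w x) \<le> 0 + e" if e: "e > 0" for e
 proof -
  define q where "q = e / (?m + 1)"
  have e': "q > 0" unfolding q_def using e m by (intro divide_pos_pos add_nonneg_pos) auto
  obtain \<phi> where \<phi>: "!!k. Cc k V \<phi>" "!!x. \<bar>\<phi> x - c x\<bar> \<le> q"
   using smooth_approx0[OF c V e'] by blast
  have "(LBINT x. c x *\<^sub>R w x) = (LBINT x. (c x - \<phi> x) *\<^sub>R w x)"
   using int[OF c] int[OF \<phi>(1)[of 0]] z[OF \<phi>(1)] by (simp add: scaleR_diff_left)
  also have "norm \<dots> \<le> (LBINT x. q * norm (w x))"
  proof (rule Bochner_Integration.integral_norm_bound_integral)
   show "integrable lborel (%x. (c x - \<phi> x) *\<^sub>R w x)"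
    using int[OF c] int[OF \<phi>(1)[of 0]] by (simp add: scaleR_diff_left)
   show "norm ((c x - \<phi> x) *\<^sub>R w x) \<le> q * norm (w x)" for x
    using \<phi>(2)[of x] by (simp add: abs_minus_commute mult_right_mono)
  qed (use w in auto)
  also have "\<dots> = e * (?m / (?m + 1))" by (simp add: q_def)
  also have "\<dots> \<le> e" by (rule mult_frac_le[OF m e])
  finally show ?thesis by simp
 qed
 then have "norm (LBINT x. c x *\<^sub>R w x) \<le> 0" by (rule field_le_epsilon)
 then show ?thesis by simp
qed

text \<open>Open sets are stable under intersection and generate the Borel sets, so the vanishing
  spreads to all Borel sets by the Dynkin argument.\<close>

lemma AE_zero_of_open_integrals:
 fixes f :: "'a::euclidean_space => 'b::euclidean_space"
 assumes f: "integrable lborel f"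
  and z: "!!U. open U ==> (LBINT x. indicator U x *\<^sub>R f x) = 0"
 shows "AE x in lborel. f x = 0"
proof (rule sigma_finite_measure.density_zero[OF sigma_finite_lborel f])
 have si: "set_integrable lborel A f" if "A \<in> sets borel" for A
  unfolding set_integrable_def using that f by (intro integrable_mult_indicator) auto
 fix A :: "'a set" assume "A \<in> sets lborel"
 then have A: "A \<in> sigma_sets UNIV {S. open S}" by (simp add: borel_def)
 have s: "A \<in> sets borel" if "A \<in> sigma_sets UNIV {S. open S}" for A :: "'a set"
  using that by (simp add: borel_def)
 have subset_Pow: "{S :: 'a set. open S} \<subseteq> Pow UNIV" by simp
 have "Int_stable {S :: 'a set. open S}" by (auto simp: Int_stable_def)
 then show "set_lebesgue_integral lborel A f = 0"
  using subset_Pow A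
 proof (induction rule: sigma_sets_induct_disjoint)
  case (basic A) then show ?case using z by (simp add: set_lebesgue_integral_def)
 next
  case empty then show ?case by (simp add: set_lebesgue_integral_def)
 next
  case (compl A)
  have "indicator (UNIV - A) x *\<^sub>R f x = f x - indicator A x *\<^sub>R f x" for x
   by (auto simp: indicator_def)
  then have "set_lebesgue_integral lborel (UNIV - A) f = (LBINT x. f x - indicator A x *\<^sub>R f x)"
   by (simp only: set_lebesgue_integral_def)
  also have "\<dots> = 0"
   using compl(2) z[of UNIV] si[OF s[OF compl(1)]] f
   by (simp add: set_lebesgue_integral_def set_integrable_def)
  finally show ?case .
 next
  case (union A)
  have "set_lebesgue_integral lborel (\<Union>i. A i) f = (\<Sum>i. set_lebesgue_integral lborel (A i) f)"
  proof (rule lebesgue_integral_countable_add)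
   show "A i \<in> sets lborel" for i using union(2) s by auto
   show "A i \<inter> A j = {}" if "i \<noteq> j" for i j using union(1) that by (auto simp: disjoint_family_on_def)
   have "(\<Union>i. A i) \<in> sets borel" using union(2) s by auto
   then show "set_integrable lborel (\<Union>i. A i) f" by (rule si)
  qed
  then show ?case using union(3) by simp
 qed
qed

text \<open>Urysohn functions along a compact exhaustion converge boundedly to the indicator of any
  open subset of \<open>V\<close>; dominated convergence then gives vanishing integrals over open
  sets.\<close>

lemma fundamental_lemma:
 fixes w :: "'a::euclidean_space => 'b::euclidean_space"
 assumes V: "open V" and w: "integrable lborel w"
  and z: "!!c::'a=>real. (!!k. Cc k V c) ==> (LBINT x. c x *\<^sub>R w x) = 0"
 shows "AE x in lborel. x \<in> V \<longrightarrow> w x = 0"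
proof -
 define f where "f x = indicator V x *\<^sub>R w x" for x
 have f: "integrable lborel f" unfolding f_def using V w by (intro integrable_mult_indicator) auto
 have "(LBINT x. indicator U x *\<^sub>R f x) = 0" if U: "open U" for U
 proof -
  have O: "open (U \<inter> V)" using U V by auto
  obtain C where C: "!!n. compact (C n)" "!!n. C n \<subseteq> U \<inter> V" "!!n. C n \<subseteq> interior (C (Suc n))"
   "\<Union>(range C) = U \<inter> V" "!!K. compact K ==> K \<subseteq> U \<inter> V ==> \<exists>N. \<forall>n\<ge>N. K \<subseteq> C n"
   using open_Union_compact_subsets[OF O] by metis
  have "\<exists>c :: 'a => real. continuous_on UNIV c \<and> (\<forall>x. c x \<in> closed_segment 1 0) \<and> (\<forall>x\<in>C n. c x = 1) \<and>
    (\<forall>x\<in>- interior (C (Suc n)). c x = 0)" for n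
  proof (rule Urysohn[of "C n" "- interior (C (Suc n))" "1::real" 0])
   show "closed (C n)" using C(1) compact_imp_closed by blast
   show "C n \<inter> - interior (C (Suc n)) = {}" using C(3)[of n] by blast
   show "closed (- interior (C (Suc n)))" by auto
  qed blast
  then obtain c :: "nat => 'a => real" where c: "!!n. continuous_on UNIV (c n)" "!!n x. c n x \<in> closed_segment 1 0"
   "!!n x. x \<in> C n ==> c n x = 1" "!!n x. x \<in> - interior (C (Suc n)) ==> c n x = 0" by metis
  have c01: "0 \<le> c n x" "c n x \<le> 1" for n x using c(2)[of n x] by (auto simp: closed_segment_eq_real_ivl)
  have Cc: "Cc 0 V (c n)" for n
  proof (rule CcI[where K="C (Suc n)"])
   show "c n x = 0" if "x \<notin> C (Suc n)" for x using that c(4) interior_subset by blast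
  qed (use c C in auto)
  have lim: "(%n. c n x *\<^sub>R w x) \<longlonglongrightarrow> indicator (U \<inter> V) x *\<^sub>R w x" for x
  proof (cases "x \<in> U \<inter> V")
   case True
   then obtain N where "\<forall>n\<ge>N. {x} \<subseteq> C n" using C(5)[of "{x}"] by auto
   then have "eventually (%n. c n x *\<^sub>R w x = indicator (U \<inter> V) x *\<^sub>R w x) sequentially"
    using c(3) True by (auto simp: eventually_sequentially intro!: exI[of _ N])
   then show ?thesis by (rule tendsto_eventually)
  next
   case False
   then have "c n x = 0" for n using c(4)[of x n] C(2)[of "Suc n"] interior_subset by blast
   then show ?thesis using False by (auto simp: indicator_def)
  qed
  have "(%n. LBINT x. c n x *\<^sub>R w x) \<longlonglongrightarrow> (LBINT x. indicator (U \<inter> V) x *\<^sub>R w x)"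
  proof (rule integral_dominated_convergence[where w="%x. norm (w x)"])
   show "(%x. c n x *\<^sub>R w x) \<in> borel_measurable lborel" for n
    using Cc_measurable[OF Cc] w by auto
   show "AE x in lborel. norm (c n x *\<^sub>R w x) \<le> norm (w x)" for n
    using c01[of n] by (intro AE_I2) (auto simp: mult_left_le_one_le)
   show "(%x. indicator (U \<inter> V) x *\<^sub>R w x) \<in> borel_measurable lborel"
    using w O by (intro borel_measurable_scaleR borel_measurable_indicator) auto
  qed (use w lim in auto)
  then have "(LBINT x. indicator (U \<inter> V) x *\<^sub>R w x) = 0"
   using integral_zero_C0[OF V w z Cc] by (simp add: LIMSEQ_const_iff)
  moreover have "indicator (U \<inter> V) x *\<^sub>R w x = indicator U x *\<^sub>R f x" for x
   by (auto simp: f_def indicator_def)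
  ultimately show ?thesis by simp
 qed
 then have "AE x in lborel. f x = 0" using AE_zero_of_open_integrals[OF f] by blast
 then show ?thesis by (rule eventually_mono) (auto simp: f_def indicator_def)
qed

subsection \<open>Weak partial derivatives\<close>

text \<open>Both functions are integrable on the whole space and \<open>V\<close> restricts only the
  test functions; convolutions with \<open>h\<close> and \<open>w\<close> are then defined
  everywhere.\<close>

definition weak_pd :: "'a::euclidean_space set => 'a => ('a => 'b::euclidean_space) => ('a => 'b) => bool" where
 "weak_pd V i h w \<longleftrightarrow> integrable lborel h \<and> integrable lborel w \<and>
   (\<forall>\<phi>. (\<forall>k. Cc k V \<phi>) \<longrightarrow> (LBINT x. \<phi> x *\<^sub>R w x) = - (LBINT x. pd i \<phi> x *\<^sub>R h x))"

text \<open>Approximation of the test function in the C^1 norm, with the error absorbed by the L^1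
  norms of \<open>w\<close> and \<open>h\<close>.\<close>

lemma weak_pd_C1:
 fixes h :: "'a::euclidean_space => 'b::euclidean_space"
 assumes V: "open V" and wk: "weak_pd V i h w" and i: "i \<in> Basis" and c: "Cc 1 V c"
 shows "(LBINT x. c x *\<^sub>R w x) = - (LBINT x. pd i c x *\<^sub>R h x)"
proof -
 have hw: "integrable lborel h" "integrable lborel w" using wk by (auto simp: weak_pd_def)
 note int = Cc_times_integrable[OF _ hw(2)] Cc_times_integrable[OF _ hw(1)]
 let ?m = "(LBINT x. norm (w x)) + (LBINT x. norm (h x))"
 let ?I = "(LBINT x. c x *\<^sub>R w x) + (LBINT x. pd i c x *\<^sub>R h x)"
 have m: "?m \<ge> 0" by simp
 have "norm ?I \<le> 0 + e" if e: "e > 0" for e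
 proof -
  define q where "q = e / (?m + 1)"
  have e': "q > 0" unfolding q_def using e m by (intro divide_pos_pos add_nonneg_pos) auto
  obtain \<phi> where \<phi>: "!!k. Cc k V \<phi>" "!!x. \<bar>\<phi> x - c x\<bar> \<le> q"
    "!!x i. i \<in> Basis ==> \<bar>pd i \<phi> x - pd i c x\<bar> \<le> q"
   using smooth_approx1[OF c V e'] by metis
  note i1 = int(1)[OF c] int(1)[OF \<phi>(1)[of 1]] int(2)[OF Cc_pd1[OF c i]] int(2)[OF Cc_pd1[OF \<phi>(1) i]]
  have "(LBINT x. \<phi> x *\<^sub>R w x) + (LBINT x. pd i \<phi> x *\<^sub>R h x) = 0"
   using wk \<phi>(1) by (simp add: weak_pd_def)
  then have "?I = (LBINT x. (c x - \<phi> x) *\<^sub>R w x) + (LBINT x. (pd i c x - pd i \<phi> x) *\<^sub>R h x)"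
   using i1 by (simp add: scaleR_diff_left algebra_simps)
  also have "norm \<dots> \<le> norm (LBINT x. (c x - \<phi> x) *\<^sub>R w x) + norm (LBINT x. (pd i c x - pd i \<phi> x) *\<^sub>R h x)"
   by (rule norm_triangle_ineq)
  also have "\<dots> \<le> (LBINT x. q * norm (w x)) + (LBINT x. q * norm (h x))"
  proof (intro add_mono Bochner_Integration.integral_norm_bound_integral)
   show "norm ((c x - \<phi> x) *\<^sub>R w x) \<le> q * norm (w x)" for x
    using \<phi>(2)[of x] by (simp add: abs_minus_commute mult_right_mono)
   show "norm ((pd i c x - pd i \<phi> x) *\<^sub>R h x) \<le> q * norm (h x)" for x
    using \<phi>(3)[OF i, of x] by (simp add: abs_minus_commute mult_right_mono)
  qed (use hw i1 in \<open>auto simp: scaleR_diff_left\<close>)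
  also have "\<dots> = e * (?m / (?m + 1))" by (simp add: q_def algebra_simps add_divide_distrib)
  also have "\<dots> \<le> e" by (rule mult_frac_le[OF m e])
  finally show ?thesis by simp
 qed
 then have "norm ?I \<le> 0" by (rule field_le_epsilon)
 then show ?thesis by (simp add: eq_neg_iff_add_eq_0)
qed

lemma Cc_moll_shift: assumes "r > 0" shows "Cc k (cball x r) (%y. moll r (x - y))"
proof (rule CcI[where K="cball x r"])
 show "Ck_on k UNIV (%y. moll r (x - y))"
  by (rule Ck_on_compose[OF open_UNIV open_UNIV _ Cc_Ck[OF Cc_moll[OF assms]]])
    (auto intro!: Ck_on_diff Ck_on_const Ck_on_id simp del: Ck_on.simps One_nat_def)
 show "moll r (x - y) = 0" if "y \<notin> cball x r" for y
  using that assms by (intro moll_eq_0) (auto simp: dist_norm)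
qed auto

lemma pd_moll_shift: assumes "r > 0" shows "pd i (%y. moll r (x - y)) y = - pd i (moll r) (x - y)"
proof -
 have md: "(moll r :: 'a => real) differentiable (at y)" for y
  by (rule Cc_differentiable[OF Cc_moll[OF assms]])
 have "((%y. moll r (x - y)) has_derivative (%v. pd (- v) (moll r) (x - y))) (at y)"
  by (rule has_derivative_compose[OF _ has_derivative_pd[OF md], of "%y. x - y" uminus, simplified])
    (auto intro!: derivative_eq_intros)
 then show ?thesis using pd_eqI[of _ _ y i] linear_neg[OF linear_pd[OF md]] by metis
qed

text \<open>The closed ball lies in \<open>V\<close>, so the shifted kernel is itself an admissible
  test function in the definition of the weak derivative.\<close>

lemma conv_pd_moll_weak:
 assumes wk: "weak_pd V i h w" and r: "r > 0" "cball x r \<subseteq> V"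
 shows "conv h (pd i (moll r)) x = conv w (moll r) x"
proof -
 have "\<forall>k. Cc k V (%y. moll r (x - y))"
  using Cc_mono[OF Cc_moll_shift[OF r(1)] order_refl r(2)] by blast
 then have "(LBINT y. moll r (x - y) *\<^sub>R w y) = - (LBINT y. pd i (%y. moll r (x - y)) y *\<^sub>R h y)"
  using wk unfolding weak_pd_def by blast
 then show ?thesis unfolding pd_moll_shift[OF r(1)] by (simp add: conv_def)
qed

lemma conv_moll_bound:
 assumes q: "integrable lborel q" and r: "r > 0" and B: "!!y. norm (q y) \<le> B"
 shows "norm (conv q (moll r) x) \<le> B"
proof -
 have "norm (conv q (moll r) x) \<le> (LBINT y. moll r (x - y) * B)"
  unfolding conv_def
 proof (rule Bochner_Integration.integral_norm_bound_integral)
  show "norm (moll r (x - y) *\<^sub>R q y) \<le> moll r (x - y) * B" for y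
   using B moll_nonneg[of r "x - y"] by (simp add: mult_left_mono)
 qed (use conv_integrable[OF q Cc_moll[OF r]] integral_moll_shift[OF r, of x] in auto)
 also have "\<dots> = B" using integral_moll_shift[OF r, of x] by simp
 finally show ?thesis .
qed

lemma conv_diff:
 assumes "integrable lborel p" "integrable lborel q" "Cc k W \<rho>"
 shows "conv (%x. p x - q x) \<rho> x = conv p \<rho> x - conv q \<rho> x"
 unfolding conv_def scaleR_diff_right
 by (rule Bochner_Integration.integral_diff) (rule conv_integrable[OF _ assms(3)], fact)+

text \<open>Mollification is self-adjoint because its kernel is even.\<close>

lemma conv_moll_Fubini:
 fixes q :: "'a::euclidean_space => real" and w :: "'a => 'b::euclidean_space"
 assumes q: "integrable lborel q" and w: "integrable lborel w" and r: "r > 0"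
 shows "(LBINT x. q x *\<^sub>R conv w (moll r) x) = (LBINT y. conv q (moll r) y *\<^sub>R w y)"
proof -
 define f :: "'a => 'a => 'b" where "f x y = (q x * moll r (x - y)) *\<^sub>R w y" for x y
 obtain B where B: "!!x::'a. norm (moll r x) \<le> B" using Cc_bounded[OF Cc_moll[OF r, of 0]] by metis
 have m[measurable]: "(moll r :: 'a => real) \<in> borel_measurable borel"
  by (rule Cc_measurable[OF Cc_moll[OF r, of 0]])
 have [measurable]: "q \<in> borel_measurable borel" "w \<in> borel_measurable borel"
  using borel_measurable_integrable[OF q] borel_measurable_integrable[OF w] by auto
 have "integrable (lborel \<Otimes>\<^sub>M lborel) (%(x, y). \<bar>q x\<bar> * norm (w y))"
  by (rule lborel_pair.Fubini_integrable) (use q w in \<open>auto simp: abs_mult\<close>)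
 then have "integrable (lborel \<Otimes>\<^sub>M lborel) (%p. B * (case p of (x, y) => \<bar>q x\<bar> * norm (w y)))"
  by (rule integrable_mult_right)
 then have "integrable (lborel \<Otimes>\<^sub>M lborel) (case_prod f)"
 proof (rule Bochner_Integration.integrable_bound)
  show "case_prod f \<in> borel_measurable (lborel \<Otimes>\<^sub>M lborel)" unfolding f_def by measurable
  show "AE p in lborel \<Otimes>\<^sub>M lborel. norm (case_prod f p) \<le> norm (B * (case p of (x, y) => \<bar>q x\<bar> * norm (w y)))"
  proof (rule AE_I2, clarify)
   fix x y
   have "\<bar>q x\<bar> * \<bar>moll r (x - y)\<bar> * norm (w y) \<le> \<bar>q x\<bar> * \<bar>B\<bar> * norm (w y)"
    using B[of "x - y"] by (intro mult_right_mono mult_left_mono) auto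
   then show "norm (f x y) \<le> norm (B * (\<bar>q x\<bar> * norm (w y)))"
    by (simp add: f_def abs_mult mult_ac)
  qed
 qed
 then have "(LBINT y. LBINT x. f x y) = (LBINT x. LBINT y. f x y)"
  by (rule lborel_pair.Fubini_integral)
 moreover have "(LBINT x. f x y) = conv q (moll r) y *\<^sub>R w y" for y
 proof -
  have "f x y = (moll r (y - x) * q x) *\<^sub>R w y" for x
   using moll_minus[of r "y - x"] by (simp add: f_def mult.commute)
  moreover have "integrable lborel (%x. moll r (y - x) * q x)"
   using conv_integrable[OF q Cc_moll[OF r, of 0], of y] by simp
  ultimately show ?thesis by (simp add: conv_def)
 qed
 moreover have "(LBINT y. f x y) = q x *\<^sub>R conv w (moll r) x" for x
 proof -
  have "f x y = q x *\<^sub>R (moll r (x - y) *\<^sub>R w y)" for y by (simp add: f_def)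
  then show ?thesis by (simp add: conv_def del: scaleR_scaleR)
 qed
 ultimately show ?thesis by simp
qed

text \<open>The radius is also bounded by the tolerance \<open>e\<close>, so that radii chosen for
  tolerances tending to 0 tend to 0 as well.\<close>

lemma uniform_conv_compact:
 fixes h :: "'a::euclidean_space => 'b::euclidean_space"
 assumes h: "integrable lborel h" "continuous_on V h" and V: "open V" and K: "compact K" "K \<subseteq> V" and e: "e > 0"
 obtains s where "s > 0" "s \<le> e" "(\<Union>x\<in>K. cball x s) \<subseteq> V" "!!x. x \<in> K ==> norm (conv h (moll s) x - h x) \<le> e"
proof -
 obtain r where r: "r > 0" "(\<Union>x\<in>K. cball x r) \<subseteq> V" using compact_thicken_subset[OF K(1) V K(2)] .
 let ?T = "\<Union>x\<in>K. cball x r"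
 have "uniformly_continuous_on ?T h"
  using compact_thicken[OF K(1)] compact_uniformly_continuous continuous_on_subset[OF h(2) r(2)] by blast
 then obtain d where d: "d > 0" "!!x y. x \<in> ?T ==> y \<in> ?T ==> dist y x < d ==> dist (h y) (h x) < e"
  using e unfolding uniformly_continuous_on_def by metis
 define s where "s = min (min r d) e"
 have s: "s > 0" "s \<le> r" "s \<le> d" "s \<le> e" using r d e by (auto simp: s_def)
 show ?thesis
 proof (rule that[OF s(1,4)])
  show "(\<Union>x\<in>K. cball x s) \<subseteq> V"
   by (rule order.trans[OF UN_mono[OF order_refl subset_cball[OF s(2)]] r(2)])
  fix x assume x: "x \<in> K"
  show "norm (conv h (moll s) x - h x) \<le> e"
  proof (rule conv_moll_close[OF h(1) s(1)])
   fix y assume y: "dist x y < s"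
   have "x \<in> cball x r" "y \<in> cball x r" using y s r by auto
   then have "x \<in> ?T" "y \<in> ?T" using x by blast+
   then have "dist (h y) (h x) < e" using y s by (intro d(2)) (auto simp: dist_commute)
   then show "norm (h y - h x) \<le> e" by (simp add: dist_norm)
  qed
 qed
qed

lemma integrable_cont_compact_support:
 fixes f :: "'a::euclidean_space => 'b::euclidean_space"
 assumes "compact K" "continuous_on K f" "!!x. x \<notin> K ==> f x = 0"
 shows "integrable lborel f"
proof -
 have "integrable lborel (%x. indicator K x *\<^sub>R f x)" by (rule borel_integrable_compact[OF assms(1,2)])
 moreover have "(%x. indicator K x *\<^sub>R f x) = f" using assms(3) by (auto simp: indicator_def fun_eq_iff)
 ultimately show ?thesis by simp
qed

text \<open>The classical chain rule holds for the mollifications \<open>hn\<close>. In the limit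
  the difficulty is the product of pd G (hn) with the mollified \<open>w\<close>, where
  \<open>w\<close> is merely integrable. The mollification is moved from \<open>w\<close> to the
  bounded factor, which converges pointwise, and dominated convergence with majorant a multiple of
  |w| finishes.\<close>

theorem weak_chain_rule:
 fixes h w :: "'a::euclidean_space => 'b::euclidean_space" and G :: "'b => real"
 assumes V: "open V" and wk: "weak_pd V i h w" and i: "i \<in> Basis" and hc: "continuous_on V h"
  and O: "open O'" "h ` V \<subseteq> O'" and G: "Ck_on 1 O' G" and c: "Cc 1 V c"
 shows "(LBINT x. c x * pd (w x) G (h x)) = - (LBINT x. pd i c x * G (h x))"
proof -
 have hi: "integrable lborel h" and wi: "integrable lborel w" using wk by (auto simp: weak_pd_def)
 obtain K where K: "compact K" "K \<subseteq> V" "!!x. x \<notin> K ==> c x = 0" using c by (auto elim: CcE)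
 have pc0: "pd i c x = 0" if "x \<notin> K" for x
  by (rule pd_eq_0_outside[OF compact_imp_closed[OF K(1)] K(3) that])
 have cd: "c differentiable (at x)" for x by (rule Cc_differentiable[OF c])
 have hK: "compact (h ` K)" using compact_continuous_image[OF continuous_on_subset[OF hc K(2)] K(1)] .
 have hKO: "h ` K \<subseteq> O'" using O(2) K(2) by blast
 obtain \<epsilon> where \<epsilon>: "\<epsilon> > 0" "(\<Union>y\<in>h ` K. cball y \<epsilon>) \<subseteq> O'" using compact_thicken_subset[OF hK O(1) hKO] .
 \<comment> \<open>A compact subset of \<open>O'\<close> that contains all values of
   \<open>h\<close> and of every \<open>hn n\<close> on \<open>K\<close>, so that bounds for
   \<open>G\<close> and its derivatives are uniform in \<open>n\<close>.\<close>
 define L where "L = (\<Union>y\<in>h ` K. cball y \<epsilon>)"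
 have L: "compact L" "L \<subseteq> O'" using compact_thicken[OF hK] \<epsilon> by (auto simp: L_def)
 define \<eta> where "\<eta> n = \<epsilon> / (real n + 1)" for n
 have \<eta>: "\<eta> n > 0" "\<eta> n \<le> \<epsilon>" for n using \<epsilon> by (auto simp: \<eta>_def divide_simps intro: add_nonneg_pos)
 have \<eta>0: "\<eta> \<longlonglongrightarrow> 0" unfolding \<eta>_def
  using tendsto_mult_right_zero[OF LIMSEQ_inverse_real_of_nat, of \<epsilon>] by (simp add: divide_inverse add.commute)
 have "\<exists>s>0. s \<le> \<eta> n \<and> (\<Union>x\<in>K. cball x s) \<subseteq> V \<and> (\<forall>x\<in>K. norm (conv h (moll s) x - h x) \<le> \<eta> n)" for n
  using uniform_conv_compact[OF hi hc V K(1,2) \<eta>(1)[of n]] by metis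
 then obtain s where s: "!!n. s n > 0" "!!n. (\<Union>x\<in>K. cball x (s n)) \<subseteq> V"
   "!!n x. x \<in> K ==> norm (conv h (moll (s n)) x - h x) \<le> \<eta> n"
   "!!n. s n \<le> \<eta> n" by metis
 define hn where "hn n = conv h (moll (s n))" for n
 define wn where "wn n = conv w (moll (s n))" for n
 have hnL: "hn n x \<in> L" if "x \<in> K" for n x
 proof -
  have "hn n x \<in> cball (h x) \<epsilon>"
   using s(3)[OF that, of n] \<eta>(2)[of n] by (auto simp: hn_def dist_norm norm_minus_commute)
  then show ?thesis using that by (auto simp: L_def)
 qed
 have hL: "h x \<in> L" if "x \<in> K" for x using that \<epsilon>(1) by (auto simp: L_def intro: bexI[of _ x])
 have hnK: "Ck_on 1 UNIV (hn n)" for n unfolding hn_def by (rule Ck_on_conv[OF hi Cc_moll[OF s(1)]])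
 have hnd: "hn n differentiable (at x)" for n x using hnK[of n] Ck_on_SucD[OF open_UNIV, of 0 "hn n" x] by simp
 have pdh: "pd i (hn n) x = wn n x" if "x \<in> K" for n x
 proof -
  have "cball x (s n) \<subseteq> V" using s(2) that by blast
  then show ?thesis
   unfolding hn_def wn_def pd_conv[OF hi Cc_moll[OF s(1)]] by (rule conv_pd_moll_weak[OF wk s(1)])
 qed
 have Gd: "G differentiable (at y)" if "y \<in> L" for y
  using G Ck_on_SucD[OF O(1), of 0 G y] L that by auto
 have Gc: "continuous_on L G"
  using Ck_on_continuous[OF O(1) G] continuous_on_subset L by blast
 have pdGc: "continuous_on L (pd v G)" for v
  using continuous_on_pd[OF O(1) G] continuous_on_subset L by blast
 have hnc: "continuous_on K (hn n)" for n
  using Ck_on_continuous[OF open_UNIV hnK] continuous_on_subset by blast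
 have hcK: "continuous_on K h" using hc K(2) continuous_on_subset by blast
 have cc: "continuous_on K c" using Ck_on_continuous[OF open_UNIV Cc_Ck[OF c]] continuous_on_subset by blast
 have pcc: "continuous_on K (pd i c)"
  using Ck_on_continuous[OF open_UNIV Cc_Ck[OF Cc_pd1[OF c i]]] continuous_on_subset by blast
 have step: "(LBINT x. c x * pd (wn n x) G (hn n x)) = - (LBINT x. pd i c x * G (hn n x))" for n
 proof -
  define U where "U = hn n -` O'"
  have U: "open U" unfolding U_def using Ck_on_continuous[OF open_UNIV hnK] O(1)
   by (metis continuous_on_open_vimage open_UNIV inf_top_right)
  have KU: "K \<subseteq> U" using hnL L by (auto simp: U_def)
  have "Ck_on 1 U (%x. G (hn n x))"
   by (rule Ck_on_compose[OF U O(1) _ G]) (use Ck_on_subset[OF open_UNIV U _ hnK] in \<open>auto simp: U_def simp del: Ck_on.simps One_nat_def\<close>)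
  then have "Ck_on 1 U (%x. c x * G (hn n x))"
   using Ck_on_subset[OF open_UNIV U _ Cc_Ck[OF c]] by (intro Ck_on_mult[OF U]) auto
  then have "Cc 1 U (%x. if x \<in> U then c x * G (hn n x) else 0)"
   using K KU by (intro Cc_zero_extend[OF U _ K(1) KU]) auto
  moreover have "(%x. if x \<in> U then c x * G (hn n x) else 0) = (%x. c x * G (hn n x))"
   using K(3) KU by (auto simp: fun_eq_iff)
  ultimately have C: "Cc 1 U (%x. c x * G (hn n x))" by simp
  have p: "pd i (%x. c x * G (hn n x)) x = c x * pd (wn n x) G (hn n x) + pd i c x * G (hn n x)" for x
  proof (cases "x \<in> K")
   case True
   have "(%x. G (hn n x)) differentiable (at x)"
    using differentiable_chain_at[OF hnd Gd[OF hnL[OF True]]] by (simp add: o_def)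
   then have "pd i (%x. c x * G (hn n x)) x = c x * pd i (%x. G (hn n x)) x + pd i c x * G (hn n x)"
    by (rule pd_mult[OF cd])
   then show ?thesis using pd_compose[OF hnd Gd[OF hnL[OF True]], where v=i] pdh[OF True] by simp
  next
   case False
   then show ?thesis
    using pd_eq_0_outside[OF compact_imp_closed[OF K(1)] _ False, of "%x. c x * G (hn n x)" i] K(3) pc0 by simp
  qed
  have i1: "integrable lborel (%x. pd i c x * G (hn n x))"
   using pc0 by (intro integrable_cont_compact_support[OF K(1)] continuous_intros pcc
     continuous_on_compose2[OF Gc hnc]) (use hnL in auto)
  have i2: "integrable lborel (%x. c x * pd (wn n x) G (hn n x) + pd i c x * G (hn n x))"
   using Cc_integrable[OF Cc_pd1[OF C i]] by (simp add: p)
  have i3: "integrable lborel (%x. c x * pd (wn n x) G (hn n x))"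
   using Bochner_Integration.integrable_diff[OF i2 i1] by simp
  have "0 = (LBINT x. pd i (%x. c x * G (hn n x)) x)" using integral_pd_eq_0[OF C i] by simp
  also have "\<dots> = (LBINT x. c x * pd (wn n x) G (hn n x)) + (LBINT x. pd i c x * G (hn n x))"
   unfolding p by (rule Bochner_Integration.integral_add[OF i3 i1])
  finally show ?thesis by simp
 qed
 have hlim: "(%n. hn n x) \<longlonglongrightarrow> h x" if "x \<in> K" for x
 proof -
  have "(%n. hn n x - h x) \<longlonglongrightarrow> 0"
   by (rule Lim_null_comparison[OF _ \<eta>0]) (simp add: hn_def s(3)[OF that])
  then show ?thesis by (rule LIM_zero_cancel)
 qed
 obtain BG where BG: "!!y. y \<in> L ==> norm (G y) \<le> BG"
  using compact_imp_bounded[OF compact_continuous_image[OF Gc L(1)]] by (auto simp: bounded_iff)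
 have lim1: "(%n. LBINT x. pd i c x * G (hn n x)) \<longlonglongrightarrow> (LBINT x. pd i c x * G (h x))"
 proof (rule integral_dominated_convergence[where w="%x. BG * norm (pd i c x)"])
  show "integrable lborel (%x. BG * norm (pd i c x))" using Cc_integrable[OF Cc_pd1[OF c i]] by auto
  have "integrable lborel (%x. pd i c x * G (h x))"
   using pc0 by (intro integrable_cont_compact_support[OF K(1)] continuous_intros pcc
     continuous_on_compose2[OF Gc hcK]) (use hL in auto)
  then show "(%x. pd i c x * G (h x)) \<in> borel_measurable lborel" by simp
  have "integrable lborel (%x. pd i c x * G (hn n x))" for n
   using pc0 by (intro integrable_cont_compact_support[OF K(1)] continuous_intros pcc
     continuous_on_compose2[OF Gc hnc]) (use hnL in auto)
  then show "(%x. pd i c x * G (hn n x)) \<in> borel_measurable lborel" for n by simp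
  show "AE x in lborel. (%n. pd i c x * G (hn n x)) \<longlonglongrightarrow> pd i c x * G (h x)"
  proof (rule AE_I2)
   fix x
   show "(%n. pd i c x * G (hn n x)) \<longlonglongrightarrow> pd i c x * G (h x)"
   proof (cases "x \<in> K")
    case True
    have "(%n. G (hn n x)) \<longlonglongrightarrow> G (h x)"
     by (rule continuous_on_tendsto_compose[OF Gc hlim[OF True] hL[OF True]]) (use hnL True in simp)
    then show ?thesis by (rule tendsto_mult_left)
   qed (simp add: pc0)
  qed
  show "AE x in lborel. norm (pd i c x * G (hn n x)) \<le> BG * norm (pd i c x)" for n
  proof (rule AE_I2)
   fix x
   show "norm (pd i c x * G (hn n x)) \<le> BG * norm (pd i c x)"
    using BG[OF hnL, of x n] pc0[of x] by (cases "x \<in> K") (auto simp: abs_mult mult.commute intro: mult_right_mono)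
  qed
 qed
 \<comment> \<open>The coefficients of the components of \<open>w\<close> in the limit, and of the
   mollified \<open>w\<close> at stage \<open>n\<close>. The cut to \<open>K\<close> is harmless
   since \<open>c\<close> vanishes outside.\<close>
 define q where "q j x = c x * (if x \<in> K then pd j G (h x) else 0)" for j x
 define qn where "qn n j x = c x * (if x \<in> K then pd j G (hn n x) else 0)" for n j x
 have qC: "Cc 0 V (q j)" for j
 proof -
  have "continuous_on V (%x. c x * pd j G (h x))"
   using continuous_on_subset[OF Ck_on_continuous[OF open_UNIV Cc_Ck[OF c]]]
   by (intro continuous_intros continuous_on_compose2[OF continuous_on_pd[OF O(1) G] hc O(2)]) auto
  then have "Cc 0 V (%x. if x \<in> V then c x * pd j G (h x) else 0)"
   using K by (intro Cc_zero_extend[OF V _ K(1,2)]) auto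
  moreover have "(%x. if x \<in> V then c x * pd j G (h x) else 0) = q j"
   using K(2,3) by (auto simp: fun_eq_iff q_def)
  ultimately show ?thesis by simp
 qed
 note qi = Cc_integrable[OF qC]
 have qnc: "continuous_on K (qn n j)" for n j
 proof -
  have "continuous_on K (%x. c x * pd j G (hn n x))"
   by (intro continuous_intros cc continuous_on_compose2[OF pdGc hnc]) (use hnL in auto)
  then show ?thesis by (rule continuous_on_eq) (simp add: qn_def)
 qed
 have qni: "integrable lborel (qn n j)" for n j
  by (rule integrable_cont_compact_support[OF K(1) qnc]) (simp add: qn_def)
 obtain Bc where Bc: "Bc > 0" "!!x. norm (c x) \<le> Bc" using Cc_bounded[OF c] by metis
 have close: "\<exists>N. \<forall>n\<ge>N. \<forall>x. norm (qn n j x - q j x) \<le> e" if e: "e > 0" for e j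
 proof -
  have "uniformly_continuous_on L (pd j G)" using compact_uniformly_continuous[OF pdGc L(1)] .
  moreover have "e / Bc > 0" using e Bc by simp
  ultimately obtain d where d: "d > 0" "!!y z. y \<in> L ==> z \<in> L ==> dist z y < d ==> dist (pd j G z) (pd j G y) < e / Bc"
   unfolding uniformly_continuous_on_def by metis
  have "eventually (%n. \<eta> n < d) sequentially" using order_tendstoD(2)[OF \<eta>0 d(1)] .
  then obtain N where N: "!!n. n \<ge> N ==> \<eta> n < d" by (auto simp: eventually_sequentially)
  have "norm (qn n j x - q j x) \<le> e" if n: "n \<ge> N" for n x
  proof (cases "x \<in> K")
   case True
   have "dist (hn n x) (h x) < d" using s(3)[OF True, of n] N[OF n] by (simp add: hn_def dist_norm)
   then have "dist (pd j G (hn n x)) (pd j G (h x)) < e / Bc" using d(2) hnL hL True by blast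
   then have "norm (c x) * norm (pd j G (hn n x) - pd j G (h x)) \<le> Bc * (e / Bc)"
    using Bc by (intro mult_mono) (auto simp: dist_norm)
   then show ?thesis using True Bc by (simp add: q_def qn_def right_diff_distrib[symmetric] abs_mult)
  qed (use e in \<open>simp add: q_def qn_def\<close>)
  then show ?thesis by blast
 qed
 \<comment> \<open>Two errors of size e/3: \<open>qn\<close> is uniformly close to \<open>q\<close>,
   and mollifying the uniformly continuous \<open>q\<close> at radius \<open>s n\<close> moves it
   little.\<close>
 have ptw: "(%n. conv (qn n j) (moll (s n)) y) \<longlonglongrightarrow> q j y" for j y
 proof (rule LIMSEQ_I)
  fix e :: real assume e: "e > 0"
  obtain N where N: "!!n x. n \<ge> N ==> norm (qn n j x - q j x) \<le> e / 3" using close[of "e/3" j] e by auto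
  obtain d where d: "d > 0" "!!x y. dist x y < d ==> dist (q j x) (q j y) < e / 3"
   using Cc_uniformly_continuous[OF qC, of "e/3" j] e by auto
  have "eventually (%n. \<eta> n < d) sequentially" using order_tendstoD(2)[OF \<eta>0 d(1)] .
  then obtain M where M: "!!n. n \<ge> M ==> \<eta> n < d" by (auto simp: eventually_sequentially)
  have "norm (conv (qn n j) (moll (s n)) y - q j y) < e" if n: "n \<ge> max N M" for n
  proof -
   have "s n \<le> d" using s(4)[of n] M[of n] n by simp
   then have 1: "norm (conv (q j) (moll (s n)) y - q j y) \<le> e / 3"
    by (intro conv_moll_uniform[OF qi s(1) _ d(2)])
   have "norm (conv (%x. qn n j x - q j x) (moll (s n)) y) \<le> e / 3"
    using N n by (intro conv_moll_bound s(1) Bochner_Integration.integrable_diff qni qi) auto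
   then have "norm (conv (qn n j) (moll (s n)) y - conv (q j) (moll (s n)) y) \<le> e / 3"
    by (simp add: conv_diff[OF qni qi Cc_moll[OF s(1)]])
   then show ?thesis using 1 e unfolding real_norm_def by linarith
  qed
  then show "\<exists>no. \<forall>n\<ge>no. norm (conv (qn n j) (moll (s n)) y - q j y) < e" by blast
 qed
 have lim2: "(%n. LBINT y. conv (qn n j) (moll (s n)) y *\<^sub>R w y) \<longlonglongrightarrow> (LBINT y. q j y *\<^sub>R w y)" for j
 proof -
  obtain Bp where Bp: "!!y. y \<in> L ==> norm (pd j G y) \<le> Bp"
   using compact_imp_bounded[OF compact_continuous_image[OF pdGc[of j] L(1)]] by (auto simp: bounded_iff)
  have qb: "norm (qn n j x) \<le> Bc * \<bar>Bp\<bar>" for n x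
  proof (cases "x \<in> K")
   case True
   have "norm (c x) * norm (pd j G (hn n x)) \<le> Bc * \<bar>Bp\<bar>"
    using Bc Bp[OF hnL[OF True], of n] by (intro mult_mono) auto
   then show ?thesis using True by (simp add: qn_def abs_mult)
  qed (use Bc in \<open>simp add: qn_def\<close>)
  have cm: "conv (qn n j) (moll (s n)) \<in> borel_measurable borel" for n
   by (rule borel_measurable_continuous_onI[OF Ck_on_continuous[OF open_UNIV Ck_on_conv[OF qni Cc_moll[OF s(1)], of 0]]])
  show ?thesis
  proof (rule integral_dominated_convergence[where w="%x. Bc * \<bar>Bp\<bar> * norm (w x)"])
   show "AE x in lborel. (%n. conv (qn n j) (moll (s n)) x *\<^sub>R w x) \<longlonglongrightarrow> q j x *\<^sub>R w x"
    by (intro AE_I2 tendsto_scaleR ptw tendsto_const)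
   show "AE x in lborel. norm (conv (qn n j) (moll (s n)) x *\<^sub>R w x) \<le> Bc * \<bar>Bp\<bar> * norm (w x)" for n
    using conv_moll_bound[OF qni s(1) qb] by (intro AE_I2) (simp add: mult_right_mono)
   show "(%x. q j x *\<^sub>R w x) \<in> borel_measurable lborel"
    using Cc_times_integrable[OF qC wi] by simp
   show "(%x. conv (qn n j) (moll (s n)) x *\<^sub>R w x) \<in> borel_measurable lborel" for n
    using cm[of n] wi by (intro borel_measurable_scaleR) auto
  qed (use wi in auto)
 qed
 have sumn: "(LBINT x. c x * pd (wn n x) G (hn n x))
   = (\<Sum>j\<in>Basis. (LBINT y. conv (qn n j) (moll (s n)) y *\<^sub>R w y) \<bullet> j)" for n
 proof -
  have wc: "continuous_on K (wn n)"
   unfolding wn_def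
   using continuous_on_subset[OF Ck_on_continuous[OF open_UNIV Ck_on_conv[OF wi Cc_moll[OF s(1)], of 0]]] by blast
  have ii: "integrable lborel (%x. qn n j x *\<^sub>R wn n x)" for j
   by (rule integrable_cont_compact_support[OF K(1) continuous_on_scaleR[OF qnc wc]]) (simp add: qn_def)
  have "c x * pd (wn n x) G (hn n x) = (\<Sum>j\<in>Basis. (qn n j x *\<^sub>R wn n x) \<bullet> j)" for x
  proof (cases "x \<in> K")
   case True
   then show ?thesis
    by (subst pd_expand[OF Gd[OF hnL[OF True]], where v="wn n x"]) (simp add: qn_def sum_distrib_left mult_ac)
  qed (simp add: K(3) qn_def)
  then have "(LBINT x. c x * pd (wn n x) G (hn n x)) = (\<Sum>j\<in>Basis. (LBINT x. (qn n j x *\<^sub>R wn n x) \<bullet> j))"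
   using ii by (simp add: Bochner_Integration.integral_sum del: inner_scaleR_left)
  also have "\<dots> = (\<Sum>j\<in>Basis. (LBINT x. qn n j x *\<^sub>R wn n x) \<bullet> j)"
   using ii by (simp del: inner_scaleR_left)
  finally show ?thesis unfolding wn_def conv_moll_Fubini[OF qni wi s(1)] .
 qed
 have suml: "(LBINT x. c x * pd (w x) G (h x)) = (\<Sum>j\<in>Basis. (LBINT y. q j y *\<^sub>R w y) \<bullet> j)"
 proof -
  note ii = Cc_times_integrable[OF qC wi]
  have "c x * pd (w x) G (h x) = (\<Sum>j\<in>Basis. (q j x *\<^sub>R w x) \<bullet> j)" for x
  proof (cases "x \<in> K")
   case True
   then show ?thesis
    by (subst pd_expand[OF Gd[OF hL[OF True]], where v="w x"]) (simp add: q_def sum_distrib_left mult_ac)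
  qed (simp add: K(3) q_def)
  then have "(LBINT x. c x * pd (w x) G (h x)) = (\<Sum>j\<in>Basis. (LBINT x. (q j x *\<^sub>R w x) \<bullet> j))"
   using ii by (simp add: Bochner_Integration.integral_sum del: inner_scaleR_left)
  also have "\<dots> = (\<Sum>j\<in>Basis. (LBINT x. q j x *\<^sub>R w x) \<bullet> j)"
   using ii by (simp del: inner_scaleR_left)
  finally show ?thesis .
 qed
 have "(%n. LBINT x. c x * pd (wn n x) G (hn n x)) \<longlonglongrightarrow> (LBINT x. c x * pd (w x) G (h x))"
  unfolding sumn suml by (intro tendsto_sum tendsto_inner lim2 tendsto_const)
 moreover have "(%n. LBINT x. c x * pd (wn n x) G (hn n x)) \<longlonglongrightarrow> - (LBINT x. pd i c x * G (h x))"
  unfolding step by (intro tendsto_minus lim1)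
 ultimately show ?thesis by (rule LIMSEQ_unique)
qed

lemma integral_pd_product_on:
 fixes f :: "'a::euclidean_space => 'b::euclidean_space"
 assumes V: "open V" and c: "Cc 1 V c" and f: "Ck_on 1 V f" and i: "i \<in> Basis"
 shows "(LBINT x. pd i c x *\<^sub>R f x) = - (LBINT x. c x *\<^sub>R pd i f x)"
proof -
 obtain K where K: "compact K" "K \<subseteq> V" "!!x. x \<notin> K ==> c x = 0" using c by (auto elim: CcE)
 have pc0: "pd i c x = 0" if "x \<notin> K" for x
  by (rule pd_eq_0_outside[OF compact_imp_closed[OF K(1)] K(3) that])
 define g where "g x = (if x \<in> V then c x *\<^sub>R f x else 0)" for x
 have "Ck_on 1 V (%x. c x *\<^sub>R f x)"
  by (rule Ck_on_scaleR[OF V Ck_on_subset[OF open_UNIV V subset_UNIV Cc_Ck[OF c]] f])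
 then have g: "Cc 1 V g" unfolding g_def using K by (intro Cc_zero_extend[OF V _ K(1,2)]) auto
 have fd: "f differentiable (at x)" if "x \<in> V" for x using f Ck_on_SucD[OF V, of 0 f x] that by simp
 have pg: "pd i g x = c x *\<^sub>R pd i f x + pd i c x *\<^sub>R f x" for x
 proof (cases "x \<in> V")
  case True
  have "pd i g x = pd i (%x. c x *\<^sub>R f x) x"
   by (rule pd_cong_open[OF V True]) (simp add: g_def)
  then show ?thesis using pd_scaleR[OF Cc_differentiable[OF c] fd[OF True]] by simp
 next
  case False
  then have "x \<notin> K" using K by auto
  moreover have "g x = 0" if "x \<notin> K" for x using K(3)[OF that] by (simp add: g_def)
  ultimately show ?thesis
   using pd_eq_0_outside[OF compact_imp_closed[OF K(1)], of g x i] pc0[of x] K(3)[of x] by simp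
 qed
 have fK: "continuous_on K f" "continuous_on K (pd i f)"
  using continuous_on_subset[OF Ck_on_continuous[OF V f] K(2)]
   continuous_on_subset[OF continuous_on_pd[OF V f] K(2)] by auto
 have cK: "continuous_on K c" "continuous_on K (pd i c)"
  using continuous_on_subset[OF Ck_on_continuous[OF open_UNIV Cc_Ck[OF c]] subset_UNIV]
   continuous_on_subset[OF continuous_on_pd[OF open_UNIV Cc_Ck[OF c]] subset_UNIV] by auto
 have i1: "integrable lborel (%x. c x *\<^sub>R pd i f x)"
  by (rule integrable_cont_compact_support[OF K(1) continuous_on_scaleR[OF cK(1) fK(2)]]) (simp add: K(3))
 have i2: "integrable lborel (%x. pd i c x *\<^sub>R f x)"
  by (rule integrable_cont_compact_support[OF K(1) continuous_on_scaleR[OF cK(2) fK(1)]]) (simp add: pc0)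
 have "0 = (LBINT x. pd i g x)" using integral_pd_eq_0[OF g i] by simp
 also have "\<dots> = (LBINT x. c x *\<^sub>R pd i f x) + (LBINT x. pd i c x *\<^sub>R f x)"
  unfolding pg by (rule Bochner_Integration.integral_add[OF i1 i2])
 finally show ?thesis by (simp add: eq_neg_iff_add_eq_0 add.commute)
qed

lemma Cc_translate:
 assumes "Cc k W c" shows "Cc k {x. x + t \<in> W} (%x. c (x + t))"
proof -
 obtain K where K: "compact K" "K \<subseteq> W" "!!x. x \<notin> K ==> c x = 0" using assms by (auto elim: CcE)
 show ?thesis
 proof (rule CcI[where K="(%x. x - t) ` K"])
  show "Ck_on k UNIV (%x. c (x + t))"
   by (rule Ck_on_compose[OF open_UNIV open_UNIV _ Cc_Ck[OF assms]])
     (auto intro!: Ck_on_add Ck_on_const Ck_on_id simp del: Ck_on.simps)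
  show "compact ((%x. x - t) ` K)" using K(1) by (intro compact_continuous_image continuous_intros)
  show "c (x + t) = 0" if "x \<notin> (%x. x - t) ` K" for x
   using that by (intro K(3)) (auto simp: image_iff)
 qed (use K in auto)
qed

lemma difference_quotient_integral_tendsto:
 fixes f :: "'a::euclidean_space => 'b::euclidean_space"
 assumes c: "Cc 1 W c" and f: "integrable lborel f" and j: "j \<in> Basis"
 shows "((%t. LBINT x. ((c (x + t *\<^sub>R j) - c x) / t) *\<^sub>R f x) \<longlongrightarrow> (LBINT x. pd j c x *\<^sub>R f x)) (at 0)"
proof (rule LIM_I)
 fix r :: real assume r: "r > 0"
 define M where "M = (LBINT x. norm (f x)) + 1"
 have M: "M > 0" by (simp add: M_def add_nonneg_pos)
 obtain d where d: "d > 0" "!!x h. norm h < d ==> norm (c (x + h) - c x - pd h c x) \<le> (r / (2 * M)) * norm h"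
  using uniform_linearization[OF c, of "r / (2 * M)"] r M by (metis divide_pos_pos mult_pos_pos zero_less_numeral)
 have "norm ((LBINT x. ((c (x + t *\<^sub>R j) - c x) / t) *\<^sub>R f x) - (LBINT x. pd j c x *\<^sub>R f x)) < r"
  if t: "t \<noteq> 0" "norm t < d" for t
 proof -
  have i1: "integrable lborel (%x. ((c (x + t *\<^sub>R j) - c x) / t) *\<^sub>R f x)"
  proof -
   have "integrable lborel (%x. (1/t) *\<^sub>R (c (x + t *\<^sub>R j) *\<^sub>R f x - c x *\<^sub>R f x))"
    by (intro integrable_scaleR_right Bochner_Integration.integrable_diff Cc_times_integrable[OF Cc_translate[OF c] f]
      Cc_times_integrable[OF c f])
   then show ?thesis by (simp add: scaleR_diff_left[symmetric] divide_inverse mult.commute)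
  qed
  note i2 = Cc_times_integrable[OF Cc_pd1[OF c j] f]
  have bd: "norm ((c (x + t *\<^sub>R j) - c x) / t - pd j c x) \<le> r / (2 * M)" for x
  proof -
   have "pd (t *\<^sub>R j) c x = t *\<^sub>R pd j c x"
    using linear_scale[OF linear_pd[OF Cc_differentiable[OF c]]] by simp
   then have "norm (c (x + t *\<^sub>R j) - c x - t * pd j c x) \<le> (r / (2 * M)) * \<bar>t\<bar>"
    using d(2)[of "t *\<^sub>R j" x] t j by simp
   moreover have "(c (x + t *\<^sub>R j) - c x) / t - pd j c x = (c (x + t *\<^sub>R j) - c x - t * pd j c x) / t"
    using t by (simp add: field_simps)
   ultimately show ?thesis using t by (simp add: abs_divide pos_divide_le_eq)
  qed
  have "(LBINT x. ((c (x + t *\<^sub>R j) - c x) / t) *\<^sub>R f x) - (LBINT x. pd j c x *\<^sub>R f x)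
    = (LBINT x. ((c (x + t *\<^sub>R j) - c x) / t - pd j c x) *\<^sub>R f x)"
   using i1 i2 by (simp add: scaleR_diff_left)
  also have "norm \<dots> \<le> (LBINT x. r / (2 * M) * norm (f x))"
  proof (rule Bochner_Integration.integral_norm_bound_integral)
   show "integrable lborel (%x. ((c (x + t *\<^sub>R j) - c x) / t - pd j c x) *\<^sub>R f x)"
    using i1 i2 by (simp add: scaleR_diff_left)
   show "norm (((c (x + t *\<^sub>R j) - c x) / t - pd j c x) *\<^sub>R f x) \<le> r / (2 * M) * norm (f x)" for x
    unfolding norm_scaleR real_norm_def[symmetric] by (intro mult_right_mono bd) simp
  qed (use f in auto)
  also have "\<dots> = r / (2 * M) * (M - 1)" by (simp add: M_def)
  also have "\<dots> < r" using r M by (simp add: field_simps add_pos_pos)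
  finally show ?thesis .
 qed
 then show "\<exists>s>0. \<forall>x. x \<noteq> 0 \<and> norm (x - 0) < s \<longrightarrow>
   norm ((LBINT z. ((c (z + x *\<^sub>R j) - c z) / x) *\<^sub>R f z) - (LBINT x. pd j c x *\<^sub>R f x)) < r"
  using d(1) by auto
qed

text \<open>The difference quotients of the test function replace the symmetry of its second derivatives.\<close>
lemma mixed_partials_weak:
 fixes f :: "'a::euclidean_space => 'b::euclidean_space"
 assumes V: "open V" and f: "Ck_on 1 V f" and c: "Cc 2 V c" and ij: "i \<in> Basis" "j \<in> Basis"
  and int: "integrable lborel (%x. indicator V x *\<^sub>R f x)" "integrable lborel (%x. indicator V x *\<^sub>R pd i f x)"
 shows "(LBINT x. pd j c x *\<^sub>R pd i f x) = (LBINT x. pd i c x *\<^sub>R pd j f x)"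
proof -
 obtain K where K: "compact K" "K \<subseteq> V" "!!x. x \<notin> K ==> c x = 0" using c by (auto elim: CcE)
 obtain r where r: "r > 0" "(\<Union>x\<in>K. cball x r) \<subseteq> V" using compact_thicken_subset[OF K(1) V K(2)] .
 have c1: "Cc 1 V c" using Cc_mono[OF c, of 1 V] by simp
 have ci: "Cc 1 V (pd i c)" using Cc_pd[of 1 V c i] c ij by (simp add: numeral_2_eq_2)
 have ind: "c x *\<^sub>R (indicator V x *\<^sub>R g x) = c x *\<^sub>R g x" if "Cc k V c" for k and c :: "'a => real" and g :: "'a => 'b" and x
  using that by (auto elim!: CcE simp: indicator_def)
 define D where "D t x = (c (x + t *\<^sub>R j) - c x) / t" for t x
 have eq: "(LBINT x. D t x *\<^sub>R (indicator V x *\<^sub>R pd i f x))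
   = - (LBINT x. ((pd i c (x + t *\<^sub>R j) - pd i c x) / t) *\<^sub>R (indicator V x *\<^sub>R f x))"
  if t: "t \<noteq> 0" "\<bar>t\<bar> < r" for t
 proof -
  have "Cc 1 V (%x. c (x + t *\<^sub>R j))"
  proof (rule CcI[OF Cc_Ck[OF Cc_translate[OF c1]]])
   show "compact (\<Union>x\<in>K. cball x r)" by (rule compact_thicken[OF K(1)])
   show "c (x + t *\<^sub>R j) = 0" if "x \<notin> (\<Union>x\<in>K. cball x r)" for x
   proof (rule K(3), rule notI)
    assume "x + t *\<^sub>R j \<in> K"
    moreover have "x \<in> cball (x + t *\<^sub>R j) r" using t ij by (simp add: dist_norm)
    ultimately show False using that by blast
   qed
  qed (rule r(2))
  then have "Cc 1 V (%x. (c (x + t *\<^sub>R j) + c x * (-1)) * inverse t)"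
   by (intro Cc_mult Cc_add c1 Ck_on_const open_UNIV)
  then have D1: "Cc 1 V (D t)" unfolding D_def by (simp add: divide_inverse)
  have cd: "c differentiable (at x)" for x by (rule Cc_differentiable[OF c1])
  have pD: "pd i (D t) x = (pd i c (x + t *\<^sub>R j) - pd i c x) / t" for x
  proof -
   have "((%x. c (x + t *\<^sub>R j)) has_derivative (%v. pd v c (x + t *\<^sub>R j))) (at x)"
    by (rule has_derivative_compose[where f="%x. x + t *\<^sub>R j" and f'="%v. v" and g=c])
      (auto intro!: derivative_eq_intros has_derivative_pd cd)
   then have "((%x. (1/t) * (c (x + t *\<^sub>R j) - c x)) has_derivative (%v. (1/t) * (pd v c (x + t *\<^sub>R j) - pd v c x))) (at x)"
    by (intro has_derivative_mult_right has_derivative_diff has_derivative_pd cd)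
   then show ?thesis using pd_eqI[of _ _ x i] by (simp add: D_def[abs_def])
  qed
  have "(LBINT x. pd i (D t) x *\<^sub>R f x) = - (LBINT x. D t x *\<^sub>R pd i f x)"
   by (rule integral_pd_product_on[OF V D1 f ij(1)])
  moreover have "(%x. D t x *\<^sub>R (indicator V x *\<^sub>R pd i f x)) = (%x. D t x *\<^sub>R pd i f x)"
   by (rule ext) (rule ind[OF D1])
  moreover have "(%x. ((pd i c (x + t *\<^sub>R j) - pd i c x) / t) *\<^sub>R (indicator V x *\<^sub>R f x)) = (%x. pd i (D t) x *\<^sub>R f x)"
   unfolding pD[symmetric] by (rule ext) (rule ind[OF Cc_pd1[OF D1 ij(1)]])
  ultimately show ?thesis by simp
 qed
 have "((%t. LBINT x. D t x *\<^sub>R (indicator V x *\<^sub>R pd i f x)) \<longlongrightarrow>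
   (LBINT x. pd j c x *\<^sub>R (indicator V x *\<^sub>R pd i f x))) (at 0)"
  unfolding D_def by (rule difference_quotient_integral_tendsto[OF c1 int(2) ij(2)])
 moreover have "((%t. LBINT x. D t x *\<^sub>R (indicator V x *\<^sub>R pd i f x)) \<longlongrightarrow>
   - (LBINT x. pd j (pd i c) x *\<^sub>R (indicator V x *\<^sub>R f x))) (at 0)"
 proof (rule Lim_transform_eventually)
  show "((%t. - (LBINT x. ((pd i c (x + t *\<^sub>R j) - pd i c x) / t) *\<^sub>R (indicator V x *\<^sub>R f x))) \<longlongrightarrow>
   - (LBINT x. pd j (pd i c) x *\<^sub>R (indicator V x *\<^sub>R f x))) (at 0)"
   by (intro tendsto_minus difference_quotient_integral_tendsto[OF ci int(1) ij(2)])
  show "\<forall>\<^sub>F t in at 0. - (LBINT x. ((pd i c (x + t *\<^sub>R j) - pd i c x) / t) *\<^sub>R (indicator V x *\<^sub>R f x))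
    = (LBINT x. D t x *\<^sub>R (indicator V x *\<^sub>R pd i f x))"
   unfolding eventually_at using r(1) eq by (intro exI[of _ r]) auto
 qed
 ultimately have lim: "(LBINT x. pd j c x *\<^sub>R (indicator V x *\<^sub>R pd i f x))
   = - (LBINT x. pd j (pd i c) x *\<^sub>R (indicator V x *\<^sub>R f x))"
  by (rule tendsto_unique[OF trivial_limit_at])
 have "(LBINT x. pd j c x *\<^sub>R pd i f x) = - (LBINT x. pd j (pd i c) x *\<^sub>R f x)"
 proof -
  have "(%x. pd j c x *\<^sub>R (indicator V x *\<^sub>R pd i f x)) = (%x. pd j c x *\<^sub>R pd i f x)"
   by (rule ext) (rule ind[OF Cc_pd1[OF c1 ij(2)]])
  moreover have "(%x. pd j (pd i c) x *\<^sub>R (indicator V x *\<^sub>R f x)) = (%x. pd j (pd i c) x *\<^sub>R f x)"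
   by (rule ext) (rule ind[OF Cc_pd1[OF ci ij(2)]])
  ultimately show ?thesis using lim by simp
 qed
 also have "\<dots> = (LBINT x. pd i c x *\<^sub>R pd j f x)"
  using integral_pd_product_on[OF V ci f ij(2)] by simp
 finally show ?thesis .
qed

text \<open>Lets the chain rule act on functions of both first derivatives of u at once, such as
  their inner product or their complex determinant.\<close>

lemma weak_pd_Pair:
 assumes "weak_pd V i h w" "weak_pd V i h' w'" and i: "i \<in> Basis"
 shows "weak_pd V i (%x. (h x, h' x)) (%x. (w x, w' x))"
proof -
 have P: "integrable lborel (%x. (f x, g x))" "(LBINT x. (f x, g x)) = ((LBINT x. f x), (LBINT x. g x))"
  if "integrable lborel f" "integrable lborel g" for f :: "'a => 'b" and g :: "'a => 'c"
 proof -
  have e: "(%x. (f x, g x)) = (%x. (f x, 0) + (0, g x))" by auto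
  have 1: "integrable lborel (%x. (f x, 0::'c))" "(LBINT x. (f x, 0::'c)) = ((LBINT x. f x), 0)"
   using integrable_bounded_linear[OF bounded_linear_Pair[OF bounded_linear_ident bounded_linear_zero] that(1)]
    integral_bounded_linear[OF bounded_linear_Pair[OF bounded_linear_ident bounded_linear_zero] that(1)] by auto
  have 2: "integrable lborel (%x. (0::'b, g x))" "(LBINT x. (0::'b, g x)) = (0, (LBINT x. g x))"
   using integrable_bounded_linear[OF bounded_linear_Pair[OF bounded_linear_zero bounded_linear_ident] that(2)]
    integral_bounded_linear[OF bounded_linear_Pair[OF bounded_linear_zero bounded_linear_ident] that(2)] by auto
  show "integrable lborel (%x. (f x, g x))" unfolding e using 1 2 by (intro Bochner_Integration.integrable_add)
  show "(LBINT x. (f x, g x)) = ((LBINT x. f x), (LBINT x. g x))"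
   unfolding e using 1 2 by (subst Bochner_Integration.integral_add) auto
 qed
 show ?thesis
  unfolding weak_pd_def
 proof (intro conjI allI impI)
  show "integrable lborel (%x. (h x, h' x))" "integrable lborel (%x. (w x, w' x))"
   using assms by (auto simp: weak_pd_def intro: P)
  fix \<phi> :: "'a => real" assume \<phi>: "\<forall>k. Cc k V \<phi>"
  have hw: "integrable lborel h" "integrable lborel w" "integrable lborel h'" "integrable lborel w'"
   using assms by (auto simp: weak_pd_def)
  have C: "Cc 0 V \<phi>" "Cc 0 V (pd i \<phi>)" using \<phi> Cc_pd1[OF _ i] by auto
  have eq: "(LBINT x. \<phi> x *\<^sub>R w x) = - (LBINT x. pd i \<phi> x *\<^sub>R h x)"
   "(LBINT x. \<phi> x *\<^sub>R w' x) = - (LBINT x. pd i \<phi> x *\<^sub>R h' x)"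
   using assms \<phi> unfolding weak_pd_def by auto
  show "(LBINT x. \<phi> x *\<^sub>R (w x, w' x)) = - (LBINT x. pd i \<phi> x *\<^sub>R (h x, h' x))"
   unfolding scaleR_Pair P(2)[OF Cc_times_integrable[OF C(1) hw(2)] Cc_times_integrable[OF C(1) hw(4)]]
    P(2)[OF Cc_times_integrable[OF C(2) hw(1)] Cc_times_integrable[OF C(2) hw(3)]] by (simp add: eq)
 qed
qed

text \<open>The Sobolev hypothesis speaks of Lebesgue measurable functions on the disc, while
  convolution and Fubini are used for Borel measure; \<open>w'\<close> is a Borel representative of
  the extension by zero.\<close>

lemma lebesgue_to_lborel:
 fixes w :: "'a::euclidean_space => 'b::euclidean_space"
 assumes "set_integrable lebesgue A w"
 obtains w' where "integrable lborel w'"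
  "!!f :: 'a => real. f \<in> borel_measurable borel ==> (LINT x:A|lebesgue. f x *\<^sub>R w x) = (LBINT x. f x *\<^sub>R w' x)"
proof -
 define g where [abs_def]: "g x = indicator A x *\<^sub>R w x" for x
 have g: "integrable lebesgue g" using assms by (simp add: g_def set_integrable_def)
 have "\<exists>g'\<in>borel_measurable lborel. (AE x in lborel. g x \<bullet> j = g' x)" for j
  using borel_measurable_integrable[OF g] by (intro completion_ex_borel_measurable_real) auto
 then obtain G where G: "!!j. G j \<in> borel_measurable lborel" "!!j. AE x in lborel. g x \<bullet> j = G j x" by metis
 define w' where "w' x = (\<Sum>j\<in>Basis. G j x *\<^sub>R j)" for x
 have m: "w' \<in> borel_measurable lborel" unfolding w'_def using G(1) by measurable
 have "AE x in lborel. \<forall>j\<in>Basis. g x \<bullet> j = G j x" using G(2) by (intro AE_finite_allI) auto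
 then have ae: "AE x in lborel. g x = w' x"
 proof (rule eventually_mono)
  fix x assume "\<forall>j\<in>Basis. g x \<bullet> j = G j x"
  then have "w' x = (\<Sum>j\<in>Basis. (g x \<bullet> j) *\<^sub>R j)" by (simp add: w'_def)
  then show "g x = w' x" by (simp add: euclidean_representation)
 qed
 then have ae': "AE x in lebesgue. g x = w' x" by (rule AE_completion)
 have m': "w' \<in> borel_measurable lebesgue" using m measurable_completion by blast
 have "integrable lebesgue w'" using g ae' m' by (metis integrable_cong_AE_imp)
 then have i: "integrable lborel w'" using integrable_completion[OF m] by simp
 show ?thesis
 proof (rule that[OF i])
  fix f :: "'a => real" assume f: "f \<in> borel_measurable borel"
  have fm: "(%x. f x *\<^sub>R w' x) \<in> borel_measurable lborel" using f m by auto
  have "(LINT x:A|lebesgue. f x *\<^sub>R w x) = (LINT x|lebesgue. f x *\<^sub>R g x)"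
   unfolding set_lebesgue_integral_def g_def by (simp add: mult.commute)
  also have "\<dots> = (LINT x|lebesgue. f x *\<^sub>R w' x)"
  proof (rule integral_cong_AE)
   show "(%x. f x *\<^sub>R g x) \<in> borel_measurable lebesgue"
    using f borel_measurable_integrable[OF g] by (intro borel_measurable_scaleR) (auto simp: measurable_completion)
   show "(%x. f x *\<^sub>R w' x) \<in> borel_measurable lebesgue" using fm measurable_completion by blast
   show "AE x in lebesgue. f x *\<^sub>R g x = f x *\<^sub>R w' x" using ae' by (rule eventually_mono) simp
  qed
  also have "\<dots> = (LBINT x. f x *\<^sub>R w' x)" by (rule integral_completion[OF fm])
  finally show "(LINT x:A|lebesgue. f x *\<^sub>R w x) = (LBINT x. f x *\<^sub>R w' x)" .
 qed
qed

section \<open>Linear algebra of conformal Lagrangian frames\<close>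

definition quat :: "complex2 => complex2" where
 "quat v = (- cnj (snd v), cnj (fst v))"

definition cscale :: "complex => complex2 => complex2" where
 "cscale c v = (c * fst v, c * snd v)"

lemma inner_complex2: "(v :: complex2) \<bullet> w = Re (fst v * cnj (fst w) + snd v * cnj (snd w))"
 by (simp add: inner_prod_def inner_complex_def)

lemma norm_complex2: "(norm (v :: complex2))\<^sup>2 = (cmod (fst v))\<^sup>2 + (cmod (snd v))\<^sup>2"
 by (simp add: norm_prod_def)

text \<open>\<open>quat\<close> is the quaternion unit j, so \<open>quat a\<close> spans the
  Hermitian complement of \<open>a\<close>. Orthogonality and the Lagrangian condition together say
  that \<open>b\<close> is Hermitian orthogonal to \<open>a\<close>; with the prescribed complex
  determinant, Cramer's rule determines \<open>b\<close>.\<close>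

lemma conformal_lagrangian_quat:
 fixes a b :: complex2
 assumes "a \<bullet> b = 0" "norm a = norm b" "omega a b = 0" "dz1_dz2 a b = of_real ((norm a)\<^sup>2) * g"
 shows "b = cscale g (quat a)"
proof (cases "a = 0")
 case True
 then have "b = 0" using assms(2) by simp
 then show ?thesis using True by (simp add: cscale_def quat_def zero_prod_def)
next
 case False
 have h: "fst b * cnj (fst a) + snd b * cnj (snd a) = 0"
  using assms(1,3) by (simp add: inner_complex2 omega_def complex_eq_iff) (simp add: algebra_simps)
 have n: "of_real ((norm a)\<^sup>2) = fst a * cnj (fst a) + snd a * cnj (snd a)"
  by (simp only: norm_complex2 of_real_add complex_norm_square)
 have d: "fst a * snd b - fst b * snd a = of_real ((norm a)\<^sup>2) * g" using assms(4) by (simp add: dz1_dz2_def)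
 have n0: "(of_real ((norm a)\<^sup>2) :: complex) \<noteq> 0" using False by simp
 have "of_real ((norm a)\<^sup>2) * fst b = - cnj (snd a) * (fst a * snd b - fst b * snd a) + fst a * (fst b * cnj (fst a) + snd b * cnj (snd a))"
  unfolding n by (simp add: algebra_simps)
 then have 1: "of_real ((norm a)\<^sup>2) * fst b = of_real ((norm a)\<^sup>2) * (g * - cnj (snd a))"
  unfolding h d by (simp add: algebra_simps)
 have "of_real ((norm a)\<^sup>2) * snd b = cnj (fst a) * (fst a * snd b - fst b * snd a) + snd a * (fst b * cnj (fst a) + snd b * cnj (snd a))"
  unfolding n by (simp add: algebra_simps)
 then have 2: "of_real ((norm a)\<^sup>2) * snd b = of_real ((norm a)\<^sup>2) * (g * cnj (fst a))"
  unfolding h d by (simp add: algebra_simps)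
 show ?thesis
  using 1 2 unfolding mult_left_cancel[OF n0] by (simp add: cscale_def quat_def prod_eq_iff)
qed

lemma AE_lebesgue_on_continuous_eq:
 fixes f g :: "'a::euclidean_space => 'b::real_normed_vector"
 assumes D: "open D" and fg: "continuous_on D f" "continuous_on D g"
  and ae: "AE z in lebesgue_on D. f z = g z" and z: "z \<in> D"
 shows "f z = g z"
proof (rule ccontr)
 assume ne: "f z \<noteq> g z"
 define U where "U = {x \<in> D. f x \<noteq> g x}"
 have "open (D \<inter> (%x. f x - g x) -` (- {0}))"
  using fg D by (intro continuous_open_preimage continuous_intros) auto
 moreover have "D \<inter> (%x. f x - g x) -` (- {0}) = U" by (auto simp: U_def)
 ultimately have U: "open U" by simp
 have "D \<in> sets lebesgue" using D by (simp add: borel_open sets_completionI_sets)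
 then have "AE x in lebesgue. x \<in> D \<longrightarrow> f x = g x" using ae by (simp add: AE_restrict_space_iff)
 then have "AE x in lebesgue. x \<notin> U" by (rule eventually_mono) (auto simp: U_def)
 then have "negligible U" using U
  by (auto simp: negligible_iff_null_sets AE_iff_null_sets borel_open sets_completionI_sets)
 then have "U = {}" using U open_not_negligible by blast
 then show False using ne z by (auto simp: U_def)
qed

lemma continuous_eq_on_cball:
 fixes f g :: "complex => 'b::real_normed_vector"
 assumes "continuous_on closed_D2 f" "continuous_on closed_D2 g" "!!z. z \<in> D2 ==> f z = g z" "z \<in> closed_D2"
 shows "f z = g z"
proof (rule ccontr)
 assume ne: "f z \<noteq> g z"
 have "closed (closed_D2 \<inter> (%x. f x - g x) -` {0})"
  using assms(1,2) by (intro continuous_closed_preimage continuous_intros) auto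
 moreover have "closed_D2 \<inter> (%x. f x - g x) -` {0} = {x \<in> closed_D2. f x = g x}" by auto
 ultimately have "closed {x \<in> closed_D2. f x = g x}" by simp
 moreover have "D2 \<subseteq> {x \<in> closed_D2. f x = g x}" using assms(3) by auto
 ultimately have "closure D2 \<subseteq> {x \<in> closed_D2. f x = g x}" by (metis closure_minimal)
 then show False using ne assms(4) by (auto simp: closure_ball)
qed

lemma integrable_inner_bounded:
 fixes w A :: "'a => 'b::euclidean_space"
 assumes "integrable M w" "A \<in> borel_measurable M" "!!x. norm (A x) \<le> C"
 shows "integrable M (%x. w x \<bullet> A x)"
proof (rule Bochner_Integration.integrable_bound[where f="%x. C *\<^sub>R w x"])
 show "AE x in M. norm (w x \<bullet> A x) \<le> norm (C *\<^sub>R w x)"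
 proof (rule AE_I2)
  fix x
  have "\<bar>w x \<bullet> A x\<bar> \<le> norm (w x) * norm (A x)" by (rule Cauchy_Schwarz_ineq2)
  also have "\<dots> \<le> norm (w x) * \<bar>C\<bar>" using assms(3)[of x] by (intro mult_left_mono) auto
  finally show "norm (w x \<bullet> A x) \<le> norm (C *\<^sub>R w x)" by (simp add: mult.commute)
 qed
qed (use assms in auto)

lemma mult_I_linear: "bounded_linear mult_I"
 unfolding mult_I_def
 by (intro bounded_linear_Pair bounded_linear_compose[OF bounded_linear_mult_right] bounded_linear_fst bounded_linear_snd)

lemma mult_I_simps [simp]:
 "mult_I 0 = 0" "mult_I (v + w) = mult_I v + mult_I w" "mult_I (v - w) = mult_I v - mult_I w"
 "mult_I (r *\<^sub>R v) = r *\<^sub>R mult_I v" "mult_I (- v) = - mult_I v" "mult_I (mult_I v) = - v"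
 "mult_I v \<bullet> mult_I w = v \<bullet> w" "mult_I v \<bullet> v = 0" "v \<bullet> mult_I v = 0" "norm (mult_I v) = norm v"
 by (auto simp: mult_I_def prod_eq_iff complex_eq_iff inner_complex2 algebra_simps norm_eq_sqrt_inner)

lemma inner_mult_I_left: "mult_I v \<bullet> w = - (v \<bullet> mult_I w)"
 by (simp add: mult_I_def inner_complex2 algebra_simps)

text \<open>The last two identities turn the variation of the complex determinant in either slot
  into the phase times a Hermitian product with the corresponding frame vector; this is how the
  derivative of the angle is computed later.\<close>

lemma quat_frame:
 assumes "cmod g = 1" and b: "b = cscale g (quat a)"
 shows "a \<bullet> b = 0" "norm b = norm a" "mult_I a \<bullet> b = 0" "a \<bullet> mult_I b = 0"
  "dz1_dz2 v b = g * (fst v * cnj (fst a) + snd v * cnj (snd a))"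
  "dz1_dz2 a v = g * (fst v * cnj (fst b) + snd v * cnj (snd b))"
proof -
 have gg: "g * cnj g = 1" using assms(1) by (simp add: complex_norm_square[symmetric])
 have bb: "fst b = - g * cnj (snd a)" "snd b = g * cnj (fst a)" by (auto simp: b cscale_def quat_def)
 have h: "fst a * cnj (fst b) + snd a * cnj (snd b) = 0" by (simp add: bb)
 show "a \<bullet> b = 0" by (simp only: inner_complex2 h) simp
 show "norm b = norm a"
  using norm_complex2[of a] norm_complex2[of b] assms(1)
  by (simp add: bb norm_mult) (metis add.commute norm_ge_zero power2_eq_iff_nonneg)
 have "fst (mult_I a) * cnj (fst b) + snd (mult_I a) * cnj (snd b) = \<i> * (fst a * cnj (fst b) + snd a * cnj (snd b))"
  by (simp add: mult_I_def algebra_simps)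
 then show 1: "mult_I a \<bullet> b = 0" by (simp only: inner_complex2 h) simp
 then show "a \<bullet> mult_I b = 0" using inner_mult_I_left[of a b] by simp
 show "dz1_dz2 v b = g * (fst v * cnj (fst a) + snd v * cnj (snd a))"
  by (simp add: dz1_dz2_def bb algebra_simps)
 have "g * (fst v * cnj (fst b) + snd v * cnj (snd b)) = (g * cnj g) * (fst a * snd v - fst v * snd a)"
  by (simp add: bb algebra_simps)
 then show "dz1_dz2 a v = g * (fst v * cnj (fst b) + snd v * cnj (snd b))"
  by (simp add: gg dz1_dz2_def)
qed

text \<open>\<open>a\<close> and \<open>b\<close> form a Hermitian orthogonal basis with vectors of
  equal length. Each complex coefficient splits into a real part along the vector and a real part
  along its image under \<open>mult_I\<close>.\<close>

lemma frame_expansion: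
 assumes g: "cmod g = 1" and b: "b = cscale g (quat a)" and a: "a \<noteq> 0"
 shows "v = (v \<bullet> a / (norm a)\<^sup>2) *\<^sub>R a + (v \<bullet> b / (norm a)\<^sup>2) *\<^sub>R b
   + (v \<bullet> mult_I a / (norm a)\<^sup>2) *\<^sub>R mult_I a + (v \<bullet> mult_I b / (norm a)\<^sup>2) *\<^sub>R mult_I b"
proof -
 define H where "H c = fst v * cnj (fst c) + snd v * cnj (snd c)" for c :: complex2
 have gg: "g * cnj g = 1" using g by (simp add: complex_norm_square[symmetric])
 have bb: "fst b = - g * cnj (snd a)" "snd b = g * cnj (fst a)" by (auto simp: b cscale_def quat_def)
 have n: "of_real ((norm a)\<^sup>2) = fst a * cnj (fst a) + snd a * cnj (snd a)"
  by (simp only: norm_complex2 of_real_add complex_norm_square)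
 have n0: "(of_real ((norm a)\<^sup>2) :: complex) \<noteq> 0" using a by simp
 have e: "(v \<bullet> c / r) *\<^sub>R c + (v \<bullet> mult_I c / r) *\<^sub>R mult_I c = cscale (H c / of_real r) c" for c r
 proof -
  have "H c = of_real (v \<bullet> c) + \<i> * of_real (v \<bullet> mult_I c)"
   by (simp add: H_def inner_complex2 mult_I_def complex_eq_iff)
  then show ?thesis
   by (simp add: cscale_def mult_I_def prod_eq_iff scaleR_conv_of_real add_divide_distrib algebra_simps)
 qed
 have "cscale (H a / of_real ((norm a)\<^sup>2)) a + cscale (H b / of_real ((norm a)\<^sup>2)) b = v"
 proof -
  have "H a * fst a + H b * fst b = fst v * (fst a * cnj (fst a)) + snd v * cnj (snd a) * fst a
    + (g * cnj g) * (fst v * (snd a * cnj (snd a)) - snd v * fst a * cnj (snd a))"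
   by (simp add: H_def bb algebra_simps)
  then have 1: "H a * fst a + H b * fst b = of_real ((norm a)\<^sup>2) * fst v"
   unfolding n gg by (simp add: algebra_simps)
  have "H a * snd a + H b * snd b = fst v * cnj (fst a) * snd a + snd v * (snd a * cnj (snd a))
    + (g * cnj g) * (snd v * (fst a * cnj (fst a)) - fst v * snd a * cnj (fst a))"
   by (simp add: H_def bb algebra_simps)
  then have 2: "H a * snd a + H b * snd b = of_real ((norm a)\<^sup>2) * snd v"
   unfolding n gg by (simp add: algebra_simps)
  show ?thesis
   using n0 1 2 by (simp add: cscale_def prod_eq_iff add_divide_distrib[symmetric] divide_eq_eq mult.commute)
 qed
 then have "v = ((v \<bullet> a / (norm a)\<^sup>2) *\<^sub>R a + (v \<bullet> mult_I a / (norm a)\<^sup>2) *\<^sub>R mult_I a)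
   + ((v \<bullet> b / (norm a)\<^sup>2) *\<^sub>R b + (v \<bullet> mult_I b / (norm a)\<^sup>2) *\<^sub>R mult_I b)"
  unfolding e by (rule sym)
 also have "\<dots> = (v \<bullet> a / (norm a)\<^sup>2) *\<^sub>R a + (v \<bullet> b / (norm a)\<^sup>2) *\<^sub>R b
   + (v \<bullet> mult_I a / (norm a)\<^sup>2) *\<^sub>R mult_I a + (v \<bullet> mult_I b / (norm a)\<^sup>2) *\<^sub>R mult_I b"
  by (simp only: ac_simps)
 finally show ?thesis .
qed

text \<open>A property of compactly supported \<open>C\<^sup>1\<close> functions which is additive and holds locally holds globally;
 the partition of unity is replaced by peeling off one ball at a time.\<close>
lemma Cc1_local_to_global:
 fixes c :: "'a::euclidean_space => real"
 assumes W: "open W" and c: "Cc 1 W c"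
  and zero: "P (%_. 0)" and add: "!!c d. Cc 1 W c ==> Cc 1 W d ==> P c ==> P d ==> P (%x. c x + d x)"
  and loc: "!!z. z \<in> W ==> \<exists>r>0. \<forall>c. Cc 1 (W \<inter> ball z r) c \<longrightarrow> P c"
 shows "P c"
proof -
 obtain r where r: "!!z. z \<in> W ==> r z > 0" "!!z c. z \<in> W ==> Cc 1 (W \<inter> ball z (r z)) c ==> P c"
  using loc by metis
 have fin: "P c" if "finite F" "F \<subseteq> W" "Cc 1 W c" "compact K" "K \<subseteq> W" "!!x. x \<notin> K ==> c x = 0"
   "K \<subseteq> (\<Union>z\<in>F. ball z (r z / 2))" for F K c
  using that
 proof (induction F arbitrary: c K rule: finite_induct)
  case empty
  then have "c = (%_. 0)" by auto
  then show ?case using zero by simp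
 next
  case (insert z F)
  have z: "z \<in> W" "r z > 0" using insert.prems r by auto
  have cl: "closed (- ball z (r z * 3 / 4))" "compact (cball z (r z / 2))" by auto
  \<comment> \<open>\<open>s\<close> lives inside radius 3/4 and \<open>t\<close> outside radius 1/2
    of the ball (9/16 and 1/4 are the squares). They never vanish together, so s / (s + t) is a
    cutoff equal to 1 on the half ball and supported in a compact part of the ball.\<close>
  define s where [abs_def]: "s x = flat 0 ((9/16) * (r z)\<^sup>2 - (x - z) \<bullet> (x - z))" for x
  define t where [abs_def]: "t x = flat 0 ((x - z) \<bullet> (x - z) - (1/4) * (r z)\<^sup>2)" for x
  have pos: "s x + t x > 0" for x
  proof (cases "(x - z) \<bullet> (x - z) < (9/16) * (r z)\<^sup>2")
   case True
   then have "s x > 0" by (simp add: s_def flat_def)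
   then show ?thesis using flat_nonneg[of 0] by (simp add: t_def add_pos_nonneg)
  next
   case False
   moreover have "(1/4) * (r z)\<^sup>2 < (9/16) * (r z)\<^sup>2" using z by simp
   ultimately have "(1/4) * (r z)\<^sup>2 < (x - z) \<bullet> (x - z)" by linarith
   then have "t x > 0" by (simp add: t_def flat_def)
   then show ?thesis using flat_nonneg[of 0] by (simp add: s_def add_nonneg_pos)
  qed
  define cut where [abs_def]: "cut x = s x * inverse (s x + t x)" for x
  have Ckst: "Ck_on 1 UNIV s" "Ck_on 1 UNIV t" unfolding s_def t_def
   by (rule Ck_on_compose[OF open_UNIV open_UNIV _ Ck_on_flat];
     intro Ck_on_diff Ck_on_const Ck_on_inner Ck_on_id open_UNIV subset_UNIV Ck_on_mult)+
  have Cinv: "Ck_on 1 {0<..} (inverse :: real => real)"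
  proof -
   have "Ck_on (Suc 0) {0<..} (inverse :: real => real)"
    by (rule Ck_on_SucI[where f'="%x v. - (inverse x * v * inverse x)"])
      (auto intro!: has_derivative_inverse' continuous_intros)
   then show ?thesis by simp
  qed
  have Ckcut: "Ck_on 1 UNIV cut" unfolding cut_def
   by (rule Ck_on_mult[OF open_UNIV Ckst(1)],
     rule Ck_on_compose[OF open_UNIV open_greaterThan _ Cinv Ck_on_add[OF open_UNIV Ckst]])
     (use pos in auto)
  have cut1: "cut x = 1" if "x \<in> ball z (r z / 2)" for x
  proof -
   have "(x - z) \<bullet> (x - z) \<le> (1/4) * (r z)\<^sup>2"
    using that z power_mono[of "norm (x - z)" "r z / 2" 2]
    by (simp add: dist_norm norm_minus_commute power2_norm_eq_inner power_divide)
   then have "t x = 0" by (simp add: t_def flat_def)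
   then show ?thesis using pos[of x] by (simp add: cut_def)
  qed
  have cut0: "cut x = 0" if "x \<notin> cball z (3/4 * r z)" for x
  proof -
   have "(9/16) * (r z)\<^sup>2 \<le> (x - z) \<bullet> (x - z)"
    using that z power_mono[of "3/4 * r z" "norm (x - z)" 2]
    by (simp add: dist_norm norm_minus_commute power2_norm_eq_inner power_mult_distrib power_divide)
   then show ?thesis by (simp add: cut_def s_def flat_def)
  qed
  have 1: "P (%x. c x * cut x)"
  proof (rule r(2)[OF z(1)])
   show "Cc 1 (W \<inter> ball z (r z)) (%x. c x * cut x)"
   proof (rule CcI[where K="K \<inter> cball z (3/4 * r z)"])
    show "Ck_on 1 UNIV (%x. c x * cut x)" using insert.prems by (intro Ck_on_mult open_UNIV Ckcut Cc_Ck[of 1 W])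
    show "compact (K \<inter> cball z (3/4 * r z))" using insert.prems by auto
    show "K \<inter> cball z (3/4 * r z) \<subseteq> W \<inter> ball z (r z)" using insert.prems z by auto
    show "c x * cut x = 0" if "x \<notin> K \<inter> cball z (3/4 * r z)" for x
     using that insert.prems(5)[of x] cut0[of x] by auto
   qed
  qed
  have C1: "Cc 1 W (%x. c x * cut x)" "Cc 1 W (%x. c x * (1 - cut x))"
   using insert.prems by (intro Cc_mult Ck_on_diff Ck_on_const Ckcut open_UNIV; simp)+
  have 2: "P (%x. c x * (1 - cut x))"
  proof (rule insert.IH[where K="K - ball z (r z / 2)"])
   show "compact (K - ball z (r z / 2))" using insert.prems by (intro compact_diff) auto
   show "c x * (1 - cut x) = 0" if "x \<notin> K - ball z (r z / 2)" for x
    using that insert.prems(5)[of x] cut1[of x] by auto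
  qed (use insert.prems C1 in auto)
  have "P (%x. c x * cut x + c x * (1 - cut x))" by (rule add[OF C1 1 2])
  moreover have "(%x. c x * cut x + c x * (1 - cut x)) = c" by (simp add: algebra_simps)
  ultimately show ?case by simp
 qed
 obtain K where K: "compact K" "K \<subseteq> W" "!!x. x \<notin> K ==> c x = 0" using c by (auto elim: CcE)
 have "K \<subseteq> (\<Union>z\<in>K. ball z (r z / 2))" using r(1) K(2) by force
 then obtain F where "F \<subseteq> K" "finite F" "K \<subseteq> (\<Union>z\<in>F. ball z (r z / 2))"
  using compactE_image[OF K(1), of K "%z. ball z (r z / 2)"] by auto
 then show ?thesis using fin[of F c K] K c by auto
qed

subsection \<open>Maps of class C1 up to the boundary of the disc\<close>

lemma at_within_closed_D2: "z \<in> D2 ==> at z within closed_D2 = at z"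
 by (rule at_within_interior) (simp add: interior_cball)

lemma C1cd_has_derivative:
 "C1_closed_disc f ==> z \<in> closed_D2 ==> (f has_derivative du f z) (at z within closed_D2)"
 unfolding du_def frechet_derivative_works[symmetric] by (simp add: C1_closed_disc_def differentiable_on_def)

lemma linear_complex_expand:
 fixes L :: "complex => 'b::real_vector"
 assumes "linear L" shows "L v = Re v *\<^sub>R L 1 + Im v *\<^sub>R L \<i>"
proof -
 have "v = Re v *\<^sub>R 1 + Im v *\<^sub>R \<i>" by (simp add: complex_eq_iff)
 then have "L v = L (Re v *\<^sub>R 1 + Im v *\<^sub>R \<i>)" by simp
 then show ?thesis by (simp only: linear_add[OF assms] linear_scale[OF assms])
qed

lemma du_expand:
 assumes "C1_closed_disc f" "z \<in> closed_D2"
 shows "du f z v = Re v *\<^sub>R dx f z + Im v *\<^sub>R dy f z"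
 unfolding dx_def dy_def
 by (rule linear_complex_expand[OF has_derivative_linear[OF C1cd_has_derivative[OF assms]]])

lemma du_eq_pd: "z \<in> D2 ==> du f z v = pd v f z"
 by (simp add: du_def at_within_closed_D2)

lemma dx_eq_pd: "z \<in> D2 ==> dx f z = pd 1 f z" and dy_eq_pd: "z \<in> D2 ==> dy f z = pd \<i> f z"
 by (simp_all add: dx_def dy_def du_eq_pd)

lemma C1cd_Ck: assumes "C1_closed_disc f" shows "Ck_on 1 D2 f"
proof -
 have "Ck_on (Suc 0) D2 f"
 proof (rule Ck_on_SucI[OF open_ball, where f'="%z v. Re v *\<^sub>R dx f z + Im v *\<^sub>R dy f z"])
  show "(f has_derivative (%v. Re v *\<^sub>R dx f z + Im v *\<^sub>R dy f z)) (at z)" if z: "z \<in> D2" for z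
  proof -
   have "du f z = (%v. Re v *\<^sub>R dx f z + Im v *\<^sub>R dy f z)" using du_expand[OF assms, of z] z by (auto simp: fun_eq_iff)
   then show ?thesis using C1cd_has_derivative[OF assms, of z] z at_within_closed_D2[OF z] by simp
  qed
  show "Ck_on 0 D2 (%z. Re i *\<^sub>R dx f z + Im i *\<^sub>R dy f z)" for i
   using assms by (auto simp: C1_closed_disc_def intro!: continuous_intros intro: continuous_on_subset[OF _ ball_subset_cball])
 qed
 then show ?thesis by simp
qed

lemma C1cd_cont: "C1_closed_disc f ==> continuous_on closed_D2 f"
 "C1_closed_disc f ==> continuous_on closed_D2 (dx f)" "C1_closed_disc f ==> continuous_on closed_D2 (dy f)"
 by (auto simp: C1_closed_disc_def differentiable_imp_continuous_on)

lemma C1cd_integrable: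
 fixes f :: "complex => 'b::euclidean_space"
 assumes "continuous_on closed_D2 f" shows "integrable lborel (%z. indicator D2 z *\<^sub>R f z)"
proof -
 have "integrable lborel (%z. indicator closed_D2 z *\<^sub>R f z)" by (rule borel_integrable_compact[OF compact_cball assms])
 then have "integrable lborel (%z. indicator D2 z *\<^sub>R (indicator closed_D2 z *\<^sub>R f z))"
  using integrable_mult_indicator[of D2 lborel "%z. indicator closed_D2 z *\<^sub>R f z"] by simp
 moreover have "(%z. indicator D2 z *\<^sub>R (indicator closed_D2 z *\<^sub>R f z)) = (%z. indicator D2 z *\<^sub>R f z)"
  by (auto simp: indicator_def fun_eq_iff)
 ultimately show ?thesis by simp
qed

lemma test_function_Cc:
 fixes \<phi> :: "'a::euclidean_space => real"
 assumes "!!k. Cc k W \<phi>"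
 shows "smooth_on UNIV \<phi>" "compact (fun_support \<phi>)" "fun_support \<phi> \<subseteq> W"
proof -
 show "smooth_on UNIV \<phi>" using assms by (auto simp: smooth_on_def Cc_def)
 obtain K where K: "compact K" "K \<subseteq> W" "!!x. x \<notin> K ==> \<phi> x = 0" using assms[of 0] by (auto elim: CcE)
 have "fun_support \<phi> \<subseteq> K" unfolding fun_support_def
  by (rule closure_minimal[OF _ compact_imp_closed[OF K(1)]]) (use K(3) in auto)
 moreover have "closed (fun_support \<phi>)" by (simp add: fun_support_def)
 ultimately show "compact (fun_support \<phi>)" "fun_support \<phi> \<subseteq> W"
  using compact_Int_closed[OF K(1)] K(2) by (metis inf.absorb_iff2, blast)
qed

lemma lebesgue_integral_cont_compact:
 fixes f :: "complex => 'b::euclidean_space"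
 assumes "compact K" "K \<subseteq> D2" "continuous_on K f" "!!x. x \<notin> K ==> f x = 0"
 shows "(LINT z:D2|lebesgue. f z) = (LBINT z. f z)"
proof -
 have "indicator D2 z *\<^sub>R f z = f z" for z
 proof (cases "z \<in> D2")
  case False
  then have "z \<notin> K" using assms(2) by blast
  then show ?thesis using assms(4) by simp
 qed simp
 then have "(LINT z:D2|lebesgue. f z) = (LINT z|lebesgue. f z)" by (simp add: set_lebesgue_integral_def)
 also have "\<dots> = (LBINT z. f z)"
  using borel_measurable_integrable[OF integrable_cont_compact_support[OF assms(1,3,4)]]
  by (intro integral_completion) auto
 finally show ?thesis .
qed

text \<open>Since u is C^1, its weak derivative \<open>w\<close> acts on test functions as the
  classical one does. It is enough to use this for the test function \<open>pd j \<phi>\<close>; no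
  pointwise comparison of the two derivatives is made.\<close>

lemma weak_second_derivative:
 fixes u :: "complex => 'b::euclidean_space"
 assumes C1: "C1_closed_disc u" and W: "sobolev_1 2 D2 u" and ij: "i \<in> Basis" "j \<in> Basis"
 obtains w where "weak_pd D2 j (%z. indicator D2 z *\<^sub>R pd i u z) w"
proof -
 obtain w where w: "weak_partial D2 i u w" "sobolev_1 1 D2 w"
  using W ij by (auto simp: numeral_2_eq_2)
 have wi: "set_integrable lebesgue D2 w" using w(2) by simp
 obtain w2 where w2: "weak_partial D2 j w w2" "set_integrable lebesgue D2 w2" using w(2) ij by auto
 obtain w' where w': "integrable lborel w'"
  "!!f :: complex => real. f \<in> borel_measurable borel ==> (LINT x:D2|lebesgue. f x *\<^sub>R w x) = (LBINT x. f x *\<^sub>R w' x)"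
  using lebesgue_to_lborel[OF wi] by metis
 obtain w2' where w2': "integrable lborel w2'"
  "!!f :: complex => real. f \<in> borel_measurable borel ==> (LINT x:D2|lebesgue. f x *\<^sub>R w2 x) = (LBINT x. f x *\<^sub>R w2' x)"
  using lebesgue_to_lborel[OF w2(2)] by metis
 have uC: "Ck_on 1 D2 u" by (rule C1cd_Ck[OF C1])
 have e1: "(LBINT x. \<phi> x *\<^sub>R w' x) = (LBINT x. \<phi> x *\<^sub>R pd i u x)" if \<phi>: "!!k. Cc k D2 \<phi>" for \<phi>
 proof -
  have p: "Cc 0 D2 (pd i \<phi>)" using Cc_pd1[OF \<phi> ij(1)] .
  obtain K where K: "compact K" "K \<subseteq> D2" "!!x. x \<notin> K ==> pd i \<phi> x = 0" using p by (auto elim: CcE)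
  have "(LBINT x. \<phi> x *\<^sub>R w' x) = (LINT x:D2|lebesgue. \<phi> x *\<^sub>R w x)"
   using w'(2)[OF Cc_measurable[OF \<phi>]] by simp
  also have "\<dots> = - (LINT x:D2|lebesgue. pd i \<phi> x *\<^sub>R u x)"
   using w(1) test_function_Cc[OF \<phi>] unfolding weak_partial_def by blast
  also have "(LINT x:D2|lebesgue. pd i \<phi> x *\<^sub>R u x) = (LBINT x. pd i \<phi> x *\<^sub>R u x)"
  proof (rule lebesgue_integral_cont_compact[OF K(1,2)])
   show "continuous_on K (%x. pd i \<phi> x *\<^sub>R u x)"
    using continuous_on_subset[OF Ck_on_continuous[OF open_ball uC] K(2)]
     continuous_on_subset[OF Ck_on_continuous[OF open_UNIV Cc_Ck[OF p]] subset_UNIV]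
    by (intro continuous_on_scaleR)
  qed (simp add: K(3))
  also have "- \<dots> = (LBINT x. \<phi> x *\<^sub>R pd i u x)"
   using integral_pd_product_on[OF open_ball \<phi> uC ij(1)] by simp
  finally show ?thesis .
 qed
 have ind: "c x *\<^sub>R (indicator D2 x *\<^sub>R g x) = c x *\<^sub>R g x" if "Cc k D2 c" for k and c :: "complex => real" and g :: "complex => 'b" and x
  using that by (auto elim!: CcE simp: indicator_def)
 have pi: "integrable lborel (%z. indicator D2 z *\<^sub>R pd i u z)"
 proof -
  have "(%z. indicator D2 z *\<^sub>R pd i u z) = (%z. indicator D2 z *\<^sub>R (if i = 1 then dx u else dy u) z)"
   using ij by (auto simp: Basis_complex_def fun_eq_iff indicator_def dx_eq_pd dy_eq_pd)
  then show ?thesis using C1cd_integrable[of "if i = 1 then dx u else dy u"] C1cd_cont[OF C1] by simp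
 qed
 have "weak_pd D2 j (%z. indicator D2 z *\<^sub>R pd i u z) w2'"
  unfolding weak_pd_def
 proof (intro conjI allI impI pi w2'(1))
  fix \<phi> :: "complex => real" assume "\<forall>k. Cc k D2 \<phi>"
  then have \<phi>: "!!k. Cc k D2 \<phi>" by simp
  have p: "Cc k D2 (pd j \<phi>)" for k using Cc_pd[OF \<phi> ij(2)] .
  have "(LBINT x. \<phi> x *\<^sub>R w2' x) = (LINT x:D2|lebesgue. \<phi> x *\<^sub>R w2 x)"
   using w2'(2)[OF Cc_measurable[OF \<phi>]] by simp
  also have "\<dots> = - (LINT x:D2|lebesgue. pd j \<phi> x *\<^sub>R w x)"
   using w2(1) test_function_Cc[OF \<phi>] unfolding weak_partial_def by blast
  also have "\<dots> = - (LBINT x. pd j \<phi> x *\<^sub>R w' x)"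
   using w'(2)[OF Cc_measurable[OF p]] by simp
  also have "\<dots> = - (LBINT x. pd j \<phi> x *\<^sub>R pd i u x)" using e1[OF p] by simp
  also have "(%x. pd j \<phi> x *\<^sub>R pd i u x) = (%x. pd j \<phi> x *\<^sub>R (indicator D2 x *\<^sub>R pd i u x))"
   by (rule ext) (rule ind[OF p, symmetric])
  finally show "(LBINT x. \<phi> x *\<^sub>R w2' x) = - (LBINT x. pd j \<phi> x *\<^sub>R (indicator D2 x *\<^sub>R pd i u x))" .
 qed
 then show ?thesis using that by blast
qed

subsection \<open>Conformal Lagrangian discs\<close>

locale conformal_lagrangian_disc =
 fixes u :: "complex => complex2" and gbar :: "complex => complex" and S :: "complex set"
 assumes C1: "C1_closed_disc u"
  and W21: "sobolev_1 2 D2 u"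
  and conformal: "weakly_conformal u"
  and branch: "finite S" "S \<subseteq> D2" "!!p v. p \<in> S ==> du u p v = 0"
  and immersion: "lagrangian_immersion_on (closed_D2 - S) u"
  and angle: "lagrangian_angle u gbar" "continuous_on D2 gbar"
begin

lemmas cont = C1cd_cont[OF C1]
lemmas contD = continuous_on_subset[OF cont(1) ball_subset_cball] continuous_on_subset[OF cont(2) ball_subset_cball]
 continuous_on_subset[OF cont(3) ball_subset_cball]

lemma dx_nonzero: assumes "z \<in> closed_D2 - S" shows "dx u z \<noteq> 0"
proof -
 have "linear (du u z)" using has_derivative_linear[OF C1cd_has_derivative[OF C1]] assms by auto
 moreover have "inj (du u z)" using immersion assms by (auto simp: lagrangian_immersion_on_def)
 ultimately show ?thesis unfolding dx_def by (metis inj_eq linear_0 zero_neq_one)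
qed

text \<open>The almost everywhere conditions hold everywhere by continuity of the first derivatives.
  The angle is extended to the circle, where u is an immersion, and lifted through the exponential
  because the closed disc is contractible.\<close>

lemma angle_lift:
 obtains \<beta> :: "complex => real" where "continuous_on closed_D2 \<beta>"
  "!!z. z \<in> closed_D2 ==> dy u z = cscale (exp (\<i> * \<beta> z)) (quat (dx u z))"
proof -
 have D2m: "AE z in lebesgue_on D2. dx u z \<bullet> dy u z = 0" "AE z in lebesgue_on D2. (norm (dx u z))\<^sup>2 = (norm (dy u z))\<^sup>2"
  using conformal unfolding weakly_conformal_def by (auto elim: eventually_mono)
 have c1: "dx u z \<bullet> dy u z = 0" if "z \<in> closed_D2" for z
 proof (rule continuous_eq_on_cball[OF _ _ _ that])
  show "dx u z \<bullet> dy u z = 0" if "z \<in> D2" for z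
   by (rule AE_lebesgue_on_continuous_eq[OF open_ball _ _ D2m(1) that]) (intro continuous_intros contD)+
 qed (intro continuous_intros cont)+
 have c2: "norm (dx u z) = norm (dy u z)" if "z \<in> closed_D2" for z
 proof -
  have "(norm (dx u z))\<^sup>2 = (norm (dy u z))\<^sup>2"
  proof (rule continuous_eq_on_cball[OF _ _ _ that])
   show "(norm (dx u z))\<^sup>2 = (norm (dy u z))\<^sup>2" if "z \<in> D2" for z
    by (rule AE_lebesgue_on_continuous_eq[OF open_ball _ _ D2m(2) that]) (intro continuous_intros contD)+
  qed (intro continuous_intros cont)+
  then show ?thesis by simp
 qed
 have om: "omega (dx u z) (dy u z) = 0" if "z \<in> closed_D2" for z
 proof (cases "z \<in> S")
  case True then show ?thesis using branch(3) by (simp add: dx_def dy_def omega_def)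
 next
  case False then show ?thesis using immersion that by (auto simp: lagrangian_immersion_on_def)
 qed
 have cd: "continuous_on X (%z. dz1_dz2 (dx u z) (dy u z))" if "X \<subseteq> closed_D2" for X
  unfolding dz1_dz2_def using cont that by (intro continuous_intros) (auto intro: continuous_on_subset)
 have d: "dz1_dz2 (dx u z) (dy u z) = of_real ((norm (dx u z))\<^sup>2) * gbar z" if "z \<in> D2" for z
 proof (rule AE_lebesgue_on_continuous_eq[OF open_ball cd _ _ that])
  show "continuous_on D2 (%z. of_real ((norm (dx u z))\<^sup>2) * gbar z)" by (intro continuous_intros contD angle(2))
  show "AE z in lebesgue_on D2. dz1_dz2 (dx u z) (dy u z) = of_real ((norm (dx u z))\<^sup>2) * gbar z"
   using angle(1) by (simp add: lagrangian_angle_def)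
 qed auto
 \<comment> \<open>The determinant quotient is continuous off \<open>S\<close>, and
   \<open>gbar\<close> is continuous inside the disc. Since \<open>S\<close> lies in the open disc,
   these two relatively open sets cover the closed disc.\<close>
 define g where "g z = (if z \<in> D2 then gbar z else dz1_dz2 (dx u z) (dy u z) / of_real ((norm (dx u z))\<^sup>2))" for z
 have dg: "dz1_dz2 (dx u z) (dy u z) = of_real ((norm (dx u z))\<^sup>2) * g z" if "z \<in> closed_D2" for z
 proof (cases "z \<in> D2")
  case True then show ?thesis by (simp only: g_def d if_True)
 next
  case False
  then have "z \<in> closed_D2 - S" using that branch(2) by blast
  then show ?thesis using dx_nonzero[of z] False by (simp add: g_def)
 qed
 have gc: "continuous_on closed_D2 g"
 proof -
  have 1: "continuous_on D2 g" using angle(2) by (rule continuous_on_eq) (simp add: g_def)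
  have "continuous_on (closed_D2 - S) (%z. dz1_dz2 (dx u z) (dy u z) / of_real ((norm (dx u z))\<^sup>2))"
   using dx_nonzero by (intro continuous_intros cd continuous_on_subset[OF cont(2)]) auto
  then have 2: "continuous_on (closed_D2 - S) g"
   by (rule continuous_on_eq) (use dg dx_nonzero in \<open>auto simp: field_simps\<close>)
  have U: "D2 \<union> (closed_D2 - S) = closed_D2" using branch(2) ball_subset_cball[of "0::complex" 1] by auto
  have "openin (top_of_set closed_D2) D2" by (rule open_subset[OF ball_subset_cball open_ball])
  moreover have "openin (top_of_set closed_D2) (closed_D2 - S)"
   using finite_imp_closed[OF branch(1)] by (metis Diff_eq closed_def openin_open_Int)
  ultimately show ?thesis using continuous_on_Un_local_open[OF _ _ 1 2] by (simp add: U)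
 qed
 have g1: "norm (g z) = 1" if "z \<in> closed_D2" for z
 proof (rule continuous_eq_on_cball[OF _ _ _ that])
  show "norm (g z) = 1" if "z \<in> D2" for z using that angle(1) by (simp add: g_def lagrangian_angle_def)
 qed (intro continuous_intros gc)+
 obtain h where h: "continuous_on closed_D2 h" "!!z. z \<in> closed_D2 ==> g z = exp (h z)"
  using continuous_logarithm_on_cball[OF gc] g1 by (metis norm_zero zero_neq_one)
 have h2: "h z = \<i> * of_real (Im (h z))" if "z \<in> closed_D2" for z
 proof -
  have "exp (Re (h z)) = 1" using g1[OF that] h(2)[OF that] by simp
  then show ?thesis by (simp add: complex_eq_iff)
 qed
 show ?thesis
 proof (rule that[of "%z. Im (h z)"])
  show "continuous_on closed_D2 (%z. Im (h z))" by (intro continuous_intros h)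
  show "dy u z = cscale (exp (\<i> * Im (h z))) (quat (dx u z))" if "z \<in> closed_D2" for z
   using conformal_lagrangian_quat[OF c1 c2 om dg] that h(2) h2 by metis
 qed
qed

end

lemma Ck_on_Im_Ln: "Ck_on 1 {y. Re y > 0} (%y. Im (Ln y))"
proof -
 have o: "open {y. Re y > 0}" using open_halfspace_Re_gt[of 0] by simp
 have "Ck_on (Suc 0) {y. Re y > 0} (%y. Im (Ln y))"
 proof (rule Ck_on_SucI[OF o, where f'="%y v. Im (inverse y * v)"])
  fix y :: complex assume "y \<in> {y. Re y > 0}"
  then have "y \<notin> \<real>\<^sub>\<le>\<^sub>0" by (auto simp: complex_nonpos_Reals_iff)
  then have "(Ln has_derivative (%v. inverse y * v)) (at y)"
   using has_field_derivative_Ln by (simp add: has_field_derivative_def)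
  then show "((%y. Im (Ln y)) has_derivative (%v. Im (inverse y * v))) (at y)"
   by (rule bounded_linear.has_derivative[OF bounded_linear_Im])
 next
  show "Ck_on 0 {y. Re y > 0} (%y. Im (inverse y * i))" for i
   by (auto intro!: continuous_intros)
 qed
 then show ?thesis by simp
qed

text \<open>The form dz1 dz2 on a pair of tangent vectors. On the pair of first derivatives of u its
  argument is the Lagrangian angle.\<close>

definition detE :: "complex2 \<times> complex2 => complex" where
 "detE x = dz1_dz2 (fst x) (snd x)"

lemma detE_has_derivative:
 "(detE has_derivative (%v. dz1_dz2 (fst v) (snd x) + dz1_dz2 (fst x) (snd v))) (at x)"
 unfolding detE_def[abs_def] dz1_dz2_def
 by (auto intro!: derivative_eq_intros simp: fun_eq_iff algebra_simps)

lemma Ck_on_detE: "Ck_on 1 UNIV detE"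
proof -
 have "Ck_on (Suc 0) UNIV detE"
 proof (rule Ck_on_SucI[OF open_UNIV detE_has_derivative])
  show "Ck_on 0 UNIV (%x. dz1_dz2 (fst i) (snd x) + dz1_dz2 (fst x) (snd i))" for i
   unfolding dz1_dz2_def by (auto intro!: continuous_intros)
 qed
 then show ?thesis by simp
qed

lemma weak_pd_subset:
 assumes "weak_pd V i h w" "U \<subseteq> V" shows "weak_pd U i h w"
 using assms Cc_mono[OF _ order_refl assms(2)] unfolding weak_pd_def by blast

text \<open>An algebraic relation satisfied by \<open>h\<close> may be differentiated: the chain
  rule makes the derivative orthogonal to all test functions.\<close>

lemma weak_chain_zero:
 fixes h w :: "'a::euclidean_space => 'b::euclidean_space" and G :: "'b => real"
 assumes V: "open V" and wk: "weak_pd V i h w" and i: "i \<in> Basis" and hc: "continuous_on V h"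
  and G: "Ck_on 1 UNIV G" and z: "!!x. x \<in> V ==> G (h x) = 0"
  and int: "integrable lborel (%x. pd (w x) G (h x))"
 shows "AE x in lborel. x \<in> V \<longrightarrow> pd (w x) G (h x) = 0"
proof (rule fundamental_lemma[OF V int])
 fix c :: "'a => real" assume c: "!!k. Cc k V c"
 have "(LBINT x. c x * pd (w x) G (h x)) = - (LBINT x. pd i c x * G (h x))"
  by (rule weak_chain_rule[OF V wk i hc open_UNIV subset_UNIV G c])
 also have "(%x. pd i c x * G (h x)) = (%x. 0)"
 proof
  fix x
  obtain K where K: "compact K" "K \<subseteq> V" "!!x. x \<notin> K ==> pd i c x = 0" using Cc_pd1[OF c i] by (auto elim: CcE)
  show "pd i c x * G (h x) = 0" using K(2,3) z[of x] by (cases "x \<in> K") auto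
 qed
 finally show "(LBINT x. c x *\<^sub>R pd (w x) G (h x)) = 0" by simp
qed

lemma Im_hermitian: "Im (fst v * cnj (fst a) + snd v * cnj (snd a)) = v \<bullet> mult_I a"
 by (simp add: inner_complex2 mult_I_def)

lemma continuous_on_closed_D2_bound:
 fixes f :: "complex => 'b::real_normed_vector"
 assumes "continuous_on closed_D2 f"
 obtains M where "M > 0" "!!z. z \<in> closed_D2 ==> norm (f z) \<le> M"
proof -
 obtain b where "b > 0" "\<forall>x\<in>f ` closed_D2. norm x \<le> b"
  using compact_imp_bounded[OF compact_continuous_image[OF assms compact_cball]] unfolding bounded_pos by blast
 then show ?thesis using that[of b] by blast
qed

context conformal_lagrangian_disc
begin

text \<open>\<open>\<mu>\<close> is the distributional Laplacian of u. Differentiating the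
  conformality and Lagrangian relations weakly, and using symmetry of the mixed derivatives, removes
  its components along \<open>dx u\<close> and \<open>dy u\<close>; \<open>B1\<close> and
  \<open>B2\<close> are the coefficients of what remains. The same relations give \<open>B1\<close>
  and \<open>B2\<close> the form that arises when the argument of the determinant is
  differentiated.\<close>

lemma second_order_structure:
 fixes \<beta> :: "complex => real"
 assumes bc: "continuous_on closed_D2 \<beta>"
  and frame: "!!z. z \<in> closed_D2 ==> dy u z = cscale (exp (\<i> * \<beta> z)) (quat (dx u z))"
 obtains \<mu> :: "complex => complex2" and B1 B2 :: "complex => real" where
  "integrable lborel \<mu>" "B1 \<in> borel_measurable borel" "B2 \<in> borel_measurable borel"
  "!!c. Cc 1 D2 c ==> (LBINT z. pd 1 c z *\<^sub>R dx u z) + (LBINT z. pd \<i> c z *\<^sub>R dy u z) = - (LBINT z. c z *\<^sub>R \<mu> z)"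
  "AE z in lborel. z \<in> D2 - S \<longrightarrow> \<mu> z = B1 z *\<^sub>R mult_I (dx u z) + B2 z *\<^sub>R mult_I (dy u z)"
  "!!z. \<bar>B1 z\<bar> * norm (dx u z) \<le> norm (\<mu> z)" "!!z. \<bar>B2 z\<bar> * norm (dx u z) \<le> norm (\<mu> z)"
  "!!c. Cc 1 (D2 - S) c ==> (LBINT z. pd 1 c z * \<beta> z) = - (LBINT z. c z * B1 z)"
  "!!c. Cc 1 (D2 - S) c ==> (LBINT z. pd \<i> c z * \<beta> z) = - (LBINT z. c z * B2 z)"
proof -
 have Ba: "1 \<in> (Basis :: complex set)" "\<i> \<in> (Basis :: complex set)" by (auto simp: Basis_complex_def)
 define A where "A z = indicator D2 z *\<^sub>R pd 1 u z" for z
 define E where "E z = indicator D2 z *\<^sub>R pd \<i> u z" for z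
 have AD: "A z = dx u z" "E z = dy u z" if "z \<in> D2" for z using that by (simp_all add: A_def E_def dx_eq_pd dy_eq_pd)
 have A0: "A z = 0" "E z = 0" if "z \<notin> D2" for z using that by (simp_all add: A_def E_def)
 obtain w11 where w11: "weak_pd D2 1 A w11" unfolding A_def by (rule weak_second_derivative[OF C1 W21 Ba(1) Ba(1)])
 obtain w12 where w12: "weak_pd D2 \<i> A w12" unfolding A_def by (rule weak_second_derivative[OF C1 W21 Ba(1) Ba(2)])
 obtain w21 where w21: "weak_pd D2 1 E w21" unfolding E_def by (rule weak_second_derivative[OF C1 W21 Ba(2) Ba(1)])
 obtain w22 where w22: "weak_pd D2 \<i> E w22" unfolding E_def by (rule weak_second_derivative[OF C1 W21 Ba(2) Ba(2)])
 have wi: "integrable lborel w11" "integrable lborel w12" "integrable lborel w21" "integrable lborel w22"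
  and Ai: "integrable lborel A" "integrable lborel E"
  using w11 w12 w21 w22 by (auto simp: weak_pd_def)
 have [measurable]: "A \<in> borel_measurable borel" "E \<in> borel_measurable borel"
   "w11 \<in> borel_measurable borel" "w12 \<in> borel_measurable borel"  "w21 \<in> borel_measurable borel"  "w22 \<in> borel_measurable borel"
  using Ai wi borel_measurable_integrable by fastforce+
 have [measurable]: "mult_I \<in> borel_measurable borel"
  by (rule borel_measurable_continuous_onI[OF linear_continuous_on[OF mult_I_linear]])
 obtain M where M: "!!z. z \<in> closed_D2 ==> norm (dx u z) \<le> M" "!!z. z \<in> closed_D2 ==> norm (dy u z) \<le> M" "M > 0"
 proof -
  obtain M1 where "M1 > 0" "!!z. z \<in> closed_D2 ==> norm (dx u z) \<le> M1"
   by (rule continuous_on_closed_D2_bound[OF cont(2)]) blast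
  moreover obtain M2 where "M2 > 0" "!!z. z \<in> closed_D2 ==> norm (dy u z) \<le> M2"
   by (rule continuous_on_closed_D2_bound[OF cont(3)]) blast
  ultimately show ?thesis using that[of "max (max M1 M2) 1"] by (auto simp: le_max_iff_disj)
 qed
 have bd: "norm (A z) \<le> M" "norm (E z) \<le> M" for z
  using AD[of z] A0[of z] M ball_subset_cball[of "0::complex" 1] by (cases "z \<in> D2"; force)+
 have Ac: "continuous_on D2 A" "continuous_on D2 E"
  by (rule continuous_on_eq[OF contD(2)], simp add: AD) (rule continuous_on_eq[OF contD(3)], simp add: AD)
 have cutA: "(%z. p z *\<^sub>R A z) = (%z. p z *\<^sub>R dx u z)" "(%z. p z *\<^sub>R E z) = (%z. p z *\<^sub>R dy u z)"
  if pk: "Cc k D2 p" for k p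
 proof -
  obtain K where "K \<subseteq> D2" "!!x. x \<notin> K ==> p x = 0" using pk by (auto elim: CcE)
  then show "(%z. p z *\<^sub>R A z) = (%z. p z *\<^sub>R dx u z)" "(%z. p z *\<^sub>R E z) = (%z. p z *\<^sub>R dy u z)"
   using AD by (auto simp: fun_eq_iff subset_iff)
 qed
 define \<mu> where "\<mu> z = w11 z + w22 z" for z
 have mi: "integrable lborel \<mu>" unfolding \<mu>_def using wi by (intro Bochner_Integration.integrable_add)
 have div: "(LBINT z. pd 1 c z *\<^sub>R dx u z) + (LBINT z. pd \<i> c z *\<^sub>R dy u z) = - (LBINT z. c z *\<^sub>R \<mu> z)"
  if c: "Cc 1 D2 c" for c
 proof -
  note ci = Cc_times_integrable[OF c]
  have "(LBINT z. c z *\<^sub>R \<mu> z) = (LBINT z. c z *\<^sub>R w11 z) + (LBINT z. c z *\<^sub>R w22 z)"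
   unfolding \<mu>_def scaleR_add_right by (rule Bochner_Integration.integral_add[OF ci[OF wi(1)] ci[OF wi(4)]])
  also have "\<dots> = - (LBINT z. pd 1 c z *\<^sub>R A z) - (LBINT z. pd \<i> c z *\<^sub>R E z)"
   using weak_pd_C1[OF open_ball w11 Ba(1) c] weak_pd_C1[OF open_ball w22 Ba(2) c] by simp
  finally show ?thesis unfolding cutA[OF Cc_pd1[OF c Ba(1)]] cutA[OF Cc_pd1[OF c Ba(2)]] by simp
 qed
 \<comment> \<open>Both weak mixed derivatives have the same integrals against test functions, by
   the weak symmetry of partial derivatives of the C^1 map u.\<close>
 have sym: "AE z in lborel. z \<in> D2 \<longrightarrow> w12 z - w21 z = 0"
 proof (rule fundamental_lemma[OF open_ball Bochner_Integration.integrable_diff[OF wi(2,3)]])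
  fix c :: "complex => real" assume c: "!!k. Cc k D2 c"
  have "(LBINT z. pd \<i> c z *\<^sub>R pd 1 u z) = (LBINT z. pd 1 c z *\<^sub>R pd \<i> u z)"
   using C1cd_integrable[OF cont(1)] Ai(1) unfolding A_def
   by (intro mixed_partials_weak[OF open_ball C1cd_Ck[OF C1] c Ba])
  moreover have eqs: "(%z. p z *\<^sub>R A z) = (%z. p z *\<^sub>R pd 1 u z)" "(%z. p z *\<^sub>R E z) = (%z. p z *\<^sub>R pd \<i> u z)" if "Cc k D2 p" for k p
   using that by (auto elim!: CcE simp: A_def E_def fun_eq_iff indicator_def)
  ultimately have "(LBINT z. pd \<i> c z *\<^sub>R A z) = (LBINT z. pd 1 c z *\<^sub>R E z)"
   unfolding eqs(1)[OF Cc_pd1[OF c Ba(2)]] eqs(2)[OF Cc_pd1[OF c Ba(1)]] by simp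
  then show "(LBINT z. c z *\<^sub>R (w12 z - w21 z)) = 0"
   using weak_pd_C1[OF open_ball w12 Ba(2) c] weak_pd_C1[OF open_ball w21 Ba(1) c]
    Cc_times_integrable[OF c[of 0] wi(2)] Cc_times_integrable[OF c[of 0] wi(3)]
   by (simp add: scaleR_diff_right)
 qed
 define h where "h z = (A z, E z)" for z
 have hc: "continuous_on D2 h" unfolding h_def by (intro continuous_on_Pair Ac)
 have hw1: "weak_pd D2 1 h (%z. (w11 z, w21 z))" unfolding h_def by (rule weak_pd_Pair[OF w11 w21 Ba(1)])
 have hw2: "weak_pd D2 \<i> h (%z. (w12 z, w22 z))" unfolding h_def by (rule weak_pd_Pair[OF w12 w22 Ba(2)])
 have qf: "A z \<bullet> E z = 0" "norm (E z) = norm (A z)" "A z \<bullet> mult_I (E z) = 0" if "z \<in> D2" for z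
  using quat_frame[of "exp (\<i> * \<beta> z)" "dy u z" "dx u z"] frame[of z] that by (auto simp: AD)
 have lin: "Ck_on 1 UNIV (fst :: complex2 \<times> complex2 => _)" "Ck_on 1 UNIV (snd :: complex2 \<times> complex2 => _)"
  by (intro Ck_on_bounded_linear open_UNIV bounded_linear_fst bounded_linear_snd)+
 have linI: "Ck_on 1 UNIV (%x :: complex2 \<times> complex2. mult_I (snd x))"
  by (rule Ck_on_linear_comp[OF open_UNIV mult_I_linear lin(2)])
 \<comment> \<open>Equal length, orthogonality and the Lagrangian condition, as functions of the
   pair of first derivatives; all three vanish along \<open>h\<close>.\<close>
 define G1 :: "complex2 \<times> complex2 => real" where "G1 = (%x. fst x \<bullet> fst x - snd x \<bullet> snd x)"
 define G2 :: "complex2 \<times> complex2 => real" where "G2 = (%x. fst x \<bullet> snd x)"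
 define G3 :: "complex2 \<times> complex2 => real" where "G3 = (%x. fst x \<bullet> mult_I (snd x))"
 have GC: "Ck_on 1 UNIV G1" "Ck_on 1 UNIV G2" "Ck_on 1 UNIV G3" unfolding G1_def G2_def G3_def
  by (intro Ck_on_diff Ck_on_inner open_UNIV lin linI)+
 have p1: "pd v G1 x = 2 * (fst v \<bullet> fst x) - 2 * (snd v \<bullet> snd x)" for v x
  unfolding G1_def by (rule pd_eqI) (auto intro!: derivative_eq_intros simp: fun_eq_iff inner_commute)
 have p2: "pd v G2 x = fst v \<bullet> snd x + snd v \<bullet> fst x" for v x
  unfolding G2_def by (rule pd_eqI) (auto intro!: derivative_eq_intros simp: fun_eq_iff inner_commute)
 have p3: "pd v G3 x = fst v \<bullet> mult_I (snd x) - snd v \<bullet> mult_I (fst x)" for v x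
  unfolding G3_def
  by (rule pd_eqI) (auto intro!: derivative_eq_intros bounded_linear.has_derivative[OF mult_I_linear] simp: fun_eq_iff inner_commute inner_mult_I_left)
 have G0: "G1 (h z) = 0" "G2 (h z) = 0" "G3 (h z) = 0" if "z \<in> D2" for z
  using qf[OF that] by (auto simp: G1_def G2_def G3_def h_def power2_norm_eq_inner[symmetric])
 have ib: "integrable lborel (%z. w z \<bullet> A z)" "integrable lborel (%z. w z \<bullet> E z)"
   "integrable lborel (%z. w z \<bullet> mult_I (A z))" "integrable lborel (%z. w z \<bullet> mult_I (E z))"
  if "integrable lborel w" for w
  by (rule integrable_inner_bounded[OF that, where C=M]; simp add: bd)+
 have q: "AE z in lborel. z \<in> D2 \<longrightarrow> pd (w11 z, w21 z) G1 (h z) = 0"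
  "AE z in lborel. z \<in> D2 \<longrightarrow> pd (w12 z, w22 z) G1 (h z) = 0"
  "AE z in lborel. z \<in> D2 \<longrightarrow> pd (w11 z, w21 z) G2 (h z) = 0"
  "AE z in lborel. z \<in> D2 \<longrightarrow> pd (w12 z, w22 z) G2 (h z) = 0"
  "AE z in lborel. z \<in> D2 \<longrightarrow> pd (w11 z, w21 z) G3 (h z) = 0"
  "AE z in lborel. z \<in> D2 \<longrightarrow> pd (w12 z, w22 z) G3 (h z) = 0"
  by (rule weak_chain_zero[OF open_ball hw1 Ba(1) hc GC(1) G0(1)] weak_chain_zero[OF open_ball hw2 Ba(2) hc GC(1) G0(1)]
    weak_chain_zero[OF open_ball hw1 Ba(1) hc GC(2) G0(2)] weak_chain_zero[OF open_ball hw2 Ba(2) hc GC(2) G0(2)]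
    weak_chain_zero[OF open_ball hw1 Ba(1) hc GC(3) G0(3)] weak_chain_zero[OF open_ball hw2 Ba(2) hc GC(3) G0(3)];
    simp add: p1 p2 p3 h_def wi ib)+
 have rel: "AE z in lborel. z \<in> D2 \<longrightarrow> w12 z = w21 z \<and> w11 z \<bullet> dx u z = w21 z \<bullet> dy u z \<and> w12 z \<bullet> dx u z = w22 z \<bullet> dy u z \<and>
   w11 z \<bullet> dy u z + w21 z \<bullet> dx u z = 0 \<and> w12 z \<bullet> dy u z + w22 z \<bullet> dx u z = 0 \<and>
   w11 z \<bullet> mult_I (dy u z) = w21 z \<bullet> mult_I (dx u z) \<and> w12 z \<bullet> mult_I (dy u z) = w22 z \<bullet> mult_I (dx u z)"
  using sym q by eventually_elim (auto simp: p1 p2 p3 h_def AD)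
 \<comment> \<open>Where \<open>A\<close> is 0, at branch points and outside the disc, division by
   zero gives 0, so the bounds by \<open>\<mu>\<close> hold at every point.\<close>
 define B1 where "B1 z = (\<mu> z \<bullet> mult_I (A z)) / (norm (A z))\<^sup>2" for z
 define B2 where "B2 z = (\<mu> z \<bullet> mult_I (E z)) / (norm (A z))\<^sup>2" for z
 have [measurable]: "\<mu> \<in> borel_measurable borel" unfolding \<mu>_def by measurable
 have Bm[measurable]: "B1 \<in> borel_measurable borel" "B2 \<in> borel_measurable borel" unfolding B1_def B2_def by measurable
 have dec: "AE z in lborel. z \<in> D2 - S \<longrightarrow> \<mu> z = B1 z *\<^sub>R mult_I (dx u z) + B2 z *\<^sub>R mult_I (dy u z)"
  using rel
 proof (eventually_elim, intro impI)
  fix z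
  assume r: "z \<in> D2 \<longrightarrow> w12 z = w21 z \<and> w11 z \<bullet> dx u z = w21 z \<bullet> dy u z \<and> w12 z \<bullet> dx u z = w22 z \<bullet> dy u z \<and>
   w11 z \<bullet> dy u z + w21 z \<bullet> dx u z = 0 \<and> w12 z \<bullet> dy u z + w22 z \<bullet> dx u z = 0 \<and>
   w11 z \<bullet> mult_I (dy u z) = w21 z \<bullet> mult_I (dx u z) \<and> w12 z \<bullet> mult_I (dy u z) = w22 z \<bullet> mult_I (dx u z)"
  assume z: "z \<in> D2 - S"
  then have zc: "z \<in> closed_D2" "z \<in> closed_D2 - S" by auto
  have "\<mu> z \<bullet> dx u z = 0" "\<mu> z \<bullet> dy u z = 0" using r z by (auto simp: \<mu>_def inner_add_left)
  then show "\<mu> z = B1 z *\<^sub>R mult_I (dx u z) + B2 z *\<^sub>R mult_I (dy u z)"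
   using frame_expansion[OF _ frame[OF zc(1)] dx_nonzero[OF zc(2)], of "\<mu> z"] z by (simp add: B1_def B2_def AD)
 qed
 have Bb: "\<bar>B1 z\<bar> * norm (dx u z) \<le> norm (\<mu> z)" "\<bar>B2 z\<bar> * norm (dx u z) \<le> norm (\<mu> z)" for z
 proof -
  have gen: "\<bar>(\<mu> z \<bullet> mult_I e) / (norm x)\<^sup>2\<bar> * norm x \<le> norm (\<mu> z)" if "norm e = norm x" for e x
  proof (cases "x = 0")
   case False
   have "\<bar>\<mu> z \<bullet> mult_I e\<bar> \<le> norm (\<mu> z) * norm x" using Cauchy_Schwarz_ineq2[of "\<mu> z" "mult_I e"] that by simp
   then show ?thesis using False by (simp add: abs_divide power2_eq_square divide_le_eq)
  qed simp
  show "\<bar>B1 z\<bar> * norm (dx u z) \<le> norm (\<mu> z)"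
   using gen[of "dx u z" "dx u z"] by (cases "z \<in> D2") (simp_all add: B1_def AD A0)
  show "\<bar>B2 z\<bar> * norm (dx u z) \<le> norm (\<mu> z)"
   using gen[of "dy u z" "dx u z"] qf(2)[of z] by (cases "z \<in> D2") (simp_all add: B2_def AD A0)
 qed
 \<comment> \<open>On the compact support of \<open>c\<close>, which avoids \<open>S\<close>, the
   length of \<open>dx u\<close> has a positive minimum; hence \<open>B\<close> is dominated there
   by a multiple of |\<mu>|.\<close>
 have cB: "integrable lborel (%z. c z * B z)"
  if c: "Cc k (D2 - S) c" and B: "B \<in> borel_measurable borel" "!!z. \<bar>B z\<bar> * norm (dx u z) \<le> norm (\<mu> z)" for c B k
 proof -
  obtain K where K: "compact K" "K \<subseteq> D2 - S" "!!x. x \<notin> K ==> c x = 0" using c by (auto elim: CcE)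
  have "\<exists>m>0. \<forall>z\<in>K. m \<le> norm (dx u z)"
  proof (cases "K = {}")
   case True then show ?thesis by (auto intro: exI[of _ 1])
  next
   case False
   have "continuous_on K (%z. norm (dx u z))" using K(2) by (intro continuous_intros continuous_on_subset[OF contD(2)]) auto
   then obtain z0 where "z0 \<in> K" "\<forall>z\<in>K. norm (dx u z0) \<le> norm (dx u z)"
    using continuous_attains_inf[OF K(1) False] by blast
   moreover have "z0 \<in> closed_D2 - S" using \<open>z0 \<in> K\<close> K(2) by auto
   ultimately show ?thesis using dx_nonzero[of z0] by (intro exI[of _ "norm (dx u z0)"]) auto
  qed
  then obtain m where m: "m > 0" "!!z. z \<in> K ==> m \<le> norm (dx u z)" by blast
  obtain C where C: "C > 0" "!!z. norm (c z) \<le> C" using Cc_bounded[OF c] by metis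
  show ?thesis
  proof (rule Bochner_Integration.integrable_bound[where f="%z. (C / m) *\<^sub>R \<mu> z"])
   show "AE z in lborel. norm (c z * B z) \<le> norm ((C / m) *\<^sub>R \<mu> z)"
   proof (rule AE_I2)
    fix z
    show "norm (c z * B z) \<le> norm ((C / m) *\<^sub>R \<mu> z)"
    proof (cases "z \<in> K")
     case True
     have "\<bar>B z\<bar> * m \<le> norm (\<mu> z)" using B(2)[of z] mult_left_mono[OF m(2)[OF True], of "\<bar>B z\<bar>"] by simp
     then have "\<bar>B z\<bar> \<le> norm (\<mu> z) / m" using m(1) by (simp add: pos_le_divide_eq)
     then have "\<bar>c z\<bar> * \<bar>B z\<bar> \<le> C * (norm (\<mu> z) / m)" using C by (intro mult_mono) auto
     then show ?thesis using C(1) m(1) by (simp add: abs_mult)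
    qed (simp add: K(3))
   qed
  qed (use mi Cc_measurable[OF c] B(1) in auto)
 qed
 \<comment> \<open>Near a point the angle is a constant plus the argument of the complex determinant
   of the first derivatives, a C^1 function of \<open>h\<close>; the weak chain rule gives its
   derivative. The passage from local to global is needed because a branch of the argument exists
   only locally.\<close>
 have grad: "(LBINT z. pd i c z * \<beta> z) = - (LBINT z. c z * B z)"
  if c: "Cc 1 (D2 - S) c" and i: "i \<in> Basis" and hw: "weak_pd D2 i h (%z. (v1 z, v2 z))"
   and B: "B \<in> borel_measurable borel" "!!z. \<bar>B z\<bar> * norm (dx u z) \<le> norm (\<mu> z)"
   and BV: "AE z in lborel. z \<in> D2 \<longrightarrow> B z = (v1 z \<bullet> mult_I (dx u z) + v2 z \<bullet> mult_I (dy u z)) / (norm (dx u z))\<^sup>2"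
  for i c B v1 v2
 proof (rule Cc1_local_to_global[OF _ c])
  show W: "open (D2 - S)" using branch(1) finite_imp_closed by (intro open_Diff) auto
  have pb: "integrable lborel (%z. pd i c z * \<beta> z)" if pc: "Cc 1 (D2 - S) c" for c
  proof -
   obtain K where K: "compact K" "K \<subseteq> D2 - S" "!!x. x \<notin> K ==> pd i c x = 0" using Cc_pd1[OF pc i] by (auto elim: CcE)
   have "K \<subseteq> closed_D2" using K(2) by auto
   then show ?thesis
    using K(3) continuous_on_subset[OF bc] continuous_on_subset[OF Ck_on_continuous[OF open_UNIV Cc_Ck[OF Cc_pd1[OF pc i]]] subset_UNIV]
    by (intro integrable_cont_compact_support[OF K(1)] continuous_on_mult) auto
  qed
  show "(LBINT z. pd i (%z. c z + d z) z * \<beta> z) = - (LBINT z. (c z + d z) * B z)"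
   if cd: "Cc 1 (D2 - S) c" "Cc 1 (D2 - S) d" and e: "(LBINT z. pd i c z * \<beta> z) = - (LBINT z. c z * B z)"
    "(LBINT z. pd i d z * \<beta> z) = - (LBINT z. d z * B z)" for c d
  proof -
   have "pd i (%z. c z + d z) z = pd i c z + pd i d z" for z
    by (rule pd_add[OF Cc_differentiable[OF cd(1)] Cc_differentiable[OF cd(2)]])
   then show ?thesis using pb[OF cd(1)] pb[OF cd(2)] cB[OF cd(1) B] cB[OF cd(2) B] e
    by (simp add: distrib_right)
  qed
  fix z0 assume z0: "z0 \<in> D2 - S"
  obtain r1 where r1: "r1 > 0" "ball z0 r1 \<subseteq> D2 - S" using W z0 openE by blast
  have "isCont \<beta> z0" using continuous_on_interior[OF bc, of z0] z0 by (simp add: interior_cball)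
  then obtain r2 where r2: "r2 > 0" "!!z. dist z z0 < r2 ==> dist (\<beta> z) (\<beta> z0) < 1"
   unfolding continuous_at_eps_delta by (metis zero_less_one)
  define r where "r = min r1 r2"
  have r: "r > 0" "ball z0 r \<subseteq> D2 - S" using r1 r2 by (auto simp: r_def)
  have bV: "\<bar>\<beta> z - \<beta> z0\<bar> < 1" if "z \<in> ball z0 r" for z
   using r2(2)[of z] that by (auto simp: r_def dist_commute dist_real_def)
  show "\<exists>r>0. \<forall>c. Cc 1 ((D2 - S) \<inter> ball z0 r) c \<longrightarrow> (LBINT z. pd i c z * \<beta> z) = - (LBINT z. c z * B z)"
  proof (intro exI[of _ r] conjI allI impI r(1))
   fix c :: "complex => real" assume "Cc 1 ((D2 - S) \<inter> ball z0 r) c"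
   then have c: "Cc 1 (ball z0 r) c" "Cc 1 (D2 - S) c" by (auto elim: Cc_mono)
   \<comment> \<open>This rotation makes the determinant positive at \<open>z0\<close>. As the angle
     varies by less than 1 < pi/2 on the ball, the rotated determinant stays in the right half
     plane, where Im o Ln is C^1.\<close>
   define k where "k = exp (- (\<i> * \<beta> z0))"
   define O' where "O' = {x. Re (k * detE x) > 0}"
   define G where "G x = Im (Ln (k * detE x))" for x
   have kC: "Ck_on 1 UNIV (%x. k * detE x)" by (rule Ck_on_linear_comp[OF open_UNIV bounded_linear_mult_right Ck_on_detE])
   have O: "open O'" unfolding O'_def
    using Ck_on_continuous[OF open_UNIV kC] by (intro open_Collect_less continuous_on_const continuous_on_Re)
   have oR: "open {y. Re y > 0}" using open_halfspace_Re_gt[of 0] by simp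
   have G: "Ck_on 1 O' G" unfolding G_def[abs_def]
    by (rule Ck_on_compose[OF O oR _ Ck_on_Im_Ln Ck_on_subset[OF open_UNIV O subset_UNIV kC]]) (auto simp: O'_def)
   have det: "k * detE (h z) = exp (of_real (ln ((norm (dx u z))\<^sup>2)) + \<i> * of_real (\<beta> z - \<beta> z0))"
    and detz: "detE (h z) = exp (\<i> * \<beta> z) * of_real ((norm (dx u z))\<^sup>2)" if "z \<in> ball z0 r" for z
   proof -
    have z: "z \<in> D2" "z \<in> closed_D2" "z \<in> closed_D2 - S" using that r(2) by auto
    have nz: "(norm (dx u z))\<^sup>2 > 0" using dx_nonzero[OF z(3)] by simp
    have "dz1_dz2 (dx u z) (dy u z) = exp (\<i> * \<beta> z) * (fst (dx u z) * cnj (fst (dx u z)) + snd (dx u z) * cnj (snd (dx u z)))"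
     by (rule quat_frame(5)[OF _ frame[OF z(2)]]) simp
    then show d: "detE (h z) = exp (\<i> * \<beta> z) * of_real ((norm (dx u z))\<^sup>2)"
     by (simp only: detE_def h_def AD[OF z(1)] fst_conv snd_conv norm_complex2 of_real_add complex_norm_square)
    have "of_real ((norm (dx u z))\<^sup>2) = exp (complex_of_real (ln ((norm (dx u z))\<^sup>2)))"
     using nz by (simp only: exp_of_real exp_ln)
    then show "k * detE (h z) = exp (of_real (ln ((norm (dx u z))\<^sup>2)) + \<i> * of_real (\<beta> z - \<beta> z0))"
     unfolding d k_def by (simp add: exp_add[symmetric] algebra_simps exp_diff exp_minus field_simps)
   qed
   have Gh: "G (h z) = \<beta> z - \<beta> z0" and hO: "h z \<in> O'" if "z \<in> ball z0 r" for z
   proof -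
    have b: "\<bar>\<beta> z - \<beta> z0\<bar> < 1" by (rule bV[OF that])
    have pi1: "(1::real) < pi / 2" using pi_gt3 by simp
    show "G (h z) = \<beta> z - \<beta> z0" unfolding G_def det[OF that]
     using b pi1 by (subst Ln_exp) auto
    have "cos (\<beta> z - \<beta> z0) > 0" using b pi1 by (intro cos_gt_zero_pi) auto
    then show "h z \<in> O'" unfolding O'_def mem_Collect_eq det[OF that] by (simp add: Re_exp)
   qed
   have hcV: "continuous_on (ball z0 r) h" using hc r(2) by (auto intro: continuous_on_subset)
   have hwV: "weak_pd (ball z0 r) i h (%z. (v1 z, v2 z))" using weak_pd_subset[OF hw] r(2) by auto
   have cancel: "inverse (K * (e * n)) * (K * e * X) = X / n" if "K \<noteq> 0" "e \<noteq> 0" for K e n X :: complex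
    using that by (cases "n = 0") (auto simp: field_simps)
   \<comment> \<open>Logarithmic differentiation: the phases cancel, and the imaginary part of a
     Hermitian product with a frame vector is the inner product with its \<open>mult_I\<close>
     image.\<close>
   have pG: "pd (v1, v2) G (h z) = (v1 \<bullet> mult_I (dx u z) + v2 \<bullet> mult_I (dy u z)) / (norm (dx u z))\<^sup>2"
    if "z \<in> ball z0 r" for z v1 v2
   proof -
    have z: "z \<in> D2" "z \<in> closed_D2" "z \<in> closed_D2 - S" using that r(2) by auto
    have "k * detE (h z) \<notin> \<real>\<^sub>\<le>\<^sub>0" using hO[OF that] by (auto simp: O'_def complex_nonpos_Reals_iff)
    then have L: "(Ln has_derivative (%v. inverse (k * detE (h z)) * v)) (at (k * detE (h z)))"
     by (rule has_field_derivative_Ln[unfolded has_field_derivative_def])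
    have kd: "((%x. k * detE x) has_derivative
      (%v. k * (dz1_dz2 (fst v) (snd (h z)) + dz1_dz2 (fst (h z)) (snd v)))) (at (h z))"
     by (rule has_derivative_mult_right[OF detE_has_derivative])
    have "(G has_derivative (%v. Im (inverse (k * detE (h z)) *
      (k * (dz1_dz2 (fst v) (snd (h z)) + dz1_dz2 (fst (h z)) (snd v)))))) (at (h z))"
     unfolding G_def[abs_def]
     by (rule bounded_linear.has_derivative[OF bounded_linear_Im has_derivative_compose[OF kd L]])
    then have "pd (v1, v2) G (h z) = Im (inverse (k * detE (h z)) * (k * (dz1_dz2 v1 (dy u z) + dz1_dz2 (dx u z) v2)))"
     by (subst pd_eqI, assumption) (simp only: h_def AD[OF z(1)] fst_conv snd_conv)
    also have "k * (dz1_dz2 v1 (dy u z) + dz1_dz2 (dx u z) v2) = k * exp (\<i> * \<beta> z) *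
      ((fst v1 * cnj (fst (dx u z)) + snd v1 * cnj (snd (dx u z))) + (fst v2 * cnj (fst (dy u z)) + snd v2 * cnj (snd (dy u z))))"
     using quat_frame(5)[OF _ frame[OF z(2)], of v1] quat_frame(6)[OF _ frame[OF z(2)], of v2]
     by (simp add: distrib_left mult.assoc)
    also have "inverse (k * detE (h z)) * \<dots> =
      ((fst v1 * cnj (fst (dx u z)) + snd v1 * cnj (snd (dx u z))) + (fst v2 * cnj (fst (dy u z)) + snd v2 * cnj (snd (dy u z)))) / of_real ((norm (dx u z))\<^sup>2)"
     unfolding detz[OF that] k_def by (rule cancel) simp_all
    finally show ?thesis
     unfolding Im_divide_of_real
     by (simp only: plus_complex.sel(2)[of "fst v1 * cnj (fst (dx u z)) + snd v1 * cnj (snd (dx u z))"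
        "fst v2 * cnj (fst (dy u z)) + snd v2 * cnj (snd (dy u z))"] Im_hermitian)
   qed
   have pi: "integrable lborel (pd i c)" using Cc_integrable[OF Cc_pd1[OF c(1) i]] .
   have ae: "AE z in lborel. c z * pd (v1 z, v2 z) G (h z) = c z * B z"
    using BV
   proof eventually_elim
    case (elim z)
    show ?case
    proof (cases "z \<in> ball z0 r")
     case True then show ?thesis using elim pG[OF True] r(2) by auto
    next
     case False
     then have "c z = 0" using c(1) by (auto elim!: CcE)
     then show ?thesis by simp
    qed
   qed
   obtain K where K: "compact K" "K \<subseteq> ball z0 r" "!!x. x \<notin> K ==> c x = 0" using c(1) by (auto elim: CcE)
   have pc0: "pd i c x = 0" if "x \<notin> K" for x
    by (rule pd_eq_0_outside[OF compact_imp_closed[OF K(1)] K(3) that])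
   have "(LBINT z. c z * B z) = (LBINT z. c z * pd (v1 z, v2 z) G (h z))"
   proof (rule integral_cong_AE)
    have "(%z. c z * pd (v1 z, v2 z) G (h z)) = (%z. c z * ((v1 z \<bullet> mult_I (A z) + v2 z \<bullet> mult_I (E z)) / (norm (A z))\<^sup>2))"
    proof
     fix z
     show "c z * pd (v1 z, v2 z) G (h z) = c z * ((v1 z \<bullet> mult_I (A z) + v2 z \<bullet> mult_I (E z)) / (norm (A z))\<^sup>2)"
     proof (cases "z \<in> K")
      case True
      then have "z \<in> ball z0 r" "z \<in> D2" using K(2) r(2) by auto
      then show ?thesis using pG by (simp add: AD)
     qed (simp add: K(3))
    qed
    moreover have "(%z. (v1 z, v2 z)) \<in> borel_measurable borel"
     using hw borel_measurable_integrable by (force simp: weak_pd_def)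
    then have "(%z. fst (v1 z, v2 z)) \<in> borel_measurable borel" "(%z. snd (v1 z, v2 z)) \<in> borel_measurable borel"
     by (auto intro: borel_measurable_continuous_on[OF continuous_on_fst[OF continuous_on_id]] borel_measurable_continuous_on[OF continuous_on_snd[OF continuous_on_id]] simp del: fst_conv snd_conv)
    then have [measurable]: "v1 \<in> borel_measurable borel" "v2 \<in> borel_measurable borel" by simp_all
    note [measurable] = Cc_measurable[OF c(1)]
    have "(%z. c z * ((v1 z \<bullet> mult_I (A z) + v2 z \<bullet> mult_I (E z)) / (norm (A z))\<^sup>2)) \<in> borel_measurable lborel" by measurable
    ultimately show "(%z. c z * pd (v1 z, v2 z) G (h z)) \<in> borel_measurable lborel" by simp
    show "(%z. c z * B z) \<in> borel_measurable lborel" using cB[OF c(2) B] by simp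
    show "AE z in lborel. c z * B z = c z * pd (v1 z, v2 z) G (h z)" using ae by (rule eventually_mono) (erule HOL.sym)
   qed
   also have "\<dots> = - (LBINT z. pd i c z * G (h z))"
    by (rule weak_chain_rule[OF open_ball hwV i hcV O _ G c(1)]) (use hO in auto)
   also have "(%z. pd i c z * G (h z)) = (%z. pd i c z * \<beta> z - \<beta> z0 * pd i c z)"
   proof
    fix z
    show "pd i c z * G (h z) = pd i c z * \<beta> z - \<beta> z0 * pd i c z"
    proof (cases "z \<in> K")
     case True
     then have "z \<in> ball z0 r" using K(2) by blast
     then have "G (h z) = \<beta> z - \<beta> z0" using Gh by blast
     then show ?thesis by (simp add: left_diff_distrib mult.commute[of "pd i c z"])
    qed (simp add: pc0)
   qed
   also have "(LBINT z. pd i c z * \<beta> z - \<beta> z0 * pd i c z) = (LBINT z. pd i c z * \<beta> z)"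
    using pb[OF c(2)] pi integral_pd_eq_0[OF c(1) i] by simp
   finally show "(LBINT z. pd i c z * \<beta> z) = - (LBINT z. c z * B z)" by simp
  qed
 qed simp
 have BV1: "AE z in lborel. z \<in> D2 \<longrightarrow> B1 z = (w11 z \<bullet> mult_I (dx u z) + w21 z \<bullet> mult_I (dy u z)) / (norm (dx u z))\<^sup>2"
  using rel by eventually_elim (auto simp: B1_def AD \<mu>_def inner_add_left)
 have BV2: "AE z in lborel. z \<in> D2 \<longrightarrow> B2 z = (w12 z \<bullet> mult_I (dx u z) + w22 z \<bullet> mult_I (dy u z)) / (norm (dx u z))\<^sup>2"
  using rel by eventually_elim (auto simp: B2_def AD \<mu>_def inner_add_left)
 show ?thesis
 proof (rule that[OF mi Bm _ dec Bb])
  fix c :: "complex => real"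
  show "(LBINT z. pd 1 c z *\<^sub>R dx u z) + (LBINT z. pd \<i> c z *\<^sub>R dy u z) = - (LBINT z. c z *\<^sub>R \<mu> z)"
   if "Cc 1 D2 c" by (rule div[OF that])
  show "(LBINT z. pd 1 c z * \<beta> z) = - (LBINT z. c z * B1 z)" if "Cc 1 (D2 - S) c"
   by (rule grad[OF that Ba(1) hw1 Bm(1) Bb(1) BV1])
  show "(LBINT z. pd \<i> c z * \<beta> z) = - (LBINT z. c z * B2 z)" if "Cc 1 (D2 - S) c"
   by (rule grad[OF that Ba(2) hw2 Bm(2) Bb(2) BV2])
 qed
qed

end

subsection \<open>Cutoff functions near the unit circle\<close>

definition sqpos :: "real => real" where "sqpos t = (max 0 t)\<^sup>2"

lemma sqpos_deriv: "(sqpos has_real_derivative 2 * max 0 t) (at t)"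
proof (cases t "0::real" rule: linorder_cases)
 case less
 have "((%t. 0) has_real_derivative 2 * max 0 t) (at t)" using less by simp
 then show ?thesis
  by (rule has_field_derivative_transform_within_open[where S="{..<0}"]) (use less in \<open>auto simp: sqpos_def\<close>)
next
 case greater
 have "((%t. t\<^sup>2) has_real_derivative 2 * max 0 t) (at t)" using greater by (auto intro!: derivative_eq_intros)
 then show ?thesis
  by (rule has_field_derivative_transform_within_open[where S="{0<..}"]) (use greater in \<open>auto simp: sqpos_def\<close>)
next
 case equal
 have "(sqpos has_real_derivative 0) (at 0)"
  unfolding has_field_derivative_iff
 proof (rule Lim_null_comparison[where g="%h. \<bar>h\<bar>"])
  show "\<forall>\<^sub>F x in at 0. norm ((sqpos x - sqpos 0) / (x - 0)) \<le> \<bar>x\<bar>"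
   by (rule always_eventually) (auto simp: sqpos_def max_def power2_eq_square)
  show "((%h::real. \<bar>h\<bar>) \<longlongrightarrow> 0) (at 0)" by (auto intro!: tendsto_eq_intros)
 qed
 then show ?thesis using equal by simp
qed

text \<open>A C^1 quadratic spline that rises from 0 to 1 on [1, 2]. Its derivative is the hat
  function with peak 2 at 3/2, which has explicit bounds from above and, on [5/4, 7/4], from
  below.\<close>

definition step :: "real => real" where
 "step t = 2 * (sqpos (t - 1) - 2 * sqpos (t - 3/2) + sqpos (t - 2))"

definition step' :: "real => real" where
 "step' t = 4 * (max 0 (t - 1) - 2 * max 0 (t - 3/2) + max 0 (t - 2))"

lemma step_deriv: "(step has_real_derivative step' t) (at t)"
proof -
 have s: "((%t. sqpos (t - c)) has_real_derivative 2 * max 0 (t - c)) (at t)" for c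
 proof -
  have "((%t. t - c) has_real_derivative 1) (at t)" by (auto intro!: derivative_eq_intros)
  from DERIV_chain2[OF sqpos_deriv this] show ?thesis by simp
 qed
 have "((%t. 2 * (sqpos (t - 1) - 2 * sqpos (t - 3/2) + sqpos (t - 2))) has_real_derivative
   2 * (2 * max 0 (t - 1) - 2 * (2 * max 0 (t - 3/2)) + 2 * max 0 (t - 2))) (at t)"
  by (intro DERIV_cmult DERIV_add DERIV_diff s)
 then show ?thesis unfolding step_def[abs_def] step'_def by (simp add: algebra_simps)
qed

lemma step_simps: "t \<le> 1 ==> step t = 0" "2 \<le> t ==> step t = 1"
proof -
 show "step t = 0" if "t \<le> 1" using that by (simp add: step_def sqpos_def)
 assume t: "2 \<le> t"
 then have "max 0 (t - 1) = t - 1" "max 0 (t - 3/2) = t - 3/2" "max 0 (t - 2) = t - 2" by auto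
 then show "step t = 1" by (simp add: step_def sqpos_def power2_eq_square algebra_simps)
qed

lemma step'_nonneg: "0 \<le> step' t" and step'_le: "step' t \<le> 2"
 and step'_zero: "t \<notin> {1..2} ==> step' t = 0" and step'_ge: "t \<in> {5/4..7/4} ==> 1 \<le> step' t"
 by (auto simp: step'_def max_def)

lemma step_bounds: "0 \<le> step t" "step t \<le> 1"
proof -
 have "step a \<le> step b" if "a \<le> b" for a b
  by (rule DERIV_nonneg_imp_nondecreasing[OF that]) (use step_deriv step'_nonneg in blast)
 then have "step (min t 1) \<le> step t" "step t \<le> step (max t 2)" by auto
 then show "0 \<le> step t" "step t \<le> 1" using step_simps(1)[of "min t 1"] step_simps(2)[of "max t 2"] by auto
qed

lemma continuous_step': "continuous_on X step'" unfolding step'_def by (intro continuous_intros)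

lemma Ck_on_step: "Ck_on 1 UNIV step"
proof -
 have "Ck_on (Suc 0) UNIV step"
  by (rule Ck_on_SucI[where f'="%t v. step' t * v"])
    (use step_deriv in \<open>auto simp: has_field_derivative_def intro!: continuous_intros continuous_step'\<close>)
 then show ?thesis by simp
qed

text \<open>Cuts off in a layer at the circle of width of order 1/n. The shift in n + 2 keeps both
  radii of the layer real; the inner one is 0 for n = 0.\<close>

definition eta :: "nat => complex => real" where
 "eta n z = step ((real n + 2) * (1 - z \<bullet> z))"

text \<open>The gradient of \<open>eta n\<close> at z is -2 \<open>lam n z\<close> z. Integrals
  against \<open>lam n\<close> stand in for integrals over the circle as n grows.\<close>

definition lam :: "nat => complex => real" where
 "lam n z = (real n + 2) * step' ((real n + 2) * (1 - z \<bullet> z))"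

definition layer :: "nat => complex set" where
 "layer n = cball 0 (sqrt (1 - 1 / (real n + 2))) - ball 0 (sqrt (1 - 2 / (real n + 2)))"

lemma layer_iff: "z \<in> layer n \<longleftrightarrow> (real n + 2) * (1 - z \<bullet> z) \<in> {1..2}"
proof -
 have p: "1 / (real n + 2) \<le> 1" "2 / (real n + 2) \<le> 1" "real n + 2 > 0" by auto
 have "norm z \<le> sqrt (1 - 1 / (real n + 2)) \<longleftrightarrow> z \<bullet> z \<le> 1 - 1 / (real n + 2)"
  by (simp add: norm_eq_sqrt_inner)
 moreover have "norm z < sqrt (1 - 2 / (real n + 2)) \<longleftrightarrow> z \<bullet> z < 1 - 2 / (real n + 2)"
  by (simp add: norm_eq_sqrt_inner)
 ultimately have "z \<in> layer n \<longleftrightarrow> z \<bullet> z \<le> 1 - 1 / (real n + 2) \<and> 1 - 2 / (real n + 2) \<le> z \<bullet> z"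
  by (auto simp: layer_def dist_norm)
 also have "\<dots> \<longleftrightarrow> (real n + 2) * (1 - z \<bullet> z) \<in> {1..2}" using p(3) by (auto simp: field_simps)
 finally show ?thesis .
qed

lemma layer_sub: "layer n \<subseteq> D2"
proof
 fix z assume "z \<in> layer n"
 then have "(real n + 2) * (1 - z \<bullet> z) > 0" by (auto simp: layer_iff)
 then have "z \<bullet> z < 1" by (simp add: zero_less_mult_iff)
 then have "norm z < 1" by (simp add: norm_eq_sqrt_inner)
 then show "z \<in> D2" by simp
qed

lemma measure_layer: "measure lborel (layer n) = pi / (real n + 2)"
proof -
 have s: "ball 0 (sqrt (1 - 2 / (real n + 2))) \<subseteq> (cball 0 (sqrt (1 - 1 / (real n + 2))) :: complex set)"
  by (rule order.trans[OF ball_subset_cball subset_cball]) (auto simp: divide_right_mono)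
 have "measure lborel (layer n) = measure lborel (cball (0::complex) (sqrt (1 - 1 / (real n + 2)))) - measure lborel (ball (0::complex) (sqrt (1 - 2 / (real n + 2))))"
  unfolding layer_def
  by (rule measure_Diff) (use s emeasure_lborel_cball_finite[of "0::complex"] in \<open>auto simp: less_top[symmetric]\<close>)
 also have "measure lborel (cball (0::complex) (sqrt (1 - 1 / (real n + 2)))) = pi * (1 - 1 / (real n + 2))"
  using content_cball[of "sqrt (1 - 1 / (real n + 2))" "0::complex"] by (simp add: unit_ball_vol_2)
 also have "measure lborel (ball (0::complex) (sqrt (1 - 2 / (real n + 2)))) = pi * (1 - 2 / (real n + 2))"
  using content_ball[of "sqrt (1 - 2 / (real n + 2))" "0::complex"] by (simp add: unit_ball_vol_2)
 also have "pi * (1 - 1 / (real n + 2)) - pi * (1 - 2 / (real n + 2)) = pi / (real n + 2)"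
 proof -
  have "pi * (1 - 1 / m) - pi * (1 - 2 / m) = pi / m" if "m \<noteq> 0" for m using that by (simp add: field_simps)
  then show ?thesis by simp
 qed
 finally show ?thesis .
qed

lemma layer_borel: "layer n \<in> sets borel" unfolding layer_def by auto

lemma layer_integrable: "integrable lborel (indicator (layer n) :: complex => real)"
proof -
 have "emeasure lborel (layer n) < \<infinity>"
  using emeasure_mono[OF layer_sub, of lborel n] emeasure_lborel_ball_finite[of "0::complex" 1]
  by (auto simp: less_top intro: order.strict_trans1)
 then show ?thesis using layer_borel by simp
qed

lemma lam_eq_0: "z \<notin> layer n ==> lam n z = 0"
 using step'_zero[of "(real n + 2) * (1 - z \<bullet> z)"] layer_iff[of z n] by (simp add: lam_def)

lemma lam_nonneg: "0 \<le> lam n z"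
 using step'_nonneg by (simp add: lam_def)

lemma lam_le: "lam n z \<le> 2 * (real n + 2) * indicator (layer n) z"
proof (cases "z \<in> layer n")
 case True
 have "(real n + 2) * step' ((real n + 2) * (1 - z \<bullet> z)) \<le> (real n + 2) * 2"
  by (intro mult_left_mono step'_le) simp
 then show ?thesis using True by (simp add: lam_def)
qed (simp add: lam_eq_0)

lemma lam_measurable [measurable]: "lam n \<in> borel_measurable borel"
proof -
 have "continuous_on UNIV (lam n)" unfolding lam_def
  by (intro continuous_intros continuous_on_compose2[OF continuous_step'[of UNIV]]) auto
 then show ?thesis by (rule borel_measurable_continuous_onI)
qed

text \<open>The density is at most 2(n + 2) and the layer has area pi/(n + 2), so the bound is
  independent of n.\<close>

lemma lam_integral_bound:
 assumes p: "p \<in> borel_measurable borel" and b: "!!z. z \<in> layer n ==> \<bar>p z\<bar> \<le> e"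
 shows "integrable lborel (%z. lam n z * p z)" "\<bar>LBINT z. lam n z * p z\<bar> \<le> 2 * pi * e"
proof -
 have pw: "\<bar>lam n z * p z\<bar> \<le> (2 * (real n + 2) * e) * indicator (layer n) z" for z
 proof (cases "z \<in> layer n")
  case True
  then have "\<bar>lam n z\<bar> * \<bar>p z\<bar> \<le> (2 * (real n + 2)) * e"
   using b[OF True] lam_nonneg[of n z] lam_le[of n z] True by (intro mult_mono) auto
  then show ?thesis using True by (simp add: abs_mult)
 qed (simp add: lam_eq_0)
 have i2: "integrable lborel (%z. (2 * (real n + 2) * e) * indicator (layer n) z)"
  using layer_integrable by (rule integrable_mult_right)
 show i1: "integrable lborel (%z. lam n z * p z)"
 proof (rule Bochner_Integration.integrable_bound[OF i2])
  show "(%z. lam n z * p z) \<in> borel_measurable lborel" using p by auto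
  show "AE z in lborel. norm (lam n z * p z) \<le> norm (2 * (real n + 2) * e * indicator (layer n) z)"
   unfolding real_norm_def by (intro AE_I2 order.trans[OF pw abs_ge_self])
 qed
 have "\<bar>LBINT z. lam n z * p z\<bar> \<le> (LBINT z. (2 * (real n + 2) * e) * indicator (layer n) z)"
  using Bochner_Integration.integral_norm_bound_integral[OF i1 i2] pw by simp
 also have "\<dots> = (2 * (real n + 2) * e) * measure lborel (layer n)" using layer_borel by simp
 also have "\<dots> = 2 * pi * e" by (simp add: measure_layer field_simps)
 finally show "\<bar>LBINT z. lam n z * p z\<bar> \<le> 2 * pi * e" .
qed

lemma lam_limit:
 assumes p: "p \<in> borel_measurable borel"
  and lim: "!!e. e > 0 ==> \<exists>d>0. \<forall>z\<in>D2. 1 - z \<bullet> z < d \<longrightarrow> \<bar>p z\<bar> \<le> e"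
 shows "(%n. LBINT z. lam n z * p z) \<longlonglongrightarrow> 0"
proof (rule LIMSEQ_I)
 fix r :: real assume r: "r > 0"
 have "r / (4 * pi) > 0" using r by simp
 then obtain d where d: "d > 0" "!!z. z \<in> D2 ==> 1 - z \<bullet> z < d ==> \<bar>p z\<bar> \<le> r / (4 * pi)" using lim by metis
 obtain N :: nat where N: "2 / d < real N" using reals_Archimedean2 by blast
 have "norm ((LBINT z. lam n z * p z) - 0) < r" if "n \<ge> N" for n
 proof -
  have "\<bar>p z\<bar> \<le> r / (4 * pi)" if z: "z \<in> layer n" for z
  proof (rule d(2))
   show "z \<in> D2" using z layer_sub by blast
   have "(real n + 2) * (1 - z \<bullet> z) \<le> 2" using z by (simp add: layer_iff)
   also have "2 < (real n + 2) * d"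
   proof -
    have "2 < real N * d" using N d(1) by (simp add: pos_divide_less_eq)
    also have "\<dots> \<le> (real n + 2) * d" using \<open>n \<ge> N\<close> d(1) by (intro mult_right_mono) auto
    finally show ?thesis .
   qed
   finally have "(real n + 2) * (1 - z \<bullet> z) < (real n + 2) * d" .
   then show "1 - z \<bullet> z < d" by simp
  qed
  then have "\<bar>LBINT z. lam n z * p z\<bar> \<le> 2 * pi * (r / (4 * pi))"
   by (rule lam_integral_bound(2)[OF p])
  also have "\<dots> < r" using r by (simp add: field_simps)
  finally show ?thesis by simp
 qed
 then show "\<exists>no. \<forall>n\<ge>no. norm ((LBINT z. lam n z * p z) - 0) < r" by blast
qed

lemma Ck_on_eta: "Ck_on 1 UNIV (eta n)"
 unfolding eta_def[abs_def]
 by (rule Ck_on_compose[OF open_UNIV open_UNIV subset_UNIV Ck_on_step])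
   (intro Ck_on_mult Ck_on_diff Ck_on_const Ck_on_inner Ck_on_id open_UNIV)

lemma pd_eta: "pd v (eta n) z = - 2 * (z \<bullet> v) * lam n z"
proof (rule pd_eqI[where D="%v. - 2 * (z \<bullet> v) * lam n z"])
 have "(step has_derivative (%v. step' t * v)) (at t)" for t
  using step_deriv by (simp add: has_field_derivative_def)
 moreover have "((%z. (real n + 2) * (1 - z \<bullet> z)) has_derivative (%v. (real n + 2) * (- 2 * (z \<bullet> v)))) (at z)"
  by (auto intro!: derivative_eq_intros simp: fun_eq_iff inner_commute)
 ultimately have "((%z. step ((real n + 2) * (1 - z \<bullet> z))) has_derivative
   (%v. step' ((real n + 2) * (1 - z \<bullet> z)) * ((real n + 2) * (- 2 * (z \<bullet> v))))) (at z)"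
  by (rule has_derivative_compose[rotated])
 then show "(eta n has_derivative (%v. - 2 * (z \<bullet> v) * lam n z)) (at z)"
  unfolding eta_def[abs_def] lam_def by (simp add: algebra_simps)
qed

lemma eta_bounds: "0 \<le> eta n z" "eta n z \<le> 1"
 by (simp_all add: eta_def step_bounds)

lemma Cc_eta_ext:
 fixes X :: "complex => 'b::euclidean_space"
 assumes X: "Ck_on 1 D2 X" and O: "open O'" "!!z. z \<in> O' ==> X z = 0"
 shows "Cc 1 (D2 - O') (%z. if z \<in> D2 then eta n z *\<^sub>R X z else 0)"
proof -
 have s: "sqrt (1 - 1 / (real n + 2)) < 1" by (simp add: real_sqrt_lt_1_iff)
 let ?K = "cball 0 (sqrt (1 - 1 / (real n + 2)))"
 have e0: "eta n z = 0" if "z \<notin> ?K" for z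
 proof -
  have "\<not> z \<bullet> z \<le> 1 - 1 / (real n + 2)" using that by (simp add: norm_eq_sqrt_inner)
  then have "(real n + 2) * (1 - z \<bullet> z) \<le> 1" by (simp add: field_simps)
  then show ?thesis by (simp add: eta_def step_simps)
 qed
 have KD: "?K \<subseteq> D2"
 proof
  fix x :: complex assume "x \<in> ?K"
  then have "norm x < 1" by (intro order.strict_trans1[OF _ s]) simp
  then show "x \<in> D2" by simp
 qed
 have "Cc 1 D2 (%z. if z \<in> D2 then eta n z *\<^sub>R X z else 0)"
  using Ck_on_subset[OF open_UNIV open_ball subset_UNIV Ck_on_eta] e0
  by (intro Cc_zero_extend[OF open_ball _ compact_cball KD] Ck_on_scaleR X open_ball) auto
 then have "Ck_on 1 UNIV (%z. if z \<in> D2 then eta n z *\<^sub>R X z else 0)" by (rule Cc_Ck)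
 then show ?thesis
 proof (rule CcI[where K="?K - O'"])
  show "compact (?K - O')" by (rule compact_diff[OF compact_cball O(1)])
  show "?K - O' \<subseteq> D2 - O'" using KD by blast
  show "(if z \<in> D2 then eta n z *\<^sub>R X z else 0) = 0" if "z \<notin> ?K - O'" for z
   using that e0[of z] O(2)[of z] by (cases "z \<in> ?K") auto
 qed
qed

lemma eta_tendsto: "z \<in> D2 ==> (%n. eta n z) \<longlonglongrightarrow> 1"
proof -
 assume "z \<in> D2"
 then have "norm z < 1" by simp
 then have p: "1 - z \<bullet> z > 0" by (simp add: norm_eq_sqrt_inner)
 obtain N :: nat where N: "2 / (1 - z \<bullet> z) < real N" using reals_Archimedean2 by blast
 have "eta n z = 1" if "n \<ge> N" for n
 proof -
  have "2 < real N * (1 - z \<bullet> z)" using N p by (simp add: pos_divide_less_eq)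
  also have "\<dots> \<le> (real n + 2) * (1 - z \<bullet> z)" using that p by (intro mult_right_mono) auto
  finally show ?thesis by (simp add: eta_def step_simps)
 qed
 then show ?thesis by (intro tendsto_eventually) (auto simp: eventually_sequentially)
qed

lemma eta_integral_tendsto:
 fixes F :: "complex => real"
 assumes F: "integrable lborel F" and F0: "!!z. z \<notin> D2 ==> F z = 0"
 shows "(%n. LBINT z. eta n z * F z) \<longlonglongrightarrow> (LBINT z. F z)"
proof (rule integral_dominated_convergence[where w="%z. \<bar>F z\<bar>"])
 show "F \<in> borel_measurable lborel" using F by auto
 show "(%z. eta n z * F z) \<in> borel_measurable lborel" for n
  using F borel_measurable_continuous_onI[OF Ck_on_continuous[OF open_UNIV Ck_on_eta]] by auto
 show "integrable lborel (%z. \<bar>F z\<bar>)" using F by auto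
 show "AE z in lborel. (%n. eta n z * F z) \<longlonglongrightarrow> F z"
 proof (rule AE_I2)
  fix z
  show "(%n. eta n z * F z) \<longlonglongrightarrow> F z"
   using tendsto_mult_right[OF eta_tendsto, of z "F z"] F0[of z] by (cases "z \<in> D2") (auto simp: mult.commute)
 qed
 show "AE z in lborel. norm (eta n z * F z) \<le> \<bar>F z\<bar>" for n
  using eta_bounds[of n] by (intro AE_I2) (auto simp: abs_mult mult_left_le_one_le)
qed

section \<open>Gradients, half discs and the standing assumptions\<close>

lemma Ck1_differentiable: "open S ==> Ck_on 1 S f ==> x \<in> S ==> f differentiable (at x)"
 using Ck_on_SucD[of S 0 f x] by simp

lemma gderiv_gradient:
 fixes f :: "'a::euclidean_space => real"
 assumes "f differentiable (at x)"
 shows "gradient f x = (\<Sum>i\<in>Basis. pd i f x *\<^sub>R i)" "gradient f x \<bullet> v = pd v f x"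
proof -
 let ?g = "\<Sum>i\<in>Basis. pd i f x *\<^sub>R i"
 have g: "v \<bullet> ?g = pd v f x" for v
  using pd_expand[OF assms, where v=v] by (simp add: inner_sum_right mult.commute)
 have G: "GDERIV f x :> ?g" unfolding gderiv_def
  using has_derivative_pd[OF assms] by (simp add: g inner_commute)
 have "gradient f x = ?g" unfolding gradient_def
 proof (rule the_equality)
  show "GDERIV f x :> ?g" by (rule G)
  fix D assume "GDERIV f x :> D"
  then have "(%h. h \<bullet> D) = (%h. h \<bullet> ?g)"
   using G unfolding gderiv_def by (rule has_derivative_unique)
  from fun_cong[OF this] have "\<forall>h. h \<bullet> D = h \<bullet> ?g" by blast
  then show "D = ?g" by (rule vector_eq_ldot[THEN iffD1])
 qed
 then show "gradient f x = ?g" "gradient f x \<bullet> v = pd v f x" using g[of v] by (simp_all add: inner_commute)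
qed

lemma Ck_on_gradient:
 fixes f :: "'a::euclidean_space => real"
 assumes "!!k. Ck_on k UNIV f" shows "Ck_on k UNIV (gradient f)"
proof -
 have "f differentiable (at x)" for x using Ck_on_SucD[OF open_UNIV assms[of "Suc 0"]] by simp
 then have "gradient f = (%x. \<Sum>i\<in>Basis. pd i f x *\<^sub>R i)" using gderiv_gradient(1) by blast
 then show ?thesis
  using Ck_on_pd[OF assms] by (auto intro!: Ck_on_sum Ck_on_scaleR Ck_on_const open_UNIV simp del: Ck_on.simps)
qed

text \<open>The function |x - z0|^2 - r^2 is defining away from the centre, its only critical point;
  the centre is not on the relative boundary. The arc of the circle belongs to the domain itself and
  needs no defining function.\<close>

lemma half_disc_domain:
 assumes z0: "z0 \<in> closed_D2" and r: "r > 0"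
 shows "smooth_rel_domain (closed_D2 \<inter> ball z0 r)"
  and "closure (closed_D2 \<inter> ball z0 r) - closed_D2 \<inter> ball z0 r \<subseteq> closed_D2 \<inter> sphere z0 r"
  and "closure (closed_D2 \<inter> ball z0 r) \<subseteq> cball z0 r"
proof -
 let ?U = "closed_D2 \<inter> ball z0 r"
 have c: "closure ?U \<subseteq> closed_D2 \<inter> cball z0 r"
  by (rule closure_minimal) auto
 then show 1: "closure ?U - ?U \<subseteq> closed_D2 \<inter> sphere z0 r" by auto
 show "closure ?U \<subseteq> cball z0 r" using c by blast
 define \<rho> :: "complex => real" where "\<rho> x = (x - z0) \<bullet> (x - z0) - r\<^sup>2" for x
 have Ck: "Ck_on k UNIV \<rho>" for k unfolding \<rho>_def[abs_def]
  by (intro Ck_on_diff Ck_on_inner Ck_on_const Ck_on_id open_UNIV)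
 have pd: "pd v \<rho> x = 2 * ((x - z0) \<bullet> v)" for v x
  unfolding \<rho>_def[abs_def] by (rule pd_eqI) (auto intro!: derivative_eq_intros simp: fun_eq_iff inner_commute)
 have gr: "gradient \<rho> x \<noteq> 0" if "x \<noteq> z0" for x
 proof
  assume "gradient \<rho> x = 0"
  moreover have "gradient \<rho> x \<bullet> (x - z0) = 2 * ((x - z0) \<bullet> (x - z0))"
   using gderiv_gradient(2)[of \<rho> x "x - z0"] Ck_on_SucD[OF open_UNIV Ck] by (simp add: pd)
  ultimately show False using that by simp
 qed
 have \<rho>: "x \<in> ball z0 r \<longleftrightarrow> \<rho> x < 0" for x
 proof -
  have "r\<^sup>2 \<le> (norm (x - z0))\<^sup>2 \<longleftrightarrow> r \<le> norm (x - z0)" using r by (intro power_mono_iff) auto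
  then show ?thesis
   by (simp add: \<rho>_def dist_norm norm_minus_commute[of z0] power2_norm_eq_inner) linarith
 qed
 have "defining_function closed_D2 ?U (- {z0}) \<rho>"
  unfolding defining_function_def
 proof (intro conjI ballI)
  show "smooth_on (- {z0}) \<rho>" unfolding smooth_on_def using Ck_on_subset[OF open_UNIV open_Compl[OF closed_singleton] subset_UNIV Ck] by blast
  show "?U \<inter> - {z0} = {x \<in> closed_D2 \<inter> - {z0}. \<rho> x < 0}" using \<rho> by blast
 qed (use gr in auto)
 moreover have "p \<in> - {z0}" if "p \<in> closure ?U - ?U" for p using that z0 r by auto
 ultimately have "\<forall>p \<in> closure ?U - ?U. \<exists>W \<rho>. p \<in> W \<and> defining_function closed_D2 ?U W \<rho>" by blast
 moreover have "?U \<noteq> {}" using z0 r by auto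
 moreover have "connected ?U" by (intro convex_connected convex_Int) auto
 moreover have "openin (top_of_set closed_D2) ?U" by (simp add: openin_open_Int)
 ultimately show "smooth_rel_domain ?U" by (simp add: smooth_rel_domain_def)
qed

text \<open>Packages the lifted angle, the Laplacian \<open>\<mu>\<close> and the weak gradient
  \<open>B1\<close>, \<open>B2\<close> of the angle together with the stationarity identity, in
  which the normal is already replaced by its value x on the unit sphere.\<close>

locale fb_disc = conformal_lagrangian_disc u gbar S
 for u :: "complex => complex2" and gbar :: "complex => complex" and S :: "complex set" +
 fixes \<beta> :: "complex => real" and \<mu> :: "complex => complex2" and B1 B2 :: "complex => real"
 assumes beta_cont: "continuous_on closed_D2 \<beta>"
  and frame: "!!z. z \<in> closed_D2 ==> dy u z = cscale (exp (\<i> * \<beta> z)) (quat (dx u z))"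
  and mu_int: "integrable lborel \<mu>"
  and B_meas [measurable]: "B1 \<in> borel_measurable borel" "B2 \<in> borel_measurable borel"
  and div: "!!c. Cc 1 D2 c ==> (LBINT z. pd 1 c z *\<^sub>R dx u z) + (LBINT z. pd \<i> c z *\<^sub>R dy u z)
    = - (LBINT z. c z *\<^sub>R \<mu> z)"
  and dec: "AE z in lborel. z \<in> D2 - S \<longrightarrow> \<mu> z = B1 z *\<^sub>R mult_I (dx u z) + B2 z *\<^sub>R mult_I (dy u z)"
  and B_bound: "!!z. \<bar>B1 z\<bar> * norm (dx u z) \<le> norm (\<mu> z)" "!!z. \<bar>B2 z\<bar> * norm (dx u z) \<le> norm (\<mu> z)"
  and grad: "!!c. Cc 1 (D2 - S) c ==> (LBINT z. pd 1 c z * \<beta> z) = - (LBINT z. c z * B1 z)"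
   "!!c. Cc 1 (D2 - S) c ==> (LBINT z. pd \<i> c z * \<beta> z) = - (LBINT z. c z * B2 z)"
  and stat: "!!U f. smooth_rel_domain U ==> smooth_on UNIV f ==>
    fun_support f \<inter> closure (u ` ((closure U - U) \<inter> D2)) = {} ==>
    \<exists>V. open V \<and> u ` (closure U \<inter> circle) \<subseteq> V \<and> (\<forall>x \<in> V \<inter> sphere 0 1. mult_I (gradient f x) \<bullet> x = 0) ==>
    (LINT z:U|lebesgue. dx (%z. mult_I (gradient f (u z))) z \<bullet> dx u z
      + dy (%z. mult_I (gradient f (u z))) z \<bullet> dy u z) = 0"
  and circ: "!!z. z \<in> circle ==> norm (u z) = 1"
  and leg: "!!z. z \<in> circle ==> dtau u z \<bullet> mult_I (u z) = 0"
begin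

lemma uC: "Ck_on 1 D2 u" by (rule C1cd_Ck[OF C1])

lemma u_diff: "z \<in> D2 ==> u differentiable (at z)"
 by (rule Ck1_differentiable[OF open_ball uC])

lemma S_closed: "closed S" using branch(1) finite_imp_closed by blast

lemma Basis_c: "1 \<in> (Basis :: complex set)" "\<i> \<in> (Basis :: complex set)" by (auto simp: Basis_complex_def)

lemma AE_notin_S: "AE z in lborel. z \<notin> S"
 using branch(1) by (intro AE_not_in) (simp add: finite_imp_null_set_lborel)

text \<open>Outside a neighbourhood of the branch points, and up to the circle, |dx u| has a
  positive minimum, so the coefficients are dominated by the integrable
  \<open>\<mu>\<close>.\<close>

lemma B_integrable:
 assumes O: "open O'" "S \<subseteq> O'"
 shows "integrable lborel (%z. indicator (D2 - O') z * B1 z)" "integrable lborel (%z. indicator (D2 - O') z * B2 z)"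
proof -
 have "\<exists>m>0. \<forall>z\<in>closed_D2 - O'. m \<le> norm (dx u z)"
 proof (cases "closed_D2 - O' = {}")
  case True then show ?thesis by (auto intro: exI[of _ 1])
 next
  case False
  have "compact (closed_D2 - O')" by (rule compact_diff[OF compact_cball O(1)])
  moreover have "continuous_on (closed_D2 - O') (%z. norm (dx u z))"
   by (intro continuous_intros continuous_on_subset[OF cont(2)]) auto
  ultimately obtain z0 where "z0 \<in> closed_D2 - O'" "\<forall>z\<in>closed_D2 - O'. norm (dx u z0) \<le> norm (dx u z)"
   using continuous_attains_inf[OF _ False] by blast
  moreover from this have "z0 \<in> closed_D2 - S" using O by auto
  ultimately show ?thesis using dx_nonzero[of z0] by (intro exI[of _ "norm (dx u z0)"]) auto
 qed
 then obtain m where m: "m > 0" "!!z. z \<in> closed_D2 - O' ==> m \<le> norm (dx u z)" by blast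
 have gen: "integrable lborel (%z. indicator (D2 - O') z * B z)"
  if B: "B \<in> borel_measurable borel" "!!z. \<bar>B z\<bar> * norm (dx u z) \<le> norm (\<mu> z)" for B
 proof (rule Bochner_Integration.integrable_bound[where f="%z. (1 / m) *\<^sub>R \<mu> z"])
  show "AE z in lborel. norm (indicator (D2 - O') z * B z) \<le> norm ((1 / m) *\<^sub>R \<mu> z)"
  proof (rule AE_I2)
   fix z
   show "norm (indicator (D2 - O') z * B z) \<le> norm ((1 / m) *\<^sub>R \<mu> z)"
   proof (cases "z \<in> D2 - O'")
    case True
    then have "m \<le> norm (dx u z)" by (intro m(2)) auto
    then have "\<bar>B z\<bar> * m \<le> norm (\<mu> z)" using B(2)[of z] mult_left_mono[of m "norm (dx u z)" "\<bar>B z\<bar>"] by simp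
    then show ?thesis using True m(1) by (simp add: pos_le_divide_eq)
   qed (use m in simp)
  qed
  show "(%z. indicator (D2 - O') z * B z) \<in> borel_measurable lborel"
   using B(1) O by (intro borel_measurable_times borel_measurable_indicator) auto
 qed (use mu_int in auto)
 show "integrable lborel (%z. indicator (D2 - O') z * B1 z)" "integrable lborel (%z. indicator (D2 - O') z * B2 z)"
  by (rule gen[OF B_meas(1) B_bound(1)]) (rule gen[OF B_meas(2) B_bound(2)])
qed

lemma div_vec:
 assumes Y: "Cc 1 D2 Y"
 shows "(LBINT z. pd 1 Y z \<bullet> dx u z + pd \<i> Y z \<bullet> dy u z) = - (LBINT z. Y z \<bullet> \<mu> z)"
proof -
 have Yd: "Y differentiable (at z)" for z by (rule Cc_differentiable[OF Y])
 define c where "c j z = Y z \<bullet> j" for j z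
 have cC: "Cc 1 D2 (c j)" for j
 proof -
  obtain K where "compact K" "K \<subseteq> D2" "!!x. x \<notin> K ==> Y x = 0" using Y by (auto elim: CcE)
  moreover have "Ck_on 1 UNIV (c j)" unfolding c_def[abs_def]
   by (rule Ck_on_linear_comp[OF open_UNIV bounded_linear_inner_left Cc_Ck[OF Y]])
  ultimately show ?thesis by (intro CcI[where K=K]) (auto simp: c_def)
 qed
 have pc: "pd v (c j) z = pd v Y z \<bullet> j" for v j z
  unfolding c_def[abs_def] by (rule pd_bounded_linear[OF bounded_linear_inner_left Yd])
 have i1: "integrable lborel (%z. pd i (c j) z *\<^sub>R f z)" if i: "i \<in> Basis" and f: "continuous_on closed_D2 f" for i j and f :: "complex => complex2"
 proof -
  obtain K where K: "compact K" "K \<subseteq> D2" "!!x. x \<notin> K ==> pd i (c j) x = 0" using Cc_pd1[OF cC[of j] i] by (auto elim: CcE)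
  have "K \<subseteq> closed_D2" using K(2) by auto
  then have "continuous_on K (%z. pd i (c j) z *\<^sub>R f z)"
   by (intro continuous_on_scaleR continuous_on_subset[OF f]
     continuous_on_subset[OF Ck_on_continuous[OF open_UNIV Cc_Ck[OF Cc_pd1[OF cC i]]] subset_UNIV])
  then show ?thesis by (rule integrable_cont_compact_support[OF K(1)]) (simp add: K(3))
 qed
 note i2 = i1[OF Basis_c(1) cont(2)] i1[OF Basis_c(2) cont(3)] Cc_times_integrable[OF cC mu_int]
 have "pd 1 Y z \<bullet> dx u z + pd \<i> Y z \<bullet> dy u z = (\<Sum>j\<in>Basis. (pd 1 (c j) z *\<^sub>R dx u z) \<bullet> j + (pd \<i> (c j) z *\<^sub>R dy u z) \<bullet> j)" for z
  unfolding pc sum.distrib inner_scaleR_left euclidean_inner[of "pd 1 Y z" "dx u z"] euclidean_inner[of "pd \<i> Y z" "dy u z"]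
  by (rule refl)
 then have "(LBINT z. pd 1 Y z \<bullet> dx u z + pd \<i> Y z \<bullet> dy u z)
   = (\<Sum>j\<in>Basis. ((LBINT z. pd 1 (c j) z *\<^sub>R dx u z) + (LBINT z. pd \<i> (c j) z *\<^sub>R dy u z)) \<bullet> j)"
  using i2 by (simp add: Bochner_Integration.integral_sum inner_add_left del: inner_scaleR_left)
 also have "\<dots> = - (\<Sum>j\<in>Basis. (LBINT z. c j z *\<^sub>R \<mu> z) \<bullet> j)"
  by (simp add: div[OF cC] sum_negf)
 also have "(\<Sum>j\<in>Basis. (LBINT z. c j z *\<^sub>R \<mu> z) \<bullet> j) = (LBINT z. (\<Sum>j\<in>Basis. (c j z *\<^sub>R \<mu> z) \<bullet> j))"
  using i2 by (simp add: Bochner_Integration.integral_sum del: inner_scaleR_left)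
 also have "(%z. \<Sum>j\<in>Basis. (c j z *\<^sub>R \<mu> z) \<bullet> j) = (%z. Y z \<bullet> \<mu> z)"
  unfolding c_def inner_scaleR_left by (rule ext) (rule euclidean_inner[symmetric])
 finally show ?thesis .
qed

lemma Cc_eta_D2:
 fixes X :: "complex => 'b::euclidean_space"
 assumes X: "Ck_on 1 D2 X"
 shows "Cc 1 D2 (%z. if z \<in> D2 then eta n z *\<^sub>R X z else 0)"
 using Cc_eta_ext[OF X, of "{}"] by simp

lemma pd_eta_ext:
 fixes X :: "complex => 'b::euclidean_space"
 assumes X: "Ck_on 1 D2 X"
 shows "pd v (%z. if z \<in> D2 then eta n z *\<^sub>R X z else 0) z
   = (if z \<in> D2 then eta n z *\<^sub>R pd v X z - (2 * (z \<bullet> v) * lam n z) *\<^sub>R X z else 0)"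
proof (cases "z \<in> D2")
 case True
 have Xd: "X differentiable (at z)" by (rule Ck1_differentiable[OF open_ball X True])
 have ed: "eta n differentiable (at z)" by (rule Ck1_differentiable[OF open_UNIV Ck_on_eta UNIV_I])
 have "pd v (%z. if z \<in> D2 then eta n z *\<^sub>R X z else 0) z = pd v (%z. eta n z *\<^sub>R X z) z"
  by (rule pd_cong_open[OF open_ball True]) simp
 then show ?thesis using True by (simp add: pd_scaleR[OF ed Xd] pd_eta)
next
 case False
 obtain K where K: "compact K" "K \<subseteq> D2" "!!z. z \<notin> K ==> (if z \<in> D2 then eta n z *\<^sub>R X z else 0) = 0"
  using Cc_eta_D2[OF X, of n] by (auto elim: CcE)
 have zK: "z \<notin> K" using False K(2) by blast
 have "pd v (%z. if z \<in> D2 then eta n z *\<^sub>R X z else 0) z = 0"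
  by (rule pd_eq_0_outside[OF compact_imp_closed[OF K(1)] _ zK]) (rule K(3))
 then show ?thesis using False by simp
qed

end

section \<open>Green's formula and the first variation\<close>

context fb_disc
begin

text \<open>The weak Neumann functional: it pairs the gradient of the angle with that of the test
  function. Its vanishing for functions unrestricted at the circle encodes both harmonicity and zero
  normal derivative.\<close>

definition T :: "(complex => real) => real" where
 "T \<Phi> = (LBINT z. indicator D2 z * (B1 z * pd 1 \<Phi> z + B2 z * pd \<i> \<Phi> z))"

definition energy_density :: "(complex => complex2) => complex => real" where
 "energy_density X z = (if z \<in> D2 then pd 1 X z \<bullet> dx u z + pd \<i> X z \<bullet> dy u z else 0)"

definition flux :: "(complex => complex2) => complex => real" where
 "flux X z = (if z \<in> D2 then X z \<bullet> (Re z *\<^sub>R dx u z + Im z *\<^sub>R dy u z) else 0)"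

lemma bounded_on_D2_integrable:
 fixes F :: "complex => 'b::euclidean_space"
 assumes "continuous_on D2 F" "!!z. z \<in> D2 ==> norm (F z) \<le> M"
 shows "integrable lborel (%z. if z \<in> D2 then F z else 0)"
proof -
 have eq: "(%z. if z \<in> D2 then F z else 0) = (%z. indicator D2 z *\<^sub>R F z)" by (auto simp: fun_eq_iff)
 have "integrable lborel (%z. indicator D2 z *\<^sub>R M)"
  using emeasure_lborel_ball_finite[of "0::complex" 1] by (intro integrable_scaleR_left integrable_real_indicator) auto
 then show ?thesis unfolding eq
 proof (rule Bochner_Integration.integrable_bound)
  show "(%z. indicator D2 z *\<^sub>R F z) \<in> borel_measurable lborel"
   using borel_measurable_continuous_on_indicator[of D2 F] assms(1) by simp
  show "AE z in lborel. norm (indicator D2 z *\<^sub>R F z) \<le> norm (indicator D2 z *\<^sub>R M)"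
  proof (rule AE_I2)
   fix z
   show "norm (indicator D2 z *\<^sub>R F z) \<le> norm (indicator D2 z *\<^sub>R M)"
    using order.trans[OF assms(2) abs_ge_self, of z] by (cases "z \<in> D2") auto
  qed
 qed
qed

text \<open>Partial integration against eta n X. The gradient of the cutoff produces the flux
  through the layer; the other two terms converge by dominated convergence, so the flux integrals
  have a limit even though no trace is taken.\<close>

lemma green:
 fixes X :: "complex => complex2"
 assumes X: "Ck_on 1 D2 X"
  and M: "!!z. z \<in> D2 ==> norm (X z) \<le> M" "!!z. z \<in> D2 ==> norm (pd 1 X z) \<le> M" "!!z. z \<in> D2 ==> norm (pd \<i> X z) \<le> M"
 shows "integrable lborel (energy_density X)" "flux X \<in> borel_measurable borel"
  "integrable lborel (%z. indicator D2 z * (X z \<bullet> \<mu> z))"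
  "(%n. 2 * (LBINT z. lam n z * flux X z)) \<longlonglongrightarrow>
   (LBINT z. energy_density X z) + (LBINT z. indicator D2 z * (X z \<bullet> \<mu> z))"
proof -
 obtain Ma where Ma: "Ma > 0" "!!z. z \<in> closed_D2 ==> norm (dx u z) \<le> Ma" by (rule continuous_on_closed_D2_bound[OF cont(2)]) blast
 obtain Mb where Mb: "Mb > 0" "!!z. z \<in> closed_D2 ==> norm (dy u z) \<le> Mb" by (rule continuous_on_closed_D2_bound[OF cont(3)]) blast
 have M0: "M \<ge> 0" using order.trans[OF norm_ge_zero M(1)[of 0]] by simp
 have inner_le: "\<bar>a \<bullet> b\<bar> \<le> A * B" if "norm a \<le> A" "norm b \<le> B" "A \<ge> 0" for a b :: complex2 and A B
  by (rule order.trans[OF Cauchy_Schwarz_ineq2]) (use that in \<open>intro mult_mono, auto\<close>)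
 have pdc: "continuous_on D2 (pd v X)" for v by (rule continuous_on_pd[OF open_ball X])
 note Xc = Ck_on_continuous[OF open_ball X]
 show E: "integrable lborel (energy_density X)"
  unfolding energy_density_def[abs_def]
 proof (rule bounded_on_D2_integrable[where M="M * Ma + M * Mb"])
  show "continuous_on D2 (%z. pd 1 X z \<bullet> dx u z + pd \<i> X z \<bullet> dy u z)" by (intro continuous_intros pdc contD)
  show "norm (pd 1 X z \<bullet> dx u z + pd \<i> X z \<bullet> dy u z) \<le> M * Ma + M * Mb" if "z \<in> D2" for z
   unfolding real_norm_def
   using that by (intro order.trans[OF abs_triangle_ineq] add_mono inner_le M Ma Mb M0) auto
 qed
 have fl: "continuous_on D2 (%z. X z \<bullet> (Re z *\<^sub>R dx u z + Im z *\<^sub>R dy u z))" by (intro continuous_intros Xc contD)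
 have "(%z. indicator D2 z *\<^sub>R (X z \<bullet> (Re z *\<^sub>R dx u z + Im z *\<^sub>R dy u z))) \<in> borel_measurable borel"
  by (rule borel_measurable_continuous_on_indicator[OF _ fl]) auto
 moreover have "flux X = (%z. indicator D2 z *\<^sub>R (X z \<bullet> (Re z *\<^sub>R dx u z + Im z *\<^sub>R dy u z)))"
  by (auto simp: fun_eq_iff flux_def)
 ultimately show F: "flux X \<in> borel_measurable borel" by simp
 have flb: "\<bar>flux X z\<bar> \<le> M * (Ma + Mb)" for z
 proof (cases "z \<in> D2")
  case True
  have c: "\<bar>Re z\<bar> \<le> 1" "\<bar>Im z\<bar> \<le> 1" using True abs_Re_le_cmod[of z] abs_Im_le_cmod[of z] by auto
  have "norm (Re z *\<^sub>R dx u z + Im z *\<^sub>R dy u z) \<le> \<bar>Re z\<bar> * norm (dx u z) + \<bar>Im z\<bar> * norm (dy u z)"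
   by (rule order.trans[OF norm_triangle_ineq]) simp
  also have "\<dots> \<le> 1 * Ma + 1 * Mb" using True c by (intro add_mono mult_mono Ma Mb) auto
  finally show ?thesis using True M0 by (simp add: flux_def inner_le M)
 qed (use M0 Ma Mb in \<open>simp add: flux_def\<close>)
 have Xm: "(%z. if z \<in> D2 then X z else 0) \<in> borel_measurable lborel"
  using borel_measurable_integrable[OF bounded_on_D2_integrable[OF Xc M(1)]] .
 have "integrable lborel (%z. \<mu> z \<bullet> (if z \<in> D2 then X z else 0))"
  by (rule integrable_inner_bounded[OF mu_int Xm, where C=M]) (use M M0 in auto)
 moreover have eqm: "(%z. \<mu> z \<bullet> (if z \<in> D2 then X z else 0)) = (%z. indicator D2 z * (X z \<bullet> \<mu> z))"
  by (auto simp: fun_eq_iff inner_commute)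
 ultimately show G: "integrable lborel (%z. indicator D2 z * (X z \<bullet> \<mu> z))" by simp
 have etam: "eta n \<in> borel_measurable borel" for n
  by (rule borel_measurable_continuous_onI[OF Ck_on_continuous[OF open_UNIV Ck_on_eta]])
 have eint: "integrable lborel (%z. eta n z * f z)" if "integrable lborel f" for f :: "complex => real" and n
  using integrable_scaleR_bounded[OF that, of "eta n" 1] etam[of n] eta_bounds[of n] by (simp add: abs_of_nonneg)
 have step: "2 * (LBINT z. lam n z * flux X z) =
   (LBINT z. eta n z * energy_density X z) + (LBINT z. eta n z * (indicator D2 z * (X z \<bullet> \<mu> z)))" for n
 proof -
  let ?Y = "%z. if z \<in> D2 then eta n z *\<^sub>R X z else 0"
  have "pd 1 ?Y z \<bullet> dx u z + pd \<i> ?Y z \<bullet> dy u z = eta n z * energy_density X z - 2 * (lam n z * flux X z)" for z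
   unfolding pd_eta_ext[OF X]
   by (auto simp: energy_density_def flux_def inner_diff_left inner_add_right inner_complex_def algebra_simps)
  then have "(LBINT z. eta n z * energy_density X z - 2 * (lam n z * flux X z)) = - (LBINT z. ?Y z \<bullet> \<mu> z)"
   using div_vec[OF Cc_eta_D2[OF X, of n]] by simp
  moreover have "(%z. ?Y z \<bullet> \<mu> z) = (%z. eta n z * (indicator D2 z * (X z \<bullet> \<mu> z)))" by (auto simp: fun_eq_iff)
  moreover have "integrable lborel (%z. lam n z * flux X z)" by (rule lam_integral_bound(1)[OF F flb])
  ultimately show ?thesis using eint[OF E, of n] by simp
 qed
 show "(%n. 2 * (LBINT z. lam n z * flux X z)) \<longlonglongrightarrow>
   (LBINT z. energy_density X z) + (LBINT z. indicator D2 z * (X z \<bullet> \<mu> z))"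
  unfolding step by (intro tendsto_add eta_integral_tendsto E G) (auto simp: energy_density_def)
qed

text \<open>The first variation for half discs, in terms of the one-form \<open>B1 dx + B2 dy\<close>: the flux through the
 circle is the only boundary contribution.\<close>
lemma first_variation:
 fixes f :: "complex2 => real"
 assumes z0: "z0 \<in> closed_D2" and r: "r > 0" and f: "!!k. Ck_on k UNIV f"
  and supp: "fun_support f \<inter> u ` (closed_D2 \<inter> sphere z0 r) = {}"
  and bc: "cball z0 r \<subseteq> D2 \<or> (\<forall>x. norm x = 1 \<longrightarrow> mult_I (gradient f x) \<bullet> x = 0)"
 defines "X \<equiv> (%z. if z \<in> ball z0 r then mult_I (gradient f (u z)) else 0)"
  and "\<Phi> \<equiv> (%z. if z \<in> ball z0 r then f (u z) else 0)"
 shows "(%n. 2 * (LBINT z. lam n z * flux X z)) \<longlonglongrightarrow> T \<Phi>"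
  and "Ck_on 1 D2 \<Phi>" and "!!z v. z \<in> D2 ==> z \<in> ball z0 r ==> pd v \<Phi> z = pd (du u z v) f (u z)"
  and "!!z v. z \<in> D2 ==> z \<notin> ball z0 r ==> pd v \<Phi> z = 0"
proof -
 define A1 where "A1 = D2 \<inter> ball z0 r"
 \<comment> \<open>The support of \<open>f\<close> misses the image of the cutting sphere, so
   \<open>f o u\<close> vanishes near it and cutting at the sphere keeps \<open>X\<close> and
   \<open>\<Phi>\<close> of class C^1: \<open>A1\<close> and \<open>A2\<close> are open and cover
   the disc.\<close>
 define A2 where "A2 = (D2 \<inter> u -` (- fun_support f)) \<union> (D2 - cball z0 r)"
 define Gf where "Gf x = mult_I (gradient f x)" for x
 have GC: "Ck_on k UNIV Gf" for k unfolding Gf_def[abs_def]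
  by (rule Ck_on_linear_comp[OF open_UNIV mult_I_linear Ck_on_gradient[OF f]])
 have fd: "f differentiable (at x)" for x by (rule Ck1_differentiable[OF open_UNIV f UNIV_I])
 have Gd: "Gf differentiable (at x)" for x by (rule Ck1_differentiable[OF open_UNIV GC UNIV_I])
 have f0: "f x = 0" "Gf x = 0" if "x \<notin> fun_support f" for x
 proof -
  have sub: "{x. f x \<noteq> 0} \<subseteq> fun_support f" by (simp add: fun_support_def closure_subset)
  then show "f x = 0" using that by auto
  have o: "open (- fun_support f)" by (simp add: fun_support_def open_Compl)
  have "pd i f x = 0" for i
  proof -
   have "pd i f x = pd i (%_. 0) x" by (rule pd_cong_open[OF o]) (use that sub in auto)
   then show ?thesis by (simp add: frechet_derivative_const)
  qed
  then show "Gf x = 0" by (simp add: Gf_def gderiv_gradient(1)[OF fd])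
 qed
 have A1: "open A1" unfolding A1_def by auto
 have "open (D2 \<inter> u -` (- fun_support f))"
  by (rule continuous_open_preimage[OF contD(1) open_ball]) (simp add: fun_support_def open_Compl)
 then have A2: "open A2" unfolding A2_def by (intro open_Un) auto
 have un: "A1 \<union> A2 = D2"
 proof
  show "D2 \<subseteq> A1 \<union> A2"
  proof
   fix z assume z: "z \<in> D2"
   have "u z \<notin> fun_support f" if "dist z0 z = r"
   proof
    assume "u z \<in> fun_support f"
    moreover have "u z \<in> u ` (closed_D2 \<inter> sphere z0 r)" using z that by auto
    ultimately show False using supp by blast
   qed
   then show "z \<in> A1 \<union> A2" using z by (auto simp: A1_def A2_def)
  qed
 qed (auto simp: A1_def A2_def)
 have X1: "X z = Gf (u z)" "\<Phi> z = f (u z)" if "z \<in> A1" for z using that by (auto simp: X_def \<Phi>_def A1_def Gf_def)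
 have X2: "X z = 0" "\<Phi> z = 0" if "z \<in> A2" for z
  using that f0[of "u z"] by (auto simp: X_def \<Phi>_def A2_def Gf_def)
 have CX: "Ck_on 1 D2 X" "Ck_on 1 D2 \<Phi>"
 proof -
  have u1: "Ck_on 1 A1 u" by (rule Ck_on_subset[OF open_ball A1 _ uC]) (auto simp: A1_def)
  have "Ck_on 1 A1 (%z. Gf (u z))" "Ck_on 1 A1 (%z. f (u z))"
   by (rule Ck_on_compose[OF A1 open_UNIV subset_UNIV GC u1], rule Ck_on_compose[OF A1 open_UNIV subset_UNIV f u1])
  then have 1: "Ck_on 1 A1 X" "Ck_on 1 A1 \<Phi>"
   using Ck_on_cong[OF A1, of X "%z. Gf (u z)" 1] Ck_on_cong[OF A1, of \<Phi> "%z. f (u z)" 1] X1 by blast+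
  have 2: "Ck_on 1 A2 X" "Ck_on 1 A2 \<Phi>"
   using Ck_on_cong[OF A2, of X "%z. 0" 1] Ck_on_cong[OF A2, of \<Phi> "%z. 0" 1] X2 Ck_on_const[OF A2] by blast+
  show "Ck_on 1 D2 X" "Ck_on 1 D2 \<Phi>"
   using Ck_on_open_Un[OF A1 A2 1(1) 2(1)] Ck_on_open_Un[OF A1 A2 1(2) 2(2)] unfolding un by blast+
 qed
 show "Ck_on 1 D2 \<Phi>" by (rule CX(2))
 have p1: "pd v X z = pd (du u z v) Gf (u z)" "pd v \<Phi> z = pd (du u z v) f (u z)" if z: "z \<in> A1" for z v
 proof -
  have zD: "z \<in> D2" using z by (auto simp: A1_def)
  have "pd v X z = pd v (%z. Gf (u z)) z" "pd v \<Phi> z = pd v (%z. f (u z)) z"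
   using pd_cong_open[OF A1 z, of X "%z. Gf (u z)" v] pd_cong_open[OF A1 z, of \<Phi> "%z. f (u z)" v] X1 by blast+
  then show "pd v X z = pd (du u z v) Gf (u z)" "pd v \<Phi> z = pd (du u z v) f (u z)"
   using pd_compose[OF u_diff[OF zD] Gd] pd_compose[OF u_diff[OF zD] fd] by (simp_all add: du_eq_pd[OF zD])
 qed
 have p2: "pd v X z = 0" "pd v \<Phi> z = 0" if z: "z \<in> A2" for z v
 proof -
  have "pd v X z = pd v (%z. 0) z" "pd v \<Phi> z = pd v (%z. 0) z"
   by (rule pd_cong_open[OF A2 z], rule X2(1), assumption) (rule pd_cong_open[OF A2 z], rule X2(2), assumption)
  then show "pd v X z = 0" "pd v \<Phi> z = 0" by (simp_all add: frechet_derivative_const)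
 qed
 have nb: "z \<in> A2" if "z \<in> D2" "z \<notin> ball z0 r" for z
  using that un by (auto simp: A1_def)
 show "pd v \<Phi> z = pd (du u z v) f (u z)" if "z \<in> D2" "z \<in> ball z0 r" for z v
  using p1(2) that by (simp add: A1_def)
 show "pd v \<Phi> z = 0" if "z \<in> D2" "z \<notin> ball z0 r" for z v
  using p2(2) nb that by blast
 have bnd: "\<exists>M. \<forall>z\<in>D2. norm (X z) \<le> M \<and> norm (pd 1 X z) \<le> M \<and> norm (pd \<i> X z) \<le> M"
 proof -
  have c0: "continuous_on closed_D2 (%z. Gf (u z))"
   by (rule continuous_on_compose2[OF Ck_on_continuous[OF open_UNIV GC] cont(1) subset_UNIV])
  have cv: "continuous_on closed_D2 (%z. pd (w z) Gf (u z))" if w: "continuous_on closed_D2 w" for w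
  proof -
   have "continuous_on closed_D2 (%z. \<Sum>j\<in>Basis. (w z \<bullet> j) *\<^sub>R pd j Gf (u z))"
    by (intro continuous_intros w continuous_on_compose2[OF continuous_on_pd[OF open_UNIV GC] cont(1) subset_UNIV])
   then show ?thesis by (rule continuous_on_eq) (rule pd_expand[OF Gd, symmetric])
  qed
  obtain M1 where M1: "M1 > 0" "!!z. z \<in> closed_D2 ==> norm (Gf (u z)) \<le> M1"
   by (rule continuous_on_closed_D2_bound[OF c0]) blast
  obtain M2 where M2: "M2 > 0" "!!z. z \<in> closed_D2 ==> norm (pd (dx u z) Gf (u z)) \<le> M2"
   by (rule continuous_on_closed_D2_bound[OF cv[OF cont(2)]]) blast
  obtain M3 where M3: "M3 > 0" "!!z. z \<in> closed_D2 ==> norm (pd (dy u z) Gf (u z)) \<le> M3"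
   by (rule continuous_on_closed_D2_bound[OF cv[OF cont(3)]]) blast
  have "norm (X z) \<le> M1 + M2 + M3 \<and> norm (pd 1 X z) \<le> M1 + M2 + M3 \<and> norm (pd \<i> X z) \<le> M1 + M2 + M3" if z: "z \<in> D2" for z
  proof (cases "z \<in> A1")
   case True
   have zc: "z \<in> closed_D2" using z by auto
   show ?thesis
    using M1(2)[OF zc] M2(2)[OF zc] M3(2)[OF zc] M1(1) M2(1) M3(1)
    by (simp add: X1[OF True] p1[OF True] dx_def[symmetric] dy_def[symmetric])
  next
   case False
   then have "z \<in> A2" using z un by auto
   then show ?thesis using M1(1) M2(1) M3(1) by (simp add: X2 p2)
  qed
  then show ?thesis by blast
 qed
 then obtain M where M: "!!z. z \<in> D2 ==> norm (X z) \<le> M" "!!z. z \<in> D2 ==> norm (pd 1 X z) \<le> M" "!!z. z \<in> D2 ==> norm (pd \<i> X z) \<le> M"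
  by blast
 note gr = green[OF CX(1) M]
 \<comment> \<open>The energy term is exactly the integral in the stationarity condition for the
   half disc, up to the null set of the circle.\<close>
 have stat0: "(LBINT z. energy_density X z) = 0"
 proof -
  let ?U = "closed_D2 \<inter> ball z0 r"
  let ?F = "%z. dx (%z. Gf (u z)) z \<bullet> dx u z + dy (%z. Gf (u z)) z \<bullet> dy u z"
  have st0: "(LINT z:?U|lebesgue. ?F z) = 0"
   unfolding Gf_def
  proof (rule stat[OF half_disc_domain(1)[OF z0 r]])
   show "smooth_on UNIV f" using f by (simp add: smooth_on_def)
   have "compact (u ` (closed_D2 \<inter> sphere z0 r))"
    by (intro compact_continuous_image continuous_on_subset[OF cont(1)] compact_Int) auto
   then have "closure (u ` ((closure ?U - ?U) \<inter> D2)) \<subseteq> u ` (closed_D2 \<inter> sphere z0 r)"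
    using half_disc_domain(2)[OF z0 r] by (intro closure_minimal compact_imp_closed) auto
   then show "fun_support f \<inter> closure (u ` ((closure ?U - ?U) \<inter> D2)) = {}" using supp by blast
   show "\<exists>V. open V \<and> u ` (closure ?U \<inter> circle) \<subseteq> V \<and> (\<forall>x\<in>V \<inter> sphere 0 1. mult_I (gradient f x) \<bullet> x = 0)"
    using bc
   proof
    assume "cball z0 r \<subseteq> D2"
    then have "closure ?U \<inter> circle = {}" using half_disc_domain(3)[OF z0 r] by force
    then show ?thesis by (intro exI[of _ "{}"]) simp
   next
    assume "\<forall>x. norm x = 1 \<longrightarrow> mult_I (gradient f x) \<bullet> x = 0"
    then show ?thesis by (intro exI[of _ UNIV]) auto
   qed
  qed
  have "AE z in lebesgue. z \<notin> circle"
   using negligible_sphere[of "0::complex" 1] by (intro AE_not_in) (simp add: negligible_iff_null_sets)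
  then have ae: "AE z in lebesgue. energy_density X z = indicator ?U z *\<^sub>R ?F z"
  proof (rule eventually_mono)
   fix z :: complex assume zc: "z \<notin> circle"
   show "energy_density X z = indicator ?U z *\<^sub>R ?F z"
   proof (cases "z \<in> D2")
    case True
    show ?thesis
    proof (cases "z \<in> ball z0 r")
     case True2: True
     then have "z \<in> A1" using True by (simp add: A1_def)
     moreover have "pd v (%z. Gf (u z)) z = pd (du u z v) Gf (u z)" for v
      using pd_compose[OF u_diff[OF True] Gd] by (simp add: du_eq_pd[OF True])
     ultimately show ?thesis using True True2 by (simp add: energy_density_def p1 dx_eq_pd[OF True] dy_eq_pd[OF True])
    next
     case False
     then show ?thesis using True nb[OF True False] by (simp add: energy_density_def p2)
    qed
   next
    case False
    then show ?thesis using zc by (simp add: energy_density_def)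
   qed
  qed
  have Em: "energy_density X \<in> borel_measurable lborel" using gr(1) by simp
  have Em': "energy_density X \<in> borel_measurable lebesgue" using Em measurable_completion by blast
  have "(LBINT z. energy_density X z) = (LINT z|lebesgue. energy_density X z)"
   by (rule integral_completion[OF Em, symmetric])
  also have "\<dots> = (LINT z|lebesgue. indicator ?U z *\<^sub>R ?F z)"
   by (rule integral_cong_AE[OF Em' borel_measurable_AE[OF Em' ae] ae])
  finally show ?thesis using st0 by (simp add: set_lebesgue_integral_def)
 qed
 \<comment> \<open>Both \<open>X\<close> and \<open>\<mu>\<close> carry a factor
   \<open>mult_I\<close>, which is an isometry; what remains is the derivative of \<open>f\<close>
   along the first derivatives of u.\<close>
 have "(LBINT z. indicator D2 z * (X z \<bullet> \<mu> z)) = T \<Phi>"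
  unfolding T_def
 proof (rule integral_cong_AE)
  show "(%z. indicator D2 z * (X z \<bullet> \<mu> z)) \<in> borel_measurable lborel" using gr(3) by simp
  have "(%z. indicator D2 z *\<^sub>R pd v \<Phi> z) \<in> borel_measurable borel" for v
   by (rule borel_measurable_continuous_on_indicator[OF _ continuous_on_pd[OF open_ball CX(2)]]) auto
  then have "(%z. B1 z * (indicator D2 z *\<^sub>R pd 1 \<Phi> z) + B2 z * (indicator D2 z *\<^sub>R pd \<i> \<Phi> z)) \<in> borel_measurable lborel"
   by (intro borel_measurable_add borel_measurable_times) auto
  then show "(%z. indicator D2 z * (B1 z * pd 1 \<Phi> z + B2 z * pd \<i> \<Phi> z)) \<in> borel_measurable lborel"
   by (simp add: algebra_simps)
  show "AE z in lborel. indicator D2 z * (X z \<bullet> \<mu> z) = indicator D2 z * (B1 z * pd 1 \<Phi> z + B2 z * pd \<i> \<Phi> z)"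
   using dec AE_notin_S
  proof eventually_elim
   case (elim z)
   show ?case
   proof (cases "z \<in> A1")
    case True
    then have z: "z \<in> D2" by (simp add: A1_def)
    have "\<mu> z = B1 z *\<^sub>R mult_I (dx u z) + B2 z *\<^sub>R mult_I (dy u z)" using elim z by simp
    then show ?thesis
     by (simp add: X1[OF True] p1[OF True] Gf_def inner_add_right gderiv_gradient(2)[OF fd] dx_def[symmetric] dy_def[symmetric])
   next
    case False
    then have "z \<notin> D2 \<or> z \<in> A2" using un by blast
    then show ?thesis by (auto simp: X2 p2)
   qed
  qed
 qed
 then show "(%n. 2 * (LBINT z. lam n z * flux X z)) \<longlonglongrightarrow> T \<Phi>"
  using gr(4) stat0 by simp
qed

end

section \<open>Local charts of the plane\<close>

lemma near_scaling_estimate: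
 fixes g :: "complex => complex"
 assumes C: "convex C" and d: "!!z. z \<in> C ==> (g has_derivative g' z) (at z within C)" and k: "k \<ge> 0"
  and P: "!!z. z \<in> C ==> norm (g' z 1 - of_real k) \<le> k / 4"
  and Q: "!!z. z \<in> C ==> norm (g' z \<i> - \<i> * of_real k) \<le> k / 4"
  and xy: "x \<in> C" "y \<in> C"
 shows "norm (g x - g y - of_real k * (x - y)) \<le> k / 2 * norm (x - y)"
proof -
 have ex: "g' z v = Re v *\<^sub>R g' z 1 + Im v *\<^sub>R g' z \<i>" if "z \<in> C" for z v
  by (rule linear_complex_expand[OF has_derivative_linear[OF d[OF that]]])
 have "norm ((g x - of_real k * x) - (g y - of_real k * y)) \<le> k / 2 * norm (x - y)"
 proof (rule differentiable_bound[where S=C and f'="%z v. g' z v - of_real k * v"])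
  show "((%x. g x - of_real k * x) has_derivative (%v. g' z v - of_real k * v)) (at z within C)" if "z \<in> C" for z
   by (intro has_derivative_diff has_derivative_mult_right has_derivative_ident d[OF that])
  show "onorm (%v. g' z v - of_real k * v) \<le> k / 2" if z: "z \<in> C" for z
  proof (rule onorm_le)
   fix v
   have "g' z v - of_real k * v = Re v *\<^sub>R (g' z 1 - of_real k) + Im v *\<^sub>R (g' z \<i> - \<i> * of_real k)"
    unfolding ex[OF z, of v] by (simp add: complex_eq_iff algebra_simps)
   also have "norm \<dots> \<le> \<bar>Re v\<bar> * (k / 4) + \<bar>Im v\<bar> * (k / 4)"
    by (rule order.trans[OF norm_triangle_ineq], unfold norm_scaleR) (intro add_mono mult_left_mono P[OF z] Q[OF z] abs_ge_zero)
   also have "\<dots> \<le> norm v * (k / 4) + norm v * (k / 4)"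
    using k by (intro add_mono mult_right_mono abs_Re_le_cmod abs_Im_le_cmod) auto
   finally show "norm (g' z v - of_real k * v) \<le> k / 2 * norm v" by simp
  qed
 qed (use xy C in auto)
 then show ?thesis by (simp add: algebra_simps)
qed

text \<open>The derivative stays close to k times the identity, which makes \<open>g\<close>
  injective on the closed ball and its Jacobian positive. The image is open by invariance of domain
  and the inverse is C^1 by the explicit inverse of a 2 by 2 matrix.\<close>

lemma plane_chart:
 fixes g :: "complex => complex"
 assumes D: "open D" and g: "Ck_on 1 D g" and sub: "cball z0 r \<subseteq> D" and r: "r > 0" and k: "k > 0"
  and P: "!!z. z \<in> cball z0 r ==> norm (pd 1 g z - of_real k) \<le> k / 4"
  and Q: "!!z. z \<in> cball z0 r ==> norm (pd \<i> g z - \<i> * of_real k) \<le> k / 4"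
 obtains G where "inj_on g (cball z0 r)" "open (g ` ball z0 r)" "Ck_on 1 (g ` ball z0 r) G" "!!z. z \<in> ball z0 r ==> G (g z) = z"
proof -
 have gd: "(g has_derivative (%v. pd v g z)) (at z)" if "z \<in> cball z0 r" for z
  using has_derivative_pd[OF Ck1_differentiable[OF D g]] that sub by blast
 have ex: "pd v g z = Re v *\<^sub>R pd 1 g z + Im v *\<^sub>R pd \<i> g z" if "z \<in> cball z0 r" for z v
  by (rule linear_complex_expand[OF has_derivative_linear[OF gd[OF that]]])
 have est: "norm (g x - g y - of_real k * (x - y)) \<le> k / 2 * norm (x - y)" if "x \<in> cball z0 r" "y \<in> cball z0 r" for x y
  by (rule near_scaling_estimate[OF convex_cball has_derivative_at_withinI[OF gd] _ P Q that]) (use k in auto)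
 have inj: "inj_on g (cball z0 r)"
 proof (rule inj_onI)
  fix x y assume xy: "x \<in> cball z0 r" "y \<in> cball z0 r" "g x = g y"
  have "norm (of_real k * (x - y)) \<le> k / 2 * norm (x - y)" using est[OF xy(1,2)] xy(3) by (simp add: norm_minus_commute)
  then have "k * norm (x - y) \<le> k / 2 * norm (x - y)" using k by (simp add: norm_mult)
  then show "x = y" using k by (simp add: mult_le_cancel_right)
 qed
 have sb: "ball z0 r \<subseteq> cball z0 r" by auto
 have gc: "continuous_on (ball z0 r) g"
  using continuous_on_subset[OF Ck_on_continuous[OF D g]] sub sb by blast
 have op: "open (g ` ball z0 r)"
  by (rule invariance_of_domain[OF gc open_ball inj_on_subset[OF inj sb]])
 define G where "G = inv_into (ball z0 r) g"
 have Gg: "G (g z) = z" if "z \<in> ball z0 r" for z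
  unfolding G_def by (rule inv_into_f_f[OF inj_on_subset[OF inj sb] that])
 \<comment> \<open>The Jacobian determinant. Its diagonal product is at least (3k/4)^2 and its
   off-diagonal product at most (k/4)^2 in size.\<close>
 define Dt where "Dt z = Im (cnj (pd 1 g z) * pd \<i> g z)" for z
 have Dt: "Dt z > 0" if "z \<in> cball z0 r" for z
 proof -
  have "\<bar>Re (pd 1 g z - of_real k)\<bar> \<le> k / 4" "\<bar>Im (pd 1 g z - of_real k)\<bar> \<le> k / 4"
   using P[OF that] abs_Re_le_cmod abs_Im_le_cmod order.trans by blast+
  moreover have "\<bar>Re (pd \<i> g z - \<i> * of_real k)\<bar> \<le> k / 4" "\<bar>Im (pd \<i> g z - \<i> * of_real k)\<bar> \<le> k / 4"
   using Q[OF that] abs_Re_le_cmod abs_Im_le_cmod order.trans by blast+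
  ultimately have a: "\<bar>Re (pd 1 g z) - k\<bar> \<le> k / 4" "\<bar>Im (pd 1 g z)\<bar> \<le> k / 4" "\<bar>Re (pd \<i> g z)\<bar> \<le> k / 4" "\<bar>Im (pd \<i> g z) - k\<bar> \<le> k / 4"
   by simp_all
  have b: "3 * k / 4 \<le> Re (pd 1 g z)" "3 * k / 4 \<le> Im (pd \<i> g z)" using a(1,4) by linarith+
  have "(3 * k / 4) * (3 * k / 4) \<le> Re (pd 1 g z) * Im (pd \<i> g z)" using b k by (intro mult_mono) auto
  moreover have "\<bar>Im (pd 1 g z)\<bar> * \<bar>Re (pd \<i> g z)\<bar> \<le> (k / 4) * (k / 4)" by (rule mult_mono[OF a(2,3)]) (use k in auto)
  then have "Im (pd 1 g z) * Re (pd \<i> g z) \<le> (k / 4) * (k / 4)"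
   by (metis abs_ge_self abs_mult order.trans)
  moreover have "(k / 4) * (k / 4) < (3 * k / 4) * (3 * k / 4)" using k by simp
  ultimately show ?thesis by (simp add: Dt_def)
 qed
 \<comment> \<open>Cramer's rule for the equation that expresses \<open>v\<close> through
   \<open>pd 1 g z\<close> and \<open>pd \<i> g z\<close>.\<close>
 define Mi where "Mi z v = Complex (Im (cnj v * pd \<i> g z) / Dt z) (Im (cnj (pd 1 g z) * v) / Dt z)" for z v
 have Gd: "(G has_derivative Mi z) (at (g z))" if z: "z \<in> ball z0 r" for z
 proof (rule has_derivative_inverse_strong[OF open_ball z gc Gg gd])
  have zc: "z \<in> cball z0 r" using z by auto
  show "(%v. pd v g z) \<circ> Mi z = id"
  proof
   fix v
   have "Im (cnj v * pd \<i> g z) *\<^sub>R pd 1 g z + Im (cnj (pd 1 g z) * v) *\<^sub>R pd \<i> g z = Dt z *\<^sub>R v"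
    by (simp add: Dt_def complex_eq_iff algebra_simps)
   moreover have "pd (Mi z v) g z = (1 / Dt z) *\<^sub>R (Im (cnj v * pd \<i> g z) *\<^sub>R pd 1 g z + Im (cnj (pd 1 g z) * v) *\<^sub>R pd \<i> g z)"
    unfolding ex[OF zc, of "Mi z v"] by (simp add: Mi_def scaleR_add_right divide_inverse mult.commute)
   ultimately show "((%v. pd v g z) \<circ> Mi z) v = id v" using Dt[OF zc] by simp
  qed
 qed (use z in auto)
 have "Ck_on (Suc 0) (g ` ball z0 r) G"
 proof (rule Ck_on_SucI[OF op, where f'="%y. Mi (G y)"])
  show Gd': "(G has_derivative Mi (G y)) (at y)" if "y \<in> g ` ball z0 r" for y using that Gd Gg by auto
  have Gc: "continuous_on (g ` ball z0 r) G"
   by (intro continuous_at_imp_continuous_on ballI has_derivative_continuous[OF Gd'])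
  have Gi: "G ` (g ` ball z0 r) \<subseteq> ball z0 r" using Gg by auto
  have pc: "continuous_on (g ` ball z0 r) (%y. pd v g (G y))" for v
   by (rule continuous_on_compose2[OF continuous_on_subset[OF continuous_on_pd[OF D g]] Gc Gi]) (use sub sb in blast)
  have ne: "\<forall>y\<in>g ` ball z0 r. Dt (G y) \<noteq> 0"
  proof
   fix y assume "y \<in> g ` ball z0 r"
   then have "G y \<in> cball z0 r" using Gi sb by blast
   then show "Dt (G y) \<noteq> 0" using Dt by force
  qed
  show "Ck_on 0 (g ` ball z0 r) (%y. Mi (G y) i)" for i
   unfolding Ck_on.simps Mi_def Complex_eq
   by (intro continuous_on_add continuous_on_mult continuous_on_const continuous_on_of_real continuous_on_divide
     continuous_on_Im continuous_on_cnj pc ne) (simp add: Dt_def, intro continuous_intros pc)+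
 qed
 then have "Ck_on 1 (g ` ball z0 r) G" by simp
 then show ?thesis using that inj op Gg by blast
qed

section \<open>Admissible test functions\<close>

context fb_disc
begin

text \<open>Vanishing on a neighbourhood of \<open>S\<close> makes the coefficients integrable where
  they matter, and bounded partial derivatives make \<open>T\<close> converge; no condition is
  imposed at the circle.\<close>

definition adm :: "complex set => (complex => real) => bool" where
 "adm O' \<Phi> \<longleftrightarrow> open O' \<and> S \<subseteq> O' \<and> Ck_on 1 D2 \<Phi> \<and> (\<forall>z\<in>O' \<inter> D2. \<Phi> z = 0) \<and>
   (\<exists>M. \<forall>z\<in>D2. \<bar>pd 1 \<Phi> z\<bar> \<le> M \<and> \<bar>pd \<i> \<Phi> z\<bar> \<le> M)"

lemma admD:
 assumes "adm O' \<Phi>"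
 shows "open O'" "S \<subseteq> O'" "Ck_on 1 D2 \<Phi>" "!!z. z \<in> O' ==> z \<in> D2 ==> \<Phi> z = 0"
 using assms unfolding adm_def by blast+

lemma adm_bound:
 assumes "adm O' \<Phi>"
 obtains M where "M > 0" "!!z. z \<in> D2 ==> \<bar>pd 1 \<Phi> z\<bar> \<le> M" "!!z. z \<in> D2 ==> \<bar>pd \<i> \<Phi> z\<bar> \<le> M"
proof -
 obtain M where M: "\<forall>z\<in>D2. \<bar>pd 1 \<Phi> z\<bar> \<le> M \<and> \<bar>pd \<i> \<Phi> z\<bar> \<le> M"
  using assms unfolding adm_def by blast
 show ?thesis by (rule that[of "max M 1"]) (use M in \<open>auto simp: le_max_iff_disj simp del: mem_ball_0\<close>)
qed

lemma admI:
 assumes "open O'" "S \<subseteq> O'" "Ck_on 1 D2 \<Phi>" "!!z. z \<in> O' ==> z \<in> D2 ==> \<Phi> z = 0"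
  and "!!z. z \<in> D2 ==> \<bar>pd 1 \<Phi> z\<bar> \<le> M" "!!z. z \<in> D2 ==> \<bar>pd \<i> \<Phi> z\<bar> \<le> M"
 shows "adm O' \<Phi>"
 using assms unfolding adm_def by blast

lemma adm_mono: "adm O' \<Phi> ==> open O'' ==> S \<subseteq> O'' ==> O'' \<subseteq> O' ==> adm O'' \<Phi>"
 unfolding adm_def by blast

lemma adm_diff: "adm O' \<Phi> ==> z \<in> D2 ==> \<Phi> differentiable (at z)"
 by (rule Ck1_differentiable[OF open_ball admD(3)])

lemma adm_pd_0: assumes "adm O' \<Phi>" "z \<in> O' \<inter> D2" shows "pd v \<Phi> z = 0"
proof -
 have "pd v \<Phi> z = pd v (%_. 0) z"
  by (rule pd_cong_open[of "O' \<inter> D2"]) (use assms admD(1,4)[OF assms(1)] in auto)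
 then show ?thesis by (simp add: frechet_derivative_const)
qed

lemma adm_integrand:
 assumes "adm O' \<Phi>"
 shows "indicator D2 z * (B1 z * pd 1 \<Phi> z + B2 z * pd \<i> \<Phi> z)
   = indicator D2 z * pd 1 \<Phi> z * (indicator (D2 - O') z * B1 z) + indicator D2 z * pd \<i> \<Phi> z * (indicator (D2 - O') z * B2 z)"
 using adm_pd_0[OF assms, of z] by (cases "z \<in> D2"; cases "z \<in> O'") (auto simp: algebra_simps)

lemma adm_integrable:
 assumes a: "adm O' \<Phi>"
 shows "integrable lborel (%z. indicator D2 z * (B1 z * pd 1 \<Phi> z + B2 z * pd \<i> \<Phi> z))"
proof -
 obtain M where "M > 0" and M: "!!z. z \<in> D2 ==> \<bar>pd 1 \<Phi> z\<bar> \<le> M" "!!z. z \<in> D2 ==> \<bar>pd \<i> \<Phi> z\<bar> \<le> M" by (rule adm_bound[OF a]) (rule that)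
 note O = admD(1,2)[OF a] and C = admD(3)[OF a]
 have m: "(%z. indicator D2 z * pd v \<Phi> z) \<in> borel_measurable lborel" for v
  using borel_measurable_continuous_on_indicator[OF _ continuous_on_pd[OF open_ball C], of v] by simp
 have bd: "norm (indicator D2 z * pd 1 \<Phi> z) \<le> \<bar>M\<bar>" "norm (indicator D2 z * pd \<i> \<Phi> z) \<le> \<bar>M\<bar>" for z
  using M[of z] by (cases "z \<in> D2"; simp)+
 have "integrable lborel (%z. (indicator D2 z * pd 1 \<Phi> z) *\<^sub>R (indicator (D2 - O') z * B1 z))"
  "integrable lborel (%z. (indicator D2 z * pd \<i> \<Phi> z) *\<^sub>R (indicator (D2 - O') z * B2 z))"
  by (rule integrable_scaleR_bounded[OF B_integrable(1)[OF O] m bd(1)[unfolded real_norm_def]], rule integrable_scaleR_bounded[OF B_integrable(2)[OF O] m bd(2)[unfolded real_norm_def]])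
 then show ?thesis unfolding adm_integrand[OF a] real_scaleR_def by (rule Bochner_Integration.integrable_add)
qed

text \<open>Continuity of \<open>T\<close> in the C^1 norm, with a constant that depends only on the
  neighbourhood of \<open>S\<close>; it carries identities from smooth to C^1 test
  functions.\<close>

lemma T_bound:
 assumes a: "adm O' \<Phi>" and e: "!!z. z \<in> D2 ==> \<bar>pd 1 \<Phi> z\<bar> \<le> e" "!!z. z \<in> D2 ==> \<bar>pd \<i> \<Phi> z\<bar> \<le> e"
 shows "\<bar>T \<Phi>\<bar> \<le> e * (LBINT z. \<bar>indicator (D2 - O') z * B1 z\<bar> + \<bar>indicator (D2 - O') z * B2 z\<bar>)"
proof -
 note O = admD(1,2)[OF a]
 have e0: "e \<ge> 0" using order.trans[OF abs_ge_zero e(1)[of 0]] by simp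
 have "\<bar>T \<Phi>\<bar> \<le> (LBINT z. e * (\<bar>indicator (D2 - O') z * B1 z\<bar> + \<bar>indicator (D2 - O') z * B2 z\<bar>))"
  unfolding T_def real_norm_def[symmetric]
 proof (rule Bochner_Integration.integral_norm_bound_integral[OF adm_integrable[OF a]])
  show "integrable lborel (%z. e * (norm (indicator (D2 - O') z * B1 z) + norm (indicator (D2 - O') z * B2 z)))"
   using B_integrable[OF O] by (intro integrable_mult_right Bochner_Integration.integrable_add integrable_norm)
  fix z
  show "norm (indicator D2 z * (B1 z * pd 1 \<Phi> z + B2 z * pd \<i> \<Phi> z))
    \<le> e * (norm (indicator (D2 - O') z * B1 z) + norm (indicator (D2 - O') z * B2 z))"
  proof (cases "z \<in> D2 - O'")
   case True
   have "\<bar>B1 z * pd 1 \<Phi> z + B2 z * pd \<i> \<Phi> z\<bar> \<le> \<bar>B1 z\<bar> * e + \<bar>B2 z\<bar> * e"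
    using True e by (intro order.trans[OF abs_triangle_ineq] add_mono) (auto simp: abs_mult intro!: mult_left_mono)
   then show ?thesis using True by (simp add: algebra_simps)
  next
   case False
   then have eq0: "indicator D2 z * (B1 z * pd 1 \<Phi> z + B2 z * pd \<i> \<Phi> z) = 0"
    unfolding adm_integrand[OF a] by simp
   show ?thesis unfolding eq0 norm_zero by (intro mult_nonneg_nonneg e0 add_nonneg_nonneg norm_ge_zero)
  qed
 qed
 then show ?thesis by simp
qed

lemma adm_minus_T:
 assumes a: "adm O' \<Phi>" "adm O' \<Psi>"
 shows "adm O' (%z. \<Phi> z - \<Psi> z)" "T (%z. \<Phi> z - \<Psi> z) = T \<Phi> - T \<Psi>"
  "!!z v. z \<in> D2 ==> pd v (%z. \<Phi> z - \<Psi> z) z = pd v \<Phi> z - pd v \<Psi> z"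
proof -
 show pd: "pd v (%z. \<Phi> z - \<Psi> z) z = pd v \<Phi> z - pd v \<Psi> z" if "z \<in> D2" for z v
  by (rule pd_eqI[OF has_derivative_diff[OF has_derivative_pd has_derivative_pd]]) (rule adm_diff[OF a(1) that], rule adm_diff[OF a(2) that])
 obtain M1 where "M1 > 0" and M1: "!!z. z \<in> D2 ==> \<bar>pd 1 \<Phi> z\<bar> \<le> M1" "!!z. z \<in> D2 ==> \<bar>pd \<i> \<Phi> z\<bar> \<le> M1" by (rule adm_bound[OF a(1)]) (rule that)
 obtain M2 where "M2 > 0" and M2: "!!z. z \<in> D2 ==> \<bar>pd 1 \<Psi> z\<bar> \<le> M2" "!!z. z \<in> D2 ==> \<bar>pd \<i> \<Psi> z\<bar> \<le> M2" by (rule adm_bound[OF a(2)]) (rule that)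
 show "adm O' (%z. \<Phi> z - \<Psi> z)"
 proof (rule admI[where M="M1 + M2"])
  show "Ck_on 1 D2 (%z. \<Phi> z - \<Psi> z)" by (rule Ck_on_diff[OF open_ball admD(3)[OF a(1)] admD(3)[OF a(2)]])
  show "\<bar>pd 1 (%z. \<Phi> z - \<Psi> z) z\<bar> \<le> M1 + M2" if z: "z \<in> D2" for z
   unfolding pd[OF z] using M1(1)[OF z] M2(1)[OF z] by linarith
  show "\<bar>pd \<i> (%z. \<Phi> z - \<Psi> z) z\<bar> \<le> M1 + M2" if z: "z \<in> D2" for z
   unfolding pd[OF z] using M1(2)[OF z] M2(2)[OF z] by linarith
 qed (use admD[OF a(1)] admD[OF a(2)] in auto)
 have "(%z. indicator D2 z * (B1 z * pd 1 (%z. \<Phi> z - \<Psi> z) z + B2 z * pd \<i> (%z. \<Phi> z - \<Psi> z) z)) =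
  (%z. indicator D2 z * (B1 z * pd 1 \<Phi> z + B2 z * pd \<i> \<Phi> z) - indicator D2 z * (B1 z * pd 1 \<Psi> z + B2 z * pd \<i> \<Psi> z))"
 proof
  fix z
  show "indicator D2 z * (B1 z * pd 1 (%z. \<Phi> z - \<Psi> z) z + B2 z * pd \<i> (%z. \<Phi> z - \<Psi> z) z) =
   indicator D2 z * (B1 z * pd 1 \<Phi> z + B2 z * pd \<i> \<Phi> z) - indicator D2 z * (B1 z * pd 1 \<Psi> z + B2 z * pd \<i> \<Psi> z)"
   by (cases "z \<in> D2") (simp_all add: pd[of z] algebra_simps)
 qed
 then show "T (%z. \<Phi> z - \<Psi> z) = T \<Phi> - T \<Psi>"
  unfolding T_def using adm_integrable[OF a(1)] adm_integrable[OF a(2)] by simp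
qed

lemma adm_Cc:
 assumes c: "Cc 1 W c" and W: "W \<inter> S = {}"
 obtains O' where "adm O' c"
proof -
 obtain K where K: "compact K" "K \<subseteq> W" "!!x. x \<notin> K ==> c x = 0" using c by (auto elim: CcE)
 obtain M1 where M1: "!!z. norm (pd 1 c z) \<le> M1" using Cc_bounded[OF Cc_pd1[OF c Basis_c(1)]] by metis
 obtain M2 where M2: "!!z. norm (pd \<i> c z) \<le> M2" using Cc_bounded[OF Cc_pd1[OF c Basis_c(2)]] by metis
 have "adm (- K) c"
 proof (rule admI[where M="max M1 M2"])
  show "Ck_on 1 D2 c" by (rule Ck_on_subset[OF open_UNIV open_ball subset_UNIV Cc_Ck[OF c]])
  show "\<bar>pd 1 c z\<bar> \<le> max M1 M2" "\<bar>pd \<i> c z\<bar> \<le> max M1 M2" for z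
   using M1[of z] M2[of z] by auto
 qed (use K W compact_imp_closed[OF K(1)] in auto)
 then show ?thesis using that by blast
qed

end

subsection \<open>Testing with pullbacks of smooth functions\<close>

lemma le_0_if_small:
 assumes "!!e::real. e > 0 ==> a \<le> e * M" shows "a \<le> 0"
proof (rule ccontr)
 assume "\<not> a \<le> 0"
 then have a: "a > 0" by simp
 have M: "M > 0" using assms[of 1] a by simp
 have "a \<le> a / (2 * M) * M" using assms[of "a / (2 * M)"] a M by simp
 then show False using a M by simp
qed

lemma dist_sgn_le:
 fixes z :: complex
 assumes "z \<noteq> 0" "norm z \<le> 1"
 shows "sgn z \<in> circle" "dist z (sgn z) = 1 - norm z" "dist z (sgn z) \<le> 1 - z \<bullet> z"
proof -
 show "sgn z \<in> circle" using assms by (simp add: norm_sgn)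
 have "z - sgn z = (norm z - 1) *\<^sub>R sgn z" using assms by (simp add: sgn_div_norm algebra_simps)
 then have "norm (z - sgn z) = \<bar>norm z - 1\<bar> * norm (sgn z)" by simp
 then show eq: "dist z (sgn z) = 1 - norm z" using assms by (simp add: norm_sgn dist_norm)
 have "norm z * norm z \<le> norm z * 1" using assms by (intro mult_left_mono) auto
 then show "dist z (sgn z) \<le> 1 - z \<bullet> z" unfolding eq by (simp add: dot_square_norm power2_eq_square)
qed

text \<open>In a thin layer each point is close to its radial projection \<open>sgn z\<close> on the
  circle, where \<open>p\<close> vanishes; uniform continuity makes \<open>p\<close> small on the
  layer.\<close>

lemma lam_limit_continuous:
 fixes p :: "complex => real"
 assumes c: "continuous_on closed_D2 p" and z: "!!z. z \<in> circle ==> p z = 0"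
 shows "(%n. LBINT z. lam n z * (if z \<in> D2 then p z else 0)) \<longlonglongrightarrow> 0"
proof (rule lam_limit)
 have eq: "(%z. if z \<in> D2 then p z else 0) = (%z. indicator D2 z *\<^sub>R p z)" by (rule ext) (simp add: indicator_def)
 show "(%z. if z \<in> D2 then p z else 0) \<in> borel_measurable borel"
  unfolding eq by (rule borel_measurable_continuous_on_indicator[OF _ continuous_on_subset[OF c]]) auto
 fix e :: real assume e: "e > 0"
 obtain d where d: "d > 0" "!!x y. x \<in> closed_D2 ==> y \<in> closed_D2 ==> dist y x < d ==> dist (p y) (p x) < e"
  using compact_uniformly_continuous[OF c compact_cball] e unfolding uniformly_continuous_on_def by metis
 have "\<bar>p z\<bar> \<le> e" if zD: "z \<in> D2" "1 - z \<bullet> z < min d 1" for z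
 proof -
  have z0: "z \<noteq> 0" using zD(2) by auto
  have n: "norm z \<le> 1" using zD(1) by simp
  note s = dist_sgn_le[OF z0 n]
  have "dist (p z) (p (sgn z)) < e" by (rule d(2)) (use s zD in auto)
  then show ?thesis using z[OF s(1)] by (simp add: dist_norm)
 qed
 then show "\<exists>d>0. \<forall>z\<in>D2. 1 - z \<bullet> z < d \<longrightarrow> \<bar>if z \<in> D2 then p z else 0\<bar> \<le> e"
  using d(1) by (intro exI[of _ "min d 1"]) auto
qed

lemma continuous_cut:
 fixes h :: "complex => 'b::real_normed_vector"
 assumes c: "continuous_on closed_D2 h" and s: "!!z. z \<in> closed_D2 ==> z \<in> sphere z0 r ==> h z = 0"
 shows "continuous_on closed_D2 (%z. if z \<in> ball z0 r then h z else 0)"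
proof -
 have "continuous_on ((closed_D2 \<inter> cball z0 r) \<union> (closed_D2 - ball z0 r)) (%z. if z \<in> ball z0 r then h z else 0)"
 proof (rule continuous_on_closed_Un)
  have "continuous_on (closed_D2 \<inter> cball z0 r) h" using c by (rule continuous_on_subset) auto
  then show "continuous_on (closed_D2 \<inter> cball z0 r) (%z. if z \<in> ball z0 r then h z else 0)"
   by (rule continuous_on_eq) (use s in \<open>auto simp: less_le\<close>)
  show "continuous_on (closed_D2 - ball z0 r) (%z. if z \<in> ball z0 r then h z else 0)"
   by (rule continuous_on_eq[OF continuous_on_const[of _ 0]]) auto
 qed (auto intro: closed_Diff)
 moreover have "(closed_D2 \<inter> cball z0 r) \<union> (closed_D2 - ball z0 r) = closed_D2" by auto
 ultimately show ?thesis by simp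
qed

context fb_disc
begin

text \<open>The map \<open>p\<close> reduces the target to two real dimensions, so that
  \<open>F\<close> may be any planar function; with p o u close to a chart, arbitrary local test
  functions take this form.\<close>

definition pull :: "(complex2 => complex) => complex => real => (complex => real) => complex => real" where
 "pull p z0 r F z = (if z \<in> ball z0 r then F (p (u z)) else 0)"

lemma pull_speed:
 fixes p :: "complex2 => complex"
 assumes p: "Ck_on 1 UNIV p"
 shows "continuous_on closed_D2 (%z. pd (dx u z) p (u z))" "continuous_on closed_D2 (%z. pd (dy u z) p (u z))"
proof -
 have pdf: "p differentiable (at x)" for x by (rule Ck1_differentiable[OF open_UNIV p UNIV_I])
 have gen: "continuous_on closed_D2 (%z. pd (d z) p (u z))" if d: "continuous_on closed_D2 d" for d
 proof -
  have "continuous_on closed_D2 (%z. \<Sum>j\<in>Basis. (d z \<bullet> j) *\<^sub>R pd j p (u z))"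
   by (intro continuous_on_sum continuous_on_scaleR continuous_on_inner d continuous_on_const
     continuous_on_compose2[OF continuous_on_pd[OF open_UNIV p] cont(1) subset_UNIV])
  then show ?thesis by (rule continuous_on_eq) (rule pd_expand[OF pdf, symmetric])
 qed
 show "continuous_on closed_D2 (%z. pd (dx u z) p (u z))" "continuous_on closed_D2 (%z. pd (dy u z) p (u z))"
  by (rule gen[OF cont(2)], rule gen[OF cont(3)])
qed

lemma pull_adm:
 assumes p: "Ck_on 1 UNIV p" and S: "cball z0 r \<inter> S = {}"
  and F: "Cc 1 (- ((%z. p (u z)) ` (closed_D2 \<inter> sphere z0 r))) F"
 shows "adm (- cball z0 r) (pull p z0 r F)"
  and "!!z v. z \<in> D2 ==> pd v (pull p z0 r F) z = (if z \<in> ball z0 r then pd (pd (du u z v) p (u z)) F (p (u z)) else 0)"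
  and "continuous_on closed_D2 (pull p z0 r F)"
proof -
 obtain K where K: "compact K" "K \<subseteq> - ((%z. p (u z)) ` (closed_D2 \<inter> sphere z0 r))" "!!x. x \<notin> K ==> F x = 0"
  using F by (auto elim: CcE)
 have out: "p (u z) \<notin> K" if "z \<in> closed_D2" "z \<in> sphere z0 r" for z using K(2) that by blast
 have pdf: "p differentiable (at x)" for x by (rule Ck1_differentiable[OF open_UNIV p UNIV_I])
 have Fdf: "F differentiable (at x)" for x by (rule Cc_differentiable[OF F])
 have pc: "continuous_on closed_D2 (%z. p (u z))"
  by (rule continuous_on_compose2[OF Ck_on_continuous[OF open_UNIV p] cont(1) subset_UNIV])
 have gC: "Ck_on 1 D2 (%z. p (u z))" by (rule Ck_on_compose[OF open_ball open_UNIV subset_UNIV p uC])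
 have FgC: "Ck_on 1 D2 (%z. F (p (u z)))" by (rule Ck_on_compose[OF open_ball open_UNIV subset_UNIV Cc_Ck[OF F] gC])
 show c: "continuous_on closed_D2 (pull p z0 r F)" unfolding pull_def
 proof (rule continuous_cut)
  show "continuous_on closed_D2 (%z. F (p (u z)))"
   by (rule continuous_on_compose2[OF Ck_on_continuous[OF open_UNIV Cc_Ck[OF F]] pc subset_UNIV])
 qed (use out K(3) in blast)
 define A1 where "A1 = D2 \<inter> ball z0 r"
 define A2 where "A2 = (D2 \<inter> (%z. p (u z)) -` (- K)) \<union> (D2 - cball z0 r)"
 have A1: "open A1" unfolding A1_def by auto
 have "continuous_on D2 (%z. p (u z))" by (rule continuous_on_subset[OF pc ball_subset_cball])
 then have A2: "open A2" unfolding A2_def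
  by (intro open_Un continuous_open_preimage open_Diff closed_cball open_ball open_Compl compact_imp_closed[OF K(1)])
 have A12: "z \<in> A2" if "z \<in> D2" "z \<notin> ball z0 r" for z
  using that out[of z] by (cases "z \<in> sphere z0 r") (auto simp: A2_def)
 have D: "D2 = A1 \<union> A2"
 proof (rule set_eqI)
  fix z
  show "z \<in> D2 \<longleftrightarrow> z \<in> A1 \<union> A2"
  proof
   assume "z \<in> D2"
   then show "z \<in> A1 \<union> A2" using A12[of z] by (cases "z \<in> ball z0 r") (simp_all add: A1_def)
  next
   assume "z \<in> A1 \<union> A2"
   then show "z \<in> D2" unfolding A1_def A2_def by blast
  qed
 qed
 have e1: "pull p z0 r F z = F (p (u z))" if "z \<in> A1" for z using that by (simp add: A1_def pull_def)
 have e2: "pull p z0 r F z = 0" if "z \<in> A2" for z using that K(3) by (auto simp: A2_def pull_def)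
 have C: "Ck_on 1 D2 (pull p z0 r F)"
 proof -
  have "Ck_on 1 A1 (pull p z0 r F)"
   by (rule iffD2[OF Ck_on_cong[OF A1 e1] Ck_on_subset[OF open_ball A1 _ FgC]]) (auto simp: A1_def)
  moreover have "Ck_on 1 A2 (pull p z0 r F)"
   by (rule iffD2[OF Ck_on_cong[OF A2 e2] Ck_on_const[OF A2]])
  ultimately show ?thesis unfolding D by (rule Ck_on_open_Un[OF A1 A2])
 qed
 show pdp: "pd v (pull p z0 r F) z = (if z \<in> ball z0 r then pd (pd (du u z v) p (u z)) F (p (u z)) else 0)" if z: "z \<in> D2" for z v
 proof (cases "z \<in> ball z0 r")
  case True
  have zA: "z \<in> A1" using True z by (simp add: A1_def)
  have "pd v (pull p z0 r F) z = pd v (%z. F (p (u z))) z" by (rule pd_cong_open[OF A1 zA e1])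
  also have "\<dots> = pd (pd v (%z. p (u z)) z) F (p (u z))"
   by (rule pd_compose[OF Ck1_differentiable[OF open_ball gC z] Fdf])
  also have "pd v (%z. p (u z)) z = pd (du u z v) p (u z)"
   unfolding du_eq_pd[OF z] by (rule pd_compose[OF u_diff[OF z] pdf])
  finally show ?thesis using True by simp
 next
  case False
  have "pd v (pull p z0 r F) z = pd v (%_. 0::real) z" by (rule pd_cong_open[OF A2 A12[OF z False] e2])
  then show ?thesis using False by (simp add: frechet_derivative_const)
 qed
 obtain M1 where M1: "M1 > 0" "!!z. z \<in> closed_D2 ==> norm (pd (dx u z) p (u z)) \<le> M1"
  by (rule continuous_on_closed_D2_bound[OF pull_speed(1)[OF p]]) blast
 obtain M2 where M2: "M2 > 0" "!!z. z \<in> closed_D2 ==> norm (pd (dy u z) p (u z)) \<le> M2"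
  by (rule continuous_on_closed_D2_bound[OF pull_speed(2)[OF p]]) blast
 obtain N1 where N1: "N1 > 0" "!!z. norm (pd 1 F z) \<le> N1" using Cc_bounded[OF Cc_pd1[OF F Basis_c(1)]] by metis
 obtain N2 where N2: "N2 > 0" "!!z. norm (pd \<i> F z) \<le> N2" using Cc_bounded[OF Cc_pd1[OF F Basis_c(2)]] by metis
 have Fb: "\<bar>pd w F y\<bar> \<le> (M1 + M2) * (N1 + N2)" if "norm w \<le> M1 + M2" for w y
 proof -
  have "pd w F y = Re w *\<^sub>R pd 1 F y + Im w *\<^sub>R pd \<i> F y" by (rule linear_complex_expand[OF linear_pd[OF Fdf]])
  then have "\<bar>pd w F y\<bar> \<le> \<bar>Re w\<bar> * \<bar>pd 1 F y\<bar> + \<bar>Im w\<bar> * \<bar>pd \<i> F y\<bar>"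
   using abs_triangle_ineq[of "Re w * pd 1 F y" "Im w * pd \<i> F y"] by (simp add: abs_mult)
  also have "\<dots> \<le> (M1 + M2) * N1 + (M1 + M2) * N2"
   using that abs_Re_le_cmod[of w] abs_Im_le_cmod[of w] N1(2)[of y] N2(2)[of y] M1(1) M2(1)
   by (intro add_mono mult_mono) auto
  finally show ?thesis by (simp add: distrib_left)
 qed
 have pos: "0 \<le> (M1 + M2) * (N1 + N2)" using M1(1) M2(1) N1(1) N2(1) by simp
 show "adm (- cball z0 r) (pull p z0 r F)"
 proof (rule admI[OF _ _ C])
  fix z assume z: "z \<in> D2"
  then have zc: "z \<in> closed_D2" by simp
  have "norm (pd (dx u z) p (u z)) \<le> M1 + M2" "norm (pd (dy u z) p (u z)) \<le> M1 + M2"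
   using M1(2)[OF zc] M2(2)[OF zc] M1(1) M2(1) by linarith+
  note b = this[THEN Fb]
  show "\<bar>pd 1 (pull p z0 r F) z\<bar> \<le> (M1 + M2) * (N1 + N2)" "\<bar>pd \<i> (pull p z0 r F) z\<bar> \<le> (M1 + M2) * (N1 + N2)"
   unfolding pdp[OF z] dx_def[symmetric] dy_def[symmetric] using b pos by auto
 qed (use S in \<open>auto simp: pull_def\<close>)
qed

lemma flux_continuous:
 assumes fC: "!!k. Ck_on k UNIV f" and supp: "fun_support f \<inter> u ` (closed_D2 \<inter> sphere z0 r) = {}"
 shows "continuous_on closed_D2 (%z. (if z \<in> ball z0 r then mult_I (gradient f (u z)) else 0) \<bullet> (Re z *\<^sub>R dx u z + Im z *\<^sub>R dy u z))"
proof (intro continuous_on_inner continuous_on_add continuous_on_scaleR cont continuous_on_Re continuous_on_Im continuous_on_id continuous_cut)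
 have fd: "f differentiable (at x)" for x by (rule Ck1_differentiable[OF open_UNIV fC UNIV_I])
 show "continuous_on closed_D2 (%z. mult_I (gradient f (u z)))"
  by (rule continuous_on_compose2[OF Ck_on_continuous[OF open_UNIV Ck_on_linear_comp[OF open_UNIV mult_I_linear Ck_on_gradient[OF fC]]] cont(1) subset_UNIV])
 fix z assume "z \<in> closed_D2" "z \<in> sphere z0 r"
 then have zs: "u z \<notin> fun_support f" using supp by blast
 have cl: "closed (fun_support f)" by (simp add: fun_support_def)
 have "f x = 0" if "x \<notin> fun_support f" for x
  using that closure_subset[of "{x. f x \<noteq> 0}"] by (auto simp: fun_support_def)
 then have "pd i f (u z) = 0" for i by (rule pd_eq_0_outside[OF cl _ zs])
 then show "mult_I (gradient f (u z)) = 0" by (simp add: gderiv_gradient(1)[OF fd])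
qed

text \<open>In the interior there is no boundary contribution. At the circle the invariance of
  \<open>p\<close> gives I grad f orthogonal to x, which is both the admissibility of
  \<open>f\<close> and, as the radial derivative is a multiple of u, the vanishing of the
  flux.\<close>

lemma T_pull:
 assumes p: "!!k. Ck_on k UNIV p" and z0: "z0 \<in> closed_D2" and r: "r > 0" and S: "cball z0 r \<inter> S = {}"
  and F: "Cc 1 (- ((%z. p (u z)) ` (closed_D2 \<inter> sphere z0 r))) F"
  and bc: "cball z0 r \<subseteq> D2 \<or> (\<forall>x. pd (mult_I x) p x = 0) \<and>
   (\<forall>z\<in>circle \<inter> ball z0 r. \<exists>\<rho>. Re z *\<^sub>R dx u z + Im z *\<^sub>R dy u z = \<rho> *\<^sub>R u z)"
 shows "T (pull p z0 r F) = 0"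
proof -
 define W where "W = - ((%z. p (u z)) ` (closed_D2 \<inter> sphere z0 r))"
 have pdf: "p differentiable (at x)" for x by (rule Ck1_differentiable[OF open_UNIV p UNIV_I])
 have pc: "continuous_on closed_D2 (%z. p (u z))"
  by (rule continuous_on_compose2[OF Ck_on_continuous[OF open_UNIV p] cont(1) subset_UNIV])
 have "compact ((%z. p (u z)) ` (closed_D2 \<inter> sphere z0 r))"
  by (rule compact_continuous_image[OF continuous_on_subset[OF pc]]) (auto intro: compact_Int)
 then have W: "open W" unfolding W_def by (intro open_Compl compact_imp_closed)
 have smooth: "T (pull p z0 r \<psi>) = 0" if \<psi>: "!!k. Cc k W \<psi>" for \<psi>
 proof -
  obtain K where K: "compact K" "K \<subseteq> W" "!!x. x \<notin> K ==> \<psi> x = 0" using \<psi>[of 0] by (auto elim: CcE)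
  define f where [abs_def]: "f x = \<psi> (p x)" for x
  have fC: "Ck_on k UNIV f" for k unfolding f_def
   by (rule Ck_on_compose[OF open_UNIV open_UNIV subset_UNIV Cc_Ck[OF \<psi>] p])
  have fd: "f differentiable (at x)" for x by (rule Ck1_differentiable[OF open_UNIV fC UNIV_I])
  have "fun_support f \<subseteq> p -` K" unfolding fun_support_def
   by (intro closure_minimal closed_vimage compact_imp_closed[OF K(1)] Ck_on_continuous[OF open_UNIV p])
     (use K(3) in \<open>auto simp: f_def\<close>)
  then have supp: "fun_support f \<inter> u ` (closed_D2 \<inter> sphere z0 r) = {}"
   using K(2) unfolding W_def by blast
  have inv: "mult_I (gradient f x) \<bullet> x = 0" if "\<forall>x. pd (mult_I x) p x = 0" for x
  proof -
   have "pd (mult_I x) f x = pd (pd (mult_I x) p x) \<psi> (p x)"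
    unfolding f_def by (rule pd_compose[OF pdf Cc_differentiable[OF \<psi>]])
   also have "\<dots> = 0" unfolding that[rule_format] by (rule linear_0[OF linear_pd[OF Cc_differentiable[OF \<psi>]]])
   finally show ?thesis by (simp add: inner_mult_I_left gderiv_gradient(2)[OF fd])
  qed
  have bc': "cball z0 r \<subseteq> D2 \<or> (\<forall>x. norm x = 1 \<longrightarrow> mult_I (gradient f x) \<bullet> x = 0)"
   using bc inv by blast
  define P where "P z = (if z \<in> ball z0 r then mult_I (gradient f (u z)) else 0) \<bullet> (Re z *\<^sub>R dx u z + Im z *\<^sub>R dy u z)" for z
  have "continuous_on closed_D2 P" unfolding P_def by (rule flux_continuous[OF fC supp])
  moreover have "P z = 0" if z: "z \<in> circle" for z
  proof (cases "z \<in> ball z0 r")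
   case True
   have "z \<in> cball z0 r" "z \<notin> D2" using True z by auto
   then have "\<not> cball z0 r \<subseteq> D2" by blast
   then obtain \<rho> where "Re z *\<^sub>R dx u z + Im z *\<^sub>R dy u z = \<rho> *\<^sub>R u z" "\<forall>x. pd (mult_I x) p x = 0"
    using bc True z by blast
   then show ?thesis using True inv by (simp add: P_def)
  qed (simp add: P_def)
  ultimately have "(%n. LBINT z. lam n z * (if z \<in> D2 then P z else 0)) \<longlonglongrightarrow> 0"
   by (rule lam_limit_continuous)
  then have "(%n. 2 * (LBINT z. lam n z * (if z \<in> D2 then P z else 0))) \<longlonglongrightarrow> 2 * 0"
   by (rule tendsto_mult_left)
  moreover have "(%n. 2 * (LBINT z. lam n z * (if z \<in> D2 then P z else 0))) \<longlonglongrightarrow> T (%z. if z \<in> ball z0 r then f (u z) else 0)"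
   using first_variation(1)[OF z0 r fC supp bc'] unfolding flux_def P_def .
  ultimately have "T (%z. if z \<in> ball z0 r then f (u z) else 0) = 2 * 0" by (rule LIMSEQ_unique[rotated])
  then show ?thesis unfolding pull_def[abs_def] f_def by simp
 qed
 note F' = F[folded W_def]
 obtain M1 where M1: "M1 > 0" "!!z. z \<in> closed_D2 ==> norm (pd (dx u z) p (u z)) \<le> M1"
  by (rule continuous_on_closed_D2_bound[OF pull_speed(1)[OF p]]) blast
 obtain M2 where M2: "M2 > 0" "!!z. z \<in> closed_D2 ==> norm (pd (dy u z) p (u z)) \<le> M2"
  by (rule continuous_on_closed_D2_bound[OF pull_speed(2)[OF p]]) blast
 define J where "J = (LBINT z. \<bar>indicator (D2 - (- cball z0 r)) z * B1 z\<bar> + \<bar>indicator (D2 - (- cball z0 r)) z * B2 z\<bar>)"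
 \<comment> \<open>Stationarity covers smooth functions only; \<open>F\<close> is approximated in
   the C^1 norm, and the pulled back gradients differ by at most a fixed multiple of
   \<open>e\<close>.\<close>
 have "\<bar>T (pull p z0 r F)\<bar> \<le> 0"
 proof (rule le_0_if_small)
  fix e :: real assume e: "e > 0"
  obtain \<psi> where \<psi>: "!!k. Cc k W \<psi>" "!!x i. i \<in> Basis ==> \<bar>pd i \<psi> x - pd i F x\<bar> \<le> e"
   by (rule smooth_approx1[OF F' W e]) blast
  note aF = pull_adm[OF p S F] and a\<psi> = pull_adm[OF p S \<psi>(1)[unfolded W_def]]
  note am = adm_minus_T[OF aF(1) a\<psi>(1)]
  have w: "\<bar>pd w F y - pd w \<psi> y\<bar> \<le> 2 * (M1 + M2) * e" if "norm w \<le> M1 + M2" for w y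
  proof -
   have "pd w F y - pd w \<psi> y = Re w * (pd 1 F y - pd 1 \<psi> y) + Im w * (pd \<i> F y - pd \<i> \<psi> y)"
    using linear_complex_expand[OF linear_pd[OF Cc_differentiable[OF F]], of y w]
     linear_complex_expand[OF linear_pd[OF Cc_differentiable[OF \<psi>(1)]], of y w] by (simp add: right_diff_distrib)
   also have "\<bar>\<dots>\<bar> \<le> \<bar>Re w\<bar> * \<bar>pd 1 F y - pd 1 \<psi> y\<bar> + \<bar>Im w\<bar> * \<bar>pd \<i> F y - pd \<i> \<psi> y\<bar>"
    using abs_triangle_ineq[of "Re w * (pd 1 F y - pd 1 \<psi> y)" "Im w * (pd \<i> F y - pd \<i> \<psi> y)"] by (simp add: abs_mult)
   also have "\<dots> \<le> (M1 + M2) * e + (M1 + M2) * e"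
    using that abs_Re_le_cmod[of w] abs_Im_le_cmod[of w] \<psi>(2)[OF Basis_c(1), of y] \<psi>(2)[OF Basis_c(2), of y] M1(1) M2(1)
    by (intro add_mono mult_mono) (auto simp: abs_minus_commute)
   finally show ?thesis by (simp add: algebra_simps)
  qed
  have pos: "0 \<le> 2 * (M1 + M2) * e" using M1(1) M2(1) e by simp
  have d: "\<bar>pd 1 (%z. pull p z0 r F z - pull p z0 r \<psi> z) z\<bar> \<le> 2 * (M1 + M2) * e"
   "\<bar>pd \<i> (%z. pull p z0 r F z - pull p z0 r \<psi> z) z\<bar> \<le> 2 * (M1 + M2) * e" if z: "z \<in> D2" for z
  proof -
   have zc: "z \<in> closed_D2" using z by simp
   have "norm (pd (dx u z) p (u z)) \<le> M1 + M2" "norm (pd (dy u z) p (u z)) \<le> M1 + M2"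
    using M1(2)[OF zc] M2(2)[OF zc] M1(1) M2(1) by linarith+
   note b = this[THEN w]
   show "\<bar>pd 1 (%z. pull p z0 r F z - pull p z0 r \<psi> z) z\<bar> \<le> 2 * (M1 + M2) * e"
    "\<bar>pd \<i> (%z. pull p z0 r F z - pull p z0 r \<psi> z) z\<bar> \<le> 2 * (M1 + M2) * e"
    unfolding am(3)[OF z] aF(2)[OF z] a\<psi>(2)[OF z] dx_def[symmetric] dy_def[symmetric] using b pos by auto
  qed
  have "\<bar>T (%z. pull p z0 r F z - pull p z0 r \<psi> z)\<bar> \<le> 2 * (M1 + M2) * e * J"
   unfolding J_def by (rule T_bound[OF am(1) d])
  then show "\<bar>T (pull p z0 r F)\<bar> \<le> e * (2 * (M1 + M2) * J)"
   unfolding am(2) smooth[OF \<psi>(1)] by (simp add: mult_ac)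
 qed
 then show ?thesis by simp
qed

lemma T_add_Cc:
 assumes c: "Cc 1 W c" and d: "Cc 1 W d" and W: "W \<inter> S = {}"
 shows "T (%x. c x + d x) = T c + T d"
proof -
 obtain O1 where O1: "adm O1 (%x. c x + d x)" by (rule adm_Cc[OF Cc_add[OF c d] W])
 obtain O2 where O2: "adm O2 d" by (rule adm_Cc[OF d W])
 have O12: "open (O1 \<inter> O2)" "S \<subseteq> O1 \<inter> O2" using admD(1,2)[OF O1] admD(1,2)[OF O2] by auto
 have "T (%z. c z + d z - d z) = T (%x. c x + d x) - T d"
  by (rule adm_minus_T(2)[OF adm_mono[OF O1 O12] adm_mono[OF O2 O12]]) auto
 then show ?thesis by simp
qed

lemma frame_at:
 assumes z: "z \<in> closed_D2"
 shows "dx u z \<bullet> dy u z = 0" "norm (dy u z) = norm (dx u z)" "mult_I (dx u z) \<bullet> dy u z = 0" "dx u z \<bullet> mult_I (dy u z) = 0"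
 by (rule quat_frame[OF _ frame[OF z]]; simp)+

text \<open>Coordinates along the two first derivatives at \<open>z0\<close>. By conformality the
  composition with u has differential k times the identity at \<open>z0\<close>, with k the squared
  conformal factor.\<close>

lemma tangent_projection:
 assumes z0: "z0 \<in> closed_D2 - S"
 obtains pr :: "complex2 => complex" and k where "bounded_linear pr" "k > 0" "pr (dx u z0) = of_real k" "pr (dy u z0) = \<i> * of_real k"
proof -
 have z0c: "z0 \<in> closed_D2" using z0 by auto
 define pr where [abs_def]: "pr v = Complex (v \<bullet> dx u z0) (v \<bullet> dy u z0)" for v
 have "bounded_linear pr"
  unfolding pr_def linear_conv_bounded_linear[symmetric]
  by (rule linearI) (simp_all add: complex_eq_iff inner_add_left)
 moreover have "(norm (dx u z0))\<^sup>2 > 0" using dx_nonzero[OF z0] by simp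
 moreover have "pr (dx u z0) = of_real ((norm (dx u z0))\<^sup>2)" "pr (dy u z0) = \<i> * of_real ((norm (dx u z0))\<^sup>2)"
  using frame_at(1,2)[OF z0c] by (simp_all add: pr_def complex_eq_iff power2_norm_eq_inner[symmetric] inner_commute[of "dy u z0" "dx u z0"])
 ultimately show ?thesis using that by blast
qed

text \<open>Near an unbranched interior point the tangent projection of u is a chart, so every local
  test function is a pullback and stationarity applies to it. This is the weak harmonicity of the
  angle away from the branch points.\<close>

lemma T_interior:
 assumes c: "Cc 1 (D2 - S) c" shows "T c = 0"
proof (rule Cc1_local_to_global[OF _ c, where P="%c. T c = 0"])
 show op: "open (D2 - S)" by (rule open_Diff[OF open_ball S_closed])
 show "T (%_. 0) = 0" by (simp add: T_def frechet_derivative_const)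
 show "T (%x. c x + d x) = 0" if "Cc 1 (D2 - S) c" "Cc 1 (D2 - S) d" "T c = 0" "T d = 0" for c d
  using T_add_Cc[OF that(1,2)] that(3,4) by auto
 fix z0 assume z0: "z0 \<in> D2 - S"
 then have z0c: "z0 \<in> closed_D2" by auto
 obtain pr :: "complex2 => complex" and k where prl: "bounded_linear pr" and k: "k > 0"
  and pra: "pr (dx u z0) = of_real k" "pr (dy u z0) = \<i> * of_real k"
  by (rule tangent_projection[of z0]) (use z0 in auto)
 have prC: "Ck_on k UNIV pr" for k by (rule Ck_on_bounded_linear[OF open_UNIV prl])
 have prc: "continuous_on D2 (%z. pr (dx u z))" "continuous_on D2 (%z. pr (dy u z))"
  by (rule bounded_linear.continuous_on[OF prl continuous_on_subset[OF cont(2) ball_subset_cball]],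
    rule bounded_linear.continuous_on[OF prl continuous_on_subset[OF cont(3) ball_subset_cball]])
 \<comment> \<open>An open set where the first derivatives of the projected map are within k/4 of
   their values at \<open>z0\<close>, as the chart construction requires.\<close>
 define A where "A = (D2 - S) \<inter> (D2 \<inter> (%z. pr (dx u z)) -` ball (of_real k) (k / 4)) \<inter> (D2 \<inter> (%z. pr (dy u z)) -` ball (\<i> * of_real k) (k / 4))"
 have "open A" unfolding A_def by (intro open_Int op continuous_open_preimage prc open_ball)
 moreover have "z0 \<in> A" using z0 k pra by (auto simp: A_def)
 ultimately obtain r where r: "r > 0" "cball z0 r \<subseteq> A" using open_contains_cball by blast
 have rD: "cball z0 r \<subseteq> D2" "cball z0 r \<inter> S = {}" using r(2) by (auto simp: A_def)
 define g where [abs_def]: "g z = pr (u z)" for z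
 have gC: "Ck_on 1 D2 g" unfolding g_def by (rule Ck_on_linear_comp[OF open_ball prl uC])
 have pdg: "pd v g z = pr (pd v u z)" if "z \<in> D2" for v z unfolding g_def
  by (rule pd_bounded_linear[OF prl u_diff[OF that]])
 have PQ: "norm (pd 1 g z - of_real k) \<le> k / 4" "norm (pd \<i> g z - \<i> * of_real k) \<le> k / 4" if "z \<in> cball z0 r" for z
 proof -
  have zA: "z \<in> A" "z \<in> D2" using that r(2) rD(1) by blast+
  then have "pr (dx u z) \<in> ball (of_real k) (k / 4)" "pr (dy u z) \<in> ball (\<i> * of_real k) (k / 4)" by (auto simp: A_def)
  then show "norm (pd 1 g z - of_real k) \<le> k / 4" "norm (pd \<i> g z - \<i> * of_real k) \<le> k / 4"
   unfolding pdg[OF zA(2)] dx_eq_pd[OF zA(2)] dy_eq_pd[OF zA(2)] by (simp_all add: dist_norm norm_minus_commute)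
 qed
 obtain G where G: "inj_on g (cball z0 r)" "open (g ` ball z0 r)" "Ck_on 1 (g ` ball z0 r) G" "!!z. z \<in> ball z0 r ==> G (g z) = z"
  by (rule plane_chart[OF open_ball gC rD(1) r(1) k PQ]) (assumption | rule that)+
 have "T c = 0" if c: "Cc 1 ((D2 - S) \<inter> ball z0 r) c" for c
 proof -
  obtain K where K: "compact K" "K \<subseteq> (D2 - S) \<inter> ball z0 r" "!!x. x \<notin> K ==> c x = 0" using c by (auto elim: CcE)
  define F where [abs_def]: "F y = (if y \<in> g ` ball z0 r then c (G y) else 0)" for y
  have F: "Cc 1 (g ` ball z0 r) F" unfolding F_def
  proof (rule Cc_zero_extend[OF G(2)])
   show "Ck_on 1 (g ` ball z0 r) (%y. c (G y))"
    by (rule Ck_on_compose[OF G(2) open_UNIV subset_UNIV Cc_Ck[OF c] G(3)])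
   have "K \<subseteq> D2" using K(2) by blast
   then show "compact (g ` K)"
    by (intro compact_continuous_image continuous_on_subset[OF Ck_on_continuous[OF open_ball gC]] K(1))
   show "g ` K \<subseteq> g ` ball z0 r" using K(2) by blast
   fix y assume "y \<in> g ` ball z0 r" "y \<notin> g ` K"
   then obtain x where "x \<in> ball z0 r" "y = g x" "x \<notin> K" by blast
   then show "c (G y) = 0" using G(4) K(3) by simp
  qed
  \<comment> \<open>Injectivity on the closed ball separates the image of the open ball from that of
    the sphere, so \<open>F\<close> vanishes near the latter.\<close>
  have sub: "g ` ball z0 r \<subseteq> - ((%z. pr (u z)) ` (closed_D2 \<inter> sphere z0 r))"
  proof
   fix y assume "y \<in> g ` ball z0 r"
   then obtain x where x: "x \<in> ball z0 r" "y = g x" by blast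
   have "g x \<noteq> g z" if "z \<in> sphere z0 r" for z
    using inj_onD[OF G(1), of x z] x(1) that by auto
   then show "y \<in> - ((%z. pr (u z)) ` (closed_D2 \<inter> sphere z0 r))" unfolding x(2) g_def by blast
  qed
  have F0: "F (pr (u z)) = c z" if "z \<in> ball z0 r" for z
   using G(4)[OF that] imageI[OF that, of g] by (simp add: F_def g_def)
  have "pull pr z0 r F = c"
  proof
   fix z
   show "pull pr z0 r F z = c z" proof (cases "z \<in> ball z0 r")
    case False
    then have "z \<notin> K" using K(2) by blast
    then show ?thesis using False K(3) by (simp add: pull_def)
   qed (simp add: pull_def F0)
  qed
  moreover have "T (pull pr z0 r F) = 0"
   by (rule T_pull[OF prC z0c r(1) rD(2) Cc_mono[OF F order.refl sub]]) (use rD(1) in blast)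
  ultimately show ?thesis by simp
 qed
 then show "\<exists>r>0. \<forall>c. Cc 1 ((D2 - S) \<inter> ball z0 r) c \<longrightarrow> T c = 0" using r(1) by blast
qed

end

text \<open>By scaling, sector areas are proportional to the squared radius. The part of the layer
  where the density is at least n + 2 therefore meets the sector in area proportional to 1/(n + 2),
  and the product does not decay.\<close>

lemma lam_sector:
 assumes z0: "z0 \<in> circle" and \<theta>: "\<theta> > 0"
 obtains m where "m > 0" "!!n. m \<le> (LBINT z. lam n z * indicator {z. z \<noteq> 0 \<and> dist (sgn z) z0 < \<theta>} z)"
proof -
 define A where "A = {z::complex. z \<noteq> 0 \<and> dist (sgn z) z0 < \<theta>}"
 have "continuous_on (- {0}) (sgn :: complex => complex)" by (intro continuous_intros) auto
 then have "open ((- {0}) \<inter> sgn -` ball z0 \<theta>)" by (rule continuous_open_preimage) auto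
 also have "(- {0}) \<inter> sgn -` ball z0 \<theta> = A" by (auto simp: A_def dist_commute)
 finally have A: "open A" .
 define E where "E b = A \<inter> ball 0 b" for b
 have Eo: "open (E b)" for b using A by (auto simp: E_def)
 have Ef: "E b \<in> fmeasurable lborel" for b
  using emeasure_mono[of "E b" "ball 0 b" lborel] emeasure_lborel_ball_finite[of "0::complex" b] Eo
  by (intro fmeasurableI) (auto simp: E_def less_top intro: order.strict_trans1)
 have scale: "measure lborel (E b) = b\<^sup>2 * measure lborel (E 1)" if b: "b > 0" for b
 proof -
  have "E b = (%x. 0 + b *\<^sub>R x) ` E 1"
  proof (rule set_eqI)
   fix z
   have sg: "sgn (c *\<^sub>R w) = sgn w" if "c > 0" for c :: real and w :: complex using that by (simp add: sgn_scaleR)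
   show "z \<in> E b \<longleftrightarrow> z \<in> (%x. 0 + b *\<^sub>R x) ` E 1"
   proof
    assume z: "z \<in> E b"
    have "z = 0 + b *\<^sub>R ((1 / b) *\<^sub>R z)" using b by simp
    moreover have "(1 / b) *\<^sub>R z \<in> E 1" using z b sg[of "1 / b" z] by (simp add: E_def A_def pos_divide_less_eq)
    ultimately show "z \<in> (%x. 0 + b *\<^sub>R x) ` E 1" by blast
   next
    assume "z \<in> (%x. 0 + b *\<^sub>R x) ` E 1"
    then obtain w where w: "w \<in> E 1" "z = b *\<^sub>R w" by auto
    then show "z \<in> E b" using b sg[of b w] by (auto simp: E_def A_def)
   qed
  qed
  then have "measure lebesgue (E b) = \<bar>b\<bar> ^ DIM(complex) * measure lebesgue (E 1)"
   using measure_lebesgue_affine[of b 0 "E 1"] by simp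
  then show ?thesis using Eo by simp
 qed
 define \<mu>1 where "\<mu>1 = measure lborel (E 1)"
 have "(1/2) *\<^sub>R z0 \<in> E 1" using z0 \<theta> by (auto simp: E_def A_def sgn_scaleR sgn_div_norm)
 then obtain e where e: "e > 0" "ball ((1/2) *\<^sub>R z0) e \<subseteq> E 1" using Eo open_contains_ball by blast
 have "0 < measure lborel (ball ((1/2) *\<^sub>R z0) e)" by (rule content_ball_pos[OF e(1)])
 also have "\<dots> \<le> \<mu>1" unfolding \<mu>1_def by (rule measure_mono_fmeasurable[OF e(2) _ Ef]) auto
 finally have \<mu>1: "\<mu>1 > 0" .
 have "\<mu>1 / 2 \<le> (LBINT z. lam n z * indicator A z)" for n
 proof -
  define N where "N = real n + 2"
  have N: "N \<ge> 2" by (simp add: N_def)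
  \<comment> \<open>The radii between which N(1 - |z|^2) runs through [5/4, 7/4], where the
    derivative of \<open>step\<close> is at least 1.\<close>
  define a b where "a = sqrt (1 - 7 / 4 / N)" and "b = sqrt (1 - 5 / 4 / N)"
  have q: "7 / 4 / N < 1" "5 / 4 / N < 7 / 4 / N" using N by (auto simp: field_simps)
  then have ab: "0 < a" "a < b" "a\<^sup>2 = 1 - 7 / 4 / N" "b\<^sup>2 = 1 - 5 / 4 / N" by (auto simp: a_def b_def)
  have Ediff: "measure lborel (E b - E a) = 1 / (2 * N) * \<mu>1"
  proof -
   have "measure lborel (E b - E a) = measure lborel (E b) - measure lborel (E a)"
    by (rule measurable_measure_Diff) (use Ef Eo ab(2) in \<open>auto simp: E_def\<close>)
   also have "\<dots> = (b\<^sup>2 - a\<^sup>2) * \<mu>1" using ab scale[of a] scale[of b] by (simp add: \<mu>1_def left_diff_distrib)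
   also have "b\<^sup>2 - a\<^sup>2 = 1 / (2 * N)" unfolding ab(3,4) using N by (simp add: field_simps)
   finally show ?thesis .
  qed
  have Edf: "E b - E a \<in> fmeasurable lborel" using Ef Eo by (intro fmeasurable_Diff) auto
  have "\<mu>1 / 2 = (LBINT z. N * indicator (E b - E a) z)" using Ediff Edf N by (simp add: fmeasurable_def)
  also have "\<dots> \<le> (LBINT z. lam n z * indicator A z)"
  proof (rule integral_mono)
   show "integrable lborel (%z. N * indicator (E b - E a) z)" using Edf by (simp add: fmeasurable_def)
   show "integrable lborel (%z. lam n z * indicator A z)"
    by (rule lam_integral_bound(1)[OF borel_measurable_indicator[OF borel_open[OF A]], where e=1]) (simp add: indicator_def)
   fix z
   show "N * indicator (E b - E a) z \<le> lam n z * indicator A z"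
   proof (cases "z \<in> E b - E a")
    case True
    then have zA: "z \<in> A" and nz: "a \<le> norm z" "norm z < b" by (auto simp: E_def)
    have "a\<^sup>2 \<le> z \<bullet> z" "z \<bullet> z \<le> b\<^sup>2"
     unfolding power2_norm_eq_inner[symmetric] using nz ab(1) by (auto intro!: power_mono)
    then have "5 / 4 / N \<le> 1 - z \<bullet> z" "1 - z \<bullet> z \<le> 7 / 4 / N" unfolding ab(3,4) by auto
    note h = this
    have "N * (5 / 4 / N) \<le> N * (1 - z \<bullet> z)" by (rule mult_left_mono[OF h(1)]) (use N in simp)
    moreover have "N * (1 - z \<bullet> z) \<le> N * (7 / 4 / N)" by (rule mult_left_mono[OF h(2)]) (use N in simp)
    moreover have "N * (5 / 4 / N) = 5 / 4" "N * (7 / 4 / N) = 7 / 4" using N by auto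
    ultimately have "N * (1 - z \<bullet> z) \<in> {5/4..7/4}" by simp
    then have "1 \<le> step' (N * (1 - z \<bullet> z))" by (rule step'_ge)
    then have "N * 1 \<le> N * step' (N * (1 - z \<bullet> z))" using N by (intro mult_left_mono) auto
    then show ?thesis using True zA by (simp add: lam_def N_def)
   qed (use lam_nonneg[of n z] in \<open>auto simp: indicator_def\<close>)
  qed
  finally show ?thesis .
 qed
 then show ?thesis using \<mu>1 unfolding A_def by (intro that[of "\<mu>1 / 2"]) auto
qed

text \<open>The converse of the vanishing limit: on a thin layer \<open>p\<close> is at least
  \<kappa> on a sector and at least -\<epsilon> elsewhere. The sector contributes a fixed positive
  amount and the error at most 2 pi \<epsilon>.\<close>

lemma lam_not_tendsto_0:
 fixes p :: "complex => real"
 assumes c: "continuous_on closed_D2 p" and nn: "!!z. z \<in> circle ==> 0 \<le> p z" and z0: "z0 \<in> circle" "p z0 > 0"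
 shows "\<not> (%n. LBINT z. lam n z * (if z \<in> D2 then p z else 0)) \<longlonglongrightarrow> 0"
proof
 assume lim: "(%n. LBINT z. lam n z * (if z \<in> D2 then p z else 0)) \<longlonglongrightarrow> 0"
 define \<kappa> where "\<kappa> = p z0 / 2"
 have \<kappa>: "\<kappa> > 0" using z0 by (simp add: \<kappa>_def)
 have z0c: "z0 \<in> closed_D2" using z0 by auto
 obtain \<theta> where \<theta>: "\<theta> > 0" "!!w. w \<in> closed_D2 ==> dist w z0 < \<theta> ==> dist (p w) (p z0) < \<kappa>"
  using c z0c \<kappa> unfolding continuous_on_iff by metis
 define A where "A = {z. z \<noteq> 0 \<and> dist (sgn z) z0 < \<theta>}"
 obtain m where m: "m > 0" "!!n. m \<le> (LBINT z. lam n z * indicator A z)"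
  by (rule lam_sector[OF z0(1) \<theta>(1), folded A_def]) (rule that)
 \<comment> \<open>Chosen so that the total error 2 pi \<epsilon> is half of the gain \<kappa>
   m.\<close>
 define \<epsilon> where "\<epsilon> = \<kappa> * m / (4 * pi)"
 have \<epsilon>: "\<epsilon> > 0" using \<kappa> m by (simp add: \<epsilon>_def)
 obtain d where d: "d > 0" "!!x y. x \<in> closed_D2 ==> y \<in> closed_D2 ==> dist y x < d ==> dist (p y) (p x) < \<epsilon>"
  using compact_uniformly_continuous[OF c compact_cball] \<epsilon> unfolding uniformly_continuous_on_def by metis
 have "continuous_on (- {0}) (sgn :: complex => complex)" by (intro continuous_intros) auto
 then have "open ((- {0}) \<inter> sgn -` ball z0 \<theta>)" by (rule continuous_open_preimage) auto
 also have "(- {0}) \<inter> sgn -` ball z0 \<theta> = A" by (auto simp: A_def dist_commute)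
 finally have A: "open A" .
 obtain M where M: "M > 0" "!!z. z \<in> closed_D2 ==> norm (p z) \<le> M"
  by (rule continuous_on_closed_D2_bound[OF c]) blast
 have eq: "(%z. if z \<in> D2 then p z else 0) = (%z. indicator D2 z *\<^sub>R p z)" by (rule ext) (simp add: indicator_def)
 have pm: "(%z. if z \<in> D2 then p z else 0) \<in> borel_measurable borel"
  unfolding eq by (rule borel_measurable_continuous_on_indicator[OF _ continuous_on_subset[OF c]]) auto
 obtain N :: nat where N: "2 / min d 1 < real N" using reals_Archimedean2 by blast
 have low: "\<kappa> * m / 2 \<le> (LBINT z. lam n z * (if z \<in> D2 then p z else 0))" if n: "n \<ge> N" for n
 proof -
  have i1: "integrable lborel (%z. lam n z * indicator A z)" "integrable lborel (%z. lam n z * 1)"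
   by (rule lam_integral_bound(1)[OF borel_measurable_indicator[OF borel_open[OF A]], where e=1], simp add: indicator_def)
     (rule lam_integral_bound(1)[where p="%_. 1" and e=1], simp_all)
  have "\<bar>LBINT z. lam n z * 1\<bar> \<le> 2 * pi * 1" by (rule lam_integral_bound(2)[where p="%_. 1"]) simp_all
  then have l1: "(LBINT z. lam n z * 1) \<le> 2 * pi" by (simp add: abs_le_iff)
  have "\<kappa> * m / 2 = \<kappa> * m - \<epsilon> * (2 * pi)" by (simp add: \<epsilon>_def field_simps)
  also have "\<dots> \<le> \<kappa> * (LBINT z. lam n z * indicator A z) - \<epsilon> * (LBINT z. lam n z * 1)"
   using m(2)[of n] l1 \<kappa> \<epsilon> by (intro diff_mono mult_left_mono) auto
  also have "\<dots> = (LBINT z. \<kappa> * (lam n z * indicator A z) - \<epsilon> * (lam n z * 1))"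
   using i1 by simp
  also have "\<dots> \<le> (LBINT z. lam n z * (if z \<in> D2 then p z else 0))"
  proof (rule integral_mono)
   show "integrable lborel (%z. \<kappa> * (lam n z * indicator A z) - \<epsilon> * (lam n z * 1))"
    using i1 by (intro Bochner_Integration.integrable_diff integrable_mult_right)
   show "integrable lborel (%z. lam n z * (if z \<in> D2 then p z else 0))"
    by (rule lam_integral_bound(1)[OF pm, where e=M]) (use M in \<open>auto\<close>)
   fix z
   show "\<kappa> * (lam n z * indicator A z) - \<epsilon> * (lam n z * 1) \<le> lam n z * (if z \<in> D2 then p z else 0)"
   proof (cases "z \<in> layer n")
    case True
    have zD: "z \<in> D2" using True layer_sub by blast
    have "(real n + 2) * (1 - z \<bullet> z) \<le> 2" using True by (simp add: layer_iff)
    moreover have "2 < real N * min d 1" using N d(1) by (simp add: pos_divide_less_eq)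
    moreover have "real N * min d 1 \<le> (real n + 2) * min d 1" using n d(1) by (intro mult_right_mono) auto
    ultimately have "(real n + 2) * (1 - z \<bullet> z) < (real n + 2) * min d 1" by linarith
    then have zz: "1 - z \<bullet> z < min d 1" by (simp add: mult_less_cancel_left_pos)
    then have z0': "z \<noteq> 0" by auto
    have nz: "norm z \<le> 1" using zD by simp
    note s = dist_sgn_le[OF z0' nz]
    have sc: "sgn z \<in> closed_D2" using s(1) by auto
    have "dist (p z) (p (sgn z)) < \<epsilon>" by (rule d(2)) (use s sc zD zz in auto)
    then have p1: "p (sgn z) - \<epsilon> \<le> p z" by (simp add: dist_real_def abs_less_iff)
    have "\<kappa> * indicator A z - \<epsilon> \<le> p z"
    proof (cases "z \<in> A")
     case True
     then have "dist (p (sgn z)) (p z0) < \<kappa>" by (intro \<theta>(2) sc) (simp add: A_def)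
     then have "\<kappa> \<le> p (sgn z)" unfolding \<kappa>_def dist_real_def by linarith
     then show ?thesis using p1 True by simp
    next
     case False
     then show ?thesis using p1 nn[OF s(1)] by simp
    qed
    then have "lam n z * (\<kappa> * indicator A z - \<epsilon>) \<le> lam n z * p z" by (rule mult_left_mono[OF _ lam_nonneg])
    then show ?thesis using zD by (simp add: algebra_simps)
   qed (simp add: lam_eq_0)
  qed
  finally show ?thesis .
 qed
 have "\<kappa> * m / 2 \<le> 0" by (rule LIMSEQ_le_const[OF lim]) (use low in blast)
 then show False using \<kappa> m by (simp add: mult_le_0_iff)
qed

section \<open>Test functions that vanish on the circle\<close>

context fb_disc
begin

text \<open>Cut off by \<open>eta n\<close> and use interior harmonicity. The gradient of the cutoff
  grows like n, but \<Phi> decays linearly towards the circle, so their product is bounded and lives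
  on layers that leave every point; dominated convergence applies.\<close>

lemma T_zero_of_vanishing:
 assumes a: "adm O' \<Phi>" and c: "continuous_on closed_D2 \<Phi>" and z: "!!z. z \<in> circle ==> \<Phi> z = 0"
 shows "T \<Phi> = 0"
proof -
 obtain M where Mp: "M > 0" and M: "!!z. z \<in> D2 ==> \<bar>pd 1 \<Phi> z\<bar> \<le> M" "!!z. z \<in> D2 ==> \<bar>pd \<i> \<Phi> z\<bar> \<le> M"
  by (rule adm_bound[OF a]) (rule that)
 note O = admD(1,2)[OF a] and C = admD(3)[OF a]
 have lip: "norm (\<Phi> x - \<Phi> y) \<le> 2 * M * norm (x - y)" if "x \<in> D2" "y \<in> D2" for x y
 proof (rule differentiable_bound[OF convex_ball, where f'="%z v. pd v \<Phi> z"])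
  show "(\<Phi> has_derivative (%v. pd v \<Phi> z)) (at z within D2)" if "z \<in> D2" for z
   by (rule has_derivative_at_withinI[OF has_derivative_pd[OF adm_diff[OF a that]]])
  show "onorm (%v. pd v \<Phi> z) \<le> 2 * M" if zD: "z \<in> D2" for z
  proof (rule onorm_le)
   fix v
   have "pd v \<Phi> z = Re v * pd 1 \<Phi> z + Im v * pd \<i> \<Phi> z"
    using linear_complex_expand[OF linear_pd[OF adm_diff[OF a zD]], of v] by simp
   also have "\<bar>\<dots>\<bar> \<le> \<bar>Re v\<bar> * \<bar>pd 1 \<Phi> z\<bar> + \<bar>Im v\<bar> * \<bar>pd \<i> \<Phi> z\<bar>"
    using abs_triangle_ineq[of "Re v * pd 1 \<Phi> z" "Im v * pd \<i> \<Phi> z"] by (simp add: abs_mult)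
   also have "\<dots> \<le> norm v * M + norm v * M"
    by (intro add_mono mult_mono abs_Re_le_cmod abs_Im_le_cmod M zD) auto
   finally show "norm (pd v \<Phi> z) \<le> 2 * M * norm v" by (simp add: algebra_simps)
  qed
 qed (use that in auto)
 \<comment> \<open>The Lipschitz bound extends to the closed disc by continuity and is used between
   x and its projection to the circle.\<close>
 have bd: "\<bar>\<Phi> x\<bar> \<le> 2 * M * (1 - x \<bullet> x)" if x: "x \<in> D2" for x
 proof -
  have cl: "norm (\<Phi> x - \<Phi> y) \<le> 2 * M * norm (x - y)" if y: "y \<in> closed_D2" for y
  proof -
   have "0 \<le> 2 * M * norm (x - y) - norm (\<Phi> x - \<Phi> y)"
   proof (rule continuous_ge_on_closure[where S=D2 and f="%y. 2 * M * norm (x - y) - norm (\<Phi> x - \<Phi> y)"])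
    show "continuous_on (closure D2) (%y. 2 * M * norm (x - y) - norm (\<Phi> x - \<Phi> y))"
     using c by (auto intro!: continuous_intros)
   qed (use lip[OF x] y in auto)
   then show ?thesis by simp
  qed
  show ?thesis
  proof (cases "x = 0")
   case True
   then show ?thesis using cl[of 1] z[of 1] by simp
  next
   case False
   have "norm x \<le> 1" using x by simp
   note s = dist_sgn_le[OF False this]
   have "\<bar>\<Phi> x\<bar> \<le> 2 * M * dist x (sgn x)" using cl[of "sgn x"] s(1) z[OF s(1)] by (simp add: dist_norm)
   also have "\<dots> \<le> 2 * M * (1 - x \<bullet> x)" using s(3) Mp by (intro mult_left_mono) auto
   finally show ?thesis .
  qed
 qed
 define Y where [abs_def]: "Y x = (if x \<in> D2 then \<Phi> x else 0)" for x
 have YC: "Ck_on 1 D2 Y" by (rule iffD2[OF Ck_on_cong[OF open_ball] C]) (simp add: Y_def)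
 define E where [abs_def]: "E n x = (if x \<in> D2 then eta n x *\<^sub>R Y x else 0)" for n x
 have pdE: "pd v (E n) x = eta n x * pd v \<Phi> x - 2 * (x \<bullet> v) * lam n x * \<Phi> x" if x: "x \<in> D2" for v n x
 proof -
  have "pd v Y x = pd v \<Phi> x" by (rule pd_cong_open[OF open_ball x]) (simp add: Y_def)
  then show ?thesis using pd_eta_ext[OF YC, where v=v and n=n and z=x] x by (simp add: E_def Y_def)
 qed
 have EC: "Cc 1 (D2 - S) (E n)" for n
  unfolding E_def by (rule Cc_mono[OF Cc_eta_ext[OF YC O(1)] order.refl]) (use O(2) admD(4)[OF a] in \<open>auto simp: Y_def\<close>)
 have TE: "T (E n) = 0" for n by (rule T_interior[OF EC])
 define b where "b x = \<bar>indicator (D2 - O') x * B1 x\<bar> + \<bar>indicator (D2 - O') x * B2 x\<bar>" for x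
 define F where "F x = indicator D2 x * (B1 x * pd 1 \<Phi> x + B2 x * pd \<i> \<Phi> x)" for x
 define H where "H n x = indicator D2 x * (B1 x * pd 1 (E n) x + B2 x * pd \<i> (E n) x)" for n x
 have HF: "H n x = eta n x * F x - 2 * (lam n x * \<Phi> x) * (indicator D2 x * (B1 x * (x \<bullet> 1) + B2 x * (x \<bullet> \<i>)))" for n x
 proof (cases "x \<in> D2")
  case True
  show ?thesis unfolding H_def F_def pdE[OF True] by (simp add: algebra_simps)
 qed (simp add: H_def F_def)
 have Fi: "integrable lborel F" unfolding F_def by (rule adm_integrable[OF a])
 have Hi: "integrable lborel (H n)" for n
 proof -
  obtain O1 where "adm O1 (E n)" by (rule adm_Cc[OF EC]) auto
  then show ?thesis unfolding H_def by (rule adm_integrable)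
 qed
 have bi: "integrable lborel b" unfolding b_def
  using B_integrable[OF O] by (intro Bochner_Integration.integrable_add integrable_abs)
 have lamb: "\<bar>lam n x * \<Phi> x\<bar> \<le> 8 * M" if x: "x \<in> D2" for n x
 proof (cases "x \<in> layer n")
  case True
  have "(real n + 2) * (1 - x \<bullet> x) \<le> 2" using True by (simp add: layer_iff)
  have "\<bar>lam n x * \<Phi> x\<bar> \<le> (2 * (real n + 2)) * (2 * M * (1 - x \<bullet> x))"
   unfolding abs_mult using bd[OF x] lam_le[of n x] lam_nonneg[of n x] True by (intro mult_mono) auto
  also have "\<dots> = 4 * M * ((real n + 2) * (1 - x \<bullet> x))" by (simp add: algebra_simps)
  also have "\<dots> \<le> 4 * M * 2" using \<open>(real n + 2) * (1 - x \<bullet> x) \<le> 2\<close> Mp by (intro mult_left_mono) auto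
  finally show ?thesis by simp
 qed (use Mp in \<open>simp add: lam_eq_0\<close>)
 have "(%n. LBINT x. H n x) \<longlonglongrightarrow> (LBINT x. F x)"
 proof (rule integral_dominated_convergence[where w="%x. \<bar>F x\<bar> + 16 * M * b x"])
  show "F \<in> borel_measurable lborel" using Fi by auto
  show "H n \<in> borel_measurable lborel" for n using Hi by auto
  show "integrable lborel (%x. \<bar>F x\<bar> + 16 * M * b x)"
   using Fi bi by (intro Bochner_Integration.integrable_add integrable_mult_right integrable_abs)
  show "AE x in lborel. (%n. H n x) \<longlonglongrightarrow> F x"
  proof (rule AE_I2)
   fix x
   show "(%n. H n x) \<longlonglongrightarrow> F x"
   proof (cases "x \<in> D2")
    case True
    then have "norm x < 1" by simp
    then have p: "1 - x \<bullet> x > 0" by (simp add: norm_eq_sqrt_inner)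
    obtain N :: nat where N: "2 / (1 - x \<bullet> x) < real N" using reals_Archimedean2 by blast
    have "eta n x * F x = H n x" if "n \<ge> N" for n
    proof -
     have "2 < real N * (1 - x \<bullet> x)" using N p by (simp add: pos_divide_less_eq)
     also have "\<dots> \<le> (real n + 2) * (1 - x \<bullet> x)" using that p by (intro mult_right_mono) auto
     finally have "x \<notin> layer n" by (simp add: layer_iff)
     then show ?thesis by (simp add: HF lam_eq_0)
    qed
    then have "\<forall>\<^sub>F n in sequentially. eta n x * F x = H n x" unfolding eventually_sequentially by blast
    moreover have "(%n. eta n x * F x) \<longlonglongrightarrow> 1 * F x" by (intro tendsto_mult_right eta_tendsto True)
    ultimately have "(%n. H n x) \<longlonglongrightarrow> 1 * F x" by (rule Lim_transform_eventually[rotated])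
    then show ?thesis by simp
   qed (simp add: H_def F_def)
  qed
  show "AE x in lborel. norm (H n x) \<le> \<bar>F x\<bar> + 16 * M * b x" for n
  proof (rule AE_I2)
   fix x
   show "norm (H n x) \<le> \<bar>F x\<bar> + 16 * M * b x"
   proof (cases "x \<in> D2")
    case True
    have e: "\<bar>eta n x * F x\<bar> \<le> \<bar>F x\<bar>"
     using eta_bounds[of n x] mult_right_mono[of "eta n x" 1 "\<bar>F x\<bar>"] by (simp add: abs_mult)
    have "\<bar>2 * (lam n x * \<Phi> x) * (B1 x * (x \<bullet> 1) + B2 x * (x \<bullet> \<i>))\<bar> \<le> 16 * M * b x"
    proof (cases "x \<in> O'")
     case True
     then have "\<Phi> x = 0" using admD(4)[OF a] \<open>x \<in> D2\<close> by blast
     then show ?thesis using Mp by (simp add: b_def)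
    next
     case False
     have n1: "norm x \<le> 1" using True by simp
     have "\<bar>x \<bullet> 1\<bar> \<le> 1" "\<bar>x \<bullet> \<i>\<bar> \<le> 1"
      using n1 Cauchy_Schwarz_ineq2[of x 1] Cauchy_Schwarz_ineq2[of x \<i>] by auto
     then have "\<bar>B1 x * (x \<bullet> 1)\<bar> \<le> \<bar>B1 x\<bar>" "\<bar>B2 x * (x \<bullet> \<i>)\<bar> \<le> \<bar>B2 x\<bar>"
      by (simp_all add: abs_mult mult_left_le)
     then have "\<bar>B1 x * (x \<bullet> 1) + B2 x * (x \<bullet> \<i>)\<bar> \<le> b x"
      using True False abs_triangle_ineq[of "B1 x * (x \<bullet> 1)" "B2 x * (x \<bullet> \<i>)"] by (simp add: b_def)
     then have "\<bar>lam n x * \<Phi> x\<bar> * \<bar>B1 x * (x \<bullet> 1) + B2 x * (x \<bullet> \<i>)\<bar> \<le> (8 * M) * b x"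
      using lamb[OF True, of n] Mp by (intro mult_mono) auto
     then show ?thesis by (simp add: abs_mult mult_ac)
    qed
    then show ?thesis using e True abs_triangle_ineq4[of "eta n x * F x" "2 * (lam n x * \<Phi> x) * (B1 x * (x \<bullet> 1) + B2 x * (x \<bullet> \<i>))"]
     by (simp add: HF)
   qed (use Mp in \<open>simp add: H_def b_def\<close>)
  qed
 qed
 moreover have "(LBINT x. H n x) = 0" for n using TE[of n] by (simp add: T_def H_def)
 moreover have "(LBINT x. F x) = T \<Phi>" by (simp add: T_def F_def)
 ultimately have "(%n::nat. 0) \<longlonglongrightarrow> T \<Phi>" by simp
 then show ?thesis by (simp add: LIMSEQ_const_iff)
qed

lemma closed_D2_nbhd:
 fixes h :: "complex => 'b::topological_space"
 assumes "continuous_on closed_D2 h" "z0 \<in> closed_D2" "open V" "h z0 \<in> V"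
 obtains r where "r > 0" "!!z. z \<in> closed_D2 ==> z \<in> cball z0 r ==> h z \<in> V"
proof -
 obtain A where A: "open A" "closed_D2 \<inter> h -` V = closed_D2 \<inter> A"
  using assms(1,3) unfolding continuous_on_open_invariant by (metis Int_commute)
 then have "z0 \<in> A" using assms(2,4) by blast
 then obtain r where "r > 0" "cball z0 r \<subseteq> A" using A(1) open_contains_cball by blast
 then show ?thesis using that[of r] A(2) by blast
qed

end

subsection \<open>The radial derivative along the circle\<close>

lemma hermitian_eq_0:
 assumes "v \<bullet> w = 0" "v \<bullet> mult_I w = 0"
 shows "fst v * cnj (fst w) + snd v * cnj (snd w) = 0"
 using assms by (simp add: complex_eq_iff inner_complex2 mult_I_def algebra_simps)

text \<open>Real orthogonality to a vector and to its \<open>mult_I\<close> image is Hermitian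
  orthogonality, and two nonzero Hermitian orthogonal vectors span the complex plane of dimension
  two.\<close>

lemma hermitian_orthogonal_pair:
 assumes u: "u \<noteq> 0" and t: "t \<noteq> 0" and ut: "t \<bullet> u = 0" "t \<bullet> mult_I u = 0"
  and w: "w \<bullet> u = 0" "w \<bullet> mult_I u = 0" "w \<bullet> t = 0" "w \<bullet> mult_I t = 0"
 shows "w = (0 :: complex2)"
proof -
 obtain u1 u2 t1 t2 w1 w2 where e: "u = (u1, u2)" "t = (t1, t2)" "w = (w1, w2)" by (meson surj_pair)
 have h: "t1 * cnj u1 + t2 * cnj u2 = 0" "w1 * cnj u1 + w2 * cnj u2 = 0" "w1 * cnj t1 + w2 * cnj t2 = 0"
  using hermitian_eq_0[OF ut] hermitian_eq_0[OF w(1,2)] hermitian_eq_0[OF w(3,4)] by (simp_all add: e)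
 have "(w1 * t2 - w2 * t1) * cnj u1 = t2 * (w1 * cnj u1 + w2 * cnj u2) - w2 * (t1 * cnj u1 + t2 * cnj u2)"
  "(w1 * t2 - w2 * t1) * cnj u2 = w1 * (t1 * cnj u1 + t2 * cnj u2) - t1 * (w1 * cnj u1 + w2 * cnj u2)"
  by (simp_all add: algebra_simps)
 then have "(w1 * t2 - w2 * t1) * cnj u1 = 0" "(w1 * t2 - w2 * t1) * cnj u2 = 0" unfolding h by simp_all
 then have d: "w1 * t2 = w2 * t1" using u by (auto simp: e zero_prod_def)
 have "w1 * (t1 * cnj t1 + t2 * cnj t2) = t1 * (w1 * cnj t1 + w2 * cnj t2) + cnj t2 * (w1 * t2 - w2 * t1)"
  "w2 * (t1 * cnj t1 + t2 * cnj t2) = t2 * (w1 * cnj t1 + w2 * cnj t2) - cnj t1 * (w1 * t2 - w2 * t1)"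
  by (simp_all add: algebra_simps)
 then have z: "w1 * (t1 * cnj t1 + t2 * cnj t2) = 0" "w2 * (t1 * cnj t1 + t2 * cnj t2) = 0" unfolding h d by simp_all
 have "t1 * cnj t1 + t2 * cnj t2 = of_real ((norm t1)\<^sup>2 + (norm t2)\<^sup>2)" by (simp only: of_real_add complex_norm_square)
 also have "\<dots> \<noteq> 0" using t unfolding of_real_eq_0_iff by (auto simp: e zero_prod_def sum_power2_eq_zero_iff)
 finally show ?thesis using z by (simp add: e zero_prod_def)
qed

context fb_disc
begin

definition rad :: "complex => complex2" where
 "rad z = Re z *\<^sub>R dx u z + Im z *\<^sub>R dy u z"

lemma du_radial: "z \<in> closed_D2 ==> du u z z = rad z"
 by (simp add: rad_def du_expand[OF C1])

lemma dtau_eq: "z \<in> closed_D2 ==> dtau u z = - Im z *\<^sub>R dx u z + Re z *\<^sub>R dy u z"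
 by (simp add: dtau_def du_expand[OF C1])

lemma rad_cont: "continuous_on closed_D2 rad" unfolding rad_def[abs_def]
 by (intro continuous_intros cont)

lemma circle_not_S: "z \<in> circle ==> z \<in> closed_D2 - S" using branch(2) by auto

text \<open>The near-scaling estimate needs only a convex set, so it applies on the closed disc up
  to boundary points. Injectivity later keeps the image of a point away from the image of a cutting
  sphere around it.\<close>

lemma u_inj_near:
 assumes z0: "z0 \<in> closed_D2 - S"
 obtains r where "r > 0" "inj_on u (closed_D2 \<inter> cball z0 r)"
proof -
 have z0c: "z0 \<in> closed_D2" using z0 by auto
 obtain pr :: "complex2 => complex" and k where pr: "bounded_linear pr" "k > 0" "pr (dx u z0) = of_real k" "pr (dy u z0) = \<i> * of_real k"
  by (rule tangent_projection[OF z0])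
 have b: "pr (dx u z0) \<in> ball (of_real k) (k / 4)" "pr (dy u z0) \<in> ball (\<i> * of_real k) (k / 4)" using pr by auto
 obtain r1 where r1: "r1 > 0" "!!z. z \<in> closed_D2 ==> z \<in> cball z0 r1 ==> pr (dx u z) \<in> ball (of_real k) (k / 4)"
  by (rule closed_D2_nbhd[OF bounded_linear.continuous_on[OF pr(1) cont(2)] z0c open_ball b(1)]) blast
 obtain r2 where r2: "r2 > 0" "!!z. z \<in> closed_D2 ==> z \<in> cball z0 r2 ==> pr (dy u z) \<in> ball (\<i> * of_real k) (k / 4)"
  by (rule closed_D2_nbhd[OF bounded_linear.continuous_on[OF pr(1) cont(3)] z0c open_ball b(2)]) blast
 define r where "r = min r1 r2"
 define C where "C = closed_D2 \<inter> cball z0 r"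
 have Cc: "z \<in> closed_D2" "z \<in> cball z0 r1" "z \<in> cball z0 r2" if "z \<in> C" for z using that by (auto simp: C_def r_def)
 have est: "norm (pr (u x) - pr (u y) - of_real k * (x - y)) \<le> k / 2 * norm (x - y)" if xy: "x \<in> C" "y \<in> C" for x y
 proof (rule near_scaling_estimate[where g="%z. pr (u z)" and g'="%z v. pr (du u z v)" and C=C])
  show "convex C" unfolding C_def by (intro convex_Int convex_cball)
  show "((%z. pr (u z)) has_derivative (%v. pr (du u z v))) (at z within C)" if "z \<in> C" for z
   by (rule bounded_linear.has_derivative[OF pr(1) has_derivative_subset[OF C1cd_has_derivative[OF C1 Cc(1)[OF that]]]]) (simp add: C_def)
  show "norm (pr (du u z 1) - of_real k) \<le> k / 4" if "z \<in> C" for z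
   using r1(2)[OF Cc(1,2)[OF that]] by (simp add: dx_def dist_norm norm_minus_commute)
  show "norm (pr (du u z \<i>) - \<i> * of_real k) \<le> k / 4" if "z \<in> C" for z
   using r2(2)[OF Cc(1,3)[OF that]] by (simp add: dy_def dist_norm norm_minus_commute)
 qed (use pr(2) xy in auto)
 have "inj_on u C"
 proof (rule inj_onI)
  fix x y assume xy: "x \<in> C" "y \<in> C" "u x = u y"
  have "norm (of_real k * (x - y)) \<le> k / 2 * norm (x - y)" using est[OF xy(1,2)] xy(3) by (simp add: norm_minus_commute)
  then have "k * norm (x - y) \<le> k / 2 * norm (x - y)" using pr(2) by (simp add: norm_mult)
  then show "x = y" using pr(2) by (simp add: mult_le_cancel_right)
 qed
 moreover have "r > 0" using r1(1) r2(1) by (simp add: r_def)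
 ultimately show ?thesis using that unfolding C_def by blast
qed

lemma dtau_orthogonal:
 assumes z: "z \<in> circle" shows "dtau u z \<bullet> u z = 0"
proof -
 have zc: "z \<in> closed_D2" using z by auto
 define \<gamma> where [abs_def]: "\<gamma> t = cis t * z" for t
 have g: "\<gamma> ` UNIV \<subseteq> circle" using z by (auto simp: \<gamma>_def norm_mult)
 have gd: "(\<gamma> has_derivative (%t. t *\<^sub>R (\<i> * z))) (at 0)"
 proof -
  have "((%w. exp (\<i> * w) * z) has_field_derivative \<i> * z) (at (of_real 0))"
   by (auto intro!: derivative_eq_intros)
  from has_vector_derivative_real_field[OF this] show ?thesis
   by (simp add: has_vector_derivative_def \<gamma>_def cis_conv_exp)
 qed
 have "(u has_derivative du u z) (at (\<gamma> 0) within \<gamma> ` UNIV)"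
  using has_derivative_subset[OF C1cd_has_derivative[OF C1 zc], of "\<gamma> ` UNIV"] g by (force simp: \<gamma>_def)
 then have ud: "((%t. u (\<gamma> t)) has_derivative (%t. du u z (t *\<^sub>R (\<i> * z)))) (at 0)"
  using diff_chain_within[OF gd] by (simp add: o_def)
 have "((%t. u (\<gamma> t) \<bullet> u (\<gamma> t)) has_derivative (%t. u (\<gamma> 0) \<bullet> du u z (t *\<^sub>R (\<i> * z)) + du u z (t *\<^sub>R (\<i> * z)) \<bullet> u (\<gamma> 0))) (at 0)"
  by (rule has_derivative_inner[OF ud ud])
 moreover have "(%t. u (\<gamma> t) \<bullet> u (\<gamma> t)) = (%t. 1)"
 proof
  fix t
  have "norm (u (\<gamma> t)) = 1" using g by (intro circ) blast
  then show "u (\<gamma> t) \<bullet> u (\<gamma> t) = 1" by (simp add: dot_square_norm)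
 qed
 ultimately have "((%t::real. 1::real) has_derivative (%t. u (\<gamma> 0) \<bullet> du u z (t *\<^sub>R (\<i> * z)) + du u z (t *\<^sub>R (\<i> * z)) \<bullet> u (\<gamma> 0))) (at 0)" by simp
 from has_derivative_unique[OF this has_derivative_const]
 have "u (\<gamma> 0) \<bullet> du u z (1 *\<^sub>R (\<i> * z)) + du u z (1 *\<^sub>R (\<i> * z)) \<bullet> u (\<gamma> 0) = 0" by metis
 then show ?thesis by (simp add: dtau_def \<gamma>_def inner_commute)
qed

text \<open>The test function |x|^2 - 1 times a bump vanishes on the sphere. Its pullback therefore
  has \<open>T\<close> equal to 0, although its gradient there is twice the bump times x. The flux
  is then twice the bump times the inner product of I u and the radial derivative, of constant sign
  near \<open>z0\<close> if nonzero, which contradicts its vanishing limit.\<close>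

lemma rad_dot_I:
 assumes z0: "z0 \<in> circle" shows "rad z0 \<bullet> mult_I (u z0) = 0"
proof (rule ccontr)
 assume ne: "rad z0 \<bullet> mult_I (u z0) \<noteq> 0"
 have z0c: "z0 \<in> closed_D2" using z0 by auto
 \<comment> \<open>Normalizes the sign, so that the flux density is nonnegative on the circle and
   the lower bound for layer integrals can be applied.\<close>
 define \<sigma> where "\<sigma> = sgn (mult_I (u z0) \<bullet> rad z0)"
 define q where [abs_def]: "q z = \<sigma> * (mult_I (u z) \<bullet> rad z)" for z
 have q0: "q z0 > 0" using ne by (simp add: q_def \<sigma>_def sgn_if inner_commute)
 have qc: "continuous_on closed_D2 q" unfolding q_def
  by (intro continuous_intros rad_cont bounded_linear.continuous_on[OF mult_I_linear] cont)
 obtain r1 where r1: "r1 > 0" "inj_on u (closed_D2 \<inter> cball z0 r1)" by (rule u_inj_near[OF circle_not_S[OF z0]])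
 obtain r2 where r2: "r2 > 0" "!!z. z \<in> closed_D2 ==> z \<in> cball z0 r2 ==> q z \<in> {0<..}"
  by (rule closed_D2_nbhd[OF qc z0c open_greaterThan[of 0]]) (use q0 in auto)
 have "z0 \<in> - S" "open (- S)" using circle_not_S[OF z0] S_closed by auto
 then obtain r3 where r3: "r3 > 0" "cball z0 r3 \<subseteq> - S" using open_contains_cball by blast
 define r where "r = min r1 (min r2 r3)"
 have r: "r > 0" "cball z0 r \<subseteq> cball z0 r1" "cball z0 r \<subseteq> cball z0 r2" "cball z0 r \<subseteq> cball z0 r3"
  using r1(1) r2(1) r3(1) by (auto simp: r_def)
 define Cs where "Cs = u ` (closed_D2 \<inter> sphere z0 r)"
 have "compact Cs" unfolding Cs_def
  by (rule compact_continuous_image[OF continuous_on_subset[OF cont(1)]]) (auto intro: compact_Int)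
 then have Co: "open (- Cs)" by (intro open_Compl compact_imp_closed)
 \<comment> \<open>Local injectivity leaves room around \<open>u z0\<close> for a bump whose support
   misses the image of the cutting sphere.\<close>
 have "u z0 \<noteq> u z" if "z \<in> closed_D2" "z \<in> sphere z0 r" for z
 proof
  assume eq: "u z0 = u z"
  have "z0 \<in> closed_D2 \<inter> cball z0 r1" using z0c r1(1) by auto
  moreover have "z \<in> closed_D2 \<inter> cball z0 r1" using that r(2) by auto
  ultimately have "z0 = z" using inj_onD[OF r1(2) eq] by blast
  then show False using that(2) r(1) by simp
 qed
 then have "u z0 \<in> - Cs" unfolding Cs_def by blast
 then obtain \<rho> where \<rho>: "\<rho> > 0" "cball (u z0) \<rho> \<subseteq> - Cs" using Co open_contains_cball by blast
 define b where "b = bump (u z0) \<rho>"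
 have bC: "Ck_on k UNIV b" for k unfolding b_def by (rule Ck_on_bump)
 have b0: "b x \<ge> 0" for x unfolding b_def by (rule bump_nonneg)
 define f where [abs_def]: "f x = (x \<bullet> x - 1) * b x" for x
 have fC: "Ck_on k UNIV f" for k unfolding f_def
  by (intro Ck_on_mult Ck_on_diff Ck_on_inner Ck_on_const Ck_on_id bC open_UNIV)
 have fd: "f differentiable (at x)" for x by (rule Ck1_differentiable[OF open_UNIV fC UNIV_I])
 have bd: "b differentiable (at x)" for x by (rule Ck1_differentiable[OF open_UNIV bC UNIV_I])
 have "fun_support f \<subseteq> cball (u z0) \<rho>" unfolding fun_support_def
 proof (rule closure_minimal)
  show "{x. f x \<noteq> 0} \<subseteq> cball (u z0) \<rho>"
  proof
   fix x assume "x \<in> {x. f x \<noteq> 0}"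
   then have "b x \<noteq> 0" by (auto simp: f_def)
   then show "x \<in> cball (u z0) \<rho>" unfolding b_def bump_eq_0_iff[OF \<rho>(1)] by auto
  qed
 qed simp
 then have supp: "fun_support f \<inter> u ` (closed_D2 \<inter> sphere z0 r) = {}" using \<rho>(2) by (auto simp: Cs_def)
 have gr: "mult_I (gradient f x) \<bullet> y = 2 * b x * (mult_I x \<bullet> y)" if x: "norm x = 1" for x y
 proof -
  have xx: "x \<bullet> x = 1" using x by (simp add: dot_square_norm)
  have "(f has_derivative (%v. (x \<bullet> x - 1) * pd v b x + (x \<bullet> v + v \<bullet> x) * b x)) (at x)" unfolding f_def
   by (rule has_derivative_eq_rhs, (rule derivative_intros has_derivative_pd[OF bd])+) (simp add: fun_eq_iff)
  from pd_eqI[OF this, of "mult_I y"] have "pd (mult_I y) f x = 2 * (x \<bullet> mult_I y) * b x" by (simp add: xx inner_commute)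
  then show ?thesis by (simp add: inner_mult_I_left gderiv_gradient(2)[OF fd])
 qed
 have bc: "cball z0 r \<subseteq> D2 \<or> (\<forall>x. norm x = 1 \<longrightarrow> mult_I (gradient f x) \<bullet> x = 0)" using gr by simp
 note fv = first_variation[OF z0c r(1) fC supp bc]
 define \<Phi> where [abs_def]: "\<Phi> z = (if z \<in> ball z0 r then f (u z) else 0)" for z
 define P where "P z = (if z \<in> ball z0 r then mult_I (gradient f (u z)) else 0) \<bullet> (Re z *\<^sub>R dx u z + Im z *\<^sub>R dy u z)" for z
 have Pc: "continuous_on closed_D2 P" unfolding P_def by (rule flux_continuous[OF fC supp])
 have gc: "continuous_on closed_D2 (%z. gradient f (u z) \<bullet> dx u z)" "continuous_on closed_D2 (%z. gradient f (u z) \<bullet> dy u z)"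
  by (intro continuous_on_inner cont continuous_on_compose2[OF Ck_on_continuous[OF open_UNIV Ck_on_gradient[OF fC]] cont(1) subset_UNIV])+
 obtain M1 where M1: "M1 > 0" "!!z. z \<in> closed_D2 ==> norm (gradient f (u z) \<bullet> dx u z) \<le> M1"
  by (rule continuous_on_closed_D2_bound[OF gc(1)]) blast
 obtain M2 where M2: "M2 > 0" "!!z. z \<in> closed_D2 ==> norm (gradient f (u z) \<bullet> dy u z) \<le> M2"
  by (rule continuous_on_closed_D2_bound[OF gc(2)]) blast
 have pdz: "\<bar>pd 1 \<Phi> z\<bar> \<le> M1 + M2" "\<bar>pd \<i> \<Phi> z\<bar> \<le> M1 + M2" if z: "z \<in> D2" for z
 proof -
  have zc: "z \<in> closed_D2" using z by simp
  have "pd v \<Phi> z = (if z \<in> ball z0 r then gradient f (u z) \<bullet> du u z v else 0)" for v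
   using fv(3,4)[OF z, folded \<Phi>_def, of v] by (simp add: gderiv_gradient(2)[OF fd])
  then show "\<bar>pd 1 \<Phi> z\<bar> \<le> M1 + M2" "\<bar>pd \<i> \<Phi> z\<bar> \<le> M1 + M2"
   using M1(2)[OF zc] M2(2)[OF zc] M1(1) M2(1) by (simp_all add: dx_def dy_def)
 qed
 have ad: "adm (- cball z0 r) \<Phi>"
  by (rule admI[OF _ _ fv(2)[folded \<Phi>_def] _ pdz]) (use r(4) r3(2) in \<open>auto simp: \<Phi>_def\<close>)
 have "T \<Phi> = 0"
 proof (rule T_zero_of_vanishing[OF ad])
  show "continuous_on closed_D2 \<Phi>" unfolding \<Phi>_def
  proof (rule continuous_cut)
   show "continuous_on closed_D2 (%z. f (u z))"
    by (rule continuous_on_compose2[OF Ck_on_continuous[OF open_UNIV fC] cont(1) subset_UNIV])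
   fix z assume "z \<in> closed_D2" "z \<in> sphere z0 r"
   then have "u z \<notin> fun_support f" using supp by blast
   then show "f (u z) = 0" using closure_subset[of "{x. f x \<noteq> 0}"] by (auto simp: fun_support_def)
  qed
  show "\<Phi> z = 0" if "z \<in> circle" for z using circ[OF that] by (simp add: \<Phi>_def f_def dot_square_norm)
 qed
 then have "(%n. 2 * (LBINT z. lam n z * (if z \<in> D2 then P z else 0))) \<longlonglongrightarrow> 0"
  using fv(1)[folded \<Phi>_def] unfolding flux_def P_def by simp
 from tendsto_mult_left[OF this, of "\<sigma> / 2"]
 have "(%n. \<sigma> * (LBINT z. lam n z * (if z \<in> D2 then P z else 0))) \<longlonglongrightarrow> 0" by simp
 moreover have "\<sigma> * (LBINT z. lam n z * (if z \<in> D2 then P z else 0)) = (LBINT z. lam n z * (if z \<in> D2 then \<sigma> * P z else 0))" for n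
  unfolding integral_mult_right_zero[symmetric] by (rule Bochner_Integration.integral_cong) auto
 ultimately have lim: "(%n. LBINT z. lam n z * (if z \<in> D2 then \<sigma> * P z else 0)) \<longlonglongrightarrow> 0" by simp
 have Pz: "\<sigma> * P z = (if z \<in> ball z0 r then 2 * b (u z) * q z else 0)" if "z \<in> circle" for z
  using gr[OF circ[OF that], of "rad z"] by (simp add: P_def rad_def[symmetric] q_def)
 have "\<not> (%n. LBINT z. lam n z * (if z \<in> D2 then \<sigma> * P z else 0)) \<longlonglongrightarrow> 0"
 proof (rule lam_not_tendsto_0[OF _ _ z0])
  show "continuous_on closed_D2 (%z. \<sigma> * P z)" by (intro continuous_intros Pc)
  show "0 \<le> \<sigma> * P z" if z: "z \<in> circle" for z
  proof (cases "z \<in> ball z0 r")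
   case True
   have "z \<in> closed_D2" using z by auto
   moreover have "z \<in> cball z0 r2" using True r(3) ball_subset_cball by blast
   ultimately have "q z > 0" using r2(2) by auto
   then show ?thesis using b0 True by (simp add: Pz[OF z])
  qed (simp add: Pz[OF z])
  have "b (u z0) \<noteq> 0" unfolding b_def bump_eq_0_iff[OF \<rho>(1)] using \<rho>(1) by simp
  then have "b (u z0) > 0" using b0[of "u z0"] by simp
  then show "\<sigma> * P z0 > 0" using q0 r(1) by (simp add: Pz[OF z0])
 qed
 then show False using lim by blast
qed

text \<open>The tangential derivative is Hermitian orthogonal to u, by |u| = 1 and the Legendrian
  condition. The radial derivative is Hermitian orthogonal to the tangential one, by conformality
  and the Lagrangian condition. After removal of its component along u it is orthogonal to both,
  hence 0.\<close>

lemma rad_parallel: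
 assumes z: "z \<in> circle"
 shows "rad z = (rad z \<bullet> u z) *\<^sub>R u z" "rad z \<bullet> u z \<noteq> 0" "dtau u z \<noteq> 0"
proof -
 have zc: "z \<in> closed_D2" using z by auto
 have n1: "Re z * Re z + Im z * Im z = 1" using z by (simp add: cmod_def power2_eq_square)
 note fr = frame_at[OF zc]
 have nab: "dy u z \<bullet> dy u z = dx u z \<bullet> dx u z" using fr(2) by (simp add: dot_square_norm)
 have tt: "dtau u z \<bullet> dtau u z = (Re z * Re z + Im z * Im z) * (dx u z \<bullet> dx u z)"
  "rad z \<bullet> rad z = (Re z * Re z + Im z * Im z) * (dx u z \<bullet> dx u z)"
  using fr(1) nab by (simp_all add: dtau_eq[OF zc] rad_def inner_add_left inner_add_right inner_commute[of "dy u z" "dx u z"] algebra_simps)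
 have dz: "dx u z \<bullet> dx u z > 0" using dx_nonzero[OF circle_not_S[OF z]] by simp
 show t0: "dtau u z \<noteq> 0" using tt(1) dz n1 by auto
 have r0: "rad z \<noteq> 0" using tt(2) dz n1 by auto
 have rt: "rad z \<bullet> dtau u z = 0"
  using fr(1) nab by (simp add: dtau_eq[OF zc] rad_def inner_add_left inner_add_right inner_commute[of "dy u z" "dx u z"] algebra_simps)
 have dxI: "dy u z \<bullet> mult_I (dx u z) = 0" using fr(3) by (simp add: inner_commute)
 have rIt: "rad z \<bullet> mult_I (dtau u z) = 0"
  using fr(4) dxI by (simp add: dtau_eq[OF zc] rad_def inner_add_left inner_add_right inner_diff_right)
 have uu: "u z \<bullet> u z = 1" using circ[OF z] by (simp add: dot_square_norm)
 have u0: "u z \<noteq> 0" using circ[OF z] by auto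
 define w where "w = rad z - (rad z \<bullet> u z) *\<^sub>R u z"
 have ut: "u z \<bullet> dtau u z = 0" "u z \<bullet> mult_I (dtau u z) = 0"
  using dtau_orthogonal[OF z] leg[OF z] inner_mult_I_left[of "u z" "dtau u z"] by (simp_all add: inner_commute)
 have "w = 0"
 proof (rule hermitian_orthogonal_pair[OF u0 t0])
  show "w \<bullet> u z = 0" by (simp add: w_def inner_diff_left uu)
  show "w \<bullet> mult_I (u z) = 0" using rad_dot_I[OF z] by (simp add: w_def inner_diff_left)
  show "w \<bullet> dtau u z = 0" using rt ut(1) by (simp add: w_def inner_diff_left)
  show "w \<bullet> mult_I (dtau u z) = 0" using rIt ut(2) by (simp add: w_def inner_diff_left)
 qed (use dtau_orthogonal[OF z] leg[OF z] in auto)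
 then show e: "rad z = (rad z \<bullet> u z) *\<^sub>R u z" by (simp add: w_def)
 show "rad z \<bullet> u z \<noteq> 0" using e r0 by auto
qed

end

subsection \<open>Test functions up to the boundary\<close>

text \<open>The differential of the radial projection to the circle: the tangential part of
  \<open>v\<close>, scaled by 1/|z|.\<close>

definition sgn_deriv :: "complex => complex => complex" where
 "sgn_deriv z v = (1 / norm z) *\<^sub>R (v - (sgn z \<bullet> v) *\<^sub>R sgn z)"

lemma has_derivative_sgn:
 assumes "z \<noteq> 0" shows "(sgn has_derivative sgn_deriv z) (at z)"
proof -
 have n: "(norm has_derivative (%v. v \<bullet> sgn z)) (at z)" by (rule has_derivative_norm[OF assms])
 have "((%z. inverse (norm z) *\<^sub>R z) has_derivative sgn_deriv z) (at z)"
  by (rule has_derivative_eq_rhs[OF has_derivative_scaleR[OF Deriv.has_derivative_inverse[OF _ n] has_derivative_ident]])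
    (use assms in \<open>auto simp: fun_eq_iff sgn_deriv_def sgn_div_norm inner_commute divide_inverse algebra_simps\<close>)
 moreover have "sgn = (%z::complex. inverse (norm z) *\<^sub>R z)" by (simp add: fun_eq_iff sgn_div_norm divide_inverse)
 ultimately show ?thesis by simp
qed

lemma rotated_expansion:
 assumes "norm z0 = 1"
 shows "of_real (z0 \<bullet> v) * z0 + of_real ((\<i> * z0) \<bullet> v) * (\<i> * z0) = v"
proof -
 have n: "Re z0 * Re z0 + Im z0 * Im z0 = 1" using assms by (simp add: cmod_def power2_eq_square)
 have "Re (of_real (z0 \<bullet> v) * z0 + of_real ((\<i> * z0) \<bullet> v) * (\<i> * z0)) = (Re z0 * Re z0 + Im z0 * Im z0) * Re v"
  "Im (of_real (z0 \<bullet> v) * z0 + of_real ((\<i> * z0) \<bullet> v) * (\<i> * z0)) = (Re z0 * Re z0 + Im z0 * Im z0) * Im v"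
  by (simp_all add: inner_complex_def algebra_simps)
 then show ?thesis unfolding n by (simp add: complex_eq_iff)
qed

text \<open>The differential at x, in direction v, of the quadratic form
  \<open>hermq a b\<close>.\<close>

definition qform :: "complex2 => complex2 => complex2 => complex2 => real" where
 "qform a b x v = (v \<bullet> a) * (x \<bullet> b) + (x \<bullet> a) * (v \<bullet> b) + (v \<bullet> mult_I a) * (x \<bullet> mult_I b) + (x \<bullet> mult_I a) * (v \<bullet> mult_I b)"

text \<open>The real part of the Hermitian product of \<open>x\<close> and \<open>a\<close> times the conjugate of that of \<open>x\<close> and \<open>b\<close>;
 hence its invariance under scalar rotations.\<close>

definition hermq :: "complex2 => complex2 => complex2 => real" where
 "hermq a b x = (x \<bullet> a) * (x \<bullet> b) + (x \<bullet> mult_I a) * (x \<bullet> mult_I b)"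

lemma hermq_deriv: "(hermq a b has_derivative qform a b x) (at x)"
 unfolding hermq_def[abs_def]
 by (rule has_derivative_eq_rhs, (rule derivative_intros)+) (simp add: qform_def fun_eq_iff algebra_simps)

lemma hermq_rotation: "qform a b x (mult_I x) = 0"
proof -
 have "mult_I x \<bullet> c = - (x \<bullet> mult_I c)" for c by (rule inner_mult_I_left)
 then show ?thesis by (simp add: qform_def)
qed

lemma Ck_on_hermq: "Ck_on k UNIV (hermq a b)"
 unfolding hermq_def[abs_def]
 by (intro Ck_on_add Ck_on_mult Ck_on_inner Ck_on_const Ck_on_id open_UNIV)

context fb_disc
begin

text \<open>The map \<open>p\<close> is built from rotation invariant quadratic forms so that p o u
  has identity differential at \<open>z0\<close>. It is defined on one side of the circle only, so a
  genuine chart \<open>m\<close> of a full neighbourhood is constructed that agrees with p o u on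
  the circle. Then \<Phi> o m^(-1) o p o u, suitably cut off, is a legitimate pullback with the
  boundary values of \<Phi>, and the difference vanishes on the circle.\<close>

lemma T_boundary:
 assumes z0: "z0 \<in> circle"
 shows "\<exists>r>0. \<forall>c. Cc 1 ((- S) \<inter> ball z0 r) c \<longrightarrow> T c = 0"
proof -
 have z0c: "z0 \<in> closed_D2" and n0: "norm z0 = 1" and z0n: "z0 \<noteq> 0" using z0 by auto
 have sg0: "sgn z0 = z0" using n0 by (simp add: sgn_div_norm)
 define u0 t0 \<rho> where "u0 = u z0" and "t0 = dtau u z0" and "\<rho> = rad z0 \<bullet> u z0"
 define \<tau> where "\<tau> = t0 \<bullet> t0"
 have \<rho>: "\<rho> \<noteq> 0" "rad z0 = \<rho> *\<^sub>R u0" using rad_parallel(1,2)[OF z0] by (simp_all add: \<rho>_def u0_def)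
 have \<tau>: "\<tau> > 0" using rad_parallel(3)[OF z0] by (simp add: \<tau>_def t0_def)
 have u01: "u0 \<bullet> u0 = 1" using circ[OF z0] by (simp add: u0_def dot_square_norm)
 have t0u: "t0 \<bullet> u0 = 0" "u0 \<bullet> t0 = 0" "t0 \<bullet> mult_I u0 = 0" "u0 \<bullet> mult_I t0 = 0"
  using dtau_orthogonal[OF z0] leg[OF z0] inner_mult_I_left[of u0 t0]
  by (simp_all add: t0_def u0_def inner_commute)
 \<comment> \<open>The tangential coordinate: its differential at \<open>u0\<close> is 1 on the
   tangential derivative \<open>t0\<close> and 0 on \<open>u0\<close>, the direction of the radial
   derivative.\<close>
 define Q where [abs_def]: "Q x = hermq u0 t0 x / \<tau>" for x
 define DQ where [abs_def]: "DQ x v = qform u0 t0 x v / \<tau>" for x v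
 have Qd: "(Q has_derivative DQ x) (at x)" for x
  unfolding Q_def DQ_def by (intro bounded_linear.has_derivative[OF bounded_linear_divide] hermq_deriv)
 have DQt: "DQ u0 t0 = 1" and DQu: "DQ u0 u0 = 0"
  using \<tau> by (simp_all add: DQ_def qform_def u01 t0u \<tau>_def)
 have DQl: "linear (DQ x)" for x by (rule has_derivative_linear[OF Qd])
 \<comment> \<open>Normalizes the normal coordinate c |x|^2, whose derivative along the radial
   derivative \<rho> u0 is 2 c \<rho> = 1.\<close>
 define c where "c = 1 / (2 * \<rho>)"
 define p where [abs_def]: "p x = of_real (c * (x \<bullet> x)) * z0 + of_real (Q x) * (\<i> * z0)" for x :: complex2
 have lin: "bounded_linear (%r::real. of_real r * a)" for a :: complex
  by (rule bounded_linear_compose[OF bounded_linear_mult_left bounded_linear_of_real])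
 have pC: "Ck_on k UNIV p" for k
 proof -
  have "Ck_on k UNIV (%x. c * (x \<bullet> x))" by (intro Ck_on_mult Ck_on_inner Ck_on_const Ck_on_id open_UNIV)
  moreover have "Ck_on k UNIV Q" unfolding Q_def by (rule Ck_on_linear_comp[OF open_UNIV bounded_linear_divide Ck_on_hermq])
  ultimately show ?thesis unfolding p_def by (intro Ck_on_add[OF open_UNIV] Ck_on_linear_comp[OF open_UNIV lin])
 qed
 define Dp where [abs_def]: "Dp x v = of_real (2 * c * (x \<bullet> v)) * z0 + of_real (DQ x v) * (\<i> * z0)" for x v
 have pd_p: "(p has_derivative Dp x) (at x)" for x
  unfolding p_def Dp_def
  by (rule has_derivative_eq_rhs, (rule derivative_intros Qd)+) (simp add: fun_eq_iff inner_commute algebra_simps)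
 have pdp: "pd v p x = Dp x v" for v x by (rule pd_eqI[OF pd_p])
 have inv: "\<forall>x. pd (mult_I x) p x = 0" unfolding pdp Dp_def by (simp add: DQ_def hermq_rotation)
 \<comment> \<open>The tangential coordinate is frozen along rays and the normal one replaced by an
   explicit function of |z|, which equals c on the circle. The result is C^1 away from 0 and again
   has identity differential at \<open>z0\<close>.\<close>
 define m where [abs_def]: "m z = of_real ((z \<bullet> z - 1) / 2 + c) * z0 + of_real (Q (u (sgn z))) * (\<i> * z0)" for z
 define Dm where [abs_def]: "Dm z v = of_real (z \<bullet> v) * z0 + of_real (DQ (u (sgn z)) (du u (sgn z) (sgn_deriv z v))) * (\<i> * z0)" for z v
 have mp: "m z = p (u z)" if z: "z \<in> circle" for z
 proof -
  have "z \<bullet> z = 1" "u z \<bullet> u z = 1" "sgn z = z" using z circ[OF z] by (simp_all add: dot_square_norm sgn_div_norm)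
  then show ?thesis by (simp add: m_def p_def)
 qed
 have sgc: "sgn z \<in> closed_D2" for z :: complex by (simp add: norm_sgn)
 define D where "D = - {0::complex}"
 have Do: "open D" by (auto simp: D_def)
 have md: "(m has_derivative Dm z) (at z)" if z: "z \<in> D" for z
 proof -
  have "((%z. u (sgn z)) has_derivative (%v. du u (sgn z) (sgn_deriv z v))) (at z)"
   by (rule has_derivative_in_compose2[where t=closed_D2 and g=u and g'="du u"])
     (use C1cd_has_derivative[OF C1] sgc has_derivative_sgn z in \<open>auto simp: D_def\<close>)
  from has_derivative_compose[OF this Qd]
  have q: "((%z. Q (u (sgn z))) has_derivative (%v. DQ (u (sgn z)) (du u (sgn z) (sgn_deriv z v)))) (at z)" .
  have "((%z. (z \<bullet> z - 1) / 2 + c) has_derivative (%v. z \<bullet> v)) (at z)"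
   by (auto intro!: derivative_eq_intros simp: fun_eq_iff inner_commute)
  then show ?thesis unfolding m_def Dm_def
   by (intro has_derivative_add bounded_linear.has_derivative[OF lin] q)
 qed
 have sgC: "continuous_on D (sgn :: complex => complex)" unfolding D_def by (intro continuous_intros) auto
 have mC: "Ck_on 1 D m"
 proof -
  have "Ck_on (Suc 0) D m"
  proof (rule Ck_on_SucI[OF Do md])
   fix i
   have sc: "continuous_on D (%z. h (sgn z))" if "continuous_on closed_D2 h" for h :: "complex => complex2"
    by (rule continuous_on_compose2[OF that sgC]) (use sgc in auto)
   have w: "continuous_on D (%z. sgn_deriv z i)" unfolding sgn_deriv_def
    by (intro continuous_intros sgC) (auto simp: D_def)
   have "continuous_on D (%z. du u (sgn z) (sgn_deriv z i))"
    unfolding du_expand[OF C1 sgc] by (intro continuous_intros w sc cont)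
   then show "Ck_on 0 D (%z. Dm z i)" unfolding Ck_on.simps Dm_def DQ_def qform_def
    by (intro continuous_intros sc cont) (use \<tau> in auto)
  qed
  then show ?thesis by simp
 qed
 have ortho: "z0 \<bullet> (\<i> * z0) = 0" by (simp add: inner_complex_def)
 have Dm0: "Dm z0 v = v" for v
 proof -
  have "v - (z0 \<bullet> v) *\<^sub>R z0 = ((\<i> * z0) \<bullet> v) *\<^sub>R (\<i> * z0)"
   using rotated_expansion[OF n0, of v] by (simp add: scaleR_conv_of_real algebra_simps)
  then have "sgn_deriv z0 v = ((\<i> * z0) \<bullet> v) *\<^sub>R (\<i> * z0)" by (simp add: sgn_deriv_def sg0 n0)
  then have "du u z0 (sgn_deriv z0 v) = ((\<i> * z0) \<bullet> v) *\<^sub>R t0"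
   unfolding t0_def dtau_def by (simp add: linear_cmul[OF has_derivative_linear[OF C1cd_has_derivative[OF C1 z0c]]])
  then have "DQ u0 (du u z0 (sgn_deriv z0 v)) = (\<i> * z0) \<bullet> v" by (simp add: linear_cmul[OF DQl] DQt)
  then show ?thesis using rotated_expansion[OF n0, of v] by (simp add: Dm_def sg0 u0_def)
 qed
 define g' where [abs_def]: "g' z v = pd (du u z v) p (u z)" for z v
 have g0: "g' z0 v = v" for v
 proof -
  have ul: "linear (du u z0)" by (rule has_derivative_linear[OF C1cd_has_derivative[OF C1 z0c]])
  have "v = (z0 \<bullet> v) *\<^sub>R z0 + ((\<i> * z0) \<bullet> v) *\<^sub>R (\<i> * z0)"
   using rotated_expansion[OF n0, of v] by (simp add: scaleR_conv_of_real)
  then have "du u z0 v = du u z0 ((z0 \<bullet> v) *\<^sub>R z0 + ((\<i> * z0) \<bullet> v) *\<^sub>R (\<i> * z0))" by simp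
  also have "\<dots> = (z0 \<bullet> v) *\<^sub>R rad z0 + ((\<i> * z0) \<bullet> v) *\<^sub>R t0"
   unfolding linear_add[OF ul] linear_cmul[OF ul] by (simp add: du_radial[OF z0c] t0_def dtau_def)
  finally have d: "du u z0 v = ((z0 \<bullet> v) * \<rho>) *\<^sub>R u0 + ((\<i> * z0) \<bullet> v) *\<^sub>R t0" by (simp add: \<rho>(2))
  have "u0 \<bullet> du u z0 v = (z0 \<bullet> v) * \<rho>" unfolding d by (simp add: inner_add_right u01 t0u)
  then have "2 * c * (u0 \<bullet> du u z0 v) = z0 \<bullet> v" using \<rho>(1) by (simp add: c_def)
  moreover have "DQ u0 (du u z0 v) = (\<i> * z0) \<bullet> v" unfolding d by (simp add: linear_add[OF DQl] linear_cmul[OF DQl] DQt DQu)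
  ultimately show ?thesis using rotated_expansion[OF n0, of v] unfolding g'_def pdp Dp_def u0_def[symmetric] by simp
 qed
 have "continuous_on D (pd 1 m)" "continuous_on D (pd \<i> m)" by (rule continuous_on_pd[OF Do mC])+
 then have "open ((D \<inter> pd 1 m -` ball 1 (1/4)) \<inter> (D \<inter> pd \<i> m -` ball \<i> (1/4)) \<inter> - S)"
  by (intro open_Int continuous_open_preimage Do open_ball open_Compl S_closed)
 moreover have "z0 \<in> (D \<inter> pd 1 m -` ball 1 (1/4)) \<inter> (D \<inter> pd \<i> m -` ball \<i> (1/4)) \<inter> - S"
 proof -
  have zD: "z0 \<in> D" using z0n by (simp add: D_def)
  have "pd v m z0 = v" for v using pd_eqI[OF md[OF zD]] Dm0 by simp
  then show ?thesis using zD circle_not_S[OF z0] by simp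
 qed
 ultimately obtain r1 where r1: "r1 > 0" "cball z0 r1 \<subseteq> (D \<inter> pd 1 m -` ball 1 (1/4)) \<inter> (D \<inter> pd \<i> m -` ball \<i> (1/4)) \<inter> - S"
  using open_contains_cball by blast
 have pC1: "Ck_on 1 UNIV p" by (rule pC)
 have gc: "continuous_on closed_D2 (%z. g' z 1)" "continuous_on closed_D2 (%z. g' z \<i>)"
  unfolding g'_def dx_def[symmetric] dy_def[symmetric] by (rule pull_speed[OF pC1])+
 have gb: "g' z0 1 \<in> ball 1 (1/4)" "g' z0 \<i> \<in> ball \<i> (1/4)" by (simp_all add: g0)
 obtain r2 where r2: "r2 > 0" "!!z. z \<in> closed_D2 ==> z \<in> cball z0 r2 ==> g' z 1 \<in> ball 1 (1/4)"
  by (rule closed_D2_nbhd[OF gc(1) z0c open_ball gb(1)]) blast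
 obtain r3 where r3: "r3 > 0" "!!z. z \<in> closed_D2 ==> z \<in> cball z0 r3 ==> g' z \<i> \<in> ball \<i> (1/4)"
  by (rule closed_D2_nbhd[OF gc(2) z0c open_ball gb(2)]) blast
 \<comment> \<open>The halves of \<open>r2\<close> and \<open>r3\<close> are needed because a point
   within r of \<open>z0\<close> has its radial projection only within 2 r; the bound 1/4 keeps that
   projection within 1/2 of \<open>z0\<close>.\<close>
 define r where "r = min (min r1 (1/4)) (min (r2 / 2) (r3 / 2))"
 have r: "r > 0" "r \<le> 1/4" "r \<le> r1" "2 * r \<le> r2" "2 * r \<le> r3" using r1(1) r2(1) r3(1) by (auto simp: r_def)
 have rr1: "cball z0 r \<subseteq> cball z0 r1" using r(3) by (rule subset_cball)
 have rS: "cball z0 r \<inter> S = {}" and rD: "cball z0 r \<subseteq> D" using rr1 r1(2) by blast+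
 have mPQ: "norm (pd 1 m z - of_real 1) \<le> 1 / 4" "norm (pd \<i> m z - \<i> * of_real 1) \<le> 1 / 4" if "z \<in> cball z0 r" for z
 proof -
  have "z \<in> cball z0 r1" using that rr1 by blast
  then have "pd 1 m z \<in> ball 1 (1/4)" "pd \<i> m z \<in> ball \<i> (1/4)" using r1(2) by blast+
  then show "norm (pd 1 m z - of_real 1) \<le> 1 / 4" "norm (pd \<i> m z - \<i> * of_real 1) \<le> 1 / 4"
   by (simp_all add: dist_norm norm_minus_commute)
 qed
 obtain G where G: "inj_on m (cball z0 r)" "open (m ` ball z0 r)" "Ck_on 1 (m ` ball z0 r) G" "!!z. z \<in> ball z0 r ==> G (m z) = z"
  by (rule plane_chart[OF Do mC rD r(1) zero_less_one mPQ]) (assumption | rule that)+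
 define C where "C = closed_D2 \<inter> cball z0 (2 * r)"
 have Cin: "z \<in> closed_D2" "z \<in> cball z0 r2" "z \<in> cball z0 r3" if "z \<in> C" for z using that r(4,5) by (auto simp: C_def)
 have est: "norm (p (u x) - p (u y) - of_real 1 * (x - y)) \<le> 1 / 2 * norm (x - y)" if xy: "x \<in> C" "y \<in> C" for x y
 proof (rule near_scaling_estimate[where g="%z. p (u z)" and g'=g' and C=C])
  show "convex C" unfolding C_def by (intro convex_Int convex_cball)
  show "((%z. p (u z)) has_derivative g' z) (at z within C)" if "z \<in> C" for z
  proof -
   have "(u has_derivative du u z) (at z within C)"
    by (rule has_derivative_subset[OF C1cd_has_derivative[OF C1 Cin(1)[OF that]]]) (simp add: C_def)
   from has_derivative_compose[OF this pd_p] show ?thesis by (simp add: g'_def pdp)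
  qed
  show "norm (g' z 1 - of_real 1) \<le> 1 / 4" if "z \<in> C" for z
   using r2(2)[OF Cin(1,2)[OF that]] by (simp add: dist_norm norm_minus_commute)
  show "norm (g' z \<i> - \<i> * of_real 1) \<le> 1 / 4" if "z \<in> C" for z
   using r3(2)[OF Cin(1,3)[OF that]] by (simp add: dist_norm norm_minus_commute)
 qed (use xy in auto)
 have re: "z0 \<bullet> (of_real t * z0) = t" "z0 \<bullet> (of_real t * (\<i> * z0)) = 0" for t
  using n0 ortho unfolding scaleR_conv_of_real[symmetric] by (simp_all add: dot_square_norm)
 have re_p: "z0 \<bullet> p x = c * (x \<bullet> x)" for x
  unfolding p_def inner_add_right re by simp
 have re_m: "z0 \<bullet> m z = (z \<bullet> z - 1) / 2 + c" for z
  unfolding m_def inner_add_right re by simp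
 \<comment> \<open>If |u| = 1 at an interior point and at its projection \<open>w\<close>, then p o
   u does not move in direction \<open>z0\<close> along the ray, although it is close to the
   identity. This forces z0 . w \<le> 1/2, against |z0 - w| \<le> 1/2.\<close>
 have not1: "u z \<bullet> u z \<noteq> 1" if z: "z \<in> D2" "z \<in> cball z0 r" for z
 proof
  assume eq: "u z \<bullet> u z = 1"
  have z1: "norm z < 1" using z(1) by simp
  have "dist z0 z \<le> r" using z(2) by simp
  then have nz: "norm z \<ge> 1 - r" using n0 norm_triangle_ineq2[of z0 z] by (simp add: dist_norm)
  then have zn: "z \<noteq> 0" using r(2) by auto
  define w where "w = sgn z"
  have w: "w \<in> circle" "dist z w = 1 - norm z" using dist_sgn_le[OF zn] z1 by (auto simp: w_def)
  have "dist z0 w \<le> dist z0 z + dist z w" by (rule dist_triangle)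
  then have wr: "dist z0 w \<le> 2 * r" using \<open>dist z0 z \<le> r\<close> w(2) nz by linarith
  have zC: "z \<in> C" "w \<in> C" using z w(1) wr r(1) by (auto simp: C_def)
  have uw: "u w \<bullet> u w = 1" using circ[OF w(1)] by (simp add: dot_square_norm)
  have zw: "z - w = (norm z - 1) *\<^sub>R w" using zn by (simp add: w_def sgn_div_norm algebra_simps)
  have "z0 \<bullet> (p (u z) - p (u w) - of_real 1 * (z - w)) = (1 - norm z) * (z0 \<bullet> w)"
   unfolding inner_diff_right re_p eq uw by (simp add: zw algebra_simps)
  then have "(1 - norm z) * (z0 \<bullet> w) \<le> norm z0 * norm (p (u z) - p (u w) - of_real 1 * (z - w))"
   using norm_cauchy_schwarz by metis
  also have "\<dots> \<le> 1 / 2 * norm (z - w)" using est[OF zC] n0 by simp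
  also have "norm (z - w) = 1 - norm z" using w(2) by (simp add: dist_norm)
  finally have "(1 - norm z) * (z0 \<bullet> w) \<le> (1 - norm z) * (1 / 2)" by simp
  then have h: "z0 \<bullet> w \<le> 1 / 2" using z1 by (simp add: mult_le_cancel_left)
  have "(dist z0 w)\<^sup>2 \<le> (2 * r)\<^sup>2" using wr by (intro power_mono) auto
  also have "\<dots> \<le> (1/2)\<^sup>2" using r(1,2) by (intro power_mono) auto
  also have "(1/2)\<^sup>2 = (1/4 :: real)" by (simp add: power2_eq_square)
  finally have "(z0 - w) \<bullet> (z0 - w) \<le> 1 / 4" by (simp only: dist_norm power2_norm_eq_inner)
  moreover have "(z0 - w) \<bullet> (z0 - w) = 2 - 2 * (z0 \<bullet> w)"
  proof -
   have "z0 \<bullet> z0 = 1" "w \<bullet> w = 1" using n0 w(1) by (simp_all add: dot_square_norm)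
   then show ?thesis by (simp add: inner_diff_left inner_diff_right inner_commute[of w z0])
  qed
  ultimately show False using h by simp
 qed
 have "T \<Phi> = 0" if \<Phi>: "Cc 1 ((- S) \<inter> ball z0 r) \<Phi>" for \<Phi>
 proof -
  obtain K where K: "compact K" "K \<subseteq> (- S) \<inter> ball z0 r" "!!x. x \<notin> K ==> \<Phi> x = 0" using \<Phi> by (auto elim: CcE)
  have KD: "K \<subseteq> D" "K \<subseteq> ball z0 r" using K(2) rD ball_subset_cball by blast+
  have mK: "compact (m ` K)"
   by (intro compact_continuous_image continuous_on_subset[OF Ck_on_continuous[OF Do mC] KD(1)] K(1))
  have puc: "continuous_on closed_D2 (%z. p (u z))"
   by (rule continuous_on_compose2[OF Ck_on_continuous[OF open_UNIV pC1] cont(1) subset_UNIV])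
  define Sp where "Sp = closed_D2 \<inter> sphere z0 r"
  have SpC: "continuous_on Sp (%z. p (u z))" "continuous_on Sp u" and Spc: "compact Sp"
   using continuous_on_subset[OF puc] continuous_on_subset[OF cont(1)] by (auto simp: Sp_def)
  define Cs where "Cs = Sp \<inter> (%z. p (u z)) -` (m ` K)"
  have "closed Cs" unfolding Cs_def
   by (rule continuous_closed_preimage[OF SpC(1) compact_imp_closed[OF Spc] compact_imp_closed[OF mK]])
  then have Csc: "compact Cs" using compact_Int_closed[OF Spc, of Cs] by (simp add: Cs_def Int_absorb1 Int_left_absorb)
  have CsD: "z \<in> D2 \<and> z \<in> cball z0 r" if z: "z \<in> Cs" for z
  proof -
   have zs: "z \<in> closed_D2" "z \<in> sphere z0 r" "p (u z) \<in> m ` K" using z by (auto simp: Cs_def Sp_def)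
   have "z \<notin> circle"
   proof
    assume zc: "z \<in> circle"
    obtain x where x: "x \<in> K" "m z = m x" using zs(3) mp[OF zc] by auto
    have "z \<in> cball z0 r" "x \<in> cball z0 r" using zs(2) x(1) KD(2) by (force, force)
    then have "z = x" using inj_onD[OF G(1) x(2)] by blast
    then show False using x(1) KD(2) zs(2) by auto
   qed
   then show ?thesis using zs(1,2) by (auto simp: less_le)
  qed
  have "\<exists>\<delta>>0. \<forall>z\<in>Cs. \<delta> \<le> \<bar>c * (u z \<bullet> u z) - c\<bar>"
  proof (cases "Cs = {}")
   case False
   have "continuous_on Cs (%z. \<bar>c * (u z \<bullet> u z) - c\<bar>)"
    by (intro continuous_intros continuous_on_subset[OF SpC(2)]) (auto simp: Cs_def)
   then obtain z where z: "z \<in> Cs" "\<forall>y\<in>Cs. \<bar>c * (u z \<bullet> u z) - c\<bar> \<le> \<bar>c * (u y \<bullet> u y) - c\<bar>"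
    using continuous_attains_inf[OF Csc False] by blast
   have "c * (u z \<bullet> u z - 1) \<noteq> 0" using not1 CsD[OF z(1)] \<rho>(1) by (simp add: c_def)
   then show ?thesis using z(2) by (intro exI[of _ "\<bar>c * (u z \<bullet> u z) - c\<bar>"]) (auto simp: algebra_simps)
  qed (auto intro: exI[of _ 1])
  then obtain \<delta> where \<delta>: "\<delta> > 0" "!!z. z \<in> Cs ==> \<delta> \<le> \<bar>c * (u z \<bullet> u z) - c\<bar>" by blast
  define b :: "real => real" where [abs_def]: "b t = bump 0 (\<delta> / 2) t / bump (0::real) (\<delta> / 2) 0" for t
  have d2: "\<delta> / 2 > 0" using \<delta>(1) by simp
  have b0: "b 0 = 1" using bump_eq_0_iff[OF d2, of 0 "0::real"] d2 by (simp add: b_def)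
  have bz: "\<bar>t\<bar> < \<delta> / 2" if "b t \<noteq> 0" for t using that bump_eq_0_iff[OF d2, of 0 t] by (auto simp: b_def dist_real_def)
  have bC: "Ck_on 1 UNIV b" unfolding b_def by (rule Ck_on_linear_comp[OF open_UNIV bounded_linear_divide Ck_on_bump])
  \<comment> \<open>A further cutoff in the normal coordinate, equal to 1 on the circle. It confines
    the support of \<open>F\<close> to the slab of width \<delta>/2 about the value c, which the
    images of \<open>Cs\<close> avoid by \<delta>.\<close>
  define \<Psi> where [abs_def]: "\<Psi> z = \<Phi> z * b ((z \<bullet> z - 1) / 2)" for z
  have \<Psi>C: "Ck_on 1 UNIV \<Psi>" unfolding \<Psi>_def
  proof (rule Ck_on_mult[OF open_UNIV Cc_Ck[OF \<Phi>]])
   have "Ck_on 1 UNIV (%z::complex. (z \<bullet> z - 1) / 2)"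
    by (rule Ck_on_linear_comp[OF open_UNIV bounded_linear_divide]) (intro Ck_on_diff Ck_on_inner Ck_on_const Ck_on_id open_UNIV)
   then show "Ck_on 1 UNIV (%z::complex. b ((z \<bullet> z - 1) / 2))" by (rule Ck_on_compose[OF open_UNIV open_UNIV subset_UNIV bC])
  qed
  define F where [abs_def]: "F y = (if y \<in> m ` ball z0 r then \<Psi> (G y) else 0)" for y
  have F1: "Cc 1 (m ` ball z0 r) F" unfolding F_def
  proof (rule Cc_zero_extend[OF G(2) _ mK])
   show "Ck_on 1 (m ` ball z0 r) (%y. \<Psi> (G y))" by (rule Ck_on_compose[OF G(2) open_UNIV subset_UNIV \<Psi>C G(3)])
   show "m ` K \<subseteq> m ` ball z0 r" using KD(2) by blast
   fix y assume "y \<in> m ` ball z0 r" "y \<notin> m ` K"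
   then obtain x where "x \<in> ball z0 r" "y = m x" "x \<notin> K" by blast
   then show "\<Psi> (G y) = 0" using G(4) K(3) by (simp add: \<Psi>_def)
  qed
  have Fm: "F (m z) = \<Psi> z" if "z \<in> ball z0 r" for z
   using G(4)[OF that] imageI[OF that, of m] by (simp add: F_def)
  define K2 where "K2 = m ` K \<inter> {y. \<bar>z0 \<bullet> y - c\<bar> \<le> \<delta> / 2}"
  have "closed {y. \<bar>z0 \<bullet> y - c\<bar> \<le> \<delta> / 2}" by (intro closed_Collect_le continuous_intros)
  then have K2: "compact K2" unfolding K2_def by (rule compact_Int_closed[OF mK])
  have F2: "F y = 0" if y: "y \<notin> K2" for y
  proof (rule ccontr)
   assume ne: "F y \<noteq> 0"
   then obtain x where x: "x \<in> ball z0 r" "y = m x" by (auto simp: F_def split: if_splits)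
   then have "\<Psi> x \<noteq> 0" using ne Fm by simp
   then have "\<Phi> x \<noteq> 0" "b ((x \<bullet> x - 1) / 2) \<noteq> 0" by (auto simp: \<Psi>_def)
   then have "x \<in> K" "\<bar>(x \<bullet> x - 1) / 2\<bar> < \<delta> / 2" using K(3) bz by blast+
   then show False using y x(2) by (auto simp: K2_def re_m)
  qed
  have F: "Cc 1 (- ((%z. p (u z)) ` (closed_D2 \<inter> sphere z0 r))) F"
  proof (rule CcI[OF Cc_Ck[OF F1] K2 _ F2])
   show "K2 \<subseteq> - ((%z. p (u z)) ` (closed_D2 \<inter> sphere z0 r))"
   proof
    fix y assume y: "y \<in> K2"
    show "y \<in> - ((%z. p (u z)) ` (closed_D2 \<inter> sphere z0 r))"
    proof
     assume "y \<in> (%z. p (u z)) ` (closed_D2 \<inter> sphere z0 r)"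
     then obtain z where z: "z \<in> Sp" "y = p (u z)" unfolding Sp_def by blast
     then have "z \<in> Cs" using y by (simp add: Cs_def K2_def)
     then have "\<delta> \<le> \<bar>c * (u z \<bullet> u z) - c\<bar>" by (rule \<delta>(2))
     then show False using y \<delta>(1) unfolding K2_def z(2) by (simp add: re_p)
    qed
   qed
  qed
  have T0: "T (pull p z0 r F) = 0"
  proof (rule T_pull[OF pC z0c r(1) rS F], rule disjI2, rule conjI[OF inv], rule ballI)
   fix z assume "z \<in> circle \<inter> ball z0 r"
   then show "\<exists>\<rho>. Re z *\<^sub>R dx u z + Im z *\<^sub>R dy u z = \<rho> *\<^sub>R u z"
    using rad_parallel(1)[of z] unfolding rad_def by blast
  qed
  note pa = pull_adm[OF pC1 rS F]
  obtain O1 where O1: "adm O1 \<Phi>" by (rule adm_Cc[OF \<Phi>]) auto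
  have O12: "open (O1 \<inter> - cball z0 r)" "S \<subseteq> O1 \<inter> - cball z0 r" using admD(1,2)[OF O1] admD(1,2)[OF pa(1)] by auto
  note am = adm_minus_T[OF adm_mono[OF O1 O12 Int_lower1] adm_mono[OF pa(1) O12 Int_lower2]]
  \<comment> \<open>On the circle the pullback is \<open>F (m z)\<close>, hence
    \<open>\<Phi> z\<close>; only these boundary values matter for \<open>T\<close>.\<close>
  have "T (%z. \<Phi> z - pull p z0 r F z) = 0"
  proof (rule T_zero_of_vanishing[OF am(1)])
   show "continuous_on closed_D2 (%z. \<Phi> z - pull p z0 r F z)"
    by (intro continuous_on_diff pa(3) continuous_on_subset[OF Ck_on_continuous[OF open_UNIV Cc_Ck[OF \<Phi>]] subset_UNIV])
   fix z assume z: "z \<in> circle"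
   show "\<Phi> z - pull p z0 r F z = 0"
   proof (cases "z \<in> ball z0 r")
    case True
    have "z \<bullet> z = 1" using z by (simp add: dot_square_norm)
    then show ?thesis using True by (simp add: pull_def mp[OF z, symmetric] Fm \<Psi>_def b0)
   next
    case False
    then have "z \<notin> K" using KD(2) by blast
    then show ?thesis using False K(3) by (simp add: pull_def)
   qed
  qed
  then show ?thesis using am(2) T0 by simp
 qed
 then show ?thesis using r(1) by blast
qed

lemma T_all:
 assumes c: "Cc 1 (- S) c" shows "T c = 0"
proof (rule Cc1_local_to_global[OF _ c, where P="%c. T c = 0"])
 show "open (- S)" using S_closed by (rule open_Compl)
 show "T (%_. 0) = 0" by (simp add: T_def frechet_derivative_const)
 show "T (%x. c x + d x) = 0" if "Cc 1 (- S) c" "Cc 1 (- S) d" "T c = 0" "T d = 0" for c d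
  using T_add_Cc[OF that(1,2)] that(3,4) by auto
 fix z assume z: "z \<in> - S"
 consider "z \<in> D2" | "z \<in> circle" | "z \<in> - closed_D2" by fastforce
 then show "\<exists>r>0. \<forall>c. Cc 1 ((- S) \<inter> ball z r) c \<longrightarrow> T c = 0"
 proof cases
  case 1
  then obtain r where r: "r > 0" "ball z r \<subseteq> D2" using open_contains_ball_eq[OF open_ball] by blast
  have "T c = 0" if "Cc 1 ((- S) \<inter> ball z r) c" for c
   by (rule T_interior[OF Cc_mono[OF that order.refl]]) (use r(2) in blast)
  then show ?thesis using r(1) by blast
 next
  case 2
  then show ?thesis by (rule T_boundary)
 next
  case 3
  have "open (- closed_D2)" by auto
  then obtain r where r: "r > 0" "ball z r \<subseteq> - closed_D2" using open_contains_ball_eq 3 by blast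
  have "T c = 0" if c: "Cc 1 ((- S) \<inter> ball z r) c" for c
  proof -
   obtain K where K: "K \<subseteq> (- S) \<inter> ball z r" "!!x. x \<notin> K ==> c x = 0" using c by (auto elim: CcE)
   have c0: "c x = 0" if "x \<in> D2" for x
   proof -
    have "x \<in> closed_D2" using that by auto
    then have "x \<notin> K" using K(1) r(2) by blast
    then show ?thesis by (rule K(2))
   qed
   have p0: "pd v c x = 0" if x: "x \<in> D2" for x v
    using pd_cong_open[OF open_ball x c0, where i=v] by (simp add: frechet_derivative_const)
   have "(%x. indicator D2 x * (B1 x * pd 1 c x + B2 x * pd \<i> c x)) = (%x. 0 :: real)"
    by (rule ext) (simp add: p0 indicator_def del: mem_ball_0)
   then show ?thesis by (simp add: T_def)
  qed
  then show ?thesis using r(1) by blast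
 qed
qed

end

subsection \<open>The Lagrangian angle is constant\<close>

definition lap :: "(complex => real) => complex => real" where
 "lap q z = pd 1 (pd 1 q) z + pd \<i> (pd \<i> q) z"

lemma Ck2_D:
 assumes q: "Ck_on (Suc 1) UNIV q"
 shows "Ck_on 1 UNIV q" "j \<in> Basis ==> Ck_on 1 UNIV (pd j q)" "q differentiable (at x)" "j \<in> Basis ==> pd j q differentiable (at x)"
proof -
 show q1: "Ck_on 1 UNIV q" by (rule Ck_on_mono[OF open_UNIV q]) simp
 show "q differentiable (at x)" by (rule Ck1_differentiable[OF open_UNIV q1 UNIV_I])
 assume j: "j \<in> Basis"
 show p: "Ck_on 1 UNIV (pd j q)" by (rule Ck_on_pd[OF q j])
 show "pd j q differentiable (at x)" by (rule Ck1_differentiable[OF open_UNIV p UNIV_I])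
qed

lemma Basis_complex_mem: "1 \<in> (Basis :: complex set)" "\<i> \<in> (Basis :: complex set)" by (auto simp: Basis_complex_def)

lemma continuous_lap: "Ck_on (Suc 1) UNIV q ==> continuous_on UNIV (lap q)"
 unfolding lap_def[abs_def]
 by (intro continuous_on_add continuous_on_pd open_UNIV Ck2_D(2) Basis_complex_mem)

lemma lap_diff:
 assumes q: "Ck_on (Suc 1) UNIV q" and h: "Ck_on (Suc 1) UNIV h"
 shows "lap (%z. q z - h z) z = lap q z - lap h z"
proof -
 have d: "pd v (%x. f x - g x) x = pd v f x - pd v g x" if "f differentiable (at x)" "g differentiable (at x)" for f g :: "complex => real" and v x
  by (rule pd_eqI[OF has_derivative_diff[OF has_derivative_pd[OF that(1)] has_derivative_pd[OF that(2)]]])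
 have "pd j (%z. q z - h z) = (%z. pd j q z - pd j h z)" for j
  by (rule ext) (rule d[OF Ck2_D(3)[OF q] Ck2_D(3)[OF h]])
 then show ?thesis
  unfolding lap_def by (simp add: d[OF Ck2_D(4)[OF q] Ck2_D(4)[OF h]] Basis_complex_mem)
qed

definition cube :: "real => real" where "cube t = (max 0 t) ^ 3"

lemma Ck_on_cube: "Ck_on (Suc 1) UNIV cube"
proof -
 have s: "Ck_on 1 UNIV sqpos"
 proof -
  have "Ck_on (Suc 0) UNIV sqpos"
   by (rule Ck_on_SucI[where f'="%t v. 2 * max 0 t * v"])
     (use sqpos_deriv in \<open>auto simp: has_field_derivative_def intro!: continuous_intros\<close>)
  then show ?thesis by simp
 qed
 have d: "(cube has_real_derivative 3 * sqpos t) (at t)" for t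
 proof (cases t "0::real" rule: linorder_cases)
  case less
  have "((%t. 0) has_real_derivative 3 * sqpos t) (at t)" using less by (simp add: sqpos_def)
  then show ?thesis
   by (rule has_field_derivative_transform_within_open[where S="{..<0}"]) (use less in \<open>auto simp: cube_def\<close>)
 next
  case greater
  have "((%t. t ^ 3) has_real_derivative 3 * sqpos t) (at t)" using greater by (auto intro!: derivative_eq_intros simp: sqpos_def)
  then show ?thesis
   by (rule has_field_derivative_transform_within_open[where S="{0<..}"]) (use greater in \<open>auto simp: cube_def\<close>)
 next
  case equal
  have e: "cube h / h = h * max 0 h" if "h \<noteq> 0" for h using that by (auto simp: cube_def max_def power3_eq_cube)
  have "(%h. cube (0 + h) - cube 0) = cube" by (simp add: cube_def fun_eq_iff)
  moreover have "((%h. cube h / h) \<longlongrightarrow> 0) (at 0)"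
  proof (rule Lim_transform_eventually)
   have "((%h::real. h * max 0 h) \<longlongrightarrow> 0 * max 0 0) (at 0)" by (intro tendsto_intros)
   then show "((%h::real. h * max 0 h) \<longlongrightarrow> 0) (at 0)" by simp
   show "\<forall>\<^sub>F h in at 0. h * max 0 h = cube h / h" using e by (simp add: eventually_at_filter)
  qed
  ultimately have "(cube has_real_derivative 0) (at 0)" unfolding DERIV_def by (simp add: cube_def)
  then show ?thesis using equal by (simp add: sqpos_def)
 qed
 show ?thesis
 proof (rule Ck_on_SucI[where f'="%t v. (3 * sqpos t) * v"])
  show "(cube has_derivative (%v. (3 * sqpos t) * v)) (at t)" for t using d[of t] by (simp add: has_field_derivative_def)
  show "Ck_on 1 UNIV (%x. 3 * sqpos x * i)" for i
   by (intro Ck_on_mult Ck_on_const s open_UNIV)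
 qed auto
qed

text \<open>The third difference of t^3/6, truncated: a C^2 spline rising from 0 to 1 on [0, 3]. Two
  continuous derivatives are wanted because Laplacians of cutoffs appear.\<close>

definition cubic_step :: "real => real" where
 "cubic_step t = (cube t - 3 * cube (t - 1) + 3 * cube (t - 2) - cube (t - 3)) / 6"

lemma cubic_step_simps: "t \<le> 0 ==> cubic_step t = 0" "3 \<le> t ==> cubic_step t = 1"
proof -
 show "cubic_step t = 0" if "t \<le> 0" using that by (simp add: cubic_step_def cube_def)
 assume "3 \<le> t"
 then have "max 0 t = t" "max 0 (t - 1) = t - 1" "max 0 (t - 2) = t - 2" "max 0 (t - 3) = t - 3" by auto
 then show "cubic_step t = 1" by (simp add: cubic_step_def cube_def power3_eq_cube algebra_simps)
qed

text \<open>The argument runs from 3 at |z| = 1/2 down to 0 at |z| = 1, the two ends of the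
  spline.\<close>

definition plateau :: "complex => real" where
 "plateau z = cubic_step (4 - 4 * (z \<bullet> z))"

lemma plateau_simps: "norm z \<le> 1/2 ==> plateau z = 1" "1 \<le> norm z ==> plateau z = 0"
proof -
 assume "norm z \<le> 1/2"
 then have "(norm z)\<^sup>2 \<le> (1/2)\<^sup>2" by (intro power_mono) auto
 then show "plateau z = 1" by (simp add: plateau_def cubic_step_simps power2_norm_eq_inner power2_eq_square[of "2::real"] power_divide)
next
 assume "1 \<le> norm z"
 then have "1\<^sup>2 \<le> (norm z)\<^sup>2" by (intro power_mono) auto
 then show "plateau z = 0" by (simp add: plateau_def cubic_step_simps power2_norm_eq_inner)
qed

lemma Cc_plateau: "Cc (Suc 1) UNIV plateau"
proof (rule CcI[where K="cball 0 1"])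
 have sh: "Ck_on (Suc 1) UNIV (%t. cube (t - a))" for a
  by (rule Ck_on_compose[OF open_UNIV open_UNIV subset_UNIV Ck_on_cube]) (intro Ck_on_diff Ck_on_id Ck_on_const open_UNIV)
 have "Ck_on (Suc 1) UNIV (%t. (cube t - 3 * cube (t - 1) + 3 * cube (t - 2) - cube (t - 3)) / 6)"
  by (rule Ck_on_linear_comp[OF open_UNIV bounded_linear_divide])
    (intro Ck_on_add Ck_on_diff Ck_on_mult Ck_on_const sh Ck_on_cube open_UNIV)
 then have "Ck_on (Suc 1) UNIV cubic_step" unfolding cubic_step_def[abs_def] .
 then show "Ck_on (Suc 1) UNIV plateau" unfolding plateau_def[abs_def]
  by (rule Ck_on_compose[OF open_UNIV open_UNIV subset_UNIV])
    (intro Ck_on_diff Ck_on_mult Ck_on_inner Ck_on_const Ck_on_id open_UNIV)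
qed (use plateau_simps(2) in auto)

lemma pd_rescale:
 fixes f :: "complex => real"
 assumes f: "Ck_on 1 UNIV f"
 shows "pd v (%z. f ((1 / \<delta>) *\<^sub>R (z - s))) z = (1 / \<delta>) * pd v f ((1 / \<delta>) *\<^sub>R (z - s))"
proof -
 have fd: "f differentiable (at x)" for x by (rule Ck1_differentiable[OF open_UNIV f UNIV_I])
 have "((%z. (1 / \<delta>) *\<^sub>R (z - s)) has_derivative (%v. (1 / \<delta>) *\<^sub>R v)) (at z)"
  by (auto intro!: derivative_eq_intros)
 from has_derivative_compose[OF this has_derivative_pd[OF fd]]
 have "pd v (%z. f ((1 / \<delta>) *\<^sub>R (z - s))) z = pd ((1 / \<delta>) *\<^sub>R v) f ((1 / \<delta>) *\<^sub>R (z - s))" by (rule pd_eqI)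
 also have "\<dots> = (1 / \<delta>) *\<^sub>R pd v f ((1 / \<delta>) *\<^sub>R (z - s))" by (rule linear_cmul[OF linear_pd[OF fd]])
 finally show ?thesis by simp
qed

text \<open>A cutoff at scale \<delta> has Laplacian of order 1/\<delta>^2 on a disc of area pi
  \<delta>^2, so scaling alone gives no smallness. It comes from the continuity of \<open>b\<close>:
  the value at \<open>s\<close> may be subtracted because the Laplacian of a compactly supported
  function has integral 0.\<close>

lemma lap_point_cutoff:
 fixes b p :: "complex => real"
 assumes b: "continuous_on closed_D2 b" and s: "cball s r \<subseteq> D2" "r > 0" and p: "Ck_on (Suc 1) UNIV p" and e: "e > 0"
 obtains h \<delta> where "Ck_on (Suc 1) UNIV h" "\<delta> > 0" "!!z. z \<in> ball s \<delta> ==> h z = p z" "!!z. z \<notin> cball s r ==> h z = 0"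
  "\<bar>LBINT z. indicator D2 z * (b z * lap h z)\<bar> \<le> e"
proof -
 have "s \<in> cball s r" using s(2) by simp
 then have sD: "s \<in> D2" using s(1) by blast
 note pj = Ck2_D[OF p] and Bm = Basis_complex_mem
 have pc: "continuous_on closed_D2 f" if "continuous_on UNIV f" for f :: "complex => real" using continuous_on_subset[OF that] by auto
 have bnd: "\<exists>M>0. \<forall>z\<in>closed_D2. \<bar>f z\<bar> \<le> M" if f: "continuous_on UNIV f" for f :: "complex => real"
 proof -
  obtain M where "M > 0" "!!z. z \<in> closed_D2 ==> norm (f z) \<le> M" by (rule continuous_on_closed_D2_bound[OF pc[OF f]]) blast
  then show ?thesis by auto
 qed
 have c1: "continuous_on UNIV p" by (rule Ck_on_continuous[OF open_UNIV p])
 have c2: "continuous_on UNIV (pd j p)" for j by (rule continuous_on_pd[OF open_UNIV pj(1)])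
 have c3: "continuous_on UNIV (pd j (pd j p))" if "j \<in> Basis" for j by (rule continuous_on_pd[OF open_UNIV pj(2)[OF that]])
 obtain A1 where A1: "A1 > 0" "\<forall>z\<in>closed_D2. \<bar>p z\<bar> \<le> A1" using bnd[OF c1] by blast
 obtain A2 where A2: "A2 > 0" "\<forall>z\<in>closed_D2. \<bar>pd 1 p z\<bar> \<le> A2" using bnd[OF c2] by blast
 obtain A3 where A3: "A3 > 0" "\<forall>z\<in>closed_D2. \<bar>pd \<i> p z\<bar> \<le> A3" using bnd[OF c2] by blast
 obtain A4 where A4: "A4 > 0" "\<forall>z\<in>closed_D2. \<bar>pd 1 (pd 1 p) z\<bar> \<le> A4" using bnd[OF c3[OF Bm(1)]] by blast
 obtain A5 where A5: "A5 > 0" "\<forall>z\<in>closed_D2. \<bar>pd \<i> (pd \<i> p) z\<bar> \<le> A5" using bnd[OF c3[OF Bm(2)]] by blast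
 define A where "A = A1 + A2 + A3 + A4 + A5"
 have A0: "A > 0" using A1 A2 A3 A4 A5 unfolding A_def by linarith
 have Ap: "\<bar>p z\<bar> \<le> A" if "z \<in> closed_D2" for z
  using A1(2)[rule_format, OF that] A2(1) A3(1) A4(1) A5(1) unfolding A_def by linarith
 have Aj: "\<bar>pd j p z\<bar> \<le> A \<and> \<bar>pd j (pd j p) z\<bar> \<le> A" if z: "z \<in> closed_D2" and j: "j \<in> {1, \<i>}" for z j
 proof -
  have "\<bar>pd 1 p z\<bar> \<le> A" using A2(2)[rule_format, OF z] A1(1) A3(1) A4(1) A5(1) unfolding A_def by linarith
  moreover have "\<bar>pd \<i> p z\<bar> \<le> A" using A3(2)[rule_format, OF z] A1(1) A2(1) A4(1) A5(1) unfolding A_def by linarith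
  moreover have "\<bar>pd 1 (pd 1 p) z\<bar> \<le> A" using A4(2)[rule_format, OF z] A1(1) A2(1) A3(1) A5(1) unfolding A_def by linarith
  moreover have "\<bar>pd \<i> (pd \<i> p) z\<bar> \<le> A" using A5(2)[rule_format, OF z] A1(1) A2(1) A3(1) A4(1) unfolding A_def by linarith
  ultimately show ?thesis using j by blast
 qed
 note A = A0 Ap Aj
 define th where "th = plateau"
 note thC = Cc_plateau[folded th_def]
 note thj = Ck2_D[OF Cc_Ck[OF thC]]
 obtain H1 where H1: "H1 > 0" "!!z. norm (th z) \<le> H1" using Cc_bounded[OF thC] by metis
 obtain H2 where H2: "H2 > 0" "!!z. norm (pd 1 th z) \<le> H2" using Cc_bounded[OF Cc_pd[OF thC Bm(1)]] by metis
 obtain H3 where H3: "H3 > 0" "!!z. norm (pd \<i> th z) \<le> H3" using Cc_bounded[OF Cc_pd[OF thC Bm(2)]] by metis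
 obtain H4 where H4: "H4 > 0" "!!z. norm (pd 1 (pd 1 th) z) \<le> H4" using Cc_bounded[OF Cc_pd1[OF Cc_pd[OF thC Bm(1)] Bm(1)]] by metis
 obtain H5 where H5: "H5 > 0" "!!z. norm (pd \<i> (pd \<i> th) z) \<le> H5" using Cc_bounded[OF Cc_pd1[OF Cc_pd[OF thC Bm(2)] Bm(2)]] by metis
 define H where "H = H1 + H2 + H3 + H4 + H5"
 have H0: "H > 0" using H1 H2 H3 H4 H5 unfolding H_def by linarith
 have Hp: "\<bar>th z\<bar> \<le> H" for z
  using H1(2)[of z] H2(1) H3(1) H4(1) H5(1) unfolding H_def real_norm_def by linarith
 have Hj: "\<bar>pd j th z\<bar> \<le> H \<and> \<bar>pd j (pd j th) z\<bar> \<le> H" if j: "j \<in> {1, \<i>}" for z j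
 proof -
  have "\<bar>pd 1 th z\<bar> \<le> H" using H2(2)[of z] H1(1) H3(1) H4(1) H5(1) unfolding H_def real_norm_def by linarith
  moreover have "\<bar>pd \<i> th z\<bar> \<le> H" using H3(2)[of z] H1(1) H2(1) H4(1) H5(1) unfolding H_def real_norm_def by linarith
  moreover have "\<bar>pd 1 (pd 1 th) z\<bar> \<le> H" using H4(2)[of z] H1(1) H2(1) H3(1) H5(1) unfolding H_def real_norm_def by linarith
  moreover have "\<bar>pd \<i> (pd \<i> th) z\<bar> \<le> H" using H5(2)[of z] H1(1) H2(1) H3(1) H4(1) unfolding H_def real_norm_def by linarith
  ultimately show ?thesis using j by blast
 qed
 note H = H0 Hp Hj
 \<comment> \<open>Allowed oscillation of \<open>b\<close>: times the bound 8 A H/\<delta>^2 for the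
   Laplacian and the area pi \<delta>^2 it gives exactly \<open>e\<close>.\<close>
 define \<omega> where "\<omega> = e / (8 * A * H * pi)"
 have \<omega>: "\<omega> > 0" using e A(1) H(1) by (simp add: \<omega>_def)
 have "s \<in> closed_D2" using sD by auto
 then obtain d where d: "d > 0" "!!z. z \<in> closed_D2 ==> dist z s < d ==> dist (b z) (b s) < \<omega>"
  using b \<omega> unfolding continuous_on_iff by metis
 define \<delta> where "\<delta> = min (min r 1) (d / 2)"
 have \<delta>: "\<delta> > 0" "\<delta> \<le> r" "\<delta> \<le> 1" "\<delta> < d" using d(1) s(2) by (auto simp: \<delta>_def)
 define q where "q z = (1 / \<delta>) *\<^sub>R (z - s)" for z
 have nq: "norm (q z) = dist s z / \<delta>" for z using \<delta>(1) by (simp add: q_def dist_norm norm_minus_commute)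
 define h where [abs_def]: "h z = p z * th (q z)" for z
 have qC: "Ck_on k UNIV q" for k unfolding q_def[abs_def]
  by (intro Ck_on_scaleR Ck_on_const Ck_on_diff Ck_on_id open_UNIV)
 have hC: "Ck_on (Suc 1) UNIV h" unfolding h_def
  by (rule Ck_on_mult[OF open_UNIV p Ck_on_compose[OF open_UNIV open_UNIV subset_UNIV Cc_Ck[OF thC] qC]])
 have h1: "h z = p z" if "z \<in> ball s (\<delta> / 2)" for z
 proof -
  have "norm (q z) \<le> 1/2" using that \<delta>(1) unfolding nq by (simp add: field_simps)
  then show ?thesis by (simp add: h_def th_def plateau_simps)
 qed
 have h0: "h z = 0" if "z \<notin> cball s \<delta>" for z
 proof -
  have "1 \<le> norm (q z)" using that \<delta>(1) unfolding nq by (simp add: field_simps)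
  then show ?thesis by (simp add: h_def th_def plateau_simps)
 qed
 have KD: "cball s \<delta> \<subseteq> D2" using \<delta>(2) s(1) subset_cball[of \<delta> r s] by blast
 have KDc: "cball s \<delta> \<subseteq> closed_D2" using KD ball_subset_cball by blast
 have hCc: "Cc (Suc 1) UNIV h" by (rule CcI[OF hC compact_cball subset_UNIV h0])
 have lap0: "lap h z = 0" if z: "z \<notin> cball s \<delta>" for z
 proof -
  have "pd j h x = 0" if "x \<notin> cball s \<delta>" for j x by (rule pd_eq_0_outside[OF closed_cball h0 that])
  then have "pd j (pd j h) z = 0" for j by (rule pd_eq_0_outside[OF closed_cball _ z])
  then show ?thesis by (simp add: lap_def)
 qed
 \<comment> \<open>Two second derivatives, each a sum of four products of size at most A H, once
   \<delta> \<le> 1 is used to bring all of them over \<delta>^2.\<close>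
 have lapb: "\<bar>lap h z\<bar> \<le> 8 * A * H / \<delta>\<^sup>2" if z: "z \<in> closed_D2" for z
 proof -
  have one: "\<bar>pd j (pd j h) z\<bar> \<le> 4 * A * H / \<delta>\<^sup>2" if j: "j \<in> {1, \<i>}" for j
  proof -
   have jB: "j \<in> Basis" using j Bm by auto
   have dq: "pd j (%z. f (q z)) x = (1 / \<delta>) * pd j f (q x)" if "Ck_on 1 UNIV f" for f :: "complex => real" and x
    unfolding q_def by (rule pd_rescale[OF that])
   have dqd: "(%z. f (q z)) differentiable (at x)" if "Ck_on 1 UNIV f" for f :: "complex => real" and x
    by (rule Ck1_differentiable[OF open_UNIV Ck_on_compose[OF open_UNIV open_UNIV subset_UNIV that qC] UNIV_I])
   have m: "pd j (%z. f z * g z) x = f x * pd j g x + pd j f x * g x" if "f differentiable (at x)" "g differentiable (at x)" for f g :: "complex => real" and x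
    by (rule pd_eqI[OF has_derivative_mult[OF has_derivative_pd[OF that(1)] has_derivative_pd[OF that(2)]]])
   have "pd j h = (%z. p z * ((1 / \<delta>) * pd j th (q z)) + pd j p z * th (q z))"
    unfolding h_def by (rule ext) (simp add: m[OF pj(3) dqd[OF thj(1)]] dq[OF thj(1)])
   moreover have "((%z. p z * ((1 / \<delta>) * pd j th (q z)) + pd j p z * th (q z)) has_derivative
     (%v. (p z * ((1 / \<delta>) * pd v (%z. pd j th (q z)) z) + pd v p z * ((1 / \<delta>) * pd j th (q z))) + (pd j p z * pd v (%z. th (q z)) z + pd v (pd j p) z * th (q z)))) (at z)"
    by (intro has_derivative_add has_derivative_mult has_derivative_mult_right has_derivative_pd pj(3) pj(4)[OF jB] dqd thj(1) thj(2)[OF jB])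
   ultimately have "pd j (pd j h) z = (p z * ((1 / \<delta>) * ((1 / \<delta>) * pd j (pd j th) (q z))) + pd j p z * ((1 / \<delta>) * pd j th (q z))) + (pd j p z * ((1 / \<delta>) * pd j th (q z)) + pd j (pd j p) z * th (q z))"
    by (simp add: pd_eqI dq[OF thj(1)] dq[OF thj(2)[OF jB]])
   also have "\<dots> = (p z * pd j (pd j th) (q z) + \<delta> * (pd j p z * pd j th (q z)) + \<delta> * (pd j p z * pd j th (q z)) + \<delta>\<^sup>2 * (pd j (pd j p) z * th (q z))) / \<delta>\<^sup>2"
    using \<delta>(1) by (simp add: field_simps power2_eq_square)
   also have "\<bar>\<dots>\<bar> \<le> (A * H + 1 * (A * H) + 1 * (A * H) + 1 * (A * H)) / \<delta>\<^sup>2"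
   proof -
    have d2: "\<delta>\<^sup>2 \<le> 1" using \<delta> by (simp add: power_le_one)
    have a: "\<bar>p z * pd j (pd j th) (q z)\<bar> \<le> A * H" "\<bar>pd j p z * pd j th (q z)\<bar> \<le> A * H" "\<bar>pd j (pd j p) z * th (q z)\<bar> \<le> A * H"
     unfolding abs_mult using A(2)[OF z] A(3)[OF z j] H(2)[of "q z"] H(3)[OF j, of "q z"] A(1) H(1) by (auto intro!: mult_mono)
    have dd: "\<bar>\<delta>\<bar> \<le> 1" "\<bar>\<delta>\<^sup>2\<bar> \<le> 1" "\<bar>\<delta>\<^sup>2\<bar> = \<delta>\<^sup>2" using \<delta> d2 by simp_all
    have a': "\<bar>\<delta> * (pd j p z * pd j th (q z))\<bar> \<le> 1 * (A * H)"
     unfolding abs_mult[of \<delta>] by (rule mult_mono[OF dd(1) a(2)]) simp_all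
    have a'': "\<bar>\<delta>\<^sup>2 * (pd j (pd j p) z * th (q z))\<bar> \<le> 1 * (A * H)"
     unfolding abs_mult[of "\<delta>\<^sup>2"] by (rule mult_mono[OF dd(2) a(3)]) simp_all
    show ?thesis unfolding abs_divide dd(3)
     by (rule divide_right_mono) (use a(1) a' a'' in linarith, simp)
   qed
   finally show ?thesis by simp
  qed
  have "\<bar>lap h z\<bar> \<le> \<bar>pd 1 (pd 1 h) z\<bar> + \<bar>pd \<i> (pd \<i> h) z\<bar>" unfolding lap_def by (rule abs_triangle_ineq)
  also have "\<dots> \<le> 4 * A * H / \<delta>\<^sup>2 + 4 * A * H / \<delta>\<^sup>2" using one by (intro add_mono) auto
  finally show ?thesis by simp
 qed
 have lapi: "integrable lborel (lap h)" "(LBINT z. lap h z) = 0"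
 proof -
  note c = Cc_pd[OF hCc Bm(1)] Cc_pd[OF hCc Bm(2)]
  note i = Cc_integrable[OF Cc_pd1[OF c(1) Bm(1)]] Cc_integrable[OF Cc_pd1[OF c(2) Bm(2)]]
  show "integrable lborel (lap h)" unfolding lap_def[abs_def] using i by (rule Bochner_Integration.integrable_add)
  show "(LBINT z. lap h z) = 0" unfolding lap_def
   using i integral_pd_eq_0[OF c(1) Bm(1)] integral_pd_eq_0[OF c(2) Bm(2)] by simp
 qed
 have I1: "integrable lborel (%z. (b z - b s) * lap h z)"
  by (rule integrable_cont_compact_support[OF compact_cball[of s \<delta>]])
    (intro continuous_intros continuous_on_subset[OF b KDc] continuous_on_subset[OF continuous_lap[OF hC] subset_UNIV], simp add: lap0)
 have "(LBINT z. indicator D2 z * (b z * lap h z)) = (LBINT z. (b z - b s) * lap h z + b s * lap h z)"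
 proof (rule Bochner_Integration.integral_cong[OF refl])
  fix z
  show "indicator D2 z * (b z * lap h z) = (b z - b s) * lap h z + b s * lap h z"
  proof (cases "z \<in> D2")
   case False
   then have "lap h z = 0" using KD lap0 by blast
   then show ?thesis by simp
  qed (simp add: algebra_simps)
 qed
 also have "\<dots> = (LBINT z. (b z - b s) * lap h z)" using I1 lapi by simp
 also have "\<bar>\<dots>\<bar> \<le> (LBINT z. (\<omega> * (8 * A * H / \<delta>\<^sup>2)) * indicator (cball s \<delta>) z)"
  unfolding real_norm_def[symmetric]
 proof (rule Bochner_Integration.integral_norm_bound_integral[OF I1])
  show "integrable lborel (%z. (\<omega> * (8 * A * H / \<delta>\<^sup>2)) * indicator (cball s \<delta>) z)"
   using emeasure_lborel_cball_finite[of s \<delta>] by (intro integrable_mult_right integrable_real_indicator) auto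
  fix z
  show "norm ((b z - b s) * lap h z) \<le> (\<omega> * (8 * A * H / \<delta>\<^sup>2)) * indicator (cball s \<delta>) z"
  proof (cases "z \<in> cball s \<delta>")
   case True
   have zc: "z \<in> closed_D2" using True KDc by blast
   have "dist (b z) (b s) < \<omega>" by (rule d(2)[OF zc]) (use True \<delta>(4) in \<open>simp add: dist_commute\<close>)
   then have "\<bar>b z - b s\<bar> * \<bar>lap h z\<bar> \<le> \<omega> * (8 * A * H / \<delta>\<^sup>2)"
    using lapb[OF zc] \<omega> by (intro mult_mono) (auto simp: dist_real_def)
   then show ?thesis using True by (simp add: abs_mult)
  qed (simp add: lap0)
 qed
 also have "\<dots> = (\<omega> * (8 * A * H / \<delta>\<^sup>2)) * (pi * \<delta>\<^sup>2)"
  using content_cball[of \<delta> s] \<delta>(1) emeasure_lborel_cball_finite[of s \<delta>] by (simp add: unit_ball_vol_2)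
 also have "\<dots> = e" using \<delta>(1) A(1) H(1) by (simp add: \<omega>_def)
 finally have "\<bar>LBINT z. indicator D2 z * (b z * lap h z)\<bar> \<le> e" .
 moreover have "h z = 0" if "z \<notin> cball s r" for z
  using that h0 subset_cball[OF \<delta>(2), of s] by blast
 moreover have "\<delta> / 2 > 0" using \<delta>(1) by simp
 ultimately show ?thesis using that[OF hC _ h1] by blast
qed

section \<open>The weak Neumann problem for the angle\<close>

context fb_disc
begin

text \<open>The cutoff gradient contributes a flux with density \<open>b\<close> times the radial
  derivative of \<open>q\<close>, which vanishes on the circle; the layer integrals then tend to
  0.\<close>

lemma green_eta:
 assumes q: "Ck_on (Suc 1) UNIV q" and b: "continuous_on closed_D2 b" and N: "!!z. z \<in> circle ==> pd z q z = 0"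
 defines "E \<equiv> %n j z. if z \<in> D2 then eta n z *\<^sub>R pd j q z else 0"
 shows "(%n. (LBINT z. pd 1 (E n 1) z * b z) + (LBINT z. pd \<i> (E n \<i>) z * b z))
   \<longlonglongrightarrow> (LBINT z. indicator D2 z * (b z * lap q z))"
proof -
 have pC: "Ck_on 1 D2 (pd j q)" if "j \<in> Basis" for j
  by (rule Ck_on_subset[OF open_UNIV open_ball subset_UNIV Ck2_D(2)[OF q that]])
 define F where [abs_def]: "F z = indicator D2 z * (b z * lap q z)" for z
 define P where [abs_def]: "P z = b z * pd z q z" for z
 have qz: "pd z q z = Re z * pd 1 q z + Im z * pd \<i> q z" for z
  using linear_complex_expand[OF linear_pd[OF Ck2_D(3)[OF q]], of z z] by simp
 have cp: "continuous_on closed_D2 (pd j q)" for j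
  by (rule continuous_on_subset[OF continuous_on_pd[OF open_UNIV Ck2_D(1)[OF q]] subset_UNIV])
 have Pc: "continuous_on closed_D2 P" unfolding P_def qz by (intro continuous_intros b cp)
 have lc: "continuous_on closed_D2 (%z. b z * lap q z)"
  by (intro continuous_intros b continuous_on_subset[OF continuous_lap[OF q] subset_UNIV])
 obtain M where M: "M > 0" "!!z. z \<in> closed_D2 ==> norm (b z * lap q z) \<le> M"
  by (rule continuous_on_closed_D2_bound[OF lc]) blast
 have Feq: "F = (%z. if z \<in> D2 then b z * lap q z else 0)" by (auto simp: F_def fun_eq_iff)
 have Fi: "integrable lborel F" unfolding Feq
  by (rule bounded_on_D2_integrable[OF continuous_on_subset[OF lc ball_subset_cball], of M]) (use M in auto)
 obtain MP where MP: "MP > 0" "!!z. z \<in> closed_D2 ==> norm (P z) \<le> MP"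
  by (rule continuous_on_closed_D2_bound[OF Pc]) blast
 have eqP: "(%z. if z \<in> D2 then P z else 0) = (%z. indicator D2 z *\<^sub>R P z)" by (rule ext) (simp add: indicator_def)
 have Pm: "(%z. if z \<in> D2 then P z else 0) \<in> borel_measurable borel"
  unfolding eqP by (rule borel_measurable_continuous_on_indicator[OF _ continuous_on_subset[OF Pc]]) auto
 have li: "integrable lborel (%z. lam n z * (if z \<in> D2 then P z else 0))" for n
  by (rule lam_integral_bound(1)[OF Pm, where e=MP]) (use MP in auto)
 have ei: "integrable lborel (%z. eta n z * F z)" for n
 proof (rule Bochner_Integration.integrable_bound[OF Fi])
  show "(%z. eta n z * F z) \<in> borel_measurable lborel"
   using Fi borel_measurable_continuous_onI[OF Ck_on_continuous[OF open_UNIV Ck_on_eta[of n]]] by auto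
  show "AE z in lborel. norm (eta n z * F z) \<le> norm (F z)"
   using eta_bounds[of n] by (intro AE_I2) (auto simp: abs_mult intro!: mult_left_le_one_le)
 qed
 have EC: "Cc 1 D2 (E n j)" if "j \<in> Basis" for n j unfolding E_def by (rule Cc_eta_D2[OF pC[OF that]])
 have Ei: "integrable lborel (%z. pd j (E n j) z * b z)" if j: "j \<in> Basis" for n j
 proof -
  obtain K where "Ck_on 0 UNIV (pd j (E n j))" and K: "compact K" "K \<subseteq> D2" "!!x. x \<notin> K ==> pd j (E n j) x = 0"
   by (rule CcE[OF Cc_pd1[OF EC[OF j] j]]) (rule that)
  have "K \<subseteq> closed_D2" using K(2) by auto
  then have "continuous_on K (%z. pd j (E n j) z * b z)"
   by (intro continuous_on_mult continuous_on_subset[OF b]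
     continuous_on_subset[OF Ck_on_continuous[OF open_UNIV Cc_Ck[OF Cc_pd1[OF EC[OF j] j]]] subset_UNIV])
  then show ?thesis by (rule integrable_cont_compact_support[OF K(1)]) (simp add: K(3))
 qed
 have pE: "pd v (E n j) z = (if z \<in> D2 then eta n z *\<^sub>R pd v (pd j q) z - (2 * (z \<bullet> v) * lam n z) *\<^sub>R pd j q z else 0)"
  if "j \<in> Basis" for v n j z unfolding E_def by (rule pd_eta_ext[OF pC[OF that]])
 have "(LBINT z. pd 1 (E n 1) z * b z) + (LBINT z. pd \<i> (E n \<i>) z * b z)
   = (LBINT z. eta n z * F z) - 2 * (LBINT z. lam n z * (if z \<in> D2 then P z else 0))" for n
 proof -
  have "(LBINT z. pd 1 (E n 1) z * b z) + (LBINT z. pd \<i> (E n \<i>) z * b z)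
    = (LBINT z. pd 1 (E n 1) z * b z + pd \<i> (E n \<i>) z * b z)"
   using Ei[OF Basis_c(1)] Ei[OF Basis_c(2)] by simp
  also have "\<dots> = (LBINT z. eta n z * F z - 2 * (lam n z * (if z \<in> D2 then P z else 0)))"
  proof (rule Bochner_Integration.integral_cong[OF refl])
   fix z
   show "pd 1 (E n 1) z * b z + pd \<i> (E n \<i>) z * b z = eta n z * F z - 2 * (lam n z * (if z \<in> D2 then P z else 0))"
    unfolding pE[OF Basis_c(1)] pE[OF Basis_c(2)]
    by (cases "z \<in> D2") (simp_all add: F_def P_def qz lap_def algebra_simps)
  qed
  also have "\<dots> = (LBINT z. eta n z * F z) - 2 * (LBINT z. lam n z * (if z \<in> D2 then P z else 0))"
   using ei li by simp
  finally show ?thesis .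
 qed
 moreover have "(%n. (LBINT z. eta n z * F z) - 2 * (LBINT z. lam n z * (if z \<in> D2 then P z else 0)))
   \<longlonglongrightarrow> (LBINT z. F z) - 2 * 0"
  by (intro tendsto_diff tendsto_mult_left eta_integral_tendsto[OF Fi] lam_limit_continuous[OF Pc])
    (simp_all add: F_def P_def N)
 ultimately show ?thesis by (simp add: F_def)
qed

text \<open>The weak gradient of the angle is tested with the cut off gradient of \<open>q\<close>.
  The limit without cutoff is computed twice: it is minus T applied to \<open>q\<close>, hence 0,
  and it is the integral of the angle against the Laplacian.\<close>

lemma weak_laplace_away:
 assumes q: "Ck_on (Suc 1) UNIV q" and O: "open O'" "S \<subseteq> O'" and q0: "!!z. z \<in> O' ==> q z = 0"
  and N: "!!z. z \<in> circle ==> pd z q z = 0"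
 shows "(LBINT z. indicator D2 z * (\<beta> z * lap q z)) = 0"
proof -
 define E where [abs_def]: "E n j z = (if z \<in> D2 then eta n z *\<^sub>R pd j q z else 0)" for n j z
 have pC: "Ck_on 1 D2 (pd j q)" if "j \<in> Basis" for j
  by (rule Ck_on_subset[OF open_UNIV open_ball subset_UNIV Ck2_D(2)[OF q that]])
 have p0: "pd j q z = 0" if "z \<in> O'" for j z
  using pd_cong_open[OF O(1) that q0, where i=j] by (simp add: frechet_derivative_const)
 have EC: "Cc 1 (D2 - S) (E n j)" if "j \<in> Basis" for n j
  unfolding E_def by (rule Cc_mono[OF Cc_eta_ext[OF pC[OF that] O(1) p0] order.refl]) (use O(2) in auto)
 have cp: "continuous_on closed_D2 (pd j q)" for j
  by (rule continuous_on_subset[OF continuous_on_pd[OF open_UNIV Ck2_D(1)[OF q]] subset_UNIV])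
 obtain M1 where M1: "M1 > 0" "!!z. z \<in> closed_D2 ==> norm (pd 1 q z) \<le> M1"
  by (rule continuous_on_closed_D2_bound[OF cp]) blast
 obtain M2 where M2: "M2 > 0" "!!z. z \<in> closed_D2 ==> norm (pd \<i> q z) \<le> M2"
  by (rule continuous_on_closed_D2_bound[OF cp]) blast
 have ad: "adm O' q"
 proof (rule admI[OF O Ck_on_subset[OF open_UNIV open_ball subset_UNIV Ck2_D(1)[OF q]] q0])
  fix z assume "z \<in> D2"
  then have "z \<in> closed_D2" by simp
  from M1(2)[OF this] M2(2)[OF this] show "\<bar>pd 1 q z\<bar> \<le> M1 + M2" "\<bar>pd \<i> q z\<bar> \<le> M1 + M2"
   using M1(1) M2(1) by auto
 qed auto
 define F where [abs_def]: "F z = indicator D2 z * (B1 z * pd 1 q z + B2 z * pd \<i> q z)" for z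
 have Fi: "integrable lborel F" unfolding F_def by (rule adm_integrable[OF ad])
 have TF: "(LBINT z. F z) = 0"
 proof -
  \<comment> \<open>\<open>T\<close> is known to vanish on compactly supported functions. This
    factor is 1 for |z|^2 \<le> 3 and 0 for |z| \<ge> 2, so \<open>q\<close> is unchanged on the
    disc.\<close>
  define c where [abs_def]: "c z = q z * step (5 - z \<bullet> z)" for z
  have "Cc 1 (- S) c"
  proof (rule CcI[where K="cball 0 2 - O'"])
   have "Ck_on 1 UNIV (%z::complex. step (5 - z \<bullet> z))"
    by (rule Ck_on_compose[OF open_UNIV open_UNIV subset_UNIV Ck_on_step]) (intro Ck_on_diff Ck_on_inner Ck_on_const Ck_on_id open_UNIV)
   then show "Ck_on 1 UNIV c" unfolding c_def by (rule Ck_on_mult[OF open_UNIV Ck2_D(1)[OF q]])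
   show "compact (cball 0 2 - O')" by (rule compact_diff[OF compact_cball O(1)])
   show "cball 0 2 - O' \<subseteq> - S" using O(2) by auto
   fix z assume z: "z \<notin> cball 0 2 - O'"
   show "c z = 0"
   proof (cases "z \<in> O'")
    case False
    then have "2 \<le> norm z" using z by auto
    then have "2\<^sup>2 \<le> (norm z)\<^sup>2" by (intro power_mono) auto
    then show ?thesis by (simp add: c_def step_simps power2_norm_eq_inner)
   qed (simp add: c_def q0)
  qed
  then have "T c = 0" by (rule T_all)
  moreover have "pd v c z = pd v q z" if "z \<in> D2" for v z
  proof (rule pd_cong_open[OF open_ball that])
   fix y assume "y \<in> D2"
   then have "(norm y)\<^sup>2 \<le> 1\<^sup>2" by (intro power_mono) auto
   then show "c y = q y" by (simp add: c_def step_simps power2_norm_eq_inner)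
  qed
  then have "(%z. indicator D2 z * (B1 z * pd 1 c z + B2 z * pd \<i> c z)) = F"
   unfolding F_def by (intro ext) (simp add: indicator_def del: mem_ball_0)
  ultimately show ?thesis by (simp add: T_def)
 qed
 have EB: "integrable lborel (%z. E n j z * B z)" "!!z. E n j z * B z = E n j z * (indicator (D2 - O') z * B z)"
  if j: "j \<in> Basis" and B: "integrable lborel (%z. indicator (D2 - O') z * B z)" for n j B
 proof -
  show eq: "E n j z * B z = E n j z * (indicator (D2 - O') z * B z)" for z
   using p0[of z j] by (cases "z \<in> D2"; cases "z \<in> O'") (simp_all add: E_def)
  show "integrable lborel (%z. E n j z * B z)" unfolding eq
   using Cc_times_integrable[OF EC[OF j] B] by simp
 qed
 note eb = EB(1)[OF Basis_c(1) B_integrable(1)[OF O]] EB(1)[OF Basis_c(2) B_integrable(2)[OF O]]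
 have "(LBINT z. pd 1 (E n 1) z * \<beta> z) + (LBINT z. pd \<i> (E n \<i>) z * \<beta> z) = - (LBINT z. eta n z * F z)" for n
 proof -
  have "(LBINT z. pd 1 (E n 1) z * \<beta> z) + (LBINT z. pd \<i> (E n \<i>) z * \<beta> z)
    = - (LBINT z. E n 1 z * B1 z + E n \<i> z * B2 z)"
   unfolding grad(1)[OF EC[OF Basis_c(1)]] grad(2)[OF EC[OF Basis_c(2)]] using eb by simp
  also have "(%z. E n 1 z * B1 z + E n \<i> z * B2 z) = (%z. eta n z * F z)"
   by (rule ext) (simp add: E_def F_def indicator_def algebra_simps del: mem_ball_0)
  finally show ?thesis .
 qed
 moreover have "(%n. - (LBINT z. eta n z * F z)) \<longlonglongrightarrow> - (LBINT z. F z)"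
  by (intro tendsto_minus eta_integral_tendsto[OF Fi]) (simp add: F_def)
 ultimately have "(%n. (LBINT z. pd 1 (E n 1) z * \<beta> z) + (LBINT z. pd \<i> (E n \<i>) z * \<beta> z)) \<longlonglongrightarrow> 0"
  using TF by simp
 moreover have "(%n. (LBINT z. pd 1 (E n 1) z * \<beta> z) + (LBINT z. pd \<i> (E n \<i>) z * \<beta> z))
   \<longlonglongrightarrow> (LBINT z. indicator D2 z * (\<beta> z * lap q z))"
  unfolding E_def by (rule green_eta[OF q beta_cont N])
 ultimately show ?thesis by (rule LIMSEQ_unique[rotated])
qed

text \<open>Branch points are released one at a time: the point cutoff removes \<open>q\<close> near
  a branch point at arbitrarily small cost in the integral.\<close>

lemma weak_laplace:
 assumes q: "Ck_on (Suc 1) UNIV q" and N: "!!z. z \<in> circle ==> pd z q z = 0"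
 shows "(LBINT z. indicator D2 z * (\<beta> z * lap q z)) = 0"
proof -
 \<comment> \<open>\<open>A\<close> collects the branch points near which \<open>q\<close> is
   unrestricted. The claim quantifies over \<open>q\<close> because the induction step replaces
   it.\<close>
 have main: "\<forall>(q :: complex => real) O'. Ck_on (Suc 1) UNIV q \<longrightarrow> (\<forall>z\<in>circle. pd z q z = 0) \<longrightarrow> open O' \<longrightarrow> S - A \<subseteq> O' \<longrightarrow> (\<forall>z\<in>O'. q z = 0) \<longrightarrow>
   (LBINT z. indicator D2 z * (\<beta> z * lap q z)) = 0" if "finite A" "A \<subseteq> S" for A
  using that
 proof (induction A rule: finite_induct)
  case empty
  show ?case
  proof (intro allI impI)
   fix q :: "complex => real" and O'
   assume "Ck_on (Suc 1) UNIV q" "\<forall>z\<in>circle. pd z q z = 0" "open O'" "S - {} \<subseteq> O'" "\<forall>z\<in>O'. q z = 0"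
   then show "(LBINT z. indicator D2 z * (\<beta> z * lap q z)) = 0" by (intro weak_laplace_away[where O'=O']) auto
  qed
 next
  case (insert s A)
  show ?case
  proof (intro allI impI)
   fix q :: "complex => real" and O'
   assume q: "Ck_on (Suc 1) UNIV q" and N: "\<forall>z\<in>circle. pd z q z = 0" and O: "open O'" "S - insert s A \<subseteq> O'" "\<forall>z\<in>O'. q z = 0"
   have sS: "s \<in> S" "s \<in> D2" using insert.prems branch(2) by auto
   have "open (D2 - (S - {s}))" using branch(1) by (intro open_Diff open_ball finite_imp_closed) auto
   moreover have "s \<in> D2 - (S - {s})" using sS by blast
   ultimately obtain r where r: "r > 0" "cball s r \<subseteq> D2 - (S - {s})" using open_contains_cball by blast
   have rD: "cball s r \<subseteq> D2" using r(2) by blast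
   have "\<bar>LBINT z. indicator D2 z * (\<beta> z * lap q z)\<bar> \<le> 0"
   proof (rule field_le_epsilon)
    fix e :: real assume e: "e > 0"
    obtain h \<delta> where h: "Ck_on (Suc 1) UNIV h" "\<delta> > 0" "!!z. z \<in> ball s \<delta> ==> h z = q z" "!!z. z \<notin> cball s r ==> h z = 0"
     "\<bar>LBINT z. indicator D2 z * (\<beta> z * lap h z)\<bar> \<le> e"
     by (rule lap_point_cutoff[OF beta_cont rD r(1) q e]) (assumption | rule that)+
    \<comment> \<open>\<open>g\<close> vanishes near the released point and agrees with
      \<open>q\<close> outside a ball that meets neither the circle nor the other branch points, so
      the Neumann condition and the remaining vanishing survive.\<close>
    define g where [abs_def]: "g z = q z - h z" for z
    have gC: "Ck_on (Suc 1) UNIV g" unfolding g_def by (rule Ck_on_diff[OF open_UNIV q h(1)])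
    have gN: "pd z g z = 0" if z: "z \<in> circle" for z
    proof -
     have "z \<in> - cball s r" using z rD by auto
     then have "pd z g z = pd z q z" by (intro pd_cong_open[where S="- cball s r"]) (auto simp: g_def h(4))
     then show ?thesis using N z by simp
    qed
    have "(LBINT z. indicator D2 z * (\<beta> z * lap g z)) = 0"
    proof (rule insert.IH[rule_format])
     show "A \<subseteq> S" using insert.prems by blast
     show "open ((O' - cball s r) \<union> ball s \<delta>)" using O(1) by (intro open_Un open_Diff) auto
     show "S - A \<subseteq> (O' - cball s r) \<union> ball s \<delta>"
     proof
      fix x assume x: "x \<in> S - A"
      show "x \<in> (O' - cball s r) \<union> ball s \<delta>"
      proof (cases "x = s")
       case False
       then have "x \<notin> cball s r" using x r(2) by blast
       then show ?thesis using x O(2) False by blast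
      qed (use h(2) in simp)
     qed
     show "g z = 0" if "z \<in> (O' - cball s r) \<union> ball s \<delta>" for z
      using that h(3,4) O(3) by (auto simp: g_def)
    qed (use gC gN in auto)
    moreover have "(LBINT z. indicator D2 z * (\<beta> z * lap g z)) =
      (LBINT z. indicator D2 z * (\<beta> z * lap q z)) - (LBINT z. indicator D2 z * (\<beta> z * lap h z))"
    proof -
     have i: "integrable lborel (%z. indicator D2 z * (\<beta> z * lap f z))" if f: "Ck_on (Suc 1) UNIV f" for f
     proof -
      have c: "continuous_on closed_D2 (%z. \<beta> z * lap f z)"
       by (intro continuous_intros beta_cont continuous_on_subset[OF continuous_lap[OF f] subset_UNIV])
      obtain M where M: "M > 0" "!!z. z \<in> closed_D2 ==> norm (\<beta> z * lap f z) \<le> M"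
       by (rule continuous_on_closed_D2_bound[OF c]) blast
      have "integrable lborel (%z. if z \<in> D2 then \<beta> z * lap f z else 0)"
       by (rule bounded_on_D2_integrable[OF continuous_on_subset[OF c ball_subset_cball], of M]) (use M in auto)
      moreover have "(%z. if z \<in> D2 then \<beta> z * lap f z else 0) = (%z. indicator D2 z * (\<beta> z * lap f z))"
       by (auto simp: fun_eq_iff)
      ultimately show ?thesis by simp
     qed
     have "lap g z = lap q z - lap h z" for z unfolding g_def by (rule lap_diff[OF q h(1)])
     then show ?thesis using i[OF q] i[OF h(1)] by (simp add: right_diff_distrib)
    qed
    ultimately show "\<bar>LBINT z. indicator D2 z * (\<beta> z * lap q z)\<bar> \<le> 0 + e" using h(5) by simp
   qed
   then show "(LBINT z. indicator D2 z * (\<beta> z * lap q z)) = 0" by simp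
  qed
 qed
 show ?thesis by (rule main[OF branch(1) order.refl, rule_format, where O'="{}"]) (use q N in auto)
qed

lemma lap_mean_zero:
 assumes q: "Ck_on (Suc 1) UNIV q" and N: "!!z. z \<in> circle ==> pd z q z = 0"
 shows "(LBINT z. indicator D2 z * lap q z) = 0"
proof -
 have pC: "Ck_on 1 D2 (pd j q)" if "j \<in> Basis" for j
  by (rule Ck_on_subset[OF open_UNIV open_ball subset_UNIV Ck2_D(2)[OF q that]])
 have z: "(LBINT z. pd j (%z. if z \<in> D2 then eta n z *\<^sub>R pd j q z else 0) z * 1) = 0" if "j \<in> Basis" for n j
  using integral_pd_eq_0[OF Cc_eta_D2[OF pC[OF that], of n] that] by simp
 have "(%n::nat. 0) \<longlonglongrightarrow> (LBINT z. indicator D2 z * (1 * lap q z))"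
  using green_eta[OF q continuous_on_const[of _ 1] N] unfolding z[OF Basis_c(1)] z[OF Basis_c(2)] by simp
 then show ?thesis by (simp add: LIMSEQ_const_iff)
qed

end

section \<open>Real monomials in z and its conjugate\<close>

definition zmono :: "complex => nat => nat => complex => real" where
 "zmono \<alpha> a b z = Re (\<alpha> * z ^ a * cnj z ^ b)"

lemma zmono_simps: "zmono 0 a b z = 0" "zmono \<alpha> 0 0 z = Re \<alpha>" "zmono (- \<alpha>) a b z = - zmono \<alpha> a b z"
proof -
 show "zmono 0 a b z = 0" "zmono \<alpha> 0 0 z = Re \<alpha>" by (simp_all add: zmono_def)
 show "zmono (- \<alpha>) a b z = - zmono \<alpha> a b z" unfolding zmono_def by (simp only: mult_minus_left uminus_complex.sel)
qed

lemma zmono_scale: "k * zmono \<alpha> a b z = zmono (of_real k * \<alpha>) a b z"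
proof -
 have "Re (of_real k * x) = k * Re x" for x by simp
 then show ?thesis unfolding zmono_def mult.assoc by (rule sym)
qed

lemma zmono_has_derivative:
 "(zmono \<alpha> a b has_derivative (%v. zmono (\<alpha> * of_nat a * v) (a - 1) b z + zmono (\<alpha> * of_nat b * cnj v) a (b - 1) z)) (at z)"
proof -
 have "((%z. \<alpha> * z ^ a * cnj z ^ b) has_derivative
   (%v. \<alpha> * z ^ a * (of_nat b * cnj v * cnj z ^ (b - 1)) + \<alpha> * (of_nat a * v * z ^ (a - 1)) * cnj z ^ b)) (at z)"
  by (intro has_derivative_mult has_derivative_mult_right has_derivative_power has_derivative_cnj has_derivative_ident)
 from bounded_linear.has_derivative[OF bounded_linear_Re this] show ?thesis
  unfolding zmono_def[abs_def] plus_complex.sel(1) by (simp only: mult_ac add_ac)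
qed

lemma pd_zmono: "pd v (zmono \<alpha> a b) = (%z. zmono (\<alpha> * of_nat a * v) (a - 1) b z + zmono (\<alpha> * of_nat b * cnj v) a (b - 1) z)"
 by (rule ext) (rule pd_eqI[OF zmono_has_derivative])

lemma Ck_on_zmono: "Ck_on k UNIV (zmono \<alpha> a b)"
proof (induction k arbitrary: \<alpha> a b)
 case 0
 show ?case unfolding Ck_on.simps zmono_def by (intro continuous_intros)
next
 case (Suc k)
 show ?case by (rule Ck_on_SucI[OF open_UNIV zmono_has_derivative]) (intro Ck_on_add open_UNIV Suc)
qed

text \<open>The Laplacian is four times the mixed derivative in z and its conjugate: the pure second
  derivatives cancel between the directions 1 and \<i>.\<close>

lemma lap_zmono: "lap (zmono \<alpha> a b) z = zmono (4 * \<alpha> * of_nat a * of_nat b) (a - 1) (b - 1) z"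
proof -
 have "pd v (pd v (zmono \<alpha> a b)) z =
   (zmono (\<alpha> * of_nat a * v * of_nat (a - 1) * v) (a - 1 - 1) b z + zmono (\<alpha> * of_nat a * v * of_nat b * cnj v) (a - 1) (b - 1) z)
   + (zmono (\<alpha> * of_nat b * cnj v * of_nat a * v) (a - 1) (b - 1) z + zmono (\<alpha> * of_nat b * cnj v * of_nat (b - 1) * cnj v) a (b - 1 - 1) z)" for v
  unfolding pd_zmono by (rule pd_eqI[OF has_derivative_add[OF zmono_has_derivative zmono_has_derivative]])
 note d = this
 have s: "zmono (\<alpha> * r * \<i> * s * \<i>) m n z = - zmono (\<alpha> * r * 1 * s * 1) m n z"
  "zmono (\<alpha> * r * cnj \<i> * s * cnj \<i>) m n z = - zmono (\<alpha> * r * cnj 1 * s * cnj 1) m n z"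
  "zmono (\<alpha> * r * \<i> * s * cnj \<i>) m n z = zmono (\<alpha> * r * 1 * s * cnj 1) m n z"
  "zmono (\<alpha> * r * cnj \<i> * s * \<i>) m n z = zmono (\<alpha> * r * cnj 1 * s * 1) m n z" for r s m n
 proof -
  have e: "\<alpha> * r * \<i> * s * \<i> = - (\<alpha> * r * s)" "\<alpha> * r * cnj \<i> * s * cnj \<i> = - (\<alpha> * r * s)"
   "\<alpha> * r * \<i> * s * cnj \<i> = \<alpha> * r * s" "\<alpha> * r * cnj \<i> * s * \<i> = \<alpha> * r * s"
   by (simp_all add: complex_eq_iff algebra_simps)
  show "zmono (\<alpha> * r * \<i> * s * \<i>) m n z = - zmono (\<alpha> * r * 1 * s * 1) m n z"
   "zmono (\<alpha> * r * cnj \<i> * s * cnj \<i>) m n z = - zmono (\<alpha> * r * cnj 1 * s * cnj 1) m n z"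
   "zmono (\<alpha> * r * \<i> * s * cnj \<i>) m n z = zmono (\<alpha> * r * 1 * s * cnj 1) m n z"
   "zmono (\<alpha> * r * cnj \<i> * s * \<i>) m n z = zmono (\<alpha> * r * cnj 1 * s * 1) m n z"
   unfolding e by (simp_all add: zmono_simps)
 qed
 have q: "zmono (4 * \<alpha> * of_nat a * of_nat b) (a - 1) (b - 1) z = 4 * zmono (\<alpha> * of_nat a * of_nat b) (a - 1) (b - 1) z"
  by (simp only: zmono_scale of_real_numeral mult.assoc)
 have c: "\<alpha> * of_nat b * of_nat a = \<alpha> * of_nat a * (of_nat b :: complex)" by simp
 show ?thesis unfolding lap_def d s q by (simp add: c)
qed

text \<open>Euler's identity for a homogeneous function of degree a + b.\<close>

lemma pd_radial_zmono: "pd z (zmono \<alpha> a b) z = zmono (\<alpha> * of_nat (a + b)) a b z"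
proof -
 have e: "\<alpha> * of_nat a * z * z ^ (a - 1) * cnj z ^ b = \<alpha> * of_nat a * z ^ a * cnj z ^ b"
  "\<alpha> * of_nat b * cnj z * z ^ a * cnj z ^ (b - 1) = \<alpha> * of_nat b * z ^ a * cnj z ^ b"
  by (cases a, simp_all add: mult_ac, cases b, simp_all add: mult_ac)
 have "pd z (zmono \<alpha> a b) z = zmono (\<alpha> * of_nat a * z) (a - 1) b z + zmono (\<alpha> * of_nat b * cnj z) a (b - 1) z"
  by (rule fun_cong[OF pd_zmono])
 also have "\<dots> = zmono (\<alpha> * of_nat (a + b)) a b z"
  unfolding zmono_def e plus_complex.sel(1)[symmetric] by (simp only: of_nat_add distrib_left distrib_right)
 finally show ?thesis .
qed

lemma zmono_circle:
 assumes z: "z \<in> circle" shows "zmono \<alpha> (a + n) (b + n) z = zmono \<alpha> a b z"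
proof -
 have "z * cnj z = 1" using z by (simp add: complex_norm_square[symmetric])
 then have "(z * cnj z) ^ n = 1" by simp
 then have n: "z ^ n * cnj z ^ n = 1" by (simp add: power_mult_distrib)
 have e: "\<alpha> * z ^ (a + n) * cnj z ^ (b + n) = \<alpha> * z ^ a * cnj z ^ b * (z ^ n * cnj z ^ n)"
  by (simp add: power_add mult_ac)
 show ?thesis unfolding zmono_def e n mult_1_right ..
qed

lemma zmono_swap: "zmono \<alpha> a b = zmono (cnj \<alpha>) b a"
proof
 fix z
 have "cnj (\<alpha> * z ^ a * cnj z ^ b) = cnj \<alpha> * z ^ b * cnj z ^ a" by (simp add: mult_ac)
 then have "Re (\<alpha> * z ^ a * cnj z ^ b) = Re (cnj \<alpha> * z ^ b * cnj z ^ a)" by (metis cnj.sel(1))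
 then show "zmono \<alpha> a b z = zmono (cnj \<alpha>) b a z" by (simp only: zmono_def)
qed

text \<open>From 2 Re x Re y = Re (y x) + Re (y cnj x). Sums of monomials are thus stable under
  multiplication by real linear forms and account for all real polynomials.\<close>

lemma zmono_mult: "zmono \<gamma> 1 0 z * zmono \<alpha> a b z = zmono (\<alpha> * \<gamma> / 2) (a + 1) b z + zmono (\<alpha> * cnj \<gamma> / 2) a (b + 1) z"
proof -
 have r: "Re x * Re y = Re (y * x / 2) + Re (y * cnj x / 2)" for x y :: complex by (simp add: field_simps)
 have "zmono \<gamma> 1 0 z * zmono \<alpha> a b z = Re (\<gamma> * z) * Re (\<alpha> * z ^ a * cnj z ^ b)" by (simp only: zmono_def power_one_right power_0 mult_1_right)
 also have "\<dots> = Re ((\<alpha> * z ^ a * cnj z ^ b) * (\<gamma> * z) / 2) + Re ((\<alpha> * z ^ a * cnj z ^ b) * cnj (\<gamma> * z) / 2)" by (rule r)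
 also have "(\<alpha> * z ^ a * cnj z ^ b) * (\<gamma> * z) / 2 = \<alpha> * \<gamma> / 2 * z ^ (a + 1) * cnj z ^ b" by (simp add: mult_ac)
 also have "(\<alpha> * z ^ a * cnj z ^ b) * cnj (\<gamma> * z) / 2 = \<alpha> * cnj \<gamma> / 2 * z ^ a * cnj z ^ (b + 1)" by (simp add: mult_ac)
 finally show ?thesis by (simp only: zmono_def)
qed

lemma bounded_linear_zmono:
 fixes f :: "complex => real"
 assumes "bounded_linear f" obtains \<gamma> where "f = zmono \<gamma> 1 0"
proof -
 have "linear f" using assms by (rule bounded_linear.linear)
 have "f z = zmono (Complex (f 1) (- f \<i>)) 1 0 z" for z
 proof -
  have "f z = Re z *\<^sub>R f 1 + Im z *\<^sub>R f \<i>" by (rule linear_complex_expand[OF \<open>linear f\<close>])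
  also have "\<dots> = zmono (Complex (f 1) (- f \<i>)) 1 0 z" by (simp add: zmono_def mult.commute)
  finally show ?thesis .
 qed
 then show ?thesis using that by blast
qed

context fb_disc
begin

definition beta_mean :: real where "beta_mean = (LBINT z. indicator D2 z * \<beta> z) / pi"

text \<open>Pairing with the angle minus its mean. Subtracting the mean kills constants, which are
  not Laplacians of functions with vanishing normal derivative.\<close>

definition L :: "(complex => real) => real" where
 "L f = (LBINT z. indicator D2 z * ((\<beta> z - beta_mean) * f z))"

lemma disc_integrable:
 fixes f :: "complex => real"
 assumes c: "continuous_on closed_D2 f" shows "integrable lborel (%z. indicator D2 z * f z)"
proof -
 obtain M where M: "M > 0" "!!z. z \<in> closed_D2 ==> norm (f z) \<le> M"
  by (rule continuous_on_closed_D2_bound[OF c]) blast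
 have "integrable lborel (%z. if z \<in> D2 then f z else 0)"
  by (rule bounded_on_D2_integrable[OF continuous_on_subset[OF c ball_subset_cball], of M]) (use M in auto)
 moreover have "(%z. if z \<in> D2 then f z else 0) = (%z. indicator D2 z * f z)" by (auto simp: fun_eq_iff)
 ultimately show ?thesis by simp
qed

lemma beta0_cont: "continuous_on closed_D2 (%z. \<beta> z - beta_mean)"
 by (intro continuous_intros beta_cont)

lemma L_add:
 assumes "continuous_on closed_D2 f" "continuous_on closed_D2 g"
 shows "L (%z. f z + g z) = L f + L g"
proof -
 have "integrable lborel (%z. indicator D2 z * ((\<beta> z - beta_mean) * f z))" "integrable lborel (%z. indicator D2 z * ((\<beta> z - beta_mean) * g z))"
  by (intro disc_integrable continuous_on_mult beta0_cont assms)+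
 then show ?thesis unfolding L_def by (simp add: distrib_left)
qed

lemma L_lap:
 assumes q: "Ck_on (Suc 1) UNIV q" and N: "!!z. z \<in> circle ==> pd z q z = 0"
 shows "L (lap q) = 0"
proof -
 have c: "continuous_on closed_D2 (lap q)" by (rule continuous_on_subset[OF continuous_lap[OF q] subset_UNIV])
 have i: "integrable lborel (%z. indicator D2 z * (\<beta> z * lap q z))" "integrable lborel (%z. indicator D2 z * lap q z)"
  by (intro disc_integrable continuous_on_mult beta_cont c)+
 have "L (lap q) = (LBINT z. indicator D2 z * (\<beta> z * lap q z) - beta_mean * (indicator D2 z * lap q z))"
  unfolding L_def by (rule Bochner_Integration.integral_cong) (simp_all add: algebra_simps)
 also have "\<dots> = 0" using i weak_laplace[OF q N] lap_mean_zero[OF q N] by simp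
 finally show ?thesis .
qed

lemma L_one: "L (%z. k) = 0"
proof -
 have i: "integrable lborel (%z. indicator D2 z * \<beta> z)" "integrable lborel (%z::complex. indicator D2 z * (1::real))"
  by (intro disc_integrable beta_cont continuous_on_const)+
 have m: "(LBINT z::complex. indicator D2 z * (1::real)) = pi"
  using content_ball[of 1 "0::complex"] emeasure_lborel_ball_finite[of "0::complex" 1] by (simp add: unit_ball_vol_2)
 have "L (%z. k) = (LBINT z. k * (indicator D2 z * \<beta> z) - k * beta_mean * (indicator D2 z * 1))"
  unfolding L_def by (rule Bochner_Integration.integral_cong) (simp_all add: algebra_simps)
 also have "\<dots> = k * (LBINT z. indicator D2 z * \<beta> z) - k * beta_mean * pi"
  using i m by simp
 also have "\<dots> = 0" by (simp add: beta_mean_def)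
 finally show ?thesis .
qed

lemma zmono_cont: "continuous_on X (zmono \<alpha> a b)"
 unfolding zmono_def[abs_def] by (intro continuous_intros)

text \<open>Each monomial is, up to a constant, the Laplacian of a polynomial with vanishing normal derivative:
 subtract the harmonic polynomial with the same normal derivative, or a multiple of \<open>\<bar>z\<bar>\<^sup>2\<close> if there is none.\<close>

lemma L_zmono_less:
 assumes "b < a" shows "L (zmono \<alpha> a b) = 0"
proof -
 \<comment> \<open>\<open>\<gamma>\<close> produces the prescribed Laplacian.
   \<open>\<gamma>'\<close> equates the radial derivatives, of degrees a + b + 2 and a - b, on the
   circle; it exists because a - b is not 0.\<close>
 define \<gamma> \<gamma>' where "\<gamma> = \<alpha> / (4 * of_nat (a + 1) * of_nat (b + 1))" and "\<gamma>' = \<gamma> * of_nat (a + b + 2) / of_nat (a - b)"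
 define q where [abs_def]: "q z = zmono \<gamma> (a + 1) (b + 1) z - zmono \<gamma>' (a - b) 0 z" for z
 have qC: "Ck_on (Suc 1) UNIV q" unfolding q_def by (intro Ck_on_diff Ck_on_zmono open_UNIV)
 have nz: "of_nat (a - b) \<noteq> (0 :: complex)" "of_nat (a + 1) \<noteq> (0 :: complex)" "of_nat (b + 1) \<noteq> (0 :: complex)"
  unfolding of_nat_eq_0_iff using assms by simp_all
 have quot: "4 * (\<alpha> / (4 * A * B)) * A * B = \<alpha>" if "A \<noteq> 0" "B \<noteq> 0" for A B :: complex using that by simp
 have \<gamma>: "4 * \<gamma> * of_nat (a + 1) * of_nat (b + 1) = \<alpha>" unfolding \<gamma>_def by (rule quot[OF nz(2,3)])
 have \<gamma>': "\<gamma>' * of_nat (a - b) = \<gamma> * of_nat (a + b + 2)" using nz(1) unfolding \<gamma>'_def by simp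
 have lapq: "lap q z = zmono \<alpha> a b z" for z
 proof -
  have "lap q z = zmono (4 * \<gamma> * of_nat (a + 1) * of_nat (b + 1)) (a + 1 - 1) (b + 1 - 1) z - zmono (4 * \<gamma>' * of_nat (a - b) * of_nat 0) (a - b - 1) (0 - 1) z"
   unfolding q_def lap_diff[OF Ck_on_zmono Ck_on_zmono] lap_zmono ..
  then show ?thesis unfolding \<gamma> by (simp add: zmono_simps)
 qed
 have N: "pd z q z = 0" if z: "z \<in> circle" for z
 proof -
  have "(q has_derivative (%v. pd v (zmono \<gamma> (a + 1) (b + 1)) z - pd v (zmono \<gamma>' (a - b) 0) z)) (at z)"
   unfolding q_def by (intro has_derivative_diff has_derivative_pd Ck2_D(3) Ck_on_zmono)
  then have "pd z q z = zmono (\<gamma> * of_nat (a + 1 + (b + 1))) (a + 1) (b + 1) z - zmono (\<gamma>' * of_nat (a - b + 0)) (a - b) 0 z"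
   unfolding pd_radial_zmono[symmetric] by (rule pd_eqI)
  also have "\<gamma>' * of_nat (a - b + 0) = \<gamma> * of_nat (a + 1 + (b + 1))"
  proof -
   have "a + 1 + (b + 1) = a + b + 2" by simp
   then show ?thesis by (simp only: \<gamma>' add_0_right)
  qed
  also have "zmono (\<gamma> * of_nat (a + 1 + (b + 1))) (a + 1) (b + 1) z = zmono (\<gamma> * of_nat (a + 1 + (b + 1))) (a - b) 0 z"
  proof -
   have "a - b + (b + 1) = a + 1" using assms by simp
   then show ?thesis using zmono_circle[OF z, of "\<gamma> * of_nat (a + 1 + (b + 1))" "a - b" "b + 1" 0] by (simp only: add_0)
  qed
  finally show ?thesis by simp
 qed
 have "lap q = zmono \<alpha> a b" by (rule ext) (rule lapq)
 then show ?thesis using L_lap[OF qC N] by simp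
qed

lemma L_zmono_diag: "L (zmono \<alpha> a a) = 0"
proof -
 define \<gamma> where "\<gamma> = \<alpha> / (4 * of_nat (a + 1) * of_nat (a + 1))"
 \<comment> \<open>On the circle the radial derivative is now constant and is compensated by a
   multiple of |z|^2. Its Laplacian is a constant, on which \<open>L\<close> vanishes.\<close>
 define q where [abs_def]: "q z = zmono \<gamma> (a + 1) (a + 1) z - zmono (\<gamma> * of_nat (a + 1)) 1 1 z" for z
 have qC: "Ck_on (Suc 1) UNIV q" unfolding q_def by (intro Ck_on_diff Ck_on_zmono open_UNIV)
 have nz: "of_nat (a + 1) \<noteq> (0 :: complex)" unfolding of_nat_eq_0_iff by simp
 have quot: "4 * (\<alpha> / (4 * A * B)) * A * B = \<alpha>" if "A \<noteq> 0" "B \<noteq> 0" for A B :: complex using that by simp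
 have \<gamma>: "4 * \<gamma> * of_nat (a + 1) * of_nat (a + 1) = \<alpha>" unfolding \<gamma>_def by (rule quot[OF nz nz])
 have lapq: "zmono \<alpha> a a z = lap q z + Re (4 * (\<gamma> * of_nat (a + 1)))" for z
 proof -
  have "lap q z = zmono (4 * \<gamma> * of_nat (a + 1) * of_nat (a + 1)) (a + 1 - 1) (a + 1 - 1) z - zmono (4 * (\<gamma> * of_nat (a + 1)) * of_nat 1 * of_nat 1) (1 - 1) (1 - 1) z"
   unfolding q_def lap_diff[OF Ck_on_zmono Ck_on_zmono] lap_zmono ..
  then show ?thesis unfolding \<gamma> by (simp add: zmono_simps)
 qed
 have N: "pd z q z = 0" if z: "z \<in> circle" for z
 proof -
  have "(q has_derivative (%v. pd v (zmono \<gamma> (a + 1) (a + 1)) z - pd v (zmono (\<gamma> * of_nat (a + 1)) 1 1) z)) (at z)"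
   unfolding q_def by (intro has_derivative_diff has_derivative_pd Ck2_D(3) Ck_on_zmono)
  then have "pd z q z = zmono (\<gamma> * of_nat (a + 1 + (a + 1))) (a + 1) (a + 1) z - zmono (\<gamma> * of_nat (a + 1) * of_nat (1 + 1)) 1 1 z"
   unfolding pd_radial_zmono[symmetric] by (rule pd_eqI)
  also have "zmono (\<gamma> * of_nat (a + 1 + (a + 1))) (a + 1) (a + 1) z = zmono (\<gamma> * of_nat (a + 1 + (a + 1))) 1 1 z"
   using zmono_circle[OF z, of "\<gamma> * of_nat (a + 1 + (a + 1))" 1 a 1] by (simp only: add.commute[of 1 a])
  also have "\<gamma> * of_nat (a + 1 + (a + 1)) = \<gamma> * of_nat (a + 1) * of_nat (1 + 1)" by (simp add: algebra_simps)
  finally show ?thesis by simp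
 qed
 have "zmono \<alpha> a a = (%z. lap q z + Re (4 * (\<gamma> * of_nat (a + 1))))" by (rule ext) (rule lapq)
 then have "L (zmono \<alpha> a a) = L (lap q) + L (%_. Re (4 * (\<gamma> * of_nat (a + 1))))"
  using L_add[OF continuous_on_subset[OF continuous_lap[OF qC] subset_UNIV] continuous_on_const] by simp
 moreover have "L (lap q) = 0" by (rule L_lap[OF qC N])
 ultimately show ?thesis by (simp add: L_one)
qed

lemma L_zmono: "L (zmono \<alpha> a b) = 0"
proof (cases a b rule: linorder_cases)
 case less
 then show ?thesis using L_zmono_less[of a b "cnj \<alpha>"] zmono_swap[of \<alpha> a b] by simp
qed (use L_zmono_less L_zmono_diag in auto)

text \<open>The factor \<open>h\<close> makes the induction work: in the product case one factor is
  absorbed into it, and the linear case uses that a linear form times a monomial is a sum of two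
  monomials.\<close>

lemma L_polynomial_times:
 assumes "real_polynomial_function f" "continuous_on UNIV h" "!!\<alpha> a b. L (%z. h z * zmono \<alpha> a b z) = 0"
 shows "L (%z. f z * (h z * zmono \<alpha> a b z)) = 0"
 using assms
proof (induction f arbitrary: h \<alpha> a b rule: real_polynomial_function.induct)
 case (linear f)
 obtain \<gamma> where f: "f = zmono \<gamma> 1 0" by (rule bounded_linear_zmono[OF linear(1)])
 have "f z * (h z * zmono \<alpha> a b z) = h z * zmono (\<alpha> * \<gamma> / 2) (a + 1) b z + h z * zmono (\<alpha> * cnj \<gamma> / 2) a (b + 1) z" for z
  unfolding f distrib_left[symmetric] zmono_mult[symmetric] by (rule mult.left_commute)
 moreover have c: "continuous_on closed_D2 (%z. h z * zmono \<alpha>' a' b' z)" for \<alpha>' a' b'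
  by (intro continuous_on_mult continuous_on_subset[OF linear(2)] zmono_cont) auto
 ultimately show ?case using L_add[OF c c] linear(3) by simp
next
 case (const k)
 have e: "k * (h z * zmono \<alpha> a b z) = h z * zmono (of_real k * \<alpha>) a b z" for z
  unfolding zmono_scale[symmetric] by (rule mult.left_commute)
 show ?case unfolding e by (rule const(2))
next
 case (add f g)
 have pc: "continuous_on UNIV p" if "real_polynomial_function p" for p :: "complex => real"
  by (intro continuous_at_imp_continuous_on ballI continuous_real_polymonial_function that)
 have c: "continuous_on closed_D2 (%z. p z * (h z * zmono \<alpha> a b z))" if "real_polynomial_function p" for p
  by (intro continuous_on_mult continuous_on_subset[OF pc[OF that]] continuous_on_subset[OF add.prems(1)] zmono_cont) auto
 show ?case unfolding distrib_right
  using L_add[OF c[OF add.hyps(1)] c[OF add.hyps(2)]] add.IH(1)[OF add.prems] add.IH(2)[OF add.prems] by simp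
next
 case (mult f g)
 have pc: "continuous_on UNIV g"
  by (intro continuous_at_imp_continuous_on ballI continuous_real_polymonial_function mult.hyps(2))
 have "L (%z. f z * ((g z * h z) * zmono \<alpha> a b z)) = 0"
 proof (rule mult.IH(1))
  show "continuous_on UNIV (%z. g z * h z)" by (intro continuous_on_mult pc mult.prems(1))
  show "L (%z. g z * h z * zmono \<alpha> a b z) = 0" for \<alpha> a b
   using mult.IH(2)[OF mult.prems] by (simp add: mult.assoc)
 qed
 then show ?case by (simp add: mult.assoc)
qed

text \<open>\<open>L\<close> annihilates polynomials, hence by uniform density also the mean-free
  angle itself; that value is the integral of its square.\<close>

lemma beta_constant: "z \<in> closed_D2 ==> \<beta> z = beta_mean"
proof -
 define f where [abs_def]: "f z = \<beta> z - beta_mean" for z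
 have fc: "continuous_on closed_D2 f" unfolding f_def by (rule beta0_cont)
 obtain M where M: "M > 0" "!!z. z \<in> closed_D2 ==> norm (f z) \<le> M"
  by (rule continuous_on_closed_D2_bound[OF fc]) blast
 have "\<bar>L f\<bar> \<le> 0"
 proof (rule le_0_if_small)
  fix e :: real assume e: "e > 0"
  obtain g where g: "real_polynomial_function g" "!!x. x \<in> closed_D2 ==> \<bar>f x - g x\<bar> < e"
   by (rule Stone_Weierstrass_real_polynomial_function[OF compact_cball fc e]) blast
  have gc: "continuous_on closed_D2 g"
   by (intro continuous_at_imp_continuous_on ballI continuous_real_polymonial_function g(1))
  have "L (%z. g z * (1 * zmono 1 0 0 z)) = 0"
   by (rule L_polynomial_times[OF g(1) continuous_on_const]) (simp add: L_zmono)
  then have "L g = 0" by (simp add: zmono_simps)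
  have dc: "continuous_on closed_D2 (%z. f z - g z)" by (intro continuous_intros fc gc)
  have "L f = L (%z. (f z - g z) + g z)" by simp
  also have "\<dots> = L (%z. f z - g z)" unfolding L_add[OF dc gc] \<open>L g = 0\<close> by simp
  also have "\<bar>\<dots>\<bar> \<le> (LBINT z::complex. indicator D2 z * (M * e))"
   unfolding L_def real_norm_def[symmetric]
  proof (rule Bochner_Integration.integral_norm_bound_integral)
   show "integrable lborel (%z. indicator D2 z * ((\<beta> z - beta_mean) * (f z - g z)))"
    by (intro disc_integrable continuous_on_mult beta0_cont dc)
   show "integrable lborel (%z::complex. indicator D2 z * (M * e))" by (intro disc_integrable continuous_on_const)
   fix z :: complex
   show "norm (indicator D2 z * ((\<beta> z - beta_mean) * (f z - g z))) \<le> indicator D2 z * (M * e)"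
   proof (cases "z \<in> D2")
    case True
    then have zc: "z \<in> closed_D2" by simp
    have "\<bar>f z\<bar> * \<bar>f z - g z\<bar> \<le> M * e"
     using M(2)[OF zc] g(2)[OF zc] M(1) e by (intro mult_mono) auto
    then show ?thesis using True by (simp add: abs_mult f_def)
   qed simp
  qed
  also have "\<dots> = e * (M * pi)"
   using content_ball[of 1 "0::complex"] emeasure_lborel_ball_finite[of "0::complex" 1] by (simp add: unit_ball_vol_2)
  finally show "\<bar>L f\<bar> \<le> e * (M * pi)" .
 qed
 then have "L f = 0" by simp
 then have "(LBINT z. indicator D2 z * (f z * f z)) = 0" unfolding L_def f_def .
 moreover have "integrable lborel (%z. indicator D2 z * (f z * f z))"
  by (intro disc_integrable continuous_on_mult fc)
 ultimately have "AE z in lborel. indicator D2 z * (f z * f z) = 0"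
  using integral_nonneg_eq_0_iff_AE[of lborel "%z. indicator D2 z * (f z * f z)"] by simp
 then have "AE z in lborel. z \<in> D2 \<longrightarrow> f z = 0" by (rule AE_mp) (simp add: indicator_def)
 then have "AE z in lebesgue. z \<in> D2 \<longrightarrow> f z = 0" by (rule AE_completion)
 then have ae: "AE z in lebesgue_on D2. f z = 0" by (subst AE_restrict_space_iff) auto
 have "f z = 0" if "z \<in> D2" for z
  by (rule AE_lebesgue_on_continuous_eq[OF open_ball continuous_on_subset[OF fc ball_subset_cball] continuous_on_const ae that])
 then have "f z = 0" if "z \<in> closed_D2" for z
  by (rule continuous_eq_on_cball[OF fc continuous_on_const _ that])
 then show "z \<in> closed_D2 ==> \<beta> z = beta_mean" by (simp add: f_def)
qed

end

subsection \<open>The holomorphic curve\<close>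

text \<open>For the complex structure determined by the Lagrangian angle, \<open>u\<close> becomes a holomorphic curve.\<close>

definition hol1 :: "complex => complex2 => complex" where
 "hol1 k x = Complex (Re (cnj k * fst x)) (Re (cnj k * snd x))"

definition hol2 :: "complex => complex2 => complex" where
 "hol2 k x = Complex (Im (cnj k * fst x)) (- Im (cnj k * snd x))"

definition unhol :: "complex => complex => complex => complex2" where
 "unhol k p q = (k * Complex (Re p) (Re q), k * Complex (Im p) (- Im q))"

lemma unit_cnj: "cmod k = 1 ==> k * cnj k = 1" "cmod k = 1 ==> cnj k * k = 1"
 by (simp_all add: complex_norm_square[symmetric] mult.commute[of "cnj k" k])

lemma hol_linear: "bounded_linear (hol1 k)" "bounded_linear (hol2 k)"
 unfolding linear_conv_bounded_linear[symmetric]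
 by (rule linearI; simp add: hol1_def complex_eq_iff algebra_simps) (rule linearI; simp add: hol2_def complex_eq_iff algebra_simps)

lemma unhol_hol: assumes "cmod k = 1" shows "unhol k (hol1 k x) (hol2 k x) = x"
proof -
 have "unhol k (hol1 k x) (hol2 k x) = (k * (cnj k * fst x), k * (cnj k * snd x))"
  by (simp add: unhol_def hol1_def hol2_def complex_eq_iff del: times_complex.sel)
 then show ?thesis using unit_cnj(1)[OF assms] by (simp add: mult.assoc[symmetric])
qed

lemma norm_unhol: assumes "cmod k = 1" shows "(norm (unhol k p q))\<^sup>2 = (cmod p)\<^sup>2 + (cmod q)\<^sup>2"
 using assms by (simp add: unhol_def norm_complex2 norm_mult cmod_power2)

text \<open>In the holomorphic coordinates the symplectic form is the real part of dp dq, which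
  vanishes on every complex line.\<close>

lemma omega_unhol: assumes "cmod k = 1" shows "omega (unhol k p q) (unhol k p' q') = Re (p * q' - q * p')"
proof -
 have o: "omega v w = Im (cnj (fst v) * fst w) + Im (cnj (snd v) * snd w)" for v w by (simp add: omega_def)
 have c: "cnj (k * a) * (k * b) = cnj a * b" for a b
 proof -
  have "cnj (k * a) * (k * b) = (cnj k * k) * (cnj a * b)" by (simp add: mult_ac)
  then show ?thesis using unit_cnj(2)[OF assms] by simp
 qed
 show ?thesis unfolding o unhol_def fst_conv snd_conv c by simp
qed

lemma unhol_linear: "linear (%\<zeta>. unhol k (c1 * \<zeta>) (c2 * \<zeta>))"
 by (rule linearI) (simp_all add: unhol_def complex_eq_iff algebra_simps)

text \<open>After division by the unit \<open>k\<close>, a square root of the phase, the relation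
  between the first derivatives becomes y = quat x. The coordinates pair the real parts and the
  imaginary parts so that \<open>quat\<close> acts as multiplication by \<i> in both.\<close>

lemma hol_cauchy_riemann:
 assumes k: "cmod k = 1" and y: "y = cscale (k * k) (quat x)"
 shows "hol1 k y = \<i> * hol1 k x" "hol2 k y = \<i> * hol2 k x"
proof -
 have "cnj k * (k * k * a) = (cnj k * k) * (k * a)" for a by (simp add: mult_ac)
 then have e: "cnj k * (k * k * a) = k * a" for a using unit_cnj(2)[OF k] by simp
 have f: "cnj k * fst y = - cnj (cnj k * snd x)" "cnj k * snd y = cnj (cnj k * fst x)"
  by (simp_all add: y cscale_def quat_def e mult.assoc[symmetric] del: mult_minus_right add: e[unfolded mult.assoc[symmetric]])
 have g: "Complex (Re (- cnj A)) (Re (cnj B)) = \<i> * Complex (Re B) (Re A)"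
  "Complex (Im (- cnj A)) (- Im (cnj B)) = \<i> * Complex (Im B) (- Im A)" for A B
  by (simp_all add: complex_eq_iff)
 show "hol1 k y = \<i> * hol1 k x" "hol2 k y = \<i> * hol2 k x"
  unfolding hol1_def hol2_def f by (rule g)+
qed

text \<open>Along the circle the derivative of \<open>f\<close> is \<i> z f' = \<i> \<rho> f, which
  is orthogonal to \<open>f\<close>.\<close>

lemma norm_const_on_circle:
 fixes f f' :: "complex => complex"
 assumes d: "!!z. z \<in> circle ==> (f has_field_derivative f' z) (at z within closed_D2)"
  and r: "!!z. z \<in> circle ==> \<exists>\<rho>::real. z * f' z = of_real \<rho> * f z" and z: "z \<in> circle"
 shows "norm (f z) = norm (f 1)"
proof -
 define \<psi> where "\<psi> t = f (cis t) \<bullet> f (cis t)" for t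
 have "DERIV \<psi> t :> 0" for t
 proof -
  have ct: "cis t \<in> circle" by simp
  have "((%w. exp (\<i> * w)) has_field_derivative \<i> * cis t) (at (of_real t))"
   by (auto intro!: derivative_eq_intros simp: cis_conv_exp)
  from has_vector_derivative_real_field[OF this]
  have g: "(cis has_derivative (%s. s *\<^sub>R (\<i> * cis t))) (at t)"
   by (simp add: has_vector_derivative_def cis_conv_exp[abs_def])
  have "(f has_derivative (*) (f' (cis t))) (at (cis t) within cis ` UNIV)"
   using d[OF ct] unfolding has_field_derivative_def by (rule has_derivative_subset) auto
  from diff_chain_within[OF g this]
  have fd: "((%t. f (cis t)) has_derivative (%s. f' (cis t) * (s *\<^sub>R (\<i> * cis t)))) (at t)" by (simp add: o_def)
  obtain \<rho> :: real where \<rho>: "cis t * f' (cis t) = of_real \<rho> * f (cis t)" using r[OF ct] by blast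
  have e: "f' (cis t) * (s *\<^sub>R (\<i> * cis t)) = of_real (s * \<rho>) * (\<i> * f (cis t))" for s
  proof -
   have "f' (cis t) * (s *\<^sub>R (\<i> * cis t)) = of_real s * \<i> * (cis t * f' (cis t))" by (simp add: scaleR_conv_of_real mult_ac)
   then show ?thesis unfolding \<rho> by (simp add: mult_ac)
  qed
  have p: "w \<bullet> (of_real a * (\<i> * w)) = 0" "(of_real a * (\<i> * w)) \<bullet> w = 0" for a and w :: complex
   by (simp_all add: inner_complex_def algebra_simps)
  have "(\<psi> has_derivative (%s. 0)) (at t)"
   using has_derivative_inner[OF fd fd] unfolding \<psi>_def[abs_def] e p by simp
  then show ?thesis by (simp add: has_field_derivative_def lambda_zero[symmetric])
 qed
 then have "\<psi> (Arg z) = \<psi> 0" using DERIV_isconst_all by blast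
 moreover have "z \<noteq> 0" using z by auto
 then have "cis (Arg z) = z" using z by (simp add: cis_Arg sgn_div_norm)
 ultimately have "f z \<bullet> f z = f 1 \<bullet> f 1" by (simp add: \<psi>_def)
 then show ?thesis by (simp add: norm_eq_sqrt_inner)
qed

text \<open>The image lies in the open disc by the maximum principle and the open mapping theorem.
  The circle is mapped to the circle, so the image is relatively closed as well as open in the
  connected disc.\<close>

lemma unit_disc_surjective:
 fixes h :: "complex => complex"
 assumes hol: "h holomorphic_on D2" and c: "continuous_on closed_D2 h" and n: "!!z. z \<in> circle ==> norm (h z) = 1"
  and nc: "\<not> h constant_on D2"
 shows "h ` D2 = D2"
proof
 have op: "open (h ` D2)" by (rule open_mapping_thm[OF hol open_ball _ open_ball order.refl nc]) simp
 have "norm (h z) \<le> 1" if "z \<in> D2" for z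
  by (rule maximum_modulus_frontier[of h D2]) (use hol c n that in \<open>auto simp: interior_open\<close>)
 then have "h ` D2 \<subseteq> closed_D2" by auto
 then have "h ` D2 \<subseteq> interior closed_D2" using op by (rule interior_maximal)
 then show sub: "h ` D2 \<subseteq> D2" by (simp add: interior_cball)
 have "closed (h ` closed_D2)" by (intro compact_imp_closed compact_continuous_image c compact_cball)
 then have oc: "open (- (h ` closed_D2))" by (rule open_Compl)
 have cov: "y \<in> h ` D2 \<union> - (h ` closed_D2)" if "y \<in> D2" for y
 proof (cases "y \<in> h ` closed_D2")
  case True
  then obtain z where z: "z \<in> closed_D2" "y = h z" by blast
  have "z \<notin> circle" using n[of z] z(2) that by auto
  then have "z \<in> D2" using z(1) by auto
  then show ?thesis using z(2) by blast
 qed simp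
 have "h ` D2 \<inter> D2 = {} \<or> - (h ` closed_D2) \<inter> D2 = {}"
 proof (rule connectedD[OF _ op oc])
  show "connected D2" by simp
  show "h ` D2 \<inter> - (h ` closed_D2) \<inter> D2 = {}" using ball_subset_cball by blast
  show "D2 \<subseteq> h ` D2 \<union> - (h ` closed_D2)" using cov by blast
 qed
 moreover have "h 0 \<in> h ` D2" by (rule imageI) simp
 then have "h 0 \<in> h ` D2 \<inter> D2" using sub by blast
 ultimately have "- (h ` closed_D2) \<inter> D2 = {}" by blast
 then show "D2 \<subseteq> h ` D2" using cov by blast
qed

context fb_disc
begin

theorem flat_disc: "\<exists>P. lagrangian_plane P \<and> u ` D2 = ball 0 1 \<inter> P"
proof -
 \<comment> \<open>Half the constant angle, so that k squared is the phase relating the two first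
   derivatives.\<close>
 define k where "k = exp (\<i> * (beta_mean / 2))"
 have k: "cmod k = 1" by (simp add: k_def)
 have kk: "k * k = exp (\<i> * beta_mean)" unfolding k_def by (simp add: mult_exp_exp)
 have dyk: "dy u z = cscale (k * k) (quat (dx u z))" if "z \<in> closed_D2" for z
  using frame[OF that] beta_constant[OF that] by (simp add: kk)
 have der: "((%z. \<Lambda> (u z)) has_field_derivative \<Lambda> (dx u z)) (at z within closed_D2)" "\<Lambda> (du u z v) = v * \<Lambda> (dx u z)"
  if \<Lambda>: "bounded_linear \<Lambda>" "\<Lambda> (dy u z) = \<i> * \<Lambda> (dx u z)" and z: "z \<in> closed_D2" for \<Lambda> :: "complex2 => complex" and z v
 proof -
  have e: "\<Lambda> (du u z v) = v * \<Lambda> (dx u z)" for v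
  proof -
   have "\<Lambda> (du u z v) = Re v *\<^sub>R \<Lambda> (dx u z) + Im v *\<^sub>R (\<i> * \<Lambda> (dx u z))"
    unfolding du_expand[OF C1 z] \<Lambda>(2)[symmetric] linear_add[OF bounded_linear.linear[OF \<Lambda>(1)]] linear_cmul[OF bounded_linear.linear[OF \<Lambda>(1)]] ..
   also have "\<dots> = v * \<Lambda> (dx u z)" by (simp add: complex_eq_iff algebra_simps)
   finally show ?thesis .
  qed
  then show "\<Lambda> (du u z v) = v * \<Lambda> (dx u z)" .
  have "((%z. \<Lambda> (u z)) has_derivative (%v. \<Lambda> (du u z v))) (at z within closed_D2)"
   by (rule bounded_linear.has_derivative[OF \<Lambda>(1) C1cd_has_derivative[OF C1 z]])
  then show "((%z. \<Lambda> (u z)) has_field_derivative \<Lambda> (dx u z)) (at z within closed_D2)"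
   unfolding has_field_derivative_def e by (simp add: mult.commute[of _ "\<Lambda> (dx u z)"])
 qed
 define w1 w2 where [abs_def]: "w1 z = hol1 k (u z)" and [abs_def]: "w2 z = hol2 k (u z)" for z
 define d1 d2 where "d1 z = hol1 k (dx u z)" and "d2 z = hol2 k (dx u z)" for z
 have wd: "(w1 has_field_derivative d1 z) (at z within closed_D2)" "(w2 has_field_derivative d2 z) (at z within closed_D2)"
  if z: "z \<in> closed_D2" for z
  unfolding w1_def w2_def d1_def d2_def
  using der(1)[OF hol_linear(1) hol_cauchy_riemann(1)[OF k dyk[OF z]] z] der(1)[OF hol_linear(2) hol_cauchy_riemann(2)[OF k dyk[OF z]] z] .
 have wcirc: "z * d1 z = of_real (rad z \<bullet> u z) * w1 z" "z * d2 z = of_real (rad z \<bullet> u z) * w2 z" if z: "z \<in> circle" for z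
 proof -
  have zc: "z \<in> closed_D2" using z by auto
  have "du u z z = (rad z \<bullet> u z) *\<^sub>R u z" using rad_parallel(1)[OF z] du_radial[OF zc] by simp
  then show "z * d1 z = of_real (rad z \<bullet> u z) * w1 z" "z * d2 z = of_real (rad z \<bullet> u z) * w2 z"
   using der(2)[OF hol_linear(1) hol_cauchy_riemann(1)[OF k dyk[OF zc]] zc, of z]
    der(2)[OF hol_linear(2) hol_cauchy_riemann(2)[OF k dyk[OF zc]] zc, of z]
   by (simp_all add: d1_def d2_def w1_def w2_def scaleR_conv_of_real
     linear_cmul[OF bounded_linear.linear[OF hol_linear(1)]] linear_cmul[OF bounded_linear.linear[OF hol_linear(2)]])
 qed
 have uw: "u z = unhol k (w1 z) (w2 z)" for z using unhol_hol[OF k] by (simp add: w1_def w2_def)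
 have nu: "(norm (u z))\<^sup>2 = (cmod (w1 z))\<^sup>2 + (cmod (w2 z))\<^sup>2" for z unfolding uw[of z] by (rule norm_unhol[OF k])
 define c1 c2 where "c1 = w1 1" and "c2 = w2 1"
 have "norm (u 1) = 1" by (rule circ) simp
 then have "(cmod c1)\<^sup>2 + (cmod c2)\<^sup>2 = 1" using nu[of 1] by (simp add: c1_def c2_def)
 then have "of_real ((cmod c1)\<^sup>2 + (cmod c2)\<^sup>2) = (1 :: complex)" by simp
 then have cc: "c1 * cnj c1 + c2 * cnj c2 = 1" unfolding of_real_add complex_norm_square .
 have wc: "continuous_on closed_D2 w1" "continuous_on closed_D2 w2"
  using wd DERIV_continuous_on by blast+
 have wh: "w1 holomorphic_on D2" "w2 holomorphic_on D2"
  unfolding holomorphic_on_def field_differentiable_def using wd DERIV_subset[OF _ ball_subset_cball] ball_subset_cball by blast+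
 define F where [abs_def]: "F z = c2 * w1 z - c1 * w2 z" for z
 have Fcirc: "F z = 0" if z: "z \<in> circle" for z
 proof -
  have "norm (F z) = norm (F 1)"
  proof (rule norm_const_on_circle[where f'="%z. c2 * d1 z - c1 * d2 z", OF _ _ z])
   fix z :: complex assume z: "z \<in> circle"
   then have zc: "z \<in> closed_D2" by auto
   show "(F has_field_derivative c2 * d1 z - c1 * d2 z) (at z within closed_D2)"
    unfolding F_def by (intro DERIV_diff DERIV_cmult wd zc)
   have "z * (c2 * d1 z - c1 * d2 z) = c2 * (z * d1 z) - c1 * (z * d2 z)" by (simp add: algebra_simps)
   also have "\<dots> = of_real (rad z \<bullet> u z) * F z" unfolding wcirc[OF z] F_def by (simp add: algebra_simps)
   finally show "\<exists>\<rho>::real. z * (c2 * d1 z - c1 * d2 z) = of_real \<rho> * F z" by blast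
  qed
  also have "F 1 = 0" by (simp add: F_def c1_def c2_def)
  finally show ?thesis by simp
 qed
 have Fc: "continuous_on closed_D2 F" unfolding F_def by (intro continuous_intros wc)
 have Fh: "F holomorphic_on D2" unfolding F_def by (intro holomorphic_intros wh)
 have F0: "F z = 0" if z: "z \<in> closed_D2" for z
 proof (cases "z \<in> D2")
  case True
  have "norm (F z) \<le> 0"
   by (rule maximum_modulus_frontier[of F D2]) (use Fh Fc Fcirc True in \<open>auto simp: interior_open\<close>)
  then show ?thesis by simp
 qed (use Fcirc z in auto)
 \<comment> \<open>The curve lies on the complex line through the unit vector (c1, c2), its value at
   1; \<open>h\<close> is the coordinate along that vector.\<close>
 define h where [abs_def]: "h z = cnj c1 * w1 z + cnj c2 * w2 z" for z
 have wch: "w1 z = c1 * h z" "w2 z = c2 * h z" if "z \<in> closed_D2" for z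
 proof -
  have F: "c2 * w1 z = c1 * w2 z" using F0[OF that] by (simp add: F_def)
  have "c1 * h z = c1 * cnj c1 * w1 z + cnj c2 * (c1 * w2 z)" by (simp add: h_def algebra_simps)
  also have "\<dots> = (c1 * cnj c1 + c2 * cnj c2) * w1 z" unfolding F[symmetric] by (simp add: algebra_simps)
  finally show "w1 z = c1 * h z" unfolding cc by simp
  have "c2 * h z = cnj c1 * (c2 * w1 z) + c2 * cnj c2 * w2 z" by (simp add: h_def algebra_simps)
  also have "\<dots> = (c1 * cnj c1 + c2 * cnj c2) * w2 z" unfolding F by (simp add: algebra_simps)
  finally show "w2 z = c2 * h z" unfolding cc by simp
 qed
 \<comment> \<open>The isometric embedding of that line; its range is the Lagrangian plane, and u is
   J o h with \<open>h\<close> mapping the disc onto itself.\<close>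
 define J where [abs_def]: "J \<zeta> = unhol k (c1 * \<zeta>) (c2 * \<zeta>)" for \<zeta>
 have uJ: "u z = J (h z)" if "z \<in> closed_D2" for z unfolding uw[of z] wch[OF that] J_def ..
 have nJ: "norm (J \<zeta>) = cmod \<zeta>" for \<zeta>
 proof -
  have "(norm (J \<zeta>))\<^sup>2 = ((cmod c1)\<^sup>2 + (cmod c2)\<^sup>2) * (cmod \<zeta>)\<^sup>2"
   unfolding J_def norm_unhol[OF k] norm_mult power_mult_distrib by (simp add: algebra_simps)
  then have "(norm (J \<zeta>))\<^sup>2 = (cmod \<zeta>)\<^sup>2" using \<open>(cmod c1)\<^sup>2 + (cmod c2)\<^sup>2 = 1\<close> by simp
  then show ?thesis by (simp add: power2_eq_iff_nonneg)
 qed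
 have Jl: "linear J" unfolding J_def by (rule unhol_linear)
 have hc: "continuous_on closed_D2 h" unfolding h_def by (intro continuous_intros wc)
 have hh: "h holomorphic_on D2" unfolding h_def by (intro holomorphic_intros wh)
 have hn: "norm (h z) = 1" if "z \<in> circle" for z
 proof -
  have "z \<in> closed_D2" using that by auto
  then show ?thesis using circ[OF that] uJ nJ by simp
 qed
 \<comment> \<open>A constant \<open>h\<close> would make u constant on the disc, against the
   immersion condition off the finite set \<open>S\<close>.\<close>
 have nc: "\<not> h constant_on D2"
 proof
  assume "h constant_on D2"
  then obtain a where a: "!!z. z \<in> D2 ==> h z = a" by (auto simp: constant_on_def)
  have "infinite D2" by (rule uncountable_infinite[OF uncountable_ball]) simp
  then obtain z where z: "z \<in> D2" "z \<notin> S" using branch(1) by (meson finite_subset subsetI)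
  have uc: "u y = J a" if "y \<in> D2" for y
  proof -
   have "y \<in> closed_D2" using that by simp
   then show ?thesis using uJ a[OF that] by simp
  qed
  have "dx u z = pd 1 (%_. J a) z" unfolding dx_eq_pd[OF z(1)] by (rule pd_cong_open[OF open_ball z(1) uc])
  then have "dx u z = 0" by (simp add: frechet_derivative_const)
  then show False using dx_nonzero[of z] z by auto
 qed
 have hD: "h ` D2 = D2" by (rule unit_disc_surjective[OF hh hc hn nc])
 define P where "P = range J"
 have "u ` D2 = ball 0 1 \<inter> P"
 proof
  show "u ` D2 \<subseteq> ball 0 1 \<inter> P"
  proof
   fix x assume "x \<in> u ` D2"
   then obtain z where z: "z \<in> D2" "x = u z" by blast
   then have "x = J (h z)" using uJ[of z] by simp
   moreover have "h z \<in> D2" using hD z(1) by blast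
   ultimately show "x \<in> ball 0 1 \<inter> P" using nJ by (auto simp: P_def)
  qed
  show "ball 0 1 \<inter> P \<subseteq> u ` D2"
  proof
   fix x assume "x \<in> ball 0 1 \<inter> P"
   then obtain \<zeta> where \<zeta>: "x = J \<zeta>" "norm x < 1" by (auto simp: P_def)
   then have "\<zeta> \<in> D2" using nJ by simp
   then obtain z where z: "z \<in> D2" "\<zeta> = h z" using hD by blast
   then have "x = u z" using uJ[of z] \<zeta>(1) by simp
   then show "x \<in> u ` D2" using z(1) by blast
  qed
 qed
 moreover have "lagrangian_plane P"
  unfolding lagrangian_plane_def
 proof (intro conjI ballI)
  show "subspace P" unfolding P_def by (rule linear_subspace_image[OF Jl subspace_UNIV])
  have "inj J"
  proof (rule injI)
   fix x y assume "J x = J y"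
   then have "norm (J (x - y)) = 0" by (simp add: linear_diff[OF Jl])
   then show "x = y" unfolding nJ by simp
  qed
  then show "dim P = 2" unfolding P_def using dim_image_eq[OF Jl, of UNIV] by simp
  fix v w assume "v \<in> P" "w \<in> P"
  then obtain a b where "v = J a" "w = J b" by (auto simp: P_def)
  then show "omega v w = 0" by (simp only: J_def omega_unhol[OF k]) (simp add: mult_ac)
 qed
 ultimately show ?thesis by blast
qed

end

text \<open>Moving from x in a direction of negative inner product with x enters the ball, where the
  defining function is negative, while it is nonnegative at x. So its gradient has nonpositive
  product with all such directions, which forces it to be a positive multiple of x.\<close>

lemma outer_unit_normal_unit_ball:
 fixes x n :: "'a::euclidean_space"
 assumes "outer_unit_normal (ball 0 1) x n"
 shows "n = x"
proof -
 obtain W \<rho> where x: "norm x = 1" "x \<in> W" and W: "open W" "smooth_on W \<rho>" and g0: "gradient \<rho> x \<noteq> 0"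
  and in_W: "ball 0 1 \<inter> W = {y \<in> W. \<rho> y < 0}" and n: "n = sgn (gradient \<rho> x)"
  using assms by (auto simp: outer_unit_normal_def defining_function_def)
 define g where "g = gradient \<rho> x"
 have "Ck_on 1 W \<rho>" using W(2) unfolding smooth_on_def by blast
 then have d: "\<rho> differentiable (at x)" using Ck1_differentiable[OF W(1)] x(2) by blast
 have \<rho>x: "\<rho> x \<ge> 0"
 proof (rule ccontr)
  assume "\<not> \<rho> x \<ge> 0"
  then have "x \<in> {y \<in> W. \<rho> y < 0}" using x(2) by simp
  then show False using x(1) unfolding in_W[symmetric] by simp
 qed
 have xx: "x \<bullet> x = 1" using x(1) by (simp add: dot_square_norm)
 have inward: "g \<bullet> v \<le> 0" if v: "v \<bullet> x < 0" for v
 proof (rule ccontr)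
  assume "\<not> g \<bullet> v \<le> 0"
  then have gv: "0 < g \<bullet> v" by simp
  have "((%t. x + t *\<^sub>R v) has_derivative (%t. t *\<^sub>R v)) (at (0::real))" by (auto intro!: derivative_eq_intros)
  moreover have "(\<rho> has_derivative (%v. g \<bullet> v)) (at (x + 0 *\<^sub>R v))"
   using has_derivative_pd[OF d] unfolding g_def gderiv_gradient(2)[OF d] by simp
  ultimately have "((%t. \<rho> (x + t *\<^sub>R v)) has_derivative (%t. g \<bullet> (t *\<^sub>R v))) (at 0)" by (rule has_derivative_compose)
  then have "DERIV (%t. \<rho> (x + t *\<^sub>R v)) 0 :> g \<bullet> v" by (simp add: has_field_derivative_def mult.commute[of _ "g \<bullet> v"])
  from DERIV_pos_inc_right[OF this gv]
  obtain e where e: "e > 0" "!!h. 0 < h ==> h < e ==> \<rho> x < \<rho> (x + h *\<^sub>R v)" by auto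
  obtain \<epsilon> where \<epsilon>: "\<epsilon> > 0" "ball x \<epsilon> \<subseteq> W" using W(1) x(2) open_contains_ball by blast
  have v0: "norm v > 0" using v by auto
  \<comment> \<open>The step length respects the interval on which the defining function increases,
    the neighbourhood \<open>W\<close>, and the bound that keeps |x + h v| below 1.\<close>
  define h where "h = min (e / 2) (min (\<epsilon> / (2 * norm v)) (- (v \<bullet> x) / (v \<bullet> v)))"
  have vv: "v \<bullet> v > 0" using v0 by simp
  have h: "0 < h" "h < e" "h \<le> \<epsilon> / (2 * norm v)" "h \<le> - (v \<bullet> x) / (v \<bullet> v)"
   using e(1) \<epsilon>(1) v0 v vv by (auto simp: h_def min_less_iff_disj divide_neg_pos)
  have "h * norm v \<le> \<epsilon> / 2" using h(3) v0 by (simp add: field_simps)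
  then have "x + h *\<^sub>R v \<in> W" using \<epsilon> h(1) by (intro subsetD[OF \<epsilon>(2)]) (simp add: dist_norm)
  moreover have "x + h *\<^sub>R v \<in> ball 0 1"
  proof -
   have "h * (v \<bullet> v) \<le> - (v \<bullet> x)" using h(4) vv by (simp add: field_simps)
   then have "h * (h * (v \<bullet> v)) \<le> h * (- (v \<bullet> x))" using h(1) by (intro mult_left_mono) auto
   moreover have "(x + h *\<^sub>R v) \<bullet> (x + h *\<^sub>R v) = 1 + 2 * (h * (v \<bullet> x)) + h * (h * (v \<bullet> v))"
    by (simp add: inner_add_left inner_add_right inner_commute[of x v] xx algebra_simps)
   moreover have "h * (v \<bullet> x) < 0" using h(1) v by (simp add: mult_pos_neg)
   ultimately have "(x + h *\<^sub>R v) \<bullet> (x + h *\<^sub>R v) < 1" by simp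
   then have "norm (x + h *\<^sub>R v) < 1" by (simp only: norm_eq_sqrt_inner real_sqrt_lt_1_iff)
   then show ?thesis by simp
  qed
  ultimately have "\<rho> (x + h *\<^sub>R v) < 0" using in_W by blast
  then show False using e(2)[OF h(1,2)] \<rho>x by simp
 qed
 \<comment> \<open>A tangential direction is the limit of the inward directions v - e x.\<close>
 have flat: "g \<bullet> v \<le> 0" if v: "v \<bullet> x = 0" for v
 proof (rule le_0_if_small)
  fix e :: real assume e: "e > 0"
  have "g \<bullet> (v - e *\<^sub>R x) \<le> 0" by (rule inward) (use v e xx in \<open>simp add: inner_diff_left\<close>)
  then show "g \<bullet> v \<le> e * (g \<bullet> x)" by (simp add: inner_diff_right)
 qed
 define v where "v = g - (g \<bullet> x) *\<^sub>R x"
 have vx: "v \<bullet> x = 0" by (simp add: v_def inner_diff_left xx)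
 have "v \<bullet> v = g \<bullet> v" using vx by (simp add: v_def inner_diff_left inner_commute)
 then have "v \<bullet> v \<le> 0" using flat[OF vx] by simp
 then have "v = 0" by (metis inner_gt_zero_iff not_less)
 then have gx: "g = (g \<bullet> x) *\<^sub>R x" by (simp add: v_def)
 have "g \<bullet> (- x) \<le> 0" by (rule inward) (simp add: xx)
 moreover have "g \<bullet> x \<noteq> 0" using gx g0 unfolding g_def[symmetric] by (metis scaleR_zero_left)
 ultimately have "g \<bullet> x > 0" by simp
 then have "sgn g = sgn x" using gx by (metis sgn_scaleR sgn_pos scaleR_one)
 then show ?thesis using x(1) by (simp add: n g_def sgn_div_norm)
qed

theorem theorem1p2:
  fixes u :: "complex \<Rightarrow> complex2" and gbar :: "complex \<Rightarrow> complex"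
    and N :: "complex2 \<Rightarrow> complex2" and S :: "complex set"
  assumes normal: "\<And>x. x \<in> frontier (ball 0 1) \<Longrightarrow> outer_unit_normal (ball 0 1) x (N x)"
    and C1: "C1_closed_disc u"
    and W21: "sobolev_1 2 D2 u"
    and conformal: "weakly_conformal u"
    and branch: "finite S" "S \<subseteq> D2" "\<And>p. p \<in> S \<Longrightarrow> branch_point u gbar p"
    and immersion: "lagrangian_immersion_on (closed_D2 - S) u"
    and angle: "lagrangian_angle u gbar" "continuous_on D2 gbar"
    and stationary: "fb_hamiltonian_stationary_loc (ball 0 1) N u"
    and legendrian: "\<And>z. z \<in> circle \<Longrightarrow> dtau u z \<bullet> mult_I (N (u z)) = 0"
  shows "\<exists>P. lagrangian_plane P \<and> u ` D2 = ball 0 1 \<inter> P"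
proof -
 have fr: "frontier (ball 0 1 :: complex2 set) = sphere 0 1" by (simp add: frontier_ball)
 have Nx: "N x = x" if "x \<in> sphere 0 1" for x
  by (rule outer_unit_normal_unit_ball[OF normal]) (use that fr in simp)
 have du0: "du u p v = 0" if "p \<in> S" for p v
  using branch(3)[OF that] by (simp add: branch_point_def)
 interpret D: conformal_lagrangian_disc u gbar S
  by (rule conformal_lagrangian_disc.intro[OF C1 W21 conformal branch(1,2) du0 immersion angle])
 obtain \<beta> :: "complex => real" where \<beta>: "continuous_on closed_D2 \<beta>"
  "!!z. z \<in> closed_D2 ==> dy u z = cscale (exp (\<i> * \<beta> z)) (quat (dx u z))"
  by (rule D.angle_lift) (rule that)
 have bdry: "u ` circle \<subseteq> sphere 0 1"
  using stationary unfolding fb_hamiltonian_stationary_loc_def fr by blast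
 have stat: "(LINT z:U|lebesgue. dx (%z. mult_I (gradient f (u z))) z \<bullet> dx u z
      + dy (%z. mult_I (gradient f (u z))) z \<bullet> dy u z) = 0"
  if U: "smooth_rel_domain U" and f: "smooth_on UNIV f"
   and s: "fun_support f \<inter> closure (u ` ((closure U - U) \<inter> D2)) = {}"
   and V: "\<exists>V. open V \<and> u ` (closure U \<inter> circle) \<subseteq> V \<and> (\<forall>x \<in> V \<inter> sphere 0 1. mult_I (gradient f x) \<bullet> x = 0)"
  for U :: "complex set" and f :: "complex2 => real"
 proof -
  have "\<exists>V. open V \<and> u ` (closure U \<inter> circle) \<subseteq> V \<and> (\<forall>x \<in> V \<inter> sphere 0 1. mult_I (gradient f x) \<bullet> N x = 0)"
   using V Nx by (metis IntD2)
  then show ?thesis using stationary U f s unfolding fb_hamiltonian_stationary_loc_def fr by blast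
 qed
 have us: "u z \<in> sphere 0 1" if "z \<in> circle" for z using bdry that by blast
 then have circ: "norm (u z) = 1" if "z \<in> circle" for z using that by (metis dist_0_norm mem_sphere)
 have leg: "dtau u z \<bullet> mult_I (u z) = 0" if "z \<in> circle" for z
  using legendrian[OF that] Nx[OF us[OF that]] by simp
 obtain \<mu> :: "complex => complex2" and B1 B2 :: "complex => real" where
  "integrable lborel \<mu>" "B1 \<in> borel_measurable borel" "B2 \<in> borel_measurable borel"
  "!!c. Cc 1 D2 c ==> (LBINT z. pd 1 c z *\<^sub>R dx u z) + (LBINT z. pd \<i> c z *\<^sub>R dy u z) = - (LBINT z. c z *\<^sub>R \<mu> z)"
  "AE z in lborel. z \<in> D2 - S \<longrightarrow> \<mu> z = B1 z *\<^sub>R mult_I (dx u z) + B2 z *\<^sub>R mult_I (dy u z)"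
  "!!z. \<bar>B1 z\<bar> * norm (dx u z) \<le> norm (\<mu> z)" "!!z. \<bar>B2 z\<bar> * norm (dx u z) \<le> norm (\<mu> z)"
  "!!c. Cc 1 (D2 - S) c ==> (LBINT z. pd 1 c z * \<beta> z) = - (LBINT z. c z * B1 z)"
  "!!c. Cc 1 (D2 - S) c ==> (LBINT z. pd \<i> c z * \<beta> z) = - (LBINT z. c z * B2 z)"
  by (rule D.second_order_structure[OF \<beta>]) (assumption | rule that)+
 then interpret fb_disc u gbar S \<beta> \<mu> B1 B2
  by (intro fb_disc.intro D.conformal_lagrangian_disc_axioms fb_disc_axioms.intro \<beta> stat circ leg)
 show ?thesis by (rule flat_disc)
qed

end
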